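(* Let $\alpha\ge0$, let $a,A,q$ be constant positive definite symmetric $d\times d$ matrices, and let $\mathbf T=(\theta,a,A,q)$ be a heat tuple such that, for some $k\ge0$, $$\theta(rE)=r^k\theta(E)\qquad\text{for all }r>0\text{ and all Borel }E\subset\mathbb R^d.$$ Then, in $[0,\infty]$, $$\|\mathcal T_{\alpha,\mathbf T}\|=\sup_{\omega\in\mathbb R}\Bigl\|\Bigl(\mathcal L_A+\frac{\alpha+1}2+\frac k4-i\omega\Bigr)^{-1}\mathcal H_q\Bigr\|_{\mathrm{op},L^2(F_{\mathbf T}(1,\cdot))}.$$
   Context: Notation. $\gamma_C$ is the centered Gaussian density on $\mathbb R^d$ with covariance $C$; $C:D=\operatorname{tr}(C^{\mathsf T}D)$; matrix norms are Frobenius. A heat tuple $\mathbf T=(\theta,a,A,q)$ consists of positive definite symmetric matrices $a,A,q$ and a nonzero nonnegative Radon measure $\theta$ on $\mathbb R^d$ with $\int e^{-c|z|^2}\theta(dz)<\infty$ for all $c>0$; $F_{\mathbf T}(\tau,z)=\int\gamma_{\tau a}(z-y)\,\theta(dy)$ for $\tau>0$. $\mathcal H_qu=q^{1/2}D^2u\,q^{1/2}$. The operator $\mathcal T_{\alpha,\mathbf T}$: with $Q=(0,\infty)\times\mathbb R^d$, for $g\in C_c^\infty(Q)$, $$(\mathcal T_{\alpha,\mathbf T}g)(s,z)=\int_s^\infty\int_{\mathbb R^d}\Bigl(\frac st\Bigr)^{\alpha/2}\sqrt{\frac{F_{\mathbf T}(s,z)}{F_{\mathbf T}(t,y)}}\,\frac{\gamma_{2(t-s)A}(z-y)}{2(t-s)}\,q^{1/2}\Bigl(\frac{A^{-1}(z-y)(z-y)^{\mathsf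 T}A^{-1}}{2(t-s)}-A^{-1}\Bigr)q^{1/2}g(t,y)\,dy\,dt,$$ spatial integral first; $\|\mathcal T_{\alpha,\mathbf T}\|$ is its norm from scalar $L^2(Q)$ to matrix-valued $L^2(Q)$ (Frobenius norm on matrices), $+\infty$ if there is no bounded extension. The spatial operators: $\mathcal L_A=-A:D^2+\tfrac12x\cdot D$. For $c>0$ and $\omega\in\mathbb R$, $(\mathcal L_A+c-i\omega)^{-1}$ is the Ornstein–Uhlenbeck resolvent on $C_0(\mathbb R^d)$, acting componentwise on matrices. For a positive spatial weight $F$, $L^2(F)=L^2(\mathbb R^d,F(x)\,dx)$; the norm $\|\cdot\|_{\mathrm{op},L^2(F)}$ is from scalar to matrix-valued $L^2(F)$ (Frobenius norm on the output), defined first on complex $C_c^\infty(\mathbb R^d)$, and equals $+\infty$ if there is no bounded extension. *)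

theory Defs
  imports "HOL-Analysis.Analysis"
begin

section \<open>Matrices and Gaussians\<close>

definition pos_def :: "real^'d^'d \<Rightarrow> bool" where
  "pos_def C \<longleftrightarrow> transpose C = C \<and> (\<forall>x. x \<noteq> 0 \<longrightarrow> 0 < x \<bullet> (C *v x))"

text \<open>Only applied to positive definite matrices, which have exactly one positive definite
  square root.\<close>
definition mat_sqrt :: "real^'d^'d \<Rightarrow> real^'d^'d" where
  "mat_sqrt C = (THE B. pos_def B \<and> B ** B = C)"

definition outer :: "real^'d \<Rightarrow> real^'d^'d" where
  "outer x = (\<chi> i j. x $ i * x $ j)"

definition gaussian :: "real^'d^'d \<Rightarrow> real^'d \<Rightarrow> real" where
  "gaussian C x =
     exp (- (x \<bullet> (matrix_inv C *v x)) / 2) / sqrt ((2 * pi) ^ CARD('d) * det C)"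

definition complex_mat :: "real^'d^'d \<Rightarrow> complex^'d^'d" where
  "complex_mat M = (\<chi> i j. complex_of_real (M $ i $ j))"


section \<open>Test functions and differential operators\<close>

primrec C_k :: "nat \<Rightarrow> ('a::euclidean_space \<Rightarrow> 'b::real_normed_vector) \<Rightarrow> bool" where
  "C_k 0 f \<longleftrightarrow> continuous_on UNIV f"
| "C_k (Suc n) f \<longleftrightarrow> (\<forall>x. f differentiable at x) \<and>
     (\<forall>v. C_k n (\<lambda>x. frechet_derivative f (at x) v))"

text \<open>Smooth functions with compact support inside the open set \<open>U\<close>, extended by zero to the
  whole space.\<close>
definition test_functions :: "'a::euclidean_space set \<Rightarrow> ('a \<Rightarrow> complex) set" where
  "test_functions U = {g. (\<forall>n. C_k n g) \<and>
     compact (closure {x. g x \<noteq> 0}) \<and> closure {x. g x \<noteq> 0} \<subseteq> U}"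

definition partial_deriv :: "'d \<Rightarrow> (real^'d \<Rightarrow> complex) \<Rightarrow> real^'d \<Rightarrow> complex" where
  "partial_deriv i u x = frechet_derivative u (at x) (axis i 1)"

definition hessian :: "(real^'d \<Rightarrow> complex) \<Rightarrow> real^'d \<Rightarrow> complex^'d^'d" where
  "hessian u x = (\<chi> i j. partial_deriv i (partial_deriv j u) x)"

definition H_op :: "real^'d^'d \<Rightarrow> (real^'d \<Rightarrow> complex) \<Rightarrow> real^'d \<Rightarrow> complex^'d^'d" where
  "H_op q u x = complex_mat (mat_sqrt q) ** hessian u x ** complex_mat (mat_sqrt q)"


section \<open>Operator norms on \<open>L\<^sup>2\<close>\<close>

definition L2 :: "'x measure \<Rightarrow> ('x \<Rightarrow> 'b::{real_normed_vector,second_countable_topology}) set" where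
  "L2 M = {f \<in> borel_measurable M. integrable M (\<lambda>x. (norm (f x))\<^sup>2)}"

definition L2_norm ::
  "'x measure \<Rightarrow> ('x \<Rightarrow> 'b::{real_normed_vector,second_countable_topology}) \<Rightarrow> real" where
  "L2_norm M f = sqrt (\<integral>x. (norm (f x))\<^sup>2 \<partial>M)"

text \<open>The norm of the bounded extension to \<open>L\<^sup>2\<close> of a linear operator \<open>S\<close> given on the dense
  subspace \<open>D\<close>; it is \<open>\<infinity>\<close> (infimum of the empty set) if there is no bounded extension.  On
  \<open>complex^'d^'d\<close> the library norm is the Frobenius norm.\<close>
definition L2_op_norm ::
  "'x measure \<Rightarrow> ('x \<Rightarrow> 'b) set \<Rightarrow>
   (('x \<Rightarrow> 'b::{real_normed_vector,second_countable_topology}) \<Rightarrow>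
    'x \<Rightarrow> 'c::{real_normed_vector,second_countable_topology}) \<Rightarrow> ennreal" where
  "L2_op_norm M D S =
     (INF C \<in> {C. 0 \<le> C \<and> (\<forall>g\<in>D. S g \<in> L2 M \<and> L2_norm M (S g) \<le> C * L2_norm M g)}. ennreal C)"


section \<open>Heat tuples and the space-time operator\<close>

text \<open>On \<open>real^'d\<close> a Borel measure that is finite on compact sets is automatically regular.\<close>
definition radon_measure :: "(real^'d) measure \<Rightarrow> bool" where
  "radon_measure \<theta> \<longleftrightarrow> sets \<theta> = sets borel \<and> (\<forall>K. compact K \<longrightarrow> emeasure \<theta> K < \<infinity>)"

definition heat_tuple ::
  "(real^'d) measure \<Rightarrow> real^'d^'d \<Rightarrow> real^'d^'d \<Rightarrow> real^'d^'d \<Rightarrow> bool" where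
  "heat_tuple \<theta> a A q \<longleftrightarrow>
     pos_def a \<and> pos_def A \<and> pos_def q \<and>
     radon_measure \<theta> \<and> emeasure \<theta> UNIV \<noteq> 0 \<and>
     (\<forall>c>0. (\<integral>\<^sup>+z. ennreal (exp (- c * (norm z)\<^sup>2)) \<partial>\<theta>) < \<infinity>)"

definition heat_F :: "(real^'d) measure \<Rightarrow> real^'d^'d \<Rightarrow> real \<Rightarrow> real^'d \<Rightarrow> real" where
  "heat_F \<theta> a \<tau> z = (\<integral>y. gaussian (\<tau> *\<^sub>R a) (z - y) \<partial>\<theta>)"

definition half_space :: "(real \<times> (real^'d)) set" where
  "half_space = {0<..} \<times> UNIV"

definition T_kernel ::
  "real \<Rightarrow> (real^'d) measure \<Rightarrow> real^'d^'d \<Rightarrow> real^'d^'d \<Rightarrow> real^'d^'d \<Rightarrow>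
   real \<Rightarrow> real^'d \<Rightarrow> real \<Rightarrow> real^'d \<Rightarrow> real^'d^'d" where
  "T_kernel \<alpha> \<theta> a A q s z t y =
     ((s / t) powr (\<alpha> / 2) * sqrt (heat_F \<theta> a s z / heat_F \<theta> a t y) *
      (gaussian ((2 * (t - s)) *\<^sub>R A) (z - y) / (2 * (t - s)))) *\<^sub>R
     (mat_sqrt q **
       ((1 / (2 * (t - s))) *\<^sub>R
          (matrix_inv A ** outer (z - y) ** matrix_inv A)
        - matrix_inv A) **
      mat_sqrt q)"

definition T_op ::
  "real \<Rightarrow> (real^'d) measure \<Rightarrow> real^'d^'d \<Rightarrow> real^'d^'d \<Rightarrow> real^'d^'d \<Rightarrow>
   (real \<times> (real^'d) \<Rightarrow> complex) \<Rightarrow> real \<times> (real^'d) \<Rightarrow> complex^'d^'d" where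
  "T_op \<alpha> \<theta> a A q g = (\<lambda>(s, z).
     LINT t:{s<..}|lborel. (LINT y|lborel.
       (\<chi> i j. complex_of_real (T_kernel \<alpha> \<theta> a A q s z t y $ i $ j) * g (t, y))))"

definition T_norm ::
  "real \<Rightarrow> (real^'d) measure \<Rightarrow> real^'d^'d \<Rightarrow> real^'d^'d \<Rightarrow> real^'d^'d \<Rightarrow> ennreal" where
  "T_norm \<alpha> \<theta> a A q =
     L2_op_norm (restrict_space lborel half_space) (test_functions half_space) (T_op \<alpha> \<theta> a A q)"


section \<open>The Ornstein--Uhlenbeck resolvent\<close>

definition OU_expr :: "real^'d^'d \<Rightarrow> (real^'d \<Rightarrow> complex) \<Rightarrow> real^'d \<Rightarrow> complex" where
  "OU_expr A u x =
     - trace (transpose (complex_mat A) ** hessian u x)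
     + (\<Sum>i\<in>UNIV. complex_of_real (x $ i) * partial_deriv i u x) / 2"

definition C0 :: "(real^'d \<Rightarrow> complex) set" where
  "C0 = {u. continuous_on UNIV u \<and> (u \<longlongrightarrow> 0) at_infinity}"

text \<open>The relation \<open>L\<^sub>A u = h\<close> for the operator \<open>L\<^sub>A\<close> on \<open>C\<^sub>0\<close>, whose negative generates the
  Ornstein--Uhlenbeck semigroup.  It is the closure in \<open>C\<^sub>0\<close> (supremum norm) of the
  differential expression on compactly supported smooth functions, which form a core of the
  generator.\<close>
definition OU_graph :: "real^'d^'d \<Rightarrow> (real^'d \<Rightarrow> complex) \<Rightarrow> (real^'d \<Rightarrow> complex) \<Rightarrow> bool" where
  "OU_graph A u h \<longleftrightarrow> u \<in> C0 \<and> h \<in> C0 \<and>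
     (\<exists>v. (\<forall>n::nat. v n \<in> test_functions UNIV) \<and>
          uniform_limit UNIV v u sequentially \<and>
          uniform_limit UNIV (\<lambda>n. OU_expr A (v n)) h sequentially)"

text \<open>\<open>(L\<^sub>A + \<mu>)\<^sup>-\<^sup>1 f\<close>, for \<open>f \<in> C\<^sub>0\<close> and \<open>Re \<mu> > 0\<close>.\<close>
definition OU_resolvent ::
  "real^'d^'d \<Rightarrow> complex \<Rightarrow> (real^'d \<Rightarrow> complex) \<Rightarrow> real^'d \<Rightarrow> complex" where
  "OU_resolvent A \<mu> f = (THE u. \<exists>h. OU_graph A u h \<and> (\<forall>x. h x + \<mu> * u x = f x))"

definition OU_resolvent_mat ::
  "real^'d^'d \<Rightarrow> complex \<Rightarrow> (real^'d \<Rightarrow> complex^'d^'d) \<Rightarrow> real^'d \<Rightarrow> complex^'d^'d" where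
  "OU_resolvent_mat A \<mu> f x = (\<chi> i j. OU_resolvent A \<mu> (\<lambda>y. f y $ i $ j) x)"

definition weighted :: "(real^'d \<Rightarrow> real) \<Rightarrow> (real^'d) measure" where
  "weighted F = density lborel (\<lambda>x. ennreal (F x))"

definition spatial_op_norm ::
  "(real^'d \<Rightarrow> real) \<Rightarrow> ((real^'d \<Rightarrow> complex) \<Rightarrow> real^'d \<Rightarrow> complex^'d^'d) \<Rightarrow> ennreal" where
  "spatial_op_norm F S = L2_op_norm (weighted F) (test_functions UNIV) S"

end

theory Submission
  imports Defs "HOL-Probability.Characteristic_Functions"
begin

text \<open>
  Homogeneity of \<open>\<theta>\<close> makes the problem invariant under the parabolic dilations
  \<open>(t, y) \<mapsto> (r\<^sup>2 t, r y)\<close>, and the identity is what remains after this symmetry is diagonalised.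

  Write \<open>F = F\<^sub>T(1, \<cdot>)\<close>.  Substituting in the integral that defines the weight gives
  \<open>F\<^sub>T(t, y) = t powr ((k - d) / 2) * F (y / \<surd>t)\<close> (\<open>heat_F_scale\<close>).  In the coordinates \<open>t = exp \<sigma>\<close>,
  \<open>y = \<surd>t x\<close> a test function \<open>g\<close> on the half-space becomes a test function \<open>h\<close> of \<open>(\<sigma>, x)\<close>, where the
  factor relating the two (\<open>selfsim\<close>) is chosen such that the square integral of \<open>g\<close> is the square integral
  of \<open>h\<close> with respect to \<open>F x dx d\<sigma>\<close>.  The passage from \<open>h\<close> to \<open>g\<close> is a bijection of test functions
  (\<open>selfsim_test\<close>, \<open>selfsim_surj\<close>) because \<open>F\<close> is smooth and positive (\<open>heat_F_smooth_pos\<close>).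

  The kernel of the space-time operator is the Hessian of a Gaussian with covariance \<open>2 (t - s) A\<close>, so
  integration by parts puts the second derivatives on \<open>g\<close> divided by the root of the weight.  In the new coordinates with \<open>t = exp (\<sigma> + \<tau>)\<close>,
  \<open>s = exp \<sigma>\<close> the Gaussian convolution becomes the Ornstein--Uhlenbeck semigroup \<open>P\<^sub>\<tau>\<close> (Mehler's formula), and
  all powers of \<open>s / t\<close> collect to \<open>exp (- c \<tau>)\<close> with \<open>c = (\<alpha> + 1) / 2 + k / 4\<close>.  The operator is
  therefore conjugate to the convolution in time
  \<open>h \<mapsto> (\<lambda>\<sigma>. \<integral>\<^sub>0\<^sup>\<infinity> exp (- c \<tau>) P\<^sub>\<tau> (H\<^sub>q h (\<sigma> + \<tau>)) d\<tau>)\<close> (\<open>T_op_selfsim\<close>).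

  The Fourier transform in \<open>\<sigma>\<close> turns it into multiplication by the operators
  \<open>\<integral>\<^sub>0\<^sup>\<infinity> exp (- (c - \<i> \<omega>) \<tau>) P\<^sub>\<tau> H\<^sub>q d\<tau> = (L\<^sub>A + c - \<i> \<omega>)\<^sup>-\<^sup>1 H\<^sub>q\<close>, and the norm of such a multiplier is the
  supremum of the norms of its values.  One inequality (\<open>evolution_bound_from_resolve\<close>) applies Plancherel at each
  point \<open>x\<close> and exchanges integrals.  The other one (\<open>resolve_bound_from_evolution\<close>) tests the evolution with
  waves of frequency \<open>\<omega>\<close> under an envelope: as it widens, the rescaled responses converge pointwise to the
  envelope times the resolvent at \<open>\<omega>\<close>.

  That Mehler's integral is the resolvent of the closure of the differential expression on test functions is
  \<open>OU_resolvent_eq_ou_avg\<close>.  The integral solves the resolvent equation pointwise, by the fundamental theorem of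
  calculus along the Ornstein--Uhlenbeck paths and Gaussian integration by parts; cutoffs place it in the domain of
  the closure; and the maximum principle gives uniqueness.
\<close>

section \<open>Calculus of smooth functions\<close>

text \<open>Smoothness is needed on open subsets as well: powers and logarithms are smooth on the positive
  half-line only, and the self-similar change of coordinates lives on the open half-space.\<close>
primrec C_k_on ::
  "'a::euclidean_space set \<Rightarrow> nat \<Rightarrow> ('a \<Rightarrow> 'b::real_normed_vector) \<Rightarrow> bool" where
  "C_k_on U 0 f \<longleftrightarrow> continuous_on U f"
| "C_k_on U (Suc n) f \<longleftrightarrow> (\<forall>x\<in>U. f differentiable at x) \<and>
     (\<forall>v. C_k_on U n (\<lambda>x. frechet_derivative f (at x) v))"

definition smooth_on ::
  "'a::euclidean_space set \<Rightarrow> ('a \<Rightarrow> 'b::real_normed_vector) \<Rightarrow> bool" where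
  "smooth_on U f \<longleftrightarrow> (\<forall>n. C_k_on U n f)"

lemma C_k_eq_C_k_on: "C_k n f \<longleftrightarrow> C_k_on UNIV n f"
  by (induction n arbitrary: f) auto

lemma C_k_on_cong:
  assumes "open U" "C_k_on U n f" "\<And>x. x \<in> U \<Longrightarrow> f x = g x"
  shows "C_k_on U n g"
  using assms(2,3)
proof (induction n arbitrary: f g)
  case 0
  then show ?case using continuous_on_cong[of U U f g] by auto
next
  case (Suc n)
  have d: "(g has_derivative frechet_derivative f (at x)) (at x)" if "x \<in> U" for x
    using has_derivative_transform_within_open[OF _ assms(1) that, of f _ UNIV g] Suc.prems that
    by (auto simp: frechet_derivative_works)
  then have e: "frechet_derivative g (at x) = frechet_derivative f (at x)" if "x \<in> U" for x
    using that by (metis frechet_derivative_at)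
  have "C_k_on U n (\<lambda>x. frechet_derivative g (at x) v)" for v
    by (rule Suc.IH[of "\<lambda>x. frechet_derivative f (at x) v"]) (use Suc.prems e in auto)
  then show ?case using d by (auto simp: differentiable_def)
qed

lemma C_k_on_SucI:
  assumes "open U" "\<And>x. x \<in> U \<Longrightarrow> (f has_derivative f' x) (at x)"
    "\<And>v. C_k_on U n (\<lambda>x. f' x v)"
  shows "C_k_on U (Suc n) f"
proof -
  have "frechet_derivative f (at x) = f' x" if "x \<in> U" for x
    using assms(2)[OF that] by (metis frechet_derivative_at)
  then have "C_k_on U n (\<lambda>x. frechet_derivative f (at x) v)" for v
    by (intro C_k_on_cong[OF assms(1,3)]) auto
  then show ?thesis using assms(2) by (auto simp: differentiable_def)
qed

lemma C_k_on_SucD: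
  assumes "C_k_on U (Suc n) f" "x \<in> U"
  shows "(f has_derivative frechet_derivative f (at x)) (at x)"
  using assms by (auto simp: frechet_derivative_works)

lemma C_k_on_mono: "C_k_on U (Suc n) f \<Longrightarrow> C_k_on U n f"
proof (induction n arbitrary: f)
  case 0
  then show ?case
    by (simp add: differentiable_imp_continuous_on differentiable_on_def differentiable_at_withinI)
next
  case (Suc n)
  then show ?case by auto
qed

lemma C_k_on_const: "open U \<Longrightarrow> C_k_on U n (\<lambda>x. c)"
  by (induction n arbitrary: c) (auto intro!: C_k_on_SucI[where f'="\<lambda>x v. 0"] simp del: C_k_on.simps(2))

lemma C_k_on_bounded_linear_compose:
  assumes "open U" "bounded_linear L" "C_k_on U n f"
  shows "C_k_on U n (\<lambda>x. L (f x))"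
  using assms(3)
proof (induction n arbitrary: f)
  case 0
  then show ?case using bounded_linear.continuous_on[OF assms(2)] by simp
next
  case (Suc n)
  show ?case
  proof (rule C_k_on_SucI[OF assms(1)])
    show "((\<lambda>x. L (f x)) has_derivative (\<lambda>v. L (frechet_derivative f (at x) v))) (at x)" if "x \<in> U" for x
      using bounded_linear.has_derivative[OF assms(2) C_k_on_SucD[OF Suc.prems that]] .
    show "C_k_on U n (\<lambda>x. L (frechet_derivative f (at x) v))" for v
      using Suc by auto
  qed
qed

lemma C_k_on_add:
  assumes "open U" "C_k_on U n f" "C_k_on U n g"
  shows "C_k_on U n (\<lambda>x. f x + g x)"
  using assms(2,3)
proof (induction n arbitrary: f g)
  case 0
  then show ?case by (simp add: continuous_on_add)
next
  case (Suc n)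
  show ?case
  proof (rule C_k_on_SucI[OF assms(1)])
    show "((\<lambda>x. f x + g x) has_derivative
        (\<lambda>v. frechet_derivative f (at x) v + frechet_derivative g (at x) v)) (at x)" if "x \<in> U" for x
      using has_derivative_add[OF C_k_on_SucD[OF Suc.prems(1) that] C_k_on_SucD[OF Suc.prems(2) that]] .
    show "C_k_on U n (\<lambda>x. frechet_derivative f (at x) v + frechet_derivative g (at x) v)" for v
      using Suc by auto
  qed
qed

lemma C_k_on_sum:
  assumes "open U" "\<And>i. i \<in> I \<Longrightarrow> C_k_on U n (f i)"
  shows "C_k_on U n (\<lambda>x. \<Sum>i\<in>I. f i x)"
  using assms(2)
  by (induction I rule: infinite_finite_induct) (auto intro!: C_k_on_add C_k_on_const assms(1))

lemma C_k_on_bilinear: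
  assumes "open U" "bounded_bilinear P" "C_k_on U n f" "C_k_on U n g"
  shows "C_k_on U n (\<lambda>x. P (f x) (g x))"
  using assms(3,4)
proof (induction n arbitrary: f g)
  case 0
  then show ?case using bounded_bilinear.continuous_on[OF assms(2)] by simp
next
  case (Suc n)
  show ?case
  proof (rule C_k_on_SucI[OF assms(1)])
    show "((\<lambda>x. P (f x) (g x)) has_derivative
        (\<lambda>v. P (f x) (frechet_derivative g (at x) v) + P (frechet_derivative f (at x) v) (g x))) (at x)"
      if "x \<in> U" for x
      using bounded_bilinear.FDERIV[OF assms(2) C_k_on_SucD[OF Suc.prems(1) that]
          C_k_on_SucD[OF Suc.prems(2) that]] .
    show "C_k_on U n (\<lambda>x. P (f x) (frechet_derivative g (at x) v)
        + P (frechet_derivative f (at x) v) (g x))" for v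
      using Suc C_k_on_mono[OF Suc.prems(1)] C_k_on_mono[OF Suc.prems(2)]
      by (auto intro!: C_k_on_add assms(1))
  qed
qed

lemma linear_sum_Basis:
  fixes w :: "'b::euclidean_space"
  assumes "linear L"
  shows "L w = (\<Sum>b\<in>Basis. (w \<bullet> b) *\<^sub>R L b)"
proof -
  have "L w = L (\<Sum>b\<in>Basis. (w \<bullet> b) *\<^sub>R b)" by (simp add: euclidean_representation)
  then show ?thesis by (simp add: linear_sum[OF assms] linear_cmul[OF assms])
qed

text \<open>The chain rule expands the derivative of the outer function along the standard basis, which
  makes it a sum of products of functions of the same kind.\<close>
lemma C_k_on_compose:
  fixes f :: "'b::euclidean_space \<Rightarrow> 'c::real_normed_vector" and g :: "'a::euclidean_space \<Rightarrow> 'b"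
  assumes "open U" "open V" "C_k_on V n f" "C_k_on U n g" "\<And>x. x \<in> U \<Longrightarrow> g x \<in> V"
  shows "C_k_on U n (\<lambda>x. f (g x))"
  using assms(3,4)
proof (induction n arbitrary: f)
  case 0
  then show ?case using assms(5) by (auto intro: continuous_on_compose2)
next
  case (Suc n)
  have g: "C_k_on U n g" by (rule C_k_on_mono[OF Suc.prems(2)])
  show ?case
  proof (rule C_k_on_SucI[OF assms(1)])
    fix x assume x: "x \<in> U"
    have df: "(f has_derivative frechet_derivative f (at (g x))) (at (g x))"
      by (rule C_k_on_SucD[OF Suc.prems(1) assms(5)[OF x]])
    have "((\<lambda>x. f (g x)) has_derivative
        (\<lambda>v. frechet_derivative f (at (g x)) (frechet_derivative g (at x) v))) (at x)"
      using has_derivative_compose[OF C_k_on_SucD[OF Suc.prems(2) x] df] .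
    then show "((\<lambda>x. f (g x)) has_derivative
        (\<lambda>v. \<Sum>b\<in>Basis. (frechet_derivative g (at x) v \<bullet> b) *\<^sub>R frechet_derivative f (at (g x)) b)) (at x)"
      by (subst (asm) linear_sum_Basis[OF has_derivative_linear[OF df]])
  next
    fix v
    show "C_k_on U n (\<lambda>x. \<Sum>b\<in>Basis.
        (frechet_derivative g (at x) v \<bullet> b) *\<^sub>R frechet_derivative f (at (g x)) b)"
    proof (intro C_k_on_sum[OF assms(1)] C_k_on_bilinear[OF assms(1) bounded_bilinear_scaleR])
      fix b :: 'b
      have "C_k_on U n (\<lambda>x. frechet_derivative g (at x) v)" using Suc.prems(2) by simp
      then show "C_k_on U n (\<lambda>x. frechet_derivative g (at x) v \<bullet> b)"
        by (rule C_k_on_bounded_linear_compose[OF assms(1) bounded_linear_inner_left])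
      show "C_k_on U n (\<lambda>x. frechet_derivative f (at (g x)) b)"
        by (rule Suc.IH[OF _ g]) (use Suc.prems(1) in simp)
    qed
  qed
qed

lemma smooth_onD_differentiable:
  "smooth_on U f \<Longrightarrow> x \<in> U \<Longrightarrow> (f has_derivative frechet_derivative f (at x)) (at x)"
  unfolding smooth_on_def using C_k_on_SucD by blast

lemma smooth_onD_derivative:
  "smooth_on U f \<Longrightarrow> smooth_on U (\<lambda>x. frechet_derivative f (at x) v)"
  unfolding smooth_on_def by (metis C_k_on.simps(2))

lemma smooth_on_continuous: "smooth_on U f \<Longrightarrow> continuous_on U f"
  unfolding smooth_on_def by (metis C_k_on.simps(1))

text \<open>Smoothness is coinductive: a family of functions that is closed under directional
  derivatives consists of smooth functions.\<close>
lemma smooth_on_coinduct: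
  assumes "open U" "P f"
    and step: "\<And>f. P f \<Longrightarrow> \<exists>f'. (\<forall>x\<in>U. (f has_derivative f' x) (at x)) \<and> (\<forall>v. P (\<lambda>x. f' x v))"
  shows "smooth_on U f"
proof -
  have "P f \<Longrightarrow> C_k_on U n f" for n f
  proof (induction n arbitrary: f)
    case 0
    then obtain f' where "\<forall>x\<in>U. (f has_derivative f' x) (at x)" using step by blast
    then show ?case
      by (auto intro!: continuous_at_imp_continuous_on has_derivative_continuous)
  next
    case (Suc n)
    then obtain f' where "\<forall>x\<in>U. (f has_derivative f' x) (at x)" "\<forall>v. P (\<lambda>x. f' x v)" using step by blast
    then show ?case using Suc.IH by (intro C_k_on_SucI[OF assms(1)]) auto
  qed
  then show ?thesis using assms(2) unfolding smooth_on_def by blast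
qed

lemma smooth_on_cong: "open U \<Longrightarrow> smooth_on U f \<Longrightarrow> (\<And>x. x \<in> U \<Longrightarrow> f x = g x) \<Longrightarrow> smooth_on U g"
  unfolding smooth_on_def using C_k_on_cong by blast

lemma smooth_on_const [simp, intro]: "open U \<Longrightarrow> smooth_on U (\<lambda>x. c)"
  unfolding smooth_on_def using C_k_on_const by blast

lemma smooth_on_bounded_linear_compose:
  "open U \<Longrightarrow> bounded_linear L \<Longrightarrow> smooth_on U f \<Longrightarrow> smooth_on U (\<lambda>x. L (f x))"
  unfolding smooth_on_def using C_k_on_bounded_linear_compose by blast

lemma smooth_on_add [intro]:
  "open U \<Longrightarrow> smooth_on U f \<Longrightarrow> smooth_on U g \<Longrightarrow> smooth_on U (\<lambda>x. f x + g x)"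
  unfolding smooth_on_def using C_k_on_add by blast

lemma smooth_on_bilinear:
  "open U \<Longrightarrow> bounded_bilinear P \<Longrightarrow> smooth_on U f \<Longrightarrow> smooth_on U g \<Longrightarrow>
    smooth_on U (\<lambda>x. P (f x) (g x))"
  unfolding smooth_on_def using C_k_on_bilinear[of U P] by blast

lemmas smooth_on_mult [intro] = smooth_on_bilinear[OF _ bounded_bilinear_mult]
lemmas smooth_on_scaleR [intro] = smooth_on_bilinear[OF _ bounded_bilinear_scaleR]
lemmas smooth_on_inner = smooth_on_bilinear[OF _ bounded_bilinear_inner]

lemma smooth_on_compose:
  "smooth_on V f \<Longrightarrow> open U \<Longrightarrow> open V \<Longrightarrow> smooth_on U g \<Longrightarrow> (\<And>x. x \<in> U \<Longrightarrow> g x \<in> V) \<Longrightarrow>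
    smooth_on U (\<lambda>x. f (g x))"
  unfolding smooth_on_def using C_k_on_compose by blast

lemma smooth_on_diff [intro]:
  "open U \<Longrightarrow> smooth_on U f \<Longrightarrow> smooth_on U g \<Longrightarrow> smooth_on U (\<lambda>x. f x - g x)"
  using smooth_on_add[of U f "\<lambda>x. - g x"]
    smooth_on_bounded_linear_compose[OF _ bounded_linear_minus[OF bounded_linear_ident], of U g]
  by simp

lemma smooth_on_linear: "bounded_linear L \<Longrightarrow> open U \<Longrightarrow> smooth_on U L"
proof -
  assume L: "bounded_linear L" and U: "open U"
  have "smooth_on U (\<lambda>x. x)"
  proof (rule smooth_on_coinduct[OF U, where P="\<lambda>f. f = (\<lambda>x. x) \<or> (\<exists>c. f = (\<lambda>x. c))"])
    fix f :: "'a \<Rightarrow> 'a" assume "f = (\<lambda>x. x) \<or> (\<exists>c. f = (\<lambda>x. c))"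
    then show "\<exists>f'. (\<forall>x\<in>U. (f has_derivative f' x) (at x)) \<and>
        (\<forall>v. (\<lambda>x. f' x v) = (\<lambda>x. x) \<or> (\<exists>c. (\<lambda>x. f' x v) = (\<lambda>x. c)))"
    proof
      assume "f = (\<lambda>x. x)"
      then show ?thesis by (intro exI[of _ "\<lambda>x v. v"]) auto
    next
      assume "\<exists>c. f = (\<lambda>x. c)"
      then show ?thesis by (intro exI[of _ "\<lambda>x v. 0"]) auto
    qed
  qed simp
  from smooth_on_bounded_linear_compose[OF U L this] show ?thesis .
qed

lemma smooth_on_ident [simp, intro]: "open U \<Longrightarrow> smooth_on U (\<lambda>x. x)"
  by (rule smooth_on_linear[OF bounded_linear_ident])

lemma smooth_on_Pair:
  fixes f :: "'a::euclidean_space \<Rightarrow> 'b::euclidean_space" and g :: "'a \<Rightarrow> 'c::euclidean_space"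
  assumes "open U" "smooth_on U f" "smooth_on U g"
  shows "smooth_on U (\<lambda>x. (f x, g x))"
proof -
  have "bounded_linear (\<lambda>u::'b. (u, 0::'c))" "bounded_linear (\<lambda>u::'c. (0::'b, u))"
    by (auto intro!: bounded_linear_Pair bounded_linear_zero bounded_linear_ident)
  from smooth_on_add[OF assms(1) smooth_on_bounded_linear_compose[OF assms(1) this(1) assms(2)]
      smooth_on_bounded_linear_compose[OF assms(1) this(2) assms(3)]]
  show ?thesis by simp
qed

lemma smooth_on_powr_real: "smooth_on {0<..} (\<lambda>t::real. c * t powr p)"
proof (rule smooth_on_coinduct[where P="\<lambda>f. \<exists>c p. f = (\<lambda>t::real. c * t powr p)"])
  fix f :: "real \<Rightarrow> real" assume "\<exists>c p. f = (\<lambda>t. c * t powr p)"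
  then obtain c p where f: "f = (\<lambda>t. c * t powr p)" by blast
  show "\<exists>f'. (\<forall>x\<in>{0<..}. (f has_derivative f' x) (at x)) \<and> (\<forall>v. \<exists>c p. (\<lambda>x. f' x v) = (\<lambda>t. c * t powr p))"
  proof (intro exI[of _ "\<lambda>x v. (v * (c * p)) * x powr (p - 1)"] conjI ballI allI)
    show "(f has_derivative (\<lambda>v. (v * (c * p)) * x powr (p - 1))) (at x)" if "x \<in> {0<..}" for x
      using that by (auto simp: f intro!: derivative_eq_intros simp: fun_eq_iff powr_diff field_simps)
  qed blast
qed auto

lemma smooth_on_powr: 
  assumes "open U" "smooth_on U f" "\<And>x. x \<in> U \<Longrightarrow> f x > (0::real)"
  shows "smooth_on U (\<lambda>x. f x powr p)"
  using smooth_on_compose[OF smooth_on_powr_real[of 1 p] assms(1) _ assms(2)] assms(3) by auto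

lemma smooth_on_ln_real: "smooth_on {0<..} (ln :: real \<Rightarrow> real)"
proof -
  have "C_k_on {0<..} n (ln :: real \<Rightarrow> real)" for n
  proof (rule C_k_on_mono, rule C_k_on_SucI[where f'="\<lambda>x v. v * x powr (-1)"])
    show "(ln has_derivative (\<lambda>v. v * x powr - 1)) (at x)" if "x \<in> {0<..}" for x :: real
      using that by (auto intro!: derivative_eq_intros simp: powr_minus field_simps fun_eq_iff)
    show "C_k_on {0<..} n (\<lambda>x. v * x powr - 1)" for v :: real
      using smooth_on_powr_real[of v "-1"] unfolding smooth_on_def by auto
  qed auto
  then show ?thesis unfolding smooth_on_def by blast
qed

lemma smooth_on_ln:
  "open U \<Longrightarrow> smooth_on U f \<Longrightarrow> (\<And>x. x \<in> U \<Longrightarrow> f x > (0::real)) \<Longrightarrow> smooth_on U (\<lambda>x. ln (f x))"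
  using smooth_on_compose[OF smooth_on_ln_real] by auto

text \<open>Over the complex numbers this also covers the characters \<open>t \<mapsto> exp (\<i> \<omega> t)\<close>.\<close>
lemma smooth_on_exp_of_real:
  "smooth_on UNIV (\<lambda>t::real. exp (c * of_real t) :: 'b::{real_normed_field,banach})"
proof -
  have "smooth_on UNIV (\<lambda>t::real. (1::'b) * exp (c * of_real t))"
  proof (rule smooth_on_coinduct[where P="\<lambda>f. \<exists>a::'b. f = (\<lambda>t::real. a * exp (c * of_real t))"])
    fix f :: "real \<Rightarrow> 'b" assume "\<exists>a. f = (\<lambda>t. a * exp (c * of_real t))"
    then obtain a where f: "f = (\<lambda>t. a * exp (c * of_real t))" by blast
    show "\<exists>f'. (\<forall>x\<in>UNIV. (f has_derivative f' x) (at x)) \<and> (\<forall>v. \<exists>a. (\<lambda>x. f' x v) = (\<lambda>t. a * exp (c * of_real t)))"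
    proof (intro exI[of _ "\<lambda>x v. (a * c * of_real v) * exp (c * of_real x)"] conjI ballI allI)
      fix x
      have "((\<lambda>t::real. c * of_real t :: 'b) has_derivative (\<lambda>v. c * of_real v)) (at x)"
        by (intro bounded_linear.has_derivative[OF bounded_linear_mult_right]
            bounded_linear.has_derivative[OF bounded_linear_of_real] has_derivative_ident)
      from has_derivative_compose[OF this, of exp "\<lambda>w. exp (c * of_real x) * w"]
      have "((\<lambda>t::real. exp (c * of_real t :: 'b)) has_derivative (\<lambda>v. exp (c * of_real x) * (c * of_real v))) (at x)"
        using DERIV_exp[of "c * of_real x"] by (simp add: has_field_derivative_def)
      from bounded_linear.has_derivative[OF bounded_linear_mult_right this, of a]
      show "(f has_derivative (\<lambda>v. (a * c * of_real v) * exp (c * of_real x))) (at x)"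
        by (simp add: f mult_ac)
    qed blast
  qed (auto intro: exI[of _ 1])
  then show ?thesis by simp
qed

lemma smooth_on_exp: "open U \<Longrightarrow> smooth_on U f \<Longrightarrow> smooth_on U (\<lambda>x. exp (f x :: real))"
  using smooth_on_compose[OF smooth_on_exp_of_real[of "1::real"], of U f] by simp

text \<open>Extension by zero preserves smoothness because the function vanishes near every point
  outside the closure of its support.\<close>
lemma C_k_on_extend_zero:
  assumes "open U" "C_k_on U n f" "closure {x. f x \<noteq> 0} \<subseteq> U"
  shows "C_k_on UNIV n f"
  using assms(2,3)
proof (induction n arbitrary: f)
  case 0
  have "continuous_on (U \<union> - closure {x. f x \<noteq> 0}) f"
  proof (rule continuous_on_open_Un)
    show "continuous_on (- closure {x. f x \<noteq> 0}) f"
      by (subst continuous_on_cong[of _ _ _ "\<lambda>x. 0"]) (use closure_subset[of "{x. f x \<noteq> 0}"] in auto)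
  qed (use 0 assms(1) in auto)
  moreover have "U \<union> - closure {x. f x \<noteq> 0} = UNIV" using 0 by auto
  ultimately show ?case by simp
next
  case (Suc n)
  have out: "(f has_derivative (\<lambda>v. 0)) (at x)" if "x \<notin> closure {x. f x \<noteq> 0}" for x
    by (rule has_derivative_transform_within_open[of "\<lambda>x. 0" _ _ UNIV "- closure {x. f x \<noteq> 0}"])
       (use that closure_subset[of "{x. f x \<noteq> 0}"] in auto)
  have d: "(f has_derivative frechet_derivative f (at x)) (at x)" for x
  proof (cases "x \<in> closure {x. f x \<noteq> 0}")
    case True
    then show ?thesis using C_k_on_SucD[OF Suc.prems(1)] Suc.prems(2) by auto
  next
    case False
    then show ?thesis using out by (metis frechet_derivative_at)
  qed
  have "C_k_on UNIV n (\<lambda>x. frechet_derivative f (at x) v)" for v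
  proof (rule Suc.IH)
    have "frechet_derivative f (at x) v = 0" if "x \<notin> closure {x. f x \<noteq> 0}" for x
      using out[OF that] by (metis frechet_derivative_at)
    then have "{x. frechet_derivative f (at x) v \<noteq> 0} \<subseteq> closure {x. f x \<noteq> 0}" by auto
    then have "closure {x. frechet_derivative f (at x) v \<noteq> 0} \<subseteq> closure {x. f x \<noteq> 0}"
      by (simp add: closure_minimal)
    then show "closure {x. frechet_derivative f (at x) v \<noteq> 0} \<subseteq> U" using Suc.prems(2) by blast
  qed (use Suc.prems(1) in simp)
  then show ?case by (intro C_k_on_SucI[OF _ d]) auto
qed

subsection \<open>Test functions\<close>

text \<open>A compact set outside which a function vanishes is easier to exhibit than the closure of its support.\<close>
lemma test_functions_iff:
  "g \<in> test_functions U \<longleftrightarrow> smooth_on UNIV g \<and> (\<exists>K. compact K \<and> K \<subseteq> U \<and> (\<forall>x. x \<notin> K \<longrightarrow> g x = 0))"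
  (is "?l \<longleftrightarrow> ?r")
proof
  assume ?l
  then show ?r unfolding test_functions_def smooth_on_def C_k_eq_C_k_on
    using closure_subset[of "{x. g x \<noteq> 0}"] by (auto intro!: exI[of _ "closure {x. g x \<noteq> 0}"])
next
  assume ?r
  then obtain K where K: "smooth_on UNIV g" "compact K" "K \<subseteq> U" "\<And>x. x \<notin> K \<Longrightarrow> g x = 0" by blast
  have "closure {x. g x \<noteq> 0} \<subseteq> K" using K by (intro closure_minimal compact_imp_closed) auto
  moreover from this have "K \<inter> closure {x. g x \<noteq> 0} = closure {x. g x \<noteq> 0}" by blast
  then have "compact (closure {x. g x \<noteq> 0})"
    using compact_Int_closed[OF K(2) closed_closure[of "{x. g x \<noteq> 0}"]] by simp
  ultimately show ?l unfolding test_functions_def using K(1,3)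
    by (auto simp: smooth_on_def C_k_eq_C_k_on)
qed

lemma test_functions_extend:
  assumes "open U" "smooth_on U g" "compact K" "K \<subseteq> U" "\<And>x. x \<notin> K \<Longrightarrow> g x = 0"
  shows "g \<in> test_functions U"
proof -
  have "closure {x. g x \<noteq> 0} \<subseteq> K" using assms by (intro closure_minimal compact_imp_closed) auto
  then have "closure {x. g x \<noteq> 0} \<subseteq> U" using assms(4) by blast
  then have "smooth_on UNIV g" using C_k_on_extend_zero[OF assms(1)] assms(2)
    unfolding smooth_on_def by blast
  then show ?thesis using assms test_functions_iff by blast
qed

lemma test_functions_smooth: "g \<in> test_functions U \<Longrightarrow> smooth_on UNIV g"
  by (simp add: test_functions_iff)

lemma test_functions_has_derivative:
  "g \<in> test_functions U \<Longrightarrow> (g has_derivative frechet_derivative g (at x)) (at x)"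
  using smooth_onD_differentiable test_functions_smooth by blast

lemma test_functions_continuous: "g \<in> test_functions U \<Longrightarrow> continuous_on UNIV g"
  by (simp add: test_functions_smooth smooth_on_continuous)

lemma test_functions_measurable [measurable (raw)]:
  "g \<in> test_functions U \<Longrightarrow> g \<in> borel_measurable borel"
  by (simp add: borel_measurable_continuous_onI test_functions_continuous)

lemma test_functions_derivative:
  assumes "g \<in> test_functions U"
  shows "(\<lambda>x. frechet_derivative g (at x) v) \<in> test_functions U"
proof -
  obtain K where K: "compact K" "K \<subseteq> U" "\<And>x. x \<notin> K \<Longrightarrow> g x = 0"
    using assms test_functions_iff by blast
  have "frechet_derivative g (at x) v = 0" if "x \<notin> K" for x
  proof -
    have "(g has_derivative (\<lambda>v. 0)) (at x)"
      by (rule has_derivative_transform_within_open[of "\<lambda>x. 0" _ _ UNIV "- K"])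
         (use that K in \<open>auto intro: compact_imp_closed\<close>)
    then show ?thesis by (metis frechet_derivative_at)
  qed
  then show ?thesis
    using test_functions_iff K smooth_onD_derivative[OF test_functions_smooth[OF assms]] by blast
qed

lemma test_functions_add:
  assumes "f \<in> test_functions U" "g \<in> test_functions U"
  shows "(\<lambda>x. f x + g x) \<in> test_functions U"
proof -
  obtain K L where "compact K" "K \<subseteq> U" "\<And>x. x \<notin> K \<Longrightarrow> f x = 0" "compact L" "L \<subseteq> U" "\<And>x. x \<notin> L \<Longrightarrow> g x = 0"
    using assms test_functions_iff by metis
  then show ?thesis using assms smooth_on_add[of UNIV f g]
    by (auto simp: test_functions_iff intro!: exI[of _ "K \<union> L"] compact_Un)
qed

lemma test_functions_mult_smooth:
  assumes "f \<in> test_functions U" "smooth_on UNIV g"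
  shows "(\<lambda>x. g x * f x) \<in> test_functions U"
proof -
  obtain K where "compact K" "K \<subseteq> U" "\<And>x. x \<notin> K \<Longrightarrow> f x = 0"
    using assms test_functions_iff by metis
  then show ?thesis using assms smooth_on_mult[of UNIV g f]
    by (auto simp: test_functions_iff intro!: exI[of _ K])
qed

lemma test_functions_cmult: "f \<in> test_functions U \<Longrightarrow> (\<lambda>x. c * f x) \<in> test_functions U"
  by (rule test_functions_mult_smooth) auto

lemma test_functions_zero [simp]: "(\<lambda>x. 0) \<in> test_functions U"
  by (auto simp: test_functions_iff intro!: exI[of _ "{}"])

lemma test_functions_sum:
  "(\<And>i. i \<in> I \<Longrightarrow> f i \<in> test_functions U) \<Longrightarrow> (\<lambda>x. \<Sum>i\<in>I. f i x) \<in> test_functions U"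
  by (induction I rule: infinite_finite_induct) (auto intro!: test_functions_add)

lemma test_functions_bounded:
  assumes "f \<in> test_functions U"
  obtains K where "0 < K" "\<And>x. norm (f x) \<le> K"
proof -
  obtain C where C: "compact C" "\<And>x. x \<notin> C \<Longrightarrow> f x = 0"
    using assms test_functions_iff by metis
  have "bounded (f ` C)"
    using C(1) test_functions_continuous[OF assms]
    by (meson compact_continuous_image compact_imp_bounded continuous_on_subset subset_UNIV)
  then obtain B where "0 < B" "\<And>x. x \<in> C \<Longrightarrow> norm (f x) \<le> B"
    by (auto simp: bounded_pos)
  then have "norm (f x) \<le> B" for x using C(2)[of x] by (cases "x \<in> C") auto
  with \<open>0 < B\<close> show ?thesis using that by blast
qed

lemma onorm_le_sum_Basis:
  fixes L :: "'a::euclidean_space \<Rightarrow> 'b::real_normed_vector"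
  assumes "linear L"
  shows "onorm L \<le> (\<Sum>b\<in>Basis. norm (L b))"
proof (rule onorm_bound)
  fix x
  have "norm (L x) \<le> (\<Sum>b\<in>Basis. norm ((x \<bullet> b) *\<^sub>R L b))"
    by (subst linear_sum_Basis[OF assms]) (rule norm_sum)
  also have "\<dots> \<le> (\<Sum>b\<in>Basis. norm (L b) * norm x)"
    by (rule sum_mono) (simp add: mult.commute[of "norm (L _)"] mult_right_mono Basis_le_norm)
  finally show "norm (L x) \<le> (\<Sum>b\<in>Basis. norm (L b)) * norm x" by (simp add: sum_distrib_right)
qed (simp add: sum_nonneg)

lemma test_functions_lipschitz:
  fixes f :: "'a::euclidean_space \<Rightarrow> complex"
  assumes "f \<in> test_functions U"
  obtains K where "0 \<le> K" "\<And>x y. norm (f x - f y) \<le> K * norm (x - y)"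
proof -
  have "\<exists>B. 0 < B \<and> (\<forall>x. norm (frechet_derivative f (at x) b) \<le> B)" for b
    using test_functions_bounded[OF test_functions_derivative[OF assms]] by metis
  then obtain B where B: "\<And>b. 0 < B b" "\<And>b x. norm (frechet_derivative f (at x) b) \<le> B b"
    by metis
  have "norm (f x - f y) \<le> (\<Sum>b\<in>Basis. B b) * norm (x - y)" for x y
  proof (rule differentiable_bound[of UNIV f "\<lambda>x. frechet_derivative f (at x)"])
    show "onorm (frechet_derivative f (at x)) \<le> (\<Sum>b\<in>Basis. B b)" for x
      using onorm_le_sum_Basis[OF has_derivative_linear[OF test_functions_has_derivative[OF assms]], of x]
        sum_mono[of Basis "\<lambda>b. norm (frechet_derivative f (at x) b)" B] B(2) by (meson order_trans)
  qed (use test_functions_has_derivative[OF assms] in auto)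
  moreover have "0 \<le> (\<Sum>b\<in>Basis. B b)" using B(1) by (simp add: sum_nonneg less_imp_le)
  ultimately show ?thesis using that by blast
qed

text \<open>Since the second derivatives are bounded, the first-order Taylor remainder is quadratic
  uniformly in the base point; this is what allows differentiation under any finite integral.\<close>
lemma test_functions_taylor:
  fixes f :: "'a::euclidean_space \<Rightarrow> complex"
  assumes "f \<in> test_functions U"
  obtains K where "0 \<le> K"
    "\<And>x h. norm (f (x + h) - f x - frechet_derivative f (at x) h) \<le> K * (norm h)\<^sup>2"
proof -
  let ?D = "\<lambda>x. frechet_derivative f (at x)"
  have "\<exists>B. 0 \<le> B \<and> (\<forall>x y. norm (?D x b - ?D y b) \<le> B * norm (x - y))" for b
    using test_functions_lipschitz[OF test_functions_derivative[OF assms]] by metis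
  then obtain B where B: "\<And>b. 0 \<le> B b" "\<And>b x y. norm (?D x b - ?D y b) \<le> B b * norm (x - y)"
    by metis
  have lin: "linear (?D x)" for x
    by (rule has_derivative_linear[OF test_functions_has_derivative[OF assms]])
  have "norm (f (x + h) - f x - ?D x h) \<le> (\<Sum>b\<in>Basis. B b) * (norm h)\<^sup>2" for x h
  proof -
    have "norm (f (x + h) - f x - ?D x (x + h - x)) \<le> norm (x + h - x) * ((\<Sum>b\<in>Basis. B b) * norm h)"
    proof (rule differentiable_bound_linearization[where S="cball x (norm h)"])
      show "x + t *\<^sub>R (x + h - x) \<in> cball x (norm h)" if "t \<in> {0..1}" for t
        using that by (simp add: dist_norm mult_left_le_one_le)
      show "(f has_derivative ?D y) (at y within cball x (norm h))" for y
        using test_functions_has_derivative[OF assms] has_derivative_at_withinI by blast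
      show "onorm (?D y - ?D x) \<le> (\<Sum>b\<in>Basis. B b) * norm h" if "y \<in> cball x (norm h)" for y
      proof -
        have "linear (?D y - ?D x)"
          using linear_compose_sub[OF lin lin, of y x] by (simp add: fun_diff_def)
        then have "onorm (?D y - ?D x) \<le> (\<Sum>b\<in>Basis. norm (?D y b - ?D x b))"
          using onorm_le_sum_Basis by fastforce
        also have "\<dots> \<le> (\<Sum>b\<in>Basis. B b * norm h)"
        proof (rule sum_mono)
          fix b :: 'a
          have "norm (?D y b - ?D x b) \<le> B b * norm (y - x)" by (rule B)
          also have "\<dots> \<le> B b * norm h" using that B(1) by (intro mult_left_mono) (auto simp: dist_norm norm_minus_commute)
          finally show "norm (?D y b - ?D x b) \<le> B b * norm h" .
        qed
        finally show ?thesis by (simp add: sum_distrib_right)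
      qed
    qed auto
    then show ?thesis by (simp add: power2_eq_square mult_ac)
  qed
  moreover have "0 \<le> (\<Sum>b\<in>Basis. B b)" using B(1) by (simp add: sum_nonneg)
  ultimately show ?thesis using that by blast
qed

abbreviation dir_deriv ::
  "'a::euclidean_space \<Rightarrow> ('a \<Rightarrow> 'b::real_normed_vector) \<Rightarrow> 'a \<Rightarrow> 'b" where
  "dir_deriv v f x \<equiv> frechet_derivative f (at x) v"

lemma dir_derivI: "(f has_derivative f') (at x) \<Longrightarrow> dir_deriv v f x = f' v"
  using frechet_derivative_at[of f f' x] by simp

lemma partial_deriv_eq: "partial_deriv i f = dir_deriv (axis i 1) f"
  by (simp add: partial_deriv_def fun_eq_iff)

lemma test_functions_partial_deriv:
  "f \<in> test_functions U \<Longrightarrow> partial_deriv i f \<in> test_functions U"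
  unfolding partial_deriv_eq by (rule test_functions_derivative)

lemma vec_eq_sum_axis: "v = (\<Sum>k\<in>UNIV. v $ k *\<^sub>R axis k (1::real))"
  by (simp add: vec_eq_iff axis_def if_distrib cong: if_cong)

lemma dir_deriv_eq_partial:
  fixes f :: "real^'d \<Rightarrow> complex"
  assumes "smooth_on UNIV f"
  shows "dir_deriv v f x = (\<Sum>k\<in>UNIV. complex_of_real (v $ k) * partial_deriv k f x)"
proof -
  have lin: "linear (frechet_derivative f (at x))"
    by (rule has_derivative_linear[OF smooth_onD_differentiable[OF assms UNIV_I]])
  have "dir_deriv v f x = dir_deriv (\<Sum>k\<in>UNIV. v $ k *\<^sub>R axis k (1::real)) f x"
    by (rule arg_cong[OF vec_eq_sum_axis])
  also have "\<dots> = (\<Sum>k\<in>UNIV. v $ k *\<^sub>R dir_deriv (axis k 1) f x)"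
    by (simp only: linear_sum[OF lin] linear_cmul[OF lin])
  finally show ?thesis by (simp add: partial_deriv_def scaleR_conv_of_real)
qed

lemma dir_deriv_add:
  assumes "smooth_on UNIV f" "smooth_on UNIV g"
  shows "dir_deriv v (\<lambda>x. f x + g x) x = dir_deriv v f x + dir_deriv v g x"
  by (rule dir_derivI[OF has_derivative_add[OF smooth_onD_differentiable[OF assms(1) UNIV_I]
    smooth_onD_differentiable[OF assms(2) UNIV_I]]])

lemma dir_deriv_mult:
  fixes f g :: "'a::euclidean_space \<Rightarrow> complex"
  assumes "smooth_on UNIV f" "smooth_on UNIV g"
  shows "dir_deriv v (\<lambda>x. f x * g x) x = f x * dir_deriv v g x + dir_deriv v f x * g x"
  by (rule dir_derivI[OF has_derivative_mult[OF smooth_onD_differentiable[OF assms(1) UNIV_I]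
    smooth_onD_differentiable[OF assms(2) UNIV_I]]])

lemma dir_deriv_cmult:
  assumes "f \<in> test_functions U"
  shows "dir_deriv v (\<lambda>x. c * f x) x = c * dir_deriv v f x"
  by (rule dir_derivI[OF bounded_linear.has_derivative[OF bounded_linear_mult_right
    test_functions_has_derivative[OF assms]]])

lemma dir_deriv_sum:
  assumes "\<And>i. i \<in> I \<Longrightarrow> f i \<in> test_functions U"
  shows "dir_deriv v (\<lambda>x. \<Sum>i\<in>I. f i x) x = (\<Sum>i\<in>I. dir_deriv v (f i) x)"
  by (rule dir_derivI[OF has_derivative_sum]) (rule test_functions_has_derivative[OF assms])

lemma dir_deriv2_eq_partial:
  fixes f :: "real^'d \<Rightarrow> complex"
  assumes "f \<in> test_functions U"
  shows "dir_deriv u (dir_deriv v f) x =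
    (\<Sum>k\<in>UNIV. \<Sum>l\<in>UNIV. complex_of_real (u $ k * v $ l) * partial_deriv k (partial_deriv l f) x)"
proof -
  have "dir_deriv v f = (\<lambda>x. \<Sum>l\<in>UNIV. complex_of_real (v $ l) * partial_deriv l f x)"
    using dir_deriv_eq_partial[OF test_functions_smooth[OF assms]] by blast
  then have "dir_deriv u (dir_deriv v f) x
      = (\<Sum>l\<in>UNIV. complex_of_real (v $ l) * dir_deriv u (partial_deriv l f) x)"
    using assms
    by (simp add: dir_deriv_sum[where U=U] dir_deriv_cmult[where U=U] test_functions_partial_deriv test_functions_cmult)
  also have "\<dots> = (\<Sum>l\<in>UNIV. \<Sum>k\<in>UNIV. complex_of_real (u $ k * v $ l) * partial_deriv k (partial_deriv l f) x)"
    by (simp add: dir_deriv_eq_partial[OF test_functions_smooth[OF test_functions_partial_deriv[OF assms]]] sum_distrib_left mult_ac)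
  finally show ?thesis by (subst sum.swap) simp
qed

section \<open>Averages of test functions over random affine arguments\<close>

text \<open>Mehler's formula for the resolvent and the time Fourier transform of a test function are both of this
  form, so that smoothness and differentiation under the integral are treated once for both.\<close>
definition avg ::
  "'p measure \<Rightarrow> ('p \<Rightarrow> complex) \<Rightarrow> ('p \<Rightarrow> real) \<Rightarrow> ('p \<Rightarrow> 'a::euclidean_space) \<Rightarrow>
   ('a \<Rightarrow> complex) \<Rightarrow> 'a \<Rightarrow> complex" where
  "avg N w r \<xi> f x = (\<integral>p. w p * f (r p *\<^sub>R x + \<xi> p) \<partial>N)"

lemma integrable_mult_bounded:
  fixes w g :: "'p \<Rightarrow> complex"
  assumes "integrable N w" "g \<in> borel_measurable N" "\<And>p. norm (g p) \<le> K"
  shows "integrable N (\<lambda>p. w p * g p)"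
proof (rule Bochner_Integration.integrable_bound)
  show "integrable N (\<lambda>p. complex_of_real K * w p)" using assms(1) by simp
  have "0 \<le> K" using assms(3) norm_ge_zero order_trans by blast
  then show "AE p in N. norm (w p * g p) \<le> norm (complex_of_real K * w p)"
    using assms(3) by (auto simp: norm_mult mult.commute[of K] intro!: mult_left_mono)
qed (use assms in measurable)

lemma avg_integrable:
  assumes "integrable N w" "r \<in> borel_measurable N" "\<xi> \<in> borel_measurable N" "f \<in> test_functions U"
  shows "integrable N (\<lambda>p. w p * f (r p *\<^sub>R x + \<xi> p))"
proof -
  obtain K where K: "\<And>x. norm (f x) \<le> K" using test_functions_bounded[OF assms(4)] by metis
  have [measurable]: "f \<in> borel_measurable borel" using assms(4) by measurable
  note [measurable] = assms(2,3)
  show ?thesis by (rule integrable_mult_bounded[OF assms(1) _ K]) measurable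
qed

lemma integrable_weight_mult:
  assumes "integrable N w" "r \<in> borel_measurable N" "\<And>p. \<bar>r p\<bar> \<le> 1"
  shows "integrable N (\<lambda>p. w p * complex_of_real (r p))"
  by (rule integrable_mult_bounded[of _ _ _ 1]) (use assms in auto)

text \<open>The quadratic Taylor remainder of the integrand is dominated by a multiple of the weight, so
  the remainder of the average is quadratic as well.\<close>
lemma avg_has_derivative:
  assumes w: "integrable N w" and r[measurable]: "r \<in> borel_measurable N" and \<xi>[measurable]: "\<xi> \<in> borel_measurable N"
    and f: "f \<in> test_functions U" and r1: "\<And>p. \<bar>r p\<bar> \<le> 1"
  shows "(avg N w r \<xi> f has_derivative
      (\<lambda>h. avg N (\<lambda>p. w p * complex_of_real (r p)) r \<xi> (dir_deriv h f) x)) (at x)"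
proof -
  let ?w' = "\<lambda>p. w p * complex_of_real (r p)"
  note int0 = avg_integrable[OF w r \<xi> f]
  have int1: "integrable N (\<lambda>p. ?w' p * dir_deriv h f (r p *\<^sub>R x + \<xi> p))" for h x
    by (rule avg_integrable[OF integrable_weight_mult[OF w r r1] r \<xi> test_functions_derivative[OF f]])
  have lin: "linear (frechet_derivative f (at y))" for y
    by (rule has_derivative_linear[OF test_functions_has_derivative[OF f]])
  obtain K where K: "0 \<le> K"
    "\<And>x h. norm (f (x + h) - f x - dir_deriv h f x) \<le> K * (norm h)\<^sup>2"
    using test_functions_taylor[OF f] by metis
  have bl: "bounded_linear (\<lambda>h. avg N ?w' r \<xi> (dir_deriv h f) x)"
  proof (subst linear_conv_bounded_linear[symmetric], rule linearI)
    show "avg N ?w' r \<xi> (dir_deriv (h1 + h2) f) x = avg N ?w' r \<xi> (dir_deriv h1 f) x + avg N ?w' r \<xi> (dir_deriv h2 f) x" for h1 h2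
      unfolding avg_def using int1[where h=h1 and x=x] int1[where h=h2 and x=x]
      by (simp add: linear_add[OF lin] distrib_left)
    show "avg N ?w' r \<xi> (dir_deriv (c *\<^sub>R h) f) x = c *\<^sub>R avg N ?w' r \<xi> (dir_deriv h f) x" for c h
      unfolding avg_def by (simp add: linear_cmul[OF lin])
  qed
  have rem: "norm (avg N w r \<xi> f (x + h) - avg N w r \<xi> f x - avg N ?w' r \<xi> (dir_deriv h f) x)
      \<le> (K * (\<integral>p. norm (w p) \<partial>N)) * (norm h)\<^sup>2" for h
  proof -
    have "avg N w r \<xi> f (x + h) - avg N w r \<xi> f x - avg N ?w' r \<xi> (dir_deriv h f) x
        = (\<integral>p. w p * f (r p *\<^sub>R (x + h) + \<xi> p) - w p * f (r p *\<^sub>R x + \<xi> p)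
              - ?w' p * dir_deriv h f (r p *\<^sub>R x + \<xi> p) \<partial>N)"
      unfolding avg_def using int0 int1 by simp
    also have "norm \<dots> \<le> (\<integral>p. norm (w p) * (K * (norm h)\<^sup>2) \<partial>N)"
    proof (rule order_trans[OF integral_norm_bound integral_mono])
      show "integrable N (\<lambda>p. norm (w p * f (r p *\<^sub>R (x + h) + \<xi> p) - w p * f (r p *\<^sub>R x + \<xi> p)
              - ?w' p * dir_deriv h f (r p *\<^sub>R x + \<xi> p)))"
        by (intro integrable_norm Bochner_Integration.integrable_diff int0 int1)
      show "integrable N (\<lambda>p. norm (w p) * (K * (norm h)\<^sup>2))" using w by auto
      fix p
      let ?y = "r p *\<^sub>R x + \<xi> p"
      have "w p * f (r p *\<^sub>R (x + h) + \<xi> p) - w p * f ?y - ?w' p * dir_deriv h f ?y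
          = w p * (f (?y + r p *\<^sub>R h) - f ?y - dir_deriv (r p *\<^sub>R h) f ?y)"
        by (simp add: linear_cmul[OF lin] scaleR_conv_of_real algebra_simps)
      moreover have "norm (f (?y + r p *\<^sub>R h) - f ?y - dir_deriv (r p *\<^sub>R h) f ?y) \<le> K * (norm h)\<^sup>2"
      proof (rule order_trans[OF K(2)])
        have "norm (r p *\<^sub>R h) \<le> norm h" using r1[of p] by (simp add: mult_left_le_one_le)
        then show "K * (norm (r p *\<^sub>R h))\<^sup>2 \<le> K * (norm h)\<^sup>2"
          by (intro mult_left_mono K(1) power_mono) auto
      qed
      ultimately show "norm (w p * f (r p *\<^sub>R (x + h) + \<xi> p) - w p * f ?y - ?w' p * dir_deriv h f ?y)
          \<le> norm (w p) * (K * (norm h)\<^sup>2)"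
        by (simp add: norm_mult mult_left_mono)
    qed
    also have "\<dots> = (K * (\<integral>p. norm (w p) \<partial>N)) * (norm h)\<^sup>2" by simp
    finally show ?thesis .
  qed
  show ?thesis
  proof (rule has_derivativeI_sandwich[where e=1 and H="\<lambda>y. (K * (\<integral>p. norm (w p) \<partial>N)) * norm (y - x)"])
    show "((\<lambda>y. (K * (\<integral>p. norm (w p) \<partial>N)) * norm (y - x)) \<longlongrightarrow> 0) (at x)"
      by (auto intro!: tendsto_eq_intros)
    fix y assume "y \<noteq> x"
    then show "norm (avg N w r \<xi> f y - avg N w r \<xi> f x - avg N ?w' r \<xi> (dir_deriv (y - x) f) x) / norm (y - x)
        \<le> (K * (\<integral>p. norm (w p) \<partial>N)) * norm (y - x)"
      using rem[of "y - x"] by (simp add: divide_simps power2_eq_square mult_ac)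
  qed (use bl in auto)
qed

lemma dir_deriv_avg:
  assumes "integrable N w" "r \<in> borel_measurable N" "\<xi> \<in> borel_measurable N"
    "f \<in> test_functions U" "\<And>p. \<bar>r p\<bar> \<le> 1"
  shows "dir_deriv h (avg N w r \<xi> f) x = avg N (\<lambda>p. w p * complex_of_real (r p)) r \<xi> (dir_deriv h f) x"
  by (rule dir_derivI[OF avg_has_derivative[OF assms]])

text \<open>The derivatives of an average are averages again, with the weight multiplied by the dilation factor.\<close>
lemma avg_smooth:
  assumes "integrable N w" "r \<in> borel_measurable N" "\<xi> \<in> borel_measurable N"
    "f \<in> test_functions U" "\<And>p. \<bar>r p\<bar> \<le> 1"
  shows "smooth_on UNIV (avg N w r \<xi> f)"
proof (rule smooth_on_coinduct[where
      P="\<lambda>g. \<exists>w f. integrable N w \<and> f \<in> test_functions U \<and> g = avg N w r \<xi> f"])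
  fix g assume "\<exists>w f. integrable N w \<and> f \<in> test_functions U \<and> g = avg N w r \<xi> f"
  then obtain w f where g: "integrable N w" "f \<in> test_functions U" "g = avg N w r \<xi> f" by blast
  show "\<exists>g'. (\<forall>x\<in>UNIV. (g has_derivative g' x) (at x)) \<and>
      (\<forall>v. \<exists>w f. integrable N w \<and> f \<in> test_functions U \<and> (\<lambda>x. g' x v) = avg N w r \<xi> f)"
  proof (intro exI[of _ "\<lambda>x h. avg N (\<lambda>p. w p * complex_of_real (r p)) r \<xi> (dir_deriv h f) x"]
      conjI ballI allI)
    show "(g has_derivative (\<lambda>h. avg N (\<lambda>p. w p * complex_of_real (r p)) r \<xi> (dir_deriv h f) x)) (at x)" for x
      unfolding g(3) by (rule avg_has_derivative[OF g(1) assms(2,3) g(2) assms(5)])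
    show "\<exists>w' f'. integrable N w' \<and> f' \<in> test_functions U \<and>
        avg N (\<lambda>p. w p * complex_of_real (r p)) r \<xi> (dir_deriv v f) = avg N w' r \<xi> f'" for v
      using integrable_weight_mult[OF g(1) assms(2,5)] test_functions_derivative[OF g(2)] by blast
  qed
qed (use assms in auto)

section \<open>Bump functions\<close>

text \<open>Extended by zero, the functions \<open>p (1 / t) exp (- 1 / t)\<close> form a family that is closed under
  differentiation; carrying the polynomial along makes \<open>smooth_on_coinduct\<close> applicable.\<close>
definition flat :: "real poly \<Rightarrow> real \<Rightarrow> real" where
  "flat p t = (if 0 < t then poly p (inverse t) * exp (- inverse t) else 0)"

lemma poly_exp_tendsto_0: "((\<lambda>x::real. poly p x * exp (- x)) \<longlongrightarrow> 0) at_top"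
proof -
  have "((\<lambda>x. \<Sum>i\<le>degree p. coeff p i * (x ^ i / exp x)) \<longlongrightarrow> (\<Sum>i\<le>degree p. coeff p i * 0)) at_top"
    by (intro tendsto_sum tendsto_mult tendsto_const tendsto_power_div_exp_0)
  then show ?thesis by (simp add: poly_altdef exp_minus sum_distrib_left divide_inverse mult_ac)
qed

lemma flat_has_derivative:
  "(flat p has_field_derivative flat ([:0, 0, 1:] * (p - pderiv p)) t) (at t)"
proof -
  consider "t > 0" | "t < 0" | "t = 0" by linarith
  then show ?thesis
  proof cases
    case 1
    have "((\<lambda>t. poly p (inverse t) * exp (- inverse t)) has_field_derivative
        flat ([:0, 0, 1:] * (p - pderiv p)) t) (at t)"
      using 1 by (auto intro!: derivative_eq_intros DERIV_chain2[OF poly_DERIV]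
          simp: flat_def power2_eq_square field_simps)
    then show ?thesis
      by (rule has_field_derivative_transform_within_open[where S="{0<..}"]) (use 1 in \<open>auto simp: flat_def\<close>)
  next
    case 2
    have "((\<lambda>t. 0) has_field_derivative flat ([:0, 0, 1:] * (p - pderiv p)) t) (at t)"
      using 2 by (auto simp: flat_def)
    then show ?thesis
      by (rule has_field_derivative_transform_within_open[where S="{..<0}"]) (use 2 in \<open>auto simp: flat_def\<close>)
  next
    case 3
    have "((\<lambda>h. flat p h / h) \<longlongrightarrow> 0) (at 0)"
    proof (rule filterlim_split_at)
      show "((\<lambda>h. flat p h / h) \<longlongrightarrow> 0) (at_left 0)"
        by (rule tendsto_eventually) (auto simp: flat_def eventually_at_filter)
      have "((\<lambda>h. poly ([:0, 1:] * p) (inverse h) * exp (- inverse h)) \<longlongrightarrow> 0) (at_right 0)"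
        by (rule filterlim_compose[OF poly_exp_tendsto_0 filterlim_inverse_at_top_right])
      then show "((\<lambda>h. flat p h / h) \<longlongrightarrow> 0) (at_right 0)"
        by (rule Lim_transform_eventually) (auto simp: flat_def eventually_at_filter field_simps)
    qed
    then show ?thesis using 3 by (simp add: has_field_derivative_iff flat_def)
  qed
qed

lemma flat_smooth: "smooth_on UNIV (flat p)"
proof (rule smooth_on_coinduct[where P="\<lambda>f. \<exists>p. f = flat p"])
  fix f assume "\<exists>p. f = flat p"
  then obtain p where f: "f = flat p" by blast
  show "\<exists>f'. (\<forall>x\<in>UNIV. (f has_derivative f' x) (at x)) \<and> (\<forall>v. \<exists>p. (\<lambda>x. f' x v) = flat p)"
  proof (intro exI[of _ "\<lambda>x v. flat ([:0, 0, 1:] * (p - pderiv p)) x * v"] conjI ballI allI)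
    show "(f has_derivative (*) (flat ([:0, 0, 1:] * (p - pderiv p)) x)) (at x)" for x
      using flat_has_derivative[of p x] by (simp add: f has_field_derivative_def)
    show "\<exists>q. (\<lambda>x. flat ([:0, 0, 1:] * (p - pderiv p)) x * v) = flat q" for v
      by (rule exI[of _ "smult v ([:0, 0, 1:] * (p - pderiv p))"]) (auto simp: flat_def fun_eq_iff)
  qed
qed auto

text \<open>The factor \<open>exp 1\<close> normalises the value at the origin to one, as required of a cutoff.\<close>
definition bump :: "'a::euclidean_space \<Rightarrow> complex" where
  "bump x = complex_of_real (exp 1 * flat 1 (1 - x \<bullet> x))"

lemma bump_test: "bump \<in> test_functions UNIV"
proof -
  have "smooth_on UNIV (\<lambda>x::'a. exp 1 * flat 1 (1 - x \<bullet> x))"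
    by (intro smooth_on_mult smooth_on_compose[OF flat_smooth] smooth_on_diff smooth_on_inner) auto
  then have "smooth_on UNIV (bump :: 'a \<Rightarrow> complex)"
    unfolding bump_def[abs_def] by (rule smooth_on_bounded_linear_compose[OF open_UNIV bounded_linear_of_real])
  moreover have "bump x = 0" if "x \<notin> cball 0 1" for x :: 'a
  proof -
    have "1 < x \<bullet> x" using that by (simp add: dot_square_norm power2_eq_square less_1_mult)
    then show ?thesis by (simp add: bump_def flat_def)
  qed
  ultimately show ?thesis by (auto simp: test_functions_iff intro!: exI[of _ "cball 0 1"])
qed

lemma bump_0 [simp]: "bump 0 = 1"
  by (simp add: bump_def flat_def exp_minus)

section \<open>Linear changes of variables and Gaussian integrals\<close>

text \<open>Every linear map is a composition of coordinate projections, stretches, coordinate swaps and shears, and both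
  sides are multiplicative under composition.  For swaps and shears it suffices to measure images of boxes.\<close>
lemma lmeasurable_linear_image:
  fixes f :: "real^'d \<Rightarrow> real^'d"
  assumes "linear f" "S \<in> lmeasurable"
  shows "f ` S \<in> lmeasurable \<and> measure lebesgue (f ` S) = \<bar>det (matrix f)\<bar> * measure lebesgue S"
proof -
  let ?Q = "\<lambda>f S. f ` S \<in> lmeasurable \<and> measure lebesgue (f ` S) = \<bar>det (matrix f)\<bar> * measure lebesgue S"
  have from_boxes: "\<forall>S\<in>lmeasurable. ?Q f S"
    if "linear f" "\<And>a b. measure lebesgue (f ` cbox a b) = \<bar>det (matrix f)\<bar> * measure lebesgue (cbox a b)"
    for f :: "real^'d \<Rightarrow> real^'d"
    using measure_linear_sufficient[OF that(1) _ that(2)] by auto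
  have "\<forall>S\<in>lmeasurable. ?Q f S"
  proof (rule induct_linear_elementary[OF assms(1)])
    fix f g :: "real^'d \<Rightarrow> real^'d"
    assume "linear f" "linear g" "\<forall>S\<in>lmeasurable. ?Q f S" "\<forall>S\<in>lmeasurable. ?Q g S"
    moreover have "(f \<circ> g) ` S = f ` g ` S" for S by auto
    ultimately show "\<forall>S\<in>lmeasurable. ?Q (f \<circ> g) S"
      by (metis (no_types, lifting) matrix_compose det_mul abs_mult mult.assoc)
  next
    fix f :: "real^'d \<Rightarrow> real^'d" and i
    assume f: "linear f" "\<And>x. f x $ i = 0"
    have "row i (matrix f) = 0" using f(2) by (simp add: row_def matrix_def vec_eq_iff)
    then have det0: "det (matrix f) = 0" by (rule det_zero_row)
    have "negligible (f ` S)" for S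
      by (rule negligible_subset[OF negligible_standard_hyperplane_cart[of i]]) (use f(2) in auto)
    then show "\<forall>S\<in>lmeasurable. ?Q f S"
      by (simp add: det0 negligible_iff_measure)
  next
    fix c :: "'d \<Rightarrow> real"
    have "det (matrix (\<lambda>x. \<chi> i. c i * x $ i)) = prod c UNIV"
      by (subst det_diagonal) (auto simp: matrix_def axis_def)
    then show "\<forall>S\<in>lmeasurable. ?Q (\<lambda>x. \<chi> i. c i * x $ i) S"
      by (simp add: measurable_stretch measure_stretch)
  next
    fix m n :: 'd assume "m \<noteq> n"
    let ?h = "\<lambda>x::real^'d. \<chi> i. x $ Transposition.transpose m n i"
    have "linear ?h" by (rule linearI) (simp_all add: plus_vec_def scaleR_vec_def)
    moreover have "matrix ?h = (\<chi> i. mat 1 $ Transposition.transpose m n i)"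
      by (auto simp: matrix_def mat_def axis_def vec_eq_iff)
    then have "\<bar>det (matrix ?h)\<bar> = 1"
      by (simp add: det_permute_rows permutes_swap_id sign_swap_id abs_mult)
    moreover have "measure lebesgue (?h ` cbox a b) = measure lebesgue (cbox a b)" for a b
    proof (cases "cbox a b = {}")
      case False
      have im: "?h ` cbox a b = cbox (?h a) (?h b)"
      proof (rule set_eqI)
        fix x
        have "x \<in> ?h ` cbox a b \<longleftrightarrow> ?h x \<in> cbox a b"
        proof
          assume "?h x \<in> cbox a b"
          then have "?h (?h x) \<in> ?h ` cbox a b" by blast
          then show "x \<in> ?h ` cbox a b" by simp
        qed auto
        also have "\<dots> \<longleftrightarrow> x \<in> cbox (?h a) (?h b)"
          by (simp add: mem_box_cart) (metis transpose_involutory)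
        finally show "x \<in> ?h ` cbox a b \<longleftrightarrow> x \<in> cbox (?h a) (?h b)" .
      qed
      then have ne: "cbox (?h a) (?h b) \<noteq> {}" using False by blast
      have "(\<Prod>i\<in>UNIV. (b - a) $ Transposition.transpose m n i) = (\<Prod>i\<in>UNIV. (b - a) $ i)"
        using prod.permute[OF permutes_swap_id, of m UNIV n "\<lambda>i. (b - a) $ i"] by (simp add: o_def)
      then show ?thesis unfolding im using ne False by (simp add: content_cbox_cart)
    qed simp
    ultimately show "\<forall>S\<in>lmeasurable. ?Q ?h S" using from_boxes by simp
  next
    fix m n :: 'd assume mn: "m \<noteq> n"
    let ?h = "\<lambda>x::real^'d. \<chi> i. if i = m then x $ m + x $ n else x $ i"
    have lin: "linear ?h"
      by (rule linearI) (auto simp: algebra_simps plus_vec_def scaleR_vec_def vec_eq_iff)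
    have "matrix ?h = (\<chi> k. if k = m then row m (mat 1) + 1 *s row n (mat 1) else row k (mat 1))"
      by (auto simp: matrix_def row_def mat_def axis_def vec_eq_iff)
    then have "det (matrix ?h) = 1" using det_row_operation[OF mn, of "mat 1" 1] by simp
    moreover have "measure lebesgue (?h ` cbox a b) = measure lebesgue (cbox a b)" for a b
    proof (cases "cbox a b = {}")
      case False
      \<comment> \<open>Shearing an interval is understood when its \<open>n\<close>-th side lies in the positive half-line;
        translation moves every interval into that position.\<close>
      define v where "v = axis n (- a $ n)"
      have eq: "?h ` cbox (v + a) (v + b) = (+) (?h v) ` ?h ` cbox a b"
        by (subst cbox_translation) (simp add: image_comp o_def linear_add[OF lin])
      have "measure lebesgue (?h ` cbox a b) = measure lebesgue (?h ` cbox (v + a) (v + b))"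
        unfolding eq by (rule measure_translation[symmetric])
      also have "\<dots> = measure lebesgue (cbox (v + a) (v + b))"
        by (rule measure_shear_interval[OF mn]) (use False in \<open>auto simp: v_def axis_def cbox_translation\<close>)
      also have "\<dots> = measure lebesgue (cbox a b)"
        unfolding cbox_translation by (rule measure_translation)
      finally show ?thesis .
    qed simp
    ultimately show "\<forall>S\<in>lmeasurable. ?Q ?h S" using from_boxes[OF lin] by simp
  qed
  then show ?thesis using assms(2) by blast
qed

lemma matrix_vector_mult_measurable [measurable]: "((*v) (T::real^'n^'m)) \<in> borel_measurable borel"
  by (intro borel_measurable_continuous_onI continuous_intros matrix_vector_mult_linear_continuous_on)

lemma lborel_linear:
  fixes T :: "real^'d^'d"
  assumes "det T \<noteq> 0"
  shows "lborel = density (distr lborel borel ((*v) T)) (\<lambda>_. \<bar>det T\<bar>)"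
proof (rule lborel_eqI)
  obtain S where S: "T ** S = mat 1" "S ** T = mat 1"
    using assms by (metis invertible_def invertible_det_nz)
  fix l u :: "real^'d" assume le: "\<And>b. b \<in> Basis \<Longrightarrow> l \<bullet> b \<le> u \<bullet> b"
  have vim: "(*v) T -` box l u = (*v) S ` box l u"
  proof (rule set_eqI)
    fix x
    show "x \<in> (*v) T -` box l u \<longleftrightarrow> x \<in> (*v) S ` box l u"
      using S by (auto simp: image_iff matrix_vector_mul_assoc intro!: bexI[of _ "T *v x"])
  qed
  have m: "(*v) S ` box l u \<in> lmeasurable"
    "measure lebesgue ((*v) S ` box l u) = \<bar>det S\<bar> * measure lebesgue (box l u)"
    using lmeasurable_linear_image[of "(*v) S" "box l u"] by (auto simp: lmeasurable_box)
  have "emeasure lborel ((*v) T -` box l u) = emeasure lebesgue ((*v) S ` box l u)"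
  proof -
    have "(*v) T -` box l u \<in> sets borel" by (rule measurable_sets_borel[of _ borel]) auto
    then have "(*v) T -` box l u \<in> sets lborel" by simp
    then show ?thesis unfolding vim[symmetric] by (simp add: emeasure_completion main_part_sets)
  qed
  also have "\<dots> = ennreal (\<bar>det S\<bar> * measure lebesgue (box l u))"
    using m emeasure_eq_measure2[of _ lebesgue] by (metis fmeasurableD2 emeasure_eq_ennreal_measure top.not_eq_extremum)
  also have "measure lebesgue (box l u) = (\<Prod>b\<in>Basis. (u - l) \<bullet> b)"
    using le by simp
  finally have e: "emeasure lborel ((*v) T -` box l u) = ennreal (\<bar>det S\<bar> * (\<Prod>b\<in>Basis. (u - l) \<bullet> b))" .
  have "det T * det S = 1" using S(1) by (metis det_I det_mul)
  then have d1: "\<bar>det T\<bar> * \<bar>det S\<bar> = 1" by (metis abs_mult abs_one)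
  have "emeasure (density (distr lborel borel ((*v) T)) (\<lambda>_. \<bar>det T\<bar>)) (box l u)
      = ennreal \<bar>det T\<bar> * emeasure lborel ((*v) T -` box l u)"
    by (simp add: emeasure_density_const emeasure_distr)
  also have "\<dots> = ennreal ((\<bar>det T\<bar> * \<bar>det S\<bar>) * (\<Prod>b\<in>Basis. (u - l) \<bullet> b))"
    unfolding e by (simp add: ennreal_mult'[symmetric] mult.assoc)
  also have "\<dots> = (\<Prod>b\<in>Basis. (u - l) \<bullet> b)" unfolding d1 by simp
  finally show "emeasure (density (distr lborel borel ((*v) T)) (\<lambda>_. \<bar>det T\<bar>)) (box l u)
    = (\<Prod>b\<in>Basis. (u - l) \<bullet> b)" .
qed simp

lemma integral_linear:
  fixes T :: "real^'d^'d" and f :: "real^'d \<Rightarrow> 'b::{banach, second_countable_topology}"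
  assumes "det T \<noteq> 0" and [measurable]: "f \<in> borel_measurable borel"
  shows "(\<integral>x. f x \<partial>lborel) = \<bar>det T\<bar> *\<^sub>R (\<integral>x. f (T *v x) \<partial>lborel)"
  by (subst lborel_linear[OF assms(1)]) (simp add: integral_density integral_distr)

lemma integral_translate:
  fixes f :: "'a::euclidean_space \<Rightarrow> 'b::{banach, second_countable_topology}"
  assumes [measurable]: "f \<in> borel_measurable borel"
  shows "(\<integral>x. f (z + x) \<partial>lborel) = (\<integral>x. f x \<partial>lborel)"
  using integral_distr[of "(+) z" lborel borel f] by (simp add: lborel_distr_plus)

lemma integrable_translate:
  fixes f :: "'a::euclidean_space \<Rightarrow> 'b::{banach, second_countable_topology}"
  assumes "integrable lborel f"
  shows "integrable lborel (\<lambda>x. f (z + x))"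
  using integrable_distr[of "(+) z" lborel lborel f] assms lborel_distr_plus[of z]
  by (simp cong: distr_cong)

subsection \<open>Factorisation of positive definite matrices\<close>

lemma matrix_inv_unique:
  fixes A :: "real^'d^'d"
  assumes "A ** X = mat 1"
  shows "matrix_inv A = X"
proof -
  have X: "X ** A = mat 1" using assms by (metis matrix_left_right_inverse)
  have "A ** matrix_inv A = mat 1 \<and> matrix_inv A ** A = mat 1"
    unfolding matrix_inv_def by (rule someI[of _ X]) (use assms X in auto)
  then have "X ** (A ** matrix_inv A) = X" by simp
  then show ?thesis by (simp add: matrix_mul_assoc X)
qed

lemma inner_matrix_vector:
  fixes A :: "real^'n^'m"
  shows "x \<bullet> (A *v y) = (transpose A *v x) \<bullet> y"
  by (simp add: dot_lmul_matrix)

text \<open>Gram--Schmidt orthonormalisation for the inner product defined by \<open>C\<close>.\<close>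
lemma pos_def_orthonormal_set:
  fixes C :: "real^'d^'d"
  assumes "pos_def C" "k \<le> CARD('d)"
  shows "\<exists>S. finite S \<and> card S = k \<and> (\<forall>x\<in>S. \<forall>y\<in>S. x \<bullet> (C *v y) = (if x = y then 1 else 0))"
  using assms(2)
proof (induction k)
  case (Suc k)
  have sym: "x \<bullet> (C *v y) = y \<bullet> (C *v x)" for x y
    using assms(1) inner_matrix_vector[of x C y] by (simp add: pos_def_def inner_commute)
  obtain S where S: "finite S" "card S = k" "\<And>x y. x \<in> S \<Longrightarrow> y \<in> S \<Longrightarrow> x \<bullet> (C *v y) = (if x = y then 1 else 0)"
    using Suc by auto
  have "dim (span S) \<le> k" using S(1,2) by (metis dim_le_card' dim_span)
  then have "dim (span S) \<noteq> DIM(real^'d)" using Suc.prems by simp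
  then have "span S \<noteq> UNIV" using dim_UNIV by metis
  then obtain x where x: "x \<notin> span S" by blast
  define u where "u = x - (\<Sum>y\<in>S. (y \<bullet> (C *v x)) *\<^sub>R y)"
  have "(\<Sum>y\<in>S. (y \<bullet> (C *v x)) *\<^sub>R y) \<in> span S"
    by (intro span_sum span_scale span_base)
  then have "u \<noteq> 0" using x by (auto simp: u_def)
  then have pos: "0 < u \<bullet> (C *v u)" using assms(1) by (simp add: pos_def_def)
  have orth: "y \<bullet> (C *v u) = 0" if "y \<in> S" for y
  proof -
    have "(\<Sum>z\<in>S. (z \<bullet> (C *v x)) * (y \<bullet> (C *v z))) = (\<Sum>z\<in>S. if z = y then y \<bullet> (C *v x) else 0)"
      by (rule sum.cong) (use S(3) that in auto)
    then show ?thesis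
      using S(1) that
      by (simp add: u_def matrix_vector_mult_diff_distrib linear_sum[OF matrix_vector_mul_linear]
          inner_diff_right inner_sum_right matrix_vector_mult_scaleR)
  qed
  define v where "v = (1 / sqrt (u \<bullet> (C *v u))) *\<^sub>R u"
  have vv: "v \<bullet> (C *v v) = 1"
    using pos by (simp add: v_def matrix_vector_mult_scaleR field_simps)
  have vy: "y \<bullet> (C *v v) = 0" if "y \<in> S" for y
    using orth[OF that] by (simp add: v_def matrix_vector_mult_scaleR)
  have yv: "v \<bullet> (C *v y) = 0" if "y \<in> S" for y
    using vy[OF that] sym[of v y] by simp
  have v: "v \<notin> S" using vv vy by force
  have "x \<bullet> (C *v y) = (if x = y then 1 else 0)" if "x \<in> insert v S" "y \<in> insert v S" for x y
    using that v S(3) vv vy yv by (cases "x = v"; cases "y = v") auto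
  moreover have "card (insert v S) = Suc k" using v S(1,2) by simp
  ultimately show ?case using S(1) by (meson finite_insert)
qed (auto intro: exI[of _ "{}"])

text \<open>The matrix \<open>X\<close> whose rows form a basis orthonormal for \<open>C\<close> satisfies \<open>X C X\<^sup>T = 1\<close>, so that its inverse is a
  factor.\<close>
lemma pos_def_factor:
  fixes C :: "real^'d^'d"
  assumes "pos_def C"
  obtains B where "B ** transpose B = C" "det B \<noteq> 0"
proof -
  obtain S where S: "finite S" "card S = CARD('d)"
    "\<And>x y. x \<in> S \<Longrightarrow> y \<in> S \<Longrightarrow> x \<bullet> (C *v y) = (if x = y then 1 else 0)"
    using pos_def_orthonormal_set[OF assms order_refl] by blast
  obtain e :: "'d \<Rightarrow> real^'d" where e: "bij_betw e UNIV S"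
    using finite_same_card_bij[OF finite S(1), of UNIV] S(2) by metis
  define X where "X = (\<chi> i. e i)"
  have "(X ** C ** transpose X) $ i $ j = e i \<bullet> (C *v e j)" for i j
    unfolding matrix_mul_assoc[symmetric]
    by (simp add: X_def matrix_matrix_mult_def transpose_def matrix_vector_mult_def inner_vec_def)
  then have "(X ** C ** transpose X) $ i $ j = (if i = j then 1 else 0)" for i j
    using S(3)[of "e i" "e j"] e by (auto simp: bij_betw_def inj_on_def)
  then have XCX: "X ** C ** transpose X = mat 1" by (simp add: vec_eq_iff mat_def)
  define B where "B = matrix_inv X"
  have "X ** (C ** transpose X) = mat 1" using XCX by (simp add: matrix_mul_assoc)
  then have XB: "X ** B = mat 1" using matrix_inv_unique B_def by metis
  then have BX: "B ** X = mat 1" by (metis matrix_left_right_inverse)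
  have tXB: "transpose X ** transpose B = mat 1" by (metis BX matrix_transpose_mul transpose_mat)
  have "C = (B ** X) ** C ** (transpose X ** transpose B)" by (simp add: BX tXB)
  also have "\<dots> = B ** (X ** C ** transpose X) ** transpose B" by (simp add: matrix_mul_assoc)
  finally have "B ** transpose B = C" by (simp add: XCX)
  moreover have "det B \<noteq> 0" using BX by (metis det_I det_mul mult_zero_left zero_neq_one)
  ultimately show ?thesis using that by blast
qed

lemma factor_inv:
  fixes B :: "real^'d^'d"
  assumes "B ** transpose B = C" "det B \<noteq> 0"
  shows "(B *v x) \<bullet> (matrix_inv C *v (B *v y)) = x \<bullet> y" "transpose (matrix_inv C) = matrix_inv C"
    "C ** matrix_inv C = mat 1" "det C = (det B)\<^sup>2"
proof -
  obtain S where S: "B ** S = mat 1" "S ** B = mat 1"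
    using assms by (metis invertible_def invertible_det_nz)
  have tS: "transpose B ** transpose S = mat 1" by (metis S(2) matrix_transpose_mul transpose_mat)
  have "C ** (transpose S ** S) = B ** (transpose B ** transpose S) ** S"
    by (simp add: assms(1)[symmetric] matrix_mul_assoc)
  also have "\<dots> = mat 1" by (simp add: tS S)
  finally have 1: "C ** (transpose S ** S) = mat 1" .
  then have inv: "matrix_inv C = transpose S ** S" by (rule matrix_inv_unique)
  show "C ** matrix_inv C = mat 1" by (simp add: 1 inv)
  show "transpose (matrix_inv C) = matrix_inv C" by (simp add: inv matrix_transpose_mul)
  have "matrix_inv C *v (B *v y) = transpose S *v (S *v (B *v y))"
    by (simp add: inv matrix_vector_mul_assoc matrix_mul_assoc)
  also have "\<dots> = transpose S *v y" by (simp add: matrix_vector_mul_assoc S)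
  finally show "(B *v x) \<bullet> (matrix_inv C *v (B *v y)) = x \<bullet> y"
    by (simp only: inner_matrix_vector transpose_transpose matrix_vector_mul_assoc S matrix_vector_mul_lid)
  show "det C = (det B)\<^sup>2" by (simp add: assms(1)[symmetric] det_mul power2_eq_square)
qed

lemma matrix_inv_scaleR:
  fixes A :: "real^'d^'d"
  assumes "A ** matrix_inv A = mat 1" "c \<noteq> 0"
  shows "matrix_inv (c *\<^sub>R A) = (1 / c) *\<^sub>R matrix_inv A"
  by (rule matrix_inv_unique) (use assms in \<open>simp add: vec_eq_iff matrix_matrix_mult_def\<close>)

lemma det_scaleR_matrix:
  fixes A :: "real^'d^'d"
  shows "det (c *\<^sub>R A) = c ^ CARD('d) * det A"
proof -
  have "c *\<^sub>R A = (\<chi> i. c *s A $ i)" by (simp add: vec_eq_iff)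
  then show ?thesis using det_rows_mul[of "\<lambda>_. c" "\<lambda>i. A $ i"] by simp
qed

subsection \<open>The standard Gaussian\<close>

lemma has_derivative_imp_continuous_on:
  "(\<And>x. (f has_derivative f' x) (at x)) \<Longrightarrow> continuous_on UNIV f"
  by (intro continuous_at_imp_continuous_on ballI) (metis has_derivative_continuous)

definition std_gauss :: "real^'d \<Rightarrow> real" where
  "std_gauss x = exp (- (x \<bullet> x) / 2) / sqrt ((2 * pi) ^ CARD('d))"

lemma std_gauss_nonneg [simp]: "0 \<le> std_gauss x"
  by (simp add: std_gauss_def)

lemma std_gauss_measurable [measurable]: "std_gauss \<in> borel_measurable borel"
  unfolding std_gauss_def[abs_def] by measurable

lemma std_gauss_has_derivative:
  "(std_gauss has_derivative (\<lambda>h. - (h \<bullet> x) * std_gauss x)) (at x)"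
proof -
  define c where "c = sqrt ((2 * pi) ^ CARD('a))"
  have "c \<noteq> 0" by (simp add: c_def)
  then show ?thesis unfolding std_gauss_def[abs_def] c_def[symmetric]
    by (auto intro!: derivative_eq_intros simp: inner_commute fun_eq_iff field_simps)
qed

text \<open>The density is the product of one-dimensional standard normal densities.\<close>
lemma nn_integral_std_gauss: "(\<integral>\<^sup>+x. ennreal (std_gauss (x::real^'d)) \<partial>lborel) = 1"
proof -
  have eq: "ennreal (std_gauss x) = (\<Prod>b\<in>Basis. ennreal (std_normal_density (x \<bullet> b)))" for x :: "real^'d"
  proof -
    have "(\<Prod>b\<in>Basis. std_normal_density (x \<bullet> b)) = (\<Prod>b\<in>(Basis::(real^'d) set). 1 / sqrt (2 * pi)) * exp (\<Sum>b\<in>Basis. - (x \<bullet> b)\<^sup>2 / 2)"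
      by (simp only: std_normal_density_def prod.distrib exp_sum[OF finite_Basis])
    also have "(\<Sum>b\<in>Basis. - (x \<bullet> b)\<^sup>2 / 2) = - (x \<bullet> x) / 2"
      using euclidean_inner[of x x] by (simp add: sum_negf sum_divide_distrib[symmetric] power2_eq_square)
    also have "(\<Prod>b\<in>(Basis::(real^'d) set). 1 / sqrt (2 * pi)) = 1 / sqrt ((2 * pi) ^ CARD('d))"
      by (simp only: prod_constant DIM_cart DIM_real mult_1_right power_one_over real_sqrt_power)
    finally have "std_gauss x = (\<Prod>b\<in>Basis. std_normal_density (x \<bullet> b))" by (simp add: std_gauss_def)
    then show ?thesis by (simp add: prod_ennreal)
  qed
  have "(\<integral>\<^sup>+x. ennreal (std_normal_density x) \<partial>lborel) = 1"
    by (subst nn_integral_eq_integral) auto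
  then show ?thesis unfolding eq by (subst nn_integral_lborel_prod) auto
qed

lemma integrable_std_gauss [simp, intro]: "integrable lborel std_gauss"
  by (rule integrableI_nonneg) (simp_all add: nn_integral_std_gauss)

lemma integral_std_gauss [simp]: "(\<integral>x. std_gauss x \<partial>lborel) = 1"
  by (rule integral_eq_nn_integral[THEN trans]) (simp_all add: nn_integral_std_gauss)

lemma integrable_dilate:
  fixes f :: "'a::euclidean_space \<Rightarrow> 'b::{banach, second_countable_topology}"
  assumes "integrable lborel f" "c \<noteq> 0"
  shows "integrable lborel (\<lambda>x. f (c *\<^sub>R x))"
proof -
  have [measurable]: "f \<in> borel_measurable borel" using assms(1) by simp
  have "integrable (density (distr lborel borel (\<lambda>x::'a. 0 + c *\<^sub>R x)) (\<lambda>_. \<bar>c\<bar> ^ DIM('a))) f"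
    using assms by (subst lborel_affine[OF assms(2), symmetric])
  then have "integrable lborel (\<lambda>x. \<bar>c\<bar> ^ DIM('a) *\<^sub>R f (c *\<^sub>R x))"
    by (simp add: integrable_density integrable_distr_eq)
  then have "integrable lborel (\<lambda>x. inverse (\<bar>c\<bar> ^ DIM('a)) *\<^sub>R (\<bar>c\<bar> ^ DIM('a) *\<^sub>R f (c *\<^sub>R x)))"
    by (rule integrable_scaleR_right)
  then show ?thesis using assms(2) by simp
qed

lemma integrable_exp_norm_square:
  assumes "c > 0"
  shows "integrable lborel (\<lambda>x::real^'d. exp (- c * (norm x)\<^sup>2))"
proof -
  have "integrable lborel (\<lambda>x::real^'d. sqrt ((2 * pi) ^ CARD('d)) * std_gauss (sqrt (2 * c) *\<^sub>R x))"
    using assms by (intro integrable_mult_right integrable_dilate integrable_std_gauss) auto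
  moreover have "sqrt (2 * c) * (sqrt (2 * c) * r) = 2 * c * r" for r
    using assms by (simp add: mult.assoc[symmetric])
  ultimately show ?thesis using assms by (simp add: std_gauss_def power2_norm_eq_inner)
qed

lemma integrable_std_gauss_norm: "integrable lborel (\<lambda>x::real^'d. norm x * std_gauss x)"
proof (rule Bochner_Integration.integrable_bound)
  show "integrable lborel (\<lambda>x::real^'d. exp (- (1/4) * (norm x)\<^sup>2) / sqrt ((2 * pi) ^ CARD('d)))"
    by (intro integrable_divide integrable_exp_norm_square) auto
  have "norm x * std_gauss x \<le> exp (- (1/4) * (norm x)\<^sup>2) / sqrt ((2 * pi) ^ CARD('d))" for x :: "real^'d"
  proof -
    have "0 \<le> (norm x / 2 - 1)\<^sup>2" by simp
    then have "norm x \<le> 1 + (norm x)\<^sup>2 / 4" by (simp add: power2_diff power_divide)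
    also have "\<dots> \<le> exp ((norm x)\<^sup>2 / 4)" by (rule exp_ge_add_one_self)
    finally have "norm x * exp (- (x \<bullet> x) / 2) \<le> exp ((norm x)\<^sup>2 / 4) * exp (- (x \<bullet> x) / 2)"
      by (rule mult_right_mono) simp
    also have "\<dots> = exp (- (1/4) * (norm x)\<^sup>2)"
      by (simp add: exp_add[symmetric] power2_norm_eq_inner)
    finally show ?thesis by (simp add: std_gauss_def divide_right_mono)
  qed
  then show "AE x in lborel. norm (norm x * std_gauss x) \<le> norm (exp (- (1/4) * (norm (x::real^'d))\<^sup>2) / sqrt ((2 * pi) ^ CARD('d)))"
    by (auto simp: abs_mult)
qed measurable

text \<open>If \<open>A = B B\<^sup>T\<close>, then the centered Gaussian with covariance \<open>l A\<close> is the image of the standard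
  one under \<open>\<surd>l B\<close>.\<close>
lemma gaussian_factor:
  fixes A B :: "real^'d^'d"
  assumes B: "B ** transpose B = A" "det B \<noteq> 0" and l: "0 < l"
  shows "gaussian (l *\<^sub>R A) (sqrt l *\<^sub>R (B *v x)) * (sqrt l ^ CARD('d) * \<bar>det B\<bar>) = std_gauss x"
proof -
  note f = factor_inv[OF B]
  have inv: "matrix_inv (l *\<^sub>R A) = (1 / l) *\<^sub>R matrix_inv A"
    using matrix_inv_scaleR[OF f(3)] l by simp
  have q: "(sqrt l *\<^sub>R (B *v x)) \<bullet> (matrix_inv (l *\<^sub>R A) *v (sqrt l *\<^sub>R (B *v x))) = x \<bullet> x"
    using l f(1)[of x x]
    by (simp add: inv matrix_vector_mult_scaleR scaleR_matrix_vector_assoc[symmetric] mult.assoc[symmetric])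
  have "sqrt ((2 * pi) ^ CARD('d) * det (l *\<^sub>R A)) = sqrt ((2 * pi) ^ CARD('d)) * (sqrt l ^ CARD('d) * \<bar>det B\<bar>)"
    by (simp only: det_scaleR_matrix f(4) real_sqrt_mult real_sqrt_power[of l] real_sqrt_abs)
  moreover have "sqrt l ^ CARD('d) * \<bar>det B\<bar> \<noteq> 0" using l B(2) by simp
  ultimately show ?thesis unfolding gaussian_def q std_gauss_def by simp
qed

lemma gaussian_uminus: "gaussian C (- x) = gaussian C x"
  using matrix_vector_mult_scaleR[of "matrix_inv C" "-1" x] by (simp add: gaussian_def)

lemma gaussian_measurable [measurable]: "gaussian C \<in> borel_measurable borel"
  unfolding gaussian_def[abs_def] by measurable

lemma integral_gaussian_convolution:
  fixes A B :: "real^'d^'d" and K :: "real^'d \<Rightarrow> complex"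
  assumes B: "B ** transpose B = A" "det B \<noteq> 0" and l: "0 < l"
    and [measurable]: "K \<in> borel_measurable borel"
  shows "(\<integral>y. complex_of_real (gaussian (l *\<^sub>R A) (z - y)) * K y \<partial>lborel) =
    (\<integral>x. complex_of_real (std_gauss x) * K (z + sqrt l *\<^sub>R (B *v x)) \<partial>lborel)"
proof -
  have dT: "det (sqrt l *\<^sub>R B) = sqrt l ^ CARD('d) * det B" by (rule det_scaleR_matrix)
  then have d0: "det (sqrt l *\<^sub>R B) \<noteq> 0" using B(2) l by simp
  have "(\<integral>y. complex_of_real (gaussian (l *\<^sub>R A) (z - y)) * K y \<partial>lborel)
      = (\<integral>y. complex_of_real (gaussian (l *\<^sub>R A) y) * K (z + y) \<partial>lborel)"
    using integral_translate[of "\<lambda>y. complex_of_real (gaussian (l *\<^sub>R A) (z - y)) * K y" z]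
    by (simp add: gaussian_uminus)
  also have "\<dots> = \<bar>det (sqrt l *\<^sub>R B)\<bar> *\<^sub>R (\<integral>x. complex_of_real (gaussian (l *\<^sub>R A) ((sqrt l *\<^sub>R B) *v x)) * K (z + (sqrt l *\<^sub>R B) *v x) \<partial>lborel)"
    by (rule integral_linear[OF d0]) measurable
  also have "\<dots> = (\<integral>x. complex_of_real (gaussian (l *\<^sub>R A) (sqrt l *\<^sub>R (B *v x)) * (sqrt l ^ CARD('d) * \<bar>det B\<bar>)) * K (z + sqrt l *\<^sub>R (B *v x)) \<partial>lborel)"
    unfolding integral_scaleR_right[symmetric] dT scaleR_matrix_vector_assoc[symmetric]
    using l by (intro Bochner_Integration.integral_cong) (simp_all add: abs_mult scaleR_conv_of_real)
  finally show ?thesis unfolding gaussian_factor[OF B l] .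
qed

subsection \<open>Integration by parts\<close>

text \<open>By translation invariance \<open>\<integral> (\<phi> (y + v) - \<phi> y) dy = 0\<close>; writing the increment as the integral of
  the directional derivative along the segment and exchanging integrals gives the claim without any
  bound on the derivative beyond integrability.\<close>
lemma integral_dir_deriv_zero:
  fixes \<phi> :: "'a::euclidean_space \<Rightarrow> complex"
  assumes d: "\<And>y. (\<phi> has_derivative \<phi>' y) (at y)" and c: "continuous_on UNIV (\<lambda>y. \<phi>' y v)"
    and i: "integrable lborel \<phi>" "integrable lborel (\<lambda>y. \<phi>' y v)"
  shows "(\<integral>y. \<phi>' y v \<partial>lborel) = 0"
proof -
  define D where "D = (\<lambda>y. \<phi>' y v)"
  have [measurable]: "D \<in> borel_measurable borel"
    unfolding D_def by (rule borel_measurable_continuous_onI[OF c])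
  have line: "((\<lambda>t. \<phi> (y + t *\<^sub>R v)) has_vector_derivative D (y + t *\<^sub>R v)) (at t within S)" for y t S
  proof -
    have "((\<lambda>t. y + t *\<^sub>R v) has_derivative (\<lambda>s. s *\<^sub>R v)) (at t)"
      by (auto intro!: derivative_eq_intros)
    from has_derivative_compose[OF this d]
    have "((\<lambda>t. \<phi> (y + t *\<^sub>R v)) has_derivative (\<lambda>s. \<phi>' (y + t *\<^sub>R v) (s *\<^sub>R v))) (at t)" .
    then have "((\<lambda>t. \<phi> (y + t *\<^sub>R v)) has_vector_derivative D (y + t *\<^sub>R v)) (at t)"
      by (simp add: has_vector_derivative_def D_def linear_cmul[OF has_derivative_linear[OF d]])
    then show ?thesis by (rule has_vector_derivative_at_within)
  qed
  have ftc: "(\<integral>t. indicator {0..1} t *\<^sub>R D (y + t *\<^sub>R v) \<partial>lborel) = \<phi> (v + y) - \<phi> y" for y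
    using integral_FTC_atLeastAtMost[of 0 1 "\<lambda>t. \<phi> (y + t *\<^sub>R v)" "\<lambda>t. D (y + t *\<^sub>R v)"] line
    by (simp add: add.commute D_def continuous_on_compose2[OF c] continuous_intros)
  let ?f = "\<lambda>t y. indicator {0..1} t *\<^sub>R D (y + t *\<^sub>R v)"
  have iD: "integrable lborel (\<lambda>y. D (y + t *\<^sub>R v))" for t
    using integrable_translate[of D "t *\<^sub>R v"] i(2) by (simp add: D_def add.commute)
  have nD: "(\<integral>y. norm (D (y + t *\<^sub>R v)) \<partial>lborel) = (\<integral>y. norm (D y) \<partial>lborel)" for t
    using integral_translate[of "\<lambda>y. norm (D y)" "t *\<^sub>R v"] by (simp add: add.commute)
  have eD: "(\<integral>y. D (y + t *\<^sub>R v) \<partial>lborel) = (\<integral>y. D y \<partial>lborel)" for t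
    using integral_translate[of D "t *\<^sub>R v"] by (simp add: add.commute)
  have int: "integrable (lborel \<Otimes>\<^sub>M lborel) (case_prod ?f)"
  proof (rule lborel_pair.Fubini_integrable)
    show "integrable lborel (\<lambda>t. \<integral>y. norm (case_prod ?f (t, y)) \<partial>lborel)"
      by (simp add: nD)
    show "AE t in lborel. integrable lborel (\<lambda>y. case_prod ?f (t, y))"
      using iD by auto
  qed measurable
  have "(\<integral>y. (\<integral>t. ?f t y \<partial>lborel) \<partial>lborel) = (\<integral>t. (\<integral>y. ?f t y \<partial>lborel) \<partial>lborel)"
    by (rule lborel_pair.Fubini_integral[OF int])
  also have "\<dots> = (\<integral>y. D y \<partial>lborel)" by (simp add: eD)
  also have "(\<integral>y. (\<integral>t. ?f t y \<partial>lborel) \<partial>lborel) = (\<integral>y. \<phi> (v + y) \<partial>lborel) - (\<integral>y. \<phi> y \<partial>lborel)"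
    unfolding ftc by (rule Bochner_Integration.integral_diff[OF integrable_translate[OF i(1)] i(1)])
  also have "\<dots> = 0" using integral_translate[of \<phi> v] i(1) by simp
  finally show ?thesis by (simp add: D_def)
qed

lemma integrable_continuous_times_test:
  fixes k g :: "'a::euclidean_space \<Rightarrow> complex"
  assumes "continuous_on UNIV k" "g \<in> test_functions U"
  shows "integrable lborel (\<lambda>x. k x * g x)"
proof -
  obtain C where C: "compact C" "\<And>x. x \<notin> C \<Longrightarrow> g x = 0"
    using assms test_functions_iff by metis
  have "integrable lborel (\<lambda>x. indicat_real C x *\<^sub>R (k x * g x))"
    by (intro borel_integrable_compact C(1) continuous_on_mult
        continuous_on_subset[OF test_functions_continuous[OF assms(2)]]
        continuous_on_subset[OF assms(1)]) auto
  moreover have "(\<lambda>x. indicat_real C x *\<^sub>R (k x * g x)) = (\<lambda>x. k x * g x)"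
    using C(2) by (auto simp: fun_eq_iff indicator_def)
  ultimately show ?thesis by simp
qed

text \<open>The function \<open>y \<mapsto> k (z - y) * G y\<close> has compact support, so its directional derivative integrates to zero;
  the inner derivative of \<open>z - y\<close> cancels the sign of the usual formula.\<close>
lemma convolution_by_parts:
  fixes k :: "'a::euclidean_space \<Rightarrow> real"
  assumes d: "\<And>w. (k has_derivative k' w) (at w)" and c: "continuous_on UNIV (\<lambda>w. k' w u)"
    and G: "G \<in> test_functions U"
  shows "(\<integral>y. complex_of_real (k' (z - y) u) * G y \<partial>lborel) =
    (\<integral>y. complex_of_real (k (z - y)) * dir_deriv u G y \<partial>lborel)"
proof -
  have ck: "continuous_on UNIV k"
    by (rule has_derivative_imp_continuous_on[OF d])
  have cz: "continuous_on UNIV (\<lambda>y. complex_of_real (f (z - y)))" if "continuous_on UNIV f" for f :: "'a \<Rightarrow> real"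
    by (intro continuous_intros continuous_on_compose2[OF that]) auto
  have lin: "linear (k' w)" for w by (rule has_derivative_linear[OF d])
  define \<phi>' where "\<phi>' = (\<lambda>y h. complex_of_real (k (z - y)) * dir_deriv h G y
      + complex_of_real (k' (z - y) (- h)) * G y)"
  have "((\<lambda>y. k (z - y)) has_derivative (\<lambda>h. k' (z - y) (- h))) (at y)" for y
    by (rule has_derivative_compose[OF _ d]) (auto intro!: derivative_eq_intros)
  then have d': "((\<lambda>y. complex_of_real (k (z - y))) has_derivative (\<lambda>h. complex_of_real (k' (z - y) (- h)))) (at y)" for y
    by (rule bounded_linear.has_derivative[OF bounded_linear_of_real])
  have e: "\<phi>' y u = complex_of_real (k (z - y)) * dir_deriv u G y - complex_of_real (k' (z - y) u) * G y" for y
    by (simp add: \<phi>'_def linear_neg[OF lin])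
  have i1: "integrable lborel (\<lambda>y. complex_of_real (k (z - y)) * dir_deriv u G y)"
    by (rule integrable_continuous_times_test[OF cz[OF ck] test_functions_derivative[OF G]])
  have i2: "integrable lborel (\<lambda>y. complex_of_real (k' (z - y) u) * G y)"
    by (rule integrable_continuous_times_test[OF cz[OF c] G])
  have "(\<integral>y. \<phi>' y u \<partial>lborel) = 0"
  proof (rule integral_dir_deriv_zero[where \<phi>="\<lambda>y. complex_of_real (k (z - y)) * G y"])
    show "((\<lambda>y. complex_of_real (k (z - y)) * G y) has_derivative \<phi>' y) (at y)" for y
      unfolding \<phi>'_def by (rule has_derivative_mult[OF d' test_functions_has_derivative[OF G]])
    show "continuous_on UNIV (\<lambda>y. \<phi>' y u)"
      unfolding e by (intro continuous_on_diff continuous_on_mult cz[OF ck] cz[OF c]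
          test_functions_continuous[OF test_functions_derivative[OF G]] test_functions_continuous[OF G])
    show "integrable lborel (\<lambda>y. complex_of_real (k (z - y)) * G y)"
      by (rule integrable_continuous_times_test[OF cz[OF ck] G])
    show "integrable lborel (\<lambda>y. \<phi>' y u)" unfolding e using i1 i2 by auto
  qed
  then show ?thesis unfolding e using i1 i2 by simp
qed

lemma gaussian_has_derivative:
  fixes C :: "real^'d^'d"
  assumes "transpose (matrix_inv C) = matrix_inv C"
  shows "(gaussian C has_derivative (\<lambda>h. - (h \<bullet> (matrix_inv C *v w)) * gaussian C w)) (at w)"
proof -
  let ?M = "matrix_inv C"
  have sym: "w \<bullet> (?M *v h) = h \<bullet> (?M *v w)" for w h
    using assms inner_matrix_vector[of w ?M h] by (simp add: inner_commute)
  have "((\<lambda>x. ?M *v x) has_derivative (\<lambda>h. ?M *v h)) (at w)"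
    by (rule bounded_linear.has_derivative[OF matrix_vector_mul_bounded_linear has_derivative_ident])
  then have "((\<lambda>x. exp (- (x \<bullet> (?M *v x)) / 2)) has_derivative
      (\<lambda>h. exp (- (w \<bullet> (?M *v w)) / 2) * (- (w \<bullet> (?M *v h) + h \<bullet> (?M *v w)) / 2))) (at w)"
    by (auto intro!: derivative_eq_intros simp: fun_eq_iff field_simps)
  from bounded_linear.has_derivative[OF bounded_linear_divide this]
  have "(gaussian C has_derivative (\<lambda>h. exp (- (w \<bullet> (?M *v w)) / 2) *
      (- (w \<bullet> (?M *v h) + h \<bullet> (?M *v w)) / 2) / sqrt ((2 * pi) ^ CARD('d) * det C))) (at w)"
    unfolding gaussian_def[abs_def] .
  moreover have "exp (- (w \<bullet> (?M *v w)) / 2) *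
      (- (w \<bullet> (?M *v h) + h \<bullet> (?M *v w)) / 2) / sqrt ((2 * pi) ^ CARD('d) * det C)
      = - (h \<bullet> (?M *v w)) * gaussian C w" for h
    unfolding sym[of w h] gaussian_def by simp
  ultimately show ?thesis by simp
qed

text \<open>The polynomial factor on the left is the one in the kernel of the space-time operator: together with the Gaussian
  it is a second derivative of the Gaussian, and two integrations by parts move it to \<open>G\<close>.\<close>
lemma integral_gaussian_hessian:
  fixes C :: "real^'d^'d"
  assumes sym: "transpose (matrix_inv C) = matrix_inv C" and G: "G \<in> test_functions U"
  defines "M \<equiv> matrix_inv C"
  shows "(\<integral>y. complex_of_real (((u \<bullet> (M *v (z - y))) * (v \<bullet> (M *v (z - y))) - u \<bullet> (M *v v)) * gaussian C (z - y)) * G y \<partial>lborel)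
    = (\<integral>y. complex_of_real (gaussian C (z - y)) * dir_deriv u (dir_deriv v G) y \<partial>lborel)"
proof -
  let ?k = "\<lambda>w. - (u \<bullet> (M *v w)) * gaussian C w"
  let ?k' = "\<lambda>w h. - (u \<bullet> (M *v w)) * (- (h \<bullet> (M *v w)) * gaussian C w) + - (u \<bullet> (M *v h)) * gaussian C w"
  have cg: "continuous_on UNIV (gaussian C)"
    by (rule has_derivative_imp_continuous_on[OF gaussian_has_derivative[OF sym]])
  have cM: "continuous_on UNIV (\<lambda>w. M *v w)" by (rule matrix_vector_mult_linear_continuous_on)
  have dM: "((\<lambda>x. u \<bullet> (M *v x)) has_derivative (\<lambda>h. u \<bullet> (M *v h))) (at w)" for w
    by (intro has_derivative_inner_right bounded_linear.has_derivative[OF matrix_vector_mul_bounded_linear has_derivative_ident])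
  have dk: "(?k has_derivative ?k' w) (at w)" for w
    unfolding M_def
    by (rule has_derivative_mult[OF has_derivative_minus[OF dM[unfolded M_def]] gaussian_has_derivative[OF sym]])
  have "(\<integral>y. complex_of_real (?k' (z - y) v) * G y \<partial>lborel) =
      (\<integral>y. complex_of_real (?k (z - y)) * dir_deriv v G y \<partial>lborel)"
    by (rule convolution_by_parts[OF dk _ G]) (intro continuous_intros cg cM)
  also have "\<dots> = (\<integral>y. complex_of_real (gaussian C (z - y)) * dir_deriv u (dir_deriv v G) y \<partial>lborel)"
    unfolding M_def
    by (rule convolution_by_parts[OF gaussian_has_derivative[OF sym] _ test_functions_derivative[OF G]])
       (intro continuous_intros cg cM[unfolded M_def])
  also have "(\<lambda>y. complex_of_real (?k' (z - y) v)) = (\<lambda>y. complex_of_real (((u \<bullet> (M *v (z - y))) * (v \<bullet> (M *v (z - y))) - u \<bullet> (M *v v)) * gaussian C (z - y)))"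
    by (auto simp: fun_eq_iff algebra_simps)
  finally show ?thesis by metis
qed

lemma integrable_std_gauss_mult_bounded:
  fixes g :: "real^'d \<Rightarrow> complex"
  assumes "g \<in> borel_measurable borel" "\<And>x. norm (g x) \<le> K"
  shows "integrable lborel (\<lambda>x. complex_of_real (std_gauss x) * g x)"
  by (rule integrable_mult_bounded[of _ _ _ K]) (use assms in auto)

text \<open>The derivative of the Gaussian density in the direction \<open>v\<close> is \<open>- (x \<bullet> v)\<close> times the density, and the derivative
  of the product with \<open>g (m + T *v x)\<close> integrates to zero.\<close>
lemma std_gauss_by_parts:
  fixes T :: "real^'d^'d"
  assumes g: "g \<in> test_functions U"
  shows "integrable lborel (\<lambda>x. complex_of_real (std_gauss x * (x \<bullet> v)) * g (m + T *v x))"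
    and "(\<integral>x. complex_of_real (std_gauss x * (x \<bullet> v)) * g (m + T *v x) \<partial>lborel) =
     (\<integral>x. complex_of_real (std_gauss x) * dir_deriv (T *v v) g (m + T *v x) \<partial>lborel)"
proof -
  obtain K K' where K: "\<And>x. norm (g x) \<le> K" "\<And>x. norm (dir_deriv (T *v v) g x) \<le> K'"
    using test_functions_bounded[OF g] test_functions_bounded[OF test_functions_derivative[OF g]] by metis
  note [measurable] = test_functions_measurable[OF g] test_functions_measurable[OF test_functions_derivative[OF g]]
  have "integrable lborel (\<lambda>x::real^'d. complex_of_real (std_gauss x * (x \<bullet> v)))"
  proof (rule Bochner_Integration.integrable_bound[where f="\<lambda>x. norm v * (norm x * std_gauss x)"])
    have "norm (complex_of_real (std_gauss x * (x \<bullet> v))) \<le> norm (norm v * (norm x * std_gauss x))" for x :: "real^'d"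
    proof -
      have "norm (complex_of_real (std_gauss x * (x \<bullet> v))) = \<bar>std_gauss x * (x \<bullet> v)\<bar>" by (simp only: norm_of_real)
      also have "\<dots> = std_gauss x * \<bar>x \<bullet> v\<bar>" by (simp add: abs_mult)
      also have "\<dots> \<le> std_gauss x * (norm x * norm v)"
        by (intro mult_left_mono Cauchy_Schwarz_ineq2) auto
      finally show ?thesis by (simp add: mult_ac abs_mult)
    qed
    then show "AE x in lborel. norm (complex_of_real (std_gauss x * (x \<bullet> v))) \<le> norm (norm v * (norm (x::real^'d) * std_gauss x))" by simp
  qed (auto intro: integrable_std_gauss_norm)
  then show i1: "integrable lborel (\<lambda>x. complex_of_real (std_gauss x * (x \<bullet> v)) * g (m + T *v x))"
    by (rule integrable_mult_bounded[of _ _ _ K]) (use K in auto)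
  have i2: "integrable lborel (\<lambda>x. complex_of_real (std_gauss x) * dir_deriv (T *v v) g (m + T *v x))"
    by (rule integrable_std_gauss_mult_bounded[of _ K']) (use K in auto)
  have i3: "integrable lborel (\<lambda>x. complex_of_real (std_gauss x) * g (m + T *v x))"
    by (rule integrable_std_gauss_mult_bounded[of _ K]) (use K in auto)
  define \<phi>' where "\<phi>' = (\<lambda>x h. complex_of_real (std_gauss x) * dir_deriv (T *v h) g (m + T *v x)
      + complex_of_real (- (h \<bullet> x) * std_gauss x) * g (m + T *v x))"
  have e: "\<phi>' x v = complex_of_real (std_gauss x) * dir_deriv (T *v v) g (m + T *v x) - complex_of_real (std_gauss x * (x \<bullet> v)) * g (m + T *v x)" for x
    by (simp add: \<phi>'_def inner_commute)
  have cs: "continuous_on UNIV (std_gauss :: real^'d \<Rightarrow> real)"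
    by (rule has_derivative_imp_continuous_on[OF std_gauss_has_derivative])
  have ca: "continuous_on UNIV (\<lambda>x. m + T *v x)"
    by (intro continuous_intros matrix_vector_mult_linear_continuous_on)
  have "(\<integral>x. \<phi>' x v \<partial>lborel) = 0"
  proof (rule integral_dir_deriv_zero[where \<phi>="\<lambda>x. complex_of_real (std_gauss x) * g (m + T *v x)"])
    fix x
    have "((\<lambda>x. m + T *v x) has_derivative (\<lambda>h. T *v h)) (at x)"
      by (auto intro!: derivative_eq_intros bounded_linear.has_derivative[OF matrix_vector_mul_bounded_linear])
    then have "((\<lambda>x. g (m + T *v x)) has_derivative (\<lambda>h. dir_deriv (T *v h) g (m + T *v x))) (at x)"
      by (rule has_derivative_compose[OF _ test_functions_has_derivative[OF g]])
    then show "((\<lambda>x. complex_of_real (std_gauss x) * g (m + T *v x)) has_derivative \<phi>' x) (at x)"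
      unfolding \<phi>'_def
      by (intro has_derivative_mult bounded_linear.has_derivative[OF bounded_linear_of_real std_gauss_has_derivative])
    show "continuous_on UNIV (\<lambda>y. \<phi>' y v)"
      unfolding e by (intro continuous_intros cs ca continuous_on_compose2[OF test_functions_continuous[OF g] ca]
          continuous_on_compose2[OF test_functions_continuous[OF test_functions_derivative[OF g]] ca]) auto
    show "integrable lborel (\<lambda>y. \<phi>' y v)" unfolding e using i1 i2 by auto
  qed (rule i3)
  then show "(\<integral>x. complex_of_real (std_gauss x * (x \<bullet> v)) * g (m + T *v x) \<partial>lborel) =
     (\<integral>x. complex_of_real (std_gauss x) * dir_deriv (T *v v) g (m + T *v x) \<partial>lborel)"
    unfolding e using i1 i2 by simp
qed

section \<open>The Ornstein--Uhlenbeck resolvent\<close>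

lemma fst_borel [measurable]: "fst \<in> borel_measurable (borel :: ('a::second_countable_topology \<times> 'b::second_countable_topology) measure)"
  by (intro borel_measurable_continuous_onI continuous_intros)

lemma snd_borel [measurable]: "snd \<in> borel_measurable (borel :: ('a::second_countable_topology \<times> 'b::second_countable_topology) measure)"
  by (intro borel_measurable_continuous_onI continuous_intros)

lemma lborel_Fubini:
  fixes h :: "'a::euclidean_space \<times> 'b::euclidean_space \<Rightarrow> complex"
  assumes "integrable lborel h"
  shows "(\<integral>p. h p \<partial>lborel) = (\<integral>x. (\<integral>y. h (x, y) \<partial>lborel) \<partial>lborel)"
    and "(\<integral>p. h p \<partial>lborel) = (\<integral>y. (\<integral>x. h (x, y) \<partial>lborel) \<partial>lborel)"
proof -
  have i: "integrable (lborel \<Otimes>\<^sub>M lborel) h" using assms by (simp add: lborel_prod)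
  show "(\<integral>p. h p \<partial>lborel) = (\<integral>x. (\<integral>y. h (x, y) \<partial>lborel) \<partial>lborel)"
    using lborel_pair.integral_fst'[OF i] by (simp add: lborel_prod)
  moreover have "(\<integral>y. (\<integral>x. h (x, y) \<partial>lborel) \<partial>lborel) = (\<integral>x. (\<integral>y. h (x, y) \<partial>lborel) \<partial>lborel)"
    using lborel_pair.Fubini_integral[of "\<lambda>x y. h (x, y)"] i by simp
  ultimately show "(\<integral>p. h p \<partial>lborel) = (\<integral>y. (\<integral>x. h (x, y) \<partial>lborel) \<partial>lborel)" by simp
qed

lemma integrable_lborel_prod_mult:
  fixes f :: "'a::euclidean_space \<Rightarrow> complex" and g :: "'b::euclidean_space \<Rightarrow> complex"
  assumes "integrable lborel f" "integrable lborel g"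
  shows "integrable lborel (\<lambda>p. f (fst p) * g (snd p))"
proof -
  have [measurable]: "f \<in> borel_measurable borel" "g \<in> borel_measurable borel"
    using assms by auto
  have "integrable (lborel \<Otimes>\<^sub>M lborel) (\<lambda>p. f (fst p) * g (snd p))"
  proof (rule lborel_pair.Fubini_integrable)
    show "integrable lborel (\<lambda>x. \<integral>y. norm (f (fst (x, y)) * g (snd (x, y))) \<partial>lborel)"
      using assms by (simp add: norm_mult)
    show "AE x in lborel. integrable lborel (\<lambda>y. f (fst (x, y)) * g (snd (x, y)))"
      using assms by simp
  qed measurable
  then show ?thesis by (simp add: lborel_prod)
qed

definition ou_decay :: "complex \<Rightarrow> real \<Rightarrow> complex" where
  "ou_decay \<mu> t = (if 0 < t then exp (- \<mu> * of_real t) else 0)"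

definition ou_weight :: "complex \<Rightarrow> real \<times> (real^'d) \<Rightarrow> complex" where
  "ou_weight \<mu> p = ou_decay \<mu> (fst p) * of_real (std_gauss (snd p))"

text \<open>Only positive times matter; the absolute value keeps the contraction factor below one everywhere.\<close>
definition ou_contr :: "real \<times> (real^'d) \<Rightarrow> real" where
  "ou_contr p = exp (- \<bar>fst p\<bar> / 2)"

text \<open>By time \<open>t\<close> the Ornstein--Uhlenbeck process has accumulated Gaussian noise of covariance
  \<open>2 (1 - exp (- t)) A\<close>.\<close>
definition ou_spread :: "real \<Rightarrow> real" where
  "ou_spread t = sqrt (2 * (1 - exp (- t)))"

definition ou_shift :: "real^'d^'d \<Rightarrow> real \<times> (real^'d) \<Rightarrow> real^'d" where
  "ou_shift B p = ou_spread (fst p) *\<^sub>R (B *v snd p)"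

text \<open>Mehler's formula for the resolvent: \<open>\<integral>\<^sub>0\<^sup>\<infinity> exp (- \<mu> t) P\<^sub>t f dt\<close>, where
  \<open>P\<^sub>t f x = E f (exp (- t / 2) x + \<surd>(2 (1 - exp (- t))) B \<eta>)\<close> with \<open>\<eta>\<close> a standard Gaussian vector.\<close>
definition ou_avg ::
  "real^'d^'d \<Rightarrow> complex \<Rightarrow> (real^'d \<Rightarrow> complex) \<Rightarrow> real^'d \<Rightarrow> complex" where
  "ou_avg B \<mu> f = avg lborel (ou_weight \<mu>) ou_contr (ou_shift B) f"

lemma ou_decay_measurable [measurable]: "ou_decay \<mu> \<in> borel_measurable borel"
  unfolding ou_decay_def[abs_def] by measurable

lemma ou_weight_measurable [measurable]: "ou_weight \<mu> \<in> borel_measurable borel"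
  unfolding ou_weight_def[abs_def] by measurable

lemma ou_contr_measurable [measurable]: "ou_contr \<in> borel_measurable borel"
  unfolding ou_contr_def[abs_def] by measurable

lemma ou_spread_measurable [measurable]: "ou_spread \<in> borel_measurable borel"
  unfolding ou_spread_def[abs_def] by measurable

lemma ou_shift_measurable [measurable]: "ou_shift B \<in> borel_measurable borel"
  unfolding ou_shift_def[abs_def] by measurable

lemma ou_contr_le_1: "\<bar>ou_contr p\<bar> \<le> 1"
  by (simp add: ou_contr_def)

lemma integrable_ou_decay:
  assumes "0 < Re \<mu>"
  shows "integrable lborel (ou_decay \<mu>)"
proof -
  interpret prob_space "density lborel (exponential_density (Re \<mu>))"
    by (rule prob_space_exponential_density[OF assms])
  have "(\<integral>\<^sup>+x. ennreal (exponential_density (Re \<mu>) x) \<partial>lborel) = 1"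
    using emeasure_space_1 by (simp add: emeasure_density)
  then have i: "integrable lborel (exponential_density (Re \<mu>))"
    by (intro integrableI_nonneg) (auto simp: exponential_density_nonneg assms)
  show ?thesis
  proof (rule Bochner_Integration.integrable_bound)
    show "integrable lborel (\<lambda>x. exponential_density (Re \<mu>) x / Re \<mu>)" using i by simp
    show "AE x in lborel. norm (ou_decay \<mu> x) \<le> norm (exponential_density (Re \<mu>) x / Re \<mu>)"
      using assms by (auto simp: ou_decay_def exponential_density_def norm_exp_eq_Re mult.commute)
  qed measurable
qed

lemma integrable_ou_weight:
  assumes "0 < Re \<mu>"
  shows "integrable lborel (ou_weight \<mu> :: real \<times> (real^'d) \<Rightarrow> complex)"
  unfolding ou_weight_def[abs_def]
  by (intro integrable_lborel_prod_mult[OF integrable_ou_decay[OF assms]] integrable_of_real integrable_std_gauss)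

lemma avg_bounded:
  assumes "integrable N w" "r \<in> borel_measurable N" "\<xi> \<in> borel_measurable N" "f \<in> test_functions U"
  obtains K where "0 < K" "\<And>x. norm (avg N w r \<xi> f x) \<le> K"
proof -
  obtain K where K: "0 < K" "\<And>x. norm (f x) \<le> K" using test_functions_bounded[OF assms(4)] by metis
  have "norm (avg N w r \<xi> f x) \<le> K * (\<integral>p. norm (w p) \<partial>N) + 1" for x
  proof -
    have "norm (avg N w r \<xi> f x) \<le> (\<integral>p. norm (w p * f (r p *\<^sub>R x + \<xi> p)) \<partial>N)"
      unfolding avg_def by (rule integral_norm_bound)
    also have "\<dots> \<le> (\<integral>p. K * norm (w p) \<partial>N)"
      using avg_integrable[OF assms] assms(1) K(2)
      by (intro integral_mono integrable_norm) (auto simp: norm_mult mult.commute[of K] mult_left_mono)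
    finally show ?thesis by simp
  qed
  moreover have "0 < K * (\<integral>p. norm (w p) \<partial>N) + 1" using K(1) by (simp add: add_nonneg_pos)
  ultimately show ?thesis using that by blast
qed

lemma avg_smooth_ou: "0 < Re \<mu> \<Longrightarrow> f \<in> test_functions U \<Longrightarrow> smooth_on UNIV (ou_avg B \<mu> f)"
  unfolding ou_avg_def
  by (rule avg_smooth[OF integrable_ou_weight]) (auto intro: ou_contr_le_1)

subsection \<open>The resolvent equation\<close>

lemma ou_spread_pos: "0 < t \<Longrightarrow> 0 < ou_spread t"
  by (simp add: ou_spread_def)

lemma ou_spread_derivative:
  "0 < t \<Longrightarrow> (ou_spread has_real_derivative exp (- t) / ou_spread t) (at t)"
  unfolding ou_spread_def[abs_def]
  by (auto intro!: derivative_eq_intros simp: field_simps)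

lemma ou_spread_continuous: "isCont ou_spread t"
  unfolding ou_spread_def[abs_def] by (intro continuous_intros)

text \<open>The integrand blows up at time zero, but it is the nonnegative derivative of the bounded function
  \<open>ou_spread\<close>.\<close>
lemma integrable_ou_spread_derivative:
  "integrable lborel (\<lambda>t. if 0 < t then exp (- t) / ou_spread t else 0)"
proof -
  have "set_integrable lborel (einterval 0 \<infinity>) (\<lambda>t. exp (- t) / ou_spread t)"
  proof (rule interval_integral_FTC_nonneg(1)[where F=ou_spread and A=0 and B="sqrt 2"])
    show "((ou_spread \<circ> real_of_ereal) \<longlongrightarrow> 0) (at_right 0)"
    proof -
      have "(ou_spread \<longlongrightarrow> ou_spread 0) (at_right 0)"
        using ou_spread_continuous[of 0] by (metis isCont_def filterlim_at_split)
      then show ?thesis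
        by (simp add: zero_ereal_def ereal_tendsto_simps1 ou_spread_def)
    qed
    have "(ou_spread \<longlongrightarrow> sqrt (2 * (1 - 0))) at_top"
      unfolding ou_spread_def[abs_def]
      by (intro tendsto_intros filterlim_compose[OF exp_at_bot filterlim_uminus_at_bot_at_top])
    then show "((ou_spread \<circ> real_of_ereal) \<longlongrightarrow> sqrt 2) (at_left \<infinity>)"
      by (simp add: ereal_tendsto_simps1)
    show "(ou_spread has_real_derivative exp (- t) / ou_spread t) (at t)" if "0 < ereal t" "ereal t < \<infinity>" for t
      using ou_spread_derivative that by (simp add: zero_ereal_def)
    show "isCont (\<lambda>t. exp (- t) / ou_spread t) t" if "0 < ereal t" "ereal t < \<infinity>" for t
      using that ou_spread_pos[of t] by (auto intro!: continuous_intros ou_spread_continuous simp: zero_ereal_def)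
    show "AE t in lborel. 0 < ereal t \<longrightarrow> ereal t < \<infinity> \<longrightarrow> 0 \<le> exp (- t) / ou_spread t"
      by (auto simp: zero_ereal_def ou_spread_pos less_imp_le)
  qed simp
  moreover have "(\<lambda>t. indicator (einterval 0 \<infinity>) t *\<^sub>R (exp (- t) / ou_spread t)) =
      (\<lambda>t. if 0 < t then exp (- t) / ou_spread t else 0)"
    by (auto simp: fun_eq_iff indicator_def einterval_def zero_ereal_def)
  ultimately show ?thesis by (simp add: set_integrable_def)
qed

definition ou_path :: "real^'d \<Rightarrow> real^'d \<Rightarrow> real \<Rightarrow> real^'d" where
  "ou_path x y t = exp (- t / 2) *\<^sub>R x + ou_spread t *\<^sub>R y"

text \<open>Along the path, which starts at \<open>x\<close>, the function \<open>exp (- \<mu> t) f\<close> decays, so that the fundamental theorem of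
  calculus leaves its initial value only.  The speed of the path is unbounded but integrable near time zero.\<close>
lemma ou_path_FTC:
  fixes f :: "real^'d \<Rightarrow> complex"
  assumes f: "f \<in> test_functions U" and \<mu>: "0 < Re \<mu>"
  shows "(\<integral>t. - \<mu> * ou_decay \<mu> t * f (ou_path x y t)
      - ou_decay \<mu> t * (of_real (exp (- t / 2)) * dir_deriv x f (ou_path x y t)) / 2
      + ou_decay \<mu> t * (of_real (exp (- t) / ou_spread t) * dir_deriv y f (ou_path x y t)) \<partial>lborel) = - f x"
    (is "(\<integral>t. ?I t \<partial>lborel) = _")
proof -
  let ?\<zeta> = "ou_path x y"
  let ?e = "\<lambda>t. exp (- \<mu> * of_real t)"
  let ?F = "\<lambda>t. ?e t * f (?\<zeta> t)"
  let ?F' = "\<lambda>t. - \<mu> * ?e t * f (?\<zeta> t)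
      - ?e t * (of_real (exp (- t / 2)) * dir_deriv x f (?\<zeta> t)) / 2
      + ?e t * (of_real (exp (- t) / ou_spread t) * dir_deriv y f (?\<zeta> t))"
  have lin: "linear (frechet_derivative f (at z))" for z
    by (rule has_derivative_linear[OF test_functions_has_derivative[OF f]])
  have cont: "isCont ?\<zeta> t" for t
    unfolding ou_path_def[abs_def] by (intro continuous_intros ou_spread_continuous) auto
  have iscont: "isCont g t" if "continuous_on UNIV g" for g :: "real^'d \<Rightarrow> complex" and t
    using that by (simp add: continuous_on_eq_continuous_at)
  have contg: "isCont (\<lambda>t. g (?\<zeta> t)) t" if "continuous_on UNIV g" for g :: "real^'d \<Rightarrow> complex" and t
    using continuous_at_compose[OF cont, of t g] that
    by (simp add: o_def continuous_on_eq_continuous_at)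
  have cf: "continuous_on UNIV f" "continuous_on UNIV (dir_deriv v f)" for v
    using test_functions_continuous[OF f] test_functions_continuous[OF test_functions_derivative[OF f]] by auto
  have path': "(?\<zeta> has_derivative (\<lambda>h. h *\<^sub>R ((- exp (- t / 2) / 2) *\<^sub>R x + (exp (- t) / ou_spread t) *\<^sub>R y))) (at t)"
    if "0 < t" for t
  proof -
    have 1: "(ou_spread has_derivative (\<lambda>h. (exp (- t) / ou_spread t) * h)) (at t)"
      using ou_spread_derivative[OF that] unfolding has_field_derivative_def .
    have 2: "((\<lambda>t. exp (- t / 2)) has_derivative (\<lambda>h. (- exp (- t / 2) / 2) * h)) (at t)"
      by (auto intro!: derivative_eq_intros)
    show ?thesis unfolding ou_path_def[abs_def]
      by (rule has_derivative_eq_rhs[OF has_derivative_add[OF has_derivative_scaleR_left[OF 2] has_derivative_scaleR_left[OF 1]]])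
         (simp add: fun_eq_iff scaleR_diff_right mult.commute)
  qed
  have F': "(?F has_vector_derivative ?F' t) (at t)" if "0 < t" for t
  proof -
    have "((\<lambda>t. f (?\<zeta> t)) has_derivative (\<lambda>h. dir_deriv (h *\<^sub>R ((- exp (- t / 2) / 2) *\<^sub>R x + (exp (- t) / ou_spread t) *\<^sub>R y)) f (?\<zeta> t))) (at t)"
      by (rule has_derivative_compose[OF path'[OF that] test_functions_has_derivative[OF f]])
    then have 1: "((\<lambda>t. f (?\<zeta> t)) has_vector_derivative
        (- of_real (exp (- t / 2)) * dir_deriv x f (?\<zeta> t) / 2 + of_real (exp (- t) / ou_spread t) * dir_deriv y f (?\<zeta> t))) (at t)"
      unfolding has_vector_derivative_def linear_cmul[OF lin] linear_add[OF lin]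
      by (simp add: scaleR_conv_of_real)
    have "((\<lambda>z. exp (- \<mu> * z)) has_field_derivative (- \<mu> * ?e t)) (at (of_real t))"
      by (auto intro!: derivative_eq_intros)
    then have 2: "(?e has_vector_derivative (- \<mu> * ?e t)) (at t)"
      by (rule has_vector_derivative_real_field)
    show ?thesis
      using has_vector_derivative_mult[OF 2 1] by (simp add: algebra_simps)
  qed
  obtain K where K: "\<And>z. norm (f z) \<le> K" using test_functions_bounded[OF f] by metis
  obtain Kx where Kx: "\<And>z. norm (dir_deriv x f z) \<le> Kx"
    using test_functions_bounded[OF test_functions_derivative[OF f]] by metis
  obtain Ky where Ky: "\<And>z. norm (dir_deriv y f z) \<le> Ky"
    using test_functions_bounded[OF test_functions_derivative[OF f]] by metis
  note [measurable] = test_functions_measurable[OF f] test_functions_measurable[OF test_functions_derivative[OF f]]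
  have [measurable]: "?\<zeta> \<in> borel_measurable borel"
    unfolding ou_path_def[abs_def] by measurable
  have i1: "integrable lborel (\<lambda>t. - \<mu> * ou_decay \<mu> t * f (?\<zeta> t))"
    by (rule integrable_mult_bounded[of _ _ _ K]) (use K integrable_ou_decay[OF \<mu>] in auto)
  have i2: "integrable lborel (\<lambda>t. ou_decay \<mu> t * (of_real (exp (- t / 2)) * dir_deriv x f (?\<zeta> t)) / 2)"
  proof -
    have "integrable lborel (\<lambda>t. (ou_decay \<mu> t / 2) * (of_real (if 0 < t then exp (- t / 2) else 0) * dir_deriv x f (?\<zeta> t)))"
    proof (rule integrable_mult_bounded[of _ _ _ Kx])
      show "norm (complex_of_real (if 0 < t then exp (- t / 2) else 0) * dir_deriv x f (?\<zeta> t)) \<le> Kx" for t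
        using Kx[of "?\<zeta> t"] norm_ge_zero[of "dir_deriv x f (?\<zeta> t)"]
        by (auto simp: norm_mult intro: order_trans[OF mult_left_le_one_le] order_trans[OF norm_ge_zero])
    qed (use integrable_ou_decay[OF \<mu>] in auto)
    then show ?thesis
      by (rule Bochner_Integration.integrable_cong[THEN iffD1, rotated -1]) (auto simp: ou_decay_def)
  qed
  have i3: "integrable lborel (\<lambda>t. ou_decay \<mu> t * (of_real (exp (- t) / ou_spread t) * dir_deriv y f (?\<zeta> t)))"
  proof -
    have "integrable lborel (\<lambda>t. complex_of_real (if 0 < t then exp (- t) / ou_spread t else 0) * (ou_decay \<mu> t * dir_deriv y f (?\<zeta> t)))"
    proof (rule integrable_mult_bounded[of _ _ _ Ky])
      have "norm (ou_decay \<mu> t) \<le> 1" for t using \<mu> by (auto simp: ou_decay_def norm_exp_eq_Re)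
      then show "norm (ou_decay \<mu> t * dir_deriv y f (?\<zeta> t)) \<le> Ky" for t
        using Ky[of "?\<zeta> t"] by (auto simp: norm_mult intro: order_trans[OF mult_left_le_one_le])
    qed (auto intro!: integrable_of_real integrable_ou_spread_derivative)
    then show ?thesis
      by (rule Bochner_Integration.integrable_cong[THEN iffD1, rotated -1]) (auto simp: ou_decay_def)
  qed
  have int: "integrable lborel ?I" by (intro Bochner_Integration.integrable_add Bochner_Integration.integrable_diff i1 i2 i3)
  have eqI: "?I t = indicator (einterval 0 \<infinity>) t *\<^sub>R ?F' t" for t
    by (auto simp: indicator_def einterval_def zero_ereal_def ou_decay_def)
  have "(LBINT t=0..\<infinity>. ?F' t) = 0 - f x"
  proof (rule interval_integral_FTC_integrable)
    show "set_integrable lborel (einterval 0 \<infinity>) ?F'"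
      unfolding set_integrable_def eqI[symmetric] by (rule int)
    show "(?F has_vector_derivative ?F' t) (at t)" if "0 < ereal t" "ereal t < \<infinity>" for t
      using F' that by (simp add: zero_ereal_def)
    show "isCont ?F' t" if "0 < ereal t" "ereal t < \<infinity>" for t
      using that ou_spread_pos[of t]
      by (auto intro!: continuous_intros contg cf ou_spread_continuous simp: zero_ereal_def)
    have "isCont ?F 0" by (intro continuous_intros contg cf)
    then have "(?F \<longlongrightarrow> ?F 0) (at_right 0)"
      unfolding isCont_def by (rule tendsto_within_subset) simp
    then show "((?F \<circ> real_of_ereal) \<longlongrightarrow> f x) (at_right 0)"
      by (simp add: zero_ereal_def ereal_tendsto_simps1 ou_path_def ou_spread_def)
    have "((\<lambda>t. K * exp (- (Re \<mu> * t))) \<longlongrightarrow> 0) at_top"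
      using \<mu> by real_asymp
    then have "(?F \<longlongrightarrow> 0) at_top"
    proof (rule Lim_null_comparison[rotated])
      have "norm (?F t) \<le> K * exp (- (Re \<mu> * t))" for t
        using K[of "?\<zeta> t"] by (simp add: norm_mult mult.commute[of K] mult_left_mono)
      then show "\<forall>\<^sub>F t in at_top. norm (?F t) \<le> K * exp (- (Re \<mu> * t))" by simp
    qed
    then show "((?F \<circ> real_of_ereal) \<longlongrightarrow> 0) (at_left \<infinity>)"
      by (simp add: ereal_tendsto_simps1)
  qed simp
  then show ?thesis
    unfolding interval_lebesgue_integral_def set_lebesgue_integral_def eqI by simp
qed

definition second_order :: "real^'d^'d \<Rightarrow> (real^'d \<Rightarrow> complex) \<Rightarrow> real^'d \<Rightarrow> complex" where
  "second_order A u x =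
     (\<Sum>k\<in>UNIV. \<Sum>l\<in>UNIV. complex_of_real (A $ k $ l) * partial_deriv k (partial_deriv l u) x)"

lemma OU_expr_eq:
  assumes "smooth_on UNIV u"
  shows "OU_expr A u x = - second_order A u x + dir_deriv x u x / 2"
proof -
  have "trace (transpose (complex_mat A) ** hessian u x) = second_order A u x"
    unfolding trace_def matrix_matrix_mult_def second_order_def
    by (subst sum.swap) (simp add: transpose_def complex_mat_def hessian_def)
  then show ?thesis by (simp add: OU_expr_def dir_deriv_eq_partial[OF assms])
qed

lemma second_order_factor:
  fixes A B :: "real^'d^'d"
  assumes "B ** transpose B = A" "f \<in> test_functions U"
  shows "second_order A f x =
    (\<Sum>j\<in>UNIV. dir_deriv (B *v axis j 1) (dir_deriv (B *v axis j 1) f) x)"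
proof -
  let ?d = "\<lambda>k l. partial_deriv k (partial_deriv l f) x"
  have "(\<Sum>j\<in>UNIV. dir_deriv (B *v axis j 1) (dir_deriv (B *v axis j 1) f) x)
      = (\<Sum>j\<in>UNIV. \<Sum>k\<in>UNIV. \<Sum>l\<in>UNIV. complex_of_real (B $ k $ j * B $ l $ j) * ?d k l)"
    by (simp add: dir_deriv2_eq_partial[OF assms(2)] matrix_vector_mult_basis column_def)
  also have "\<dots> = (\<Sum>k\<in>UNIV. \<Sum>l\<in>UNIV. \<Sum>j\<in>UNIV. complex_of_real (B $ k $ j * B $ l $ j) * ?d k l)"
    by (subst sum.swap) (intro sum.cong refl sum.swap)
  also have "\<dots> = (\<Sum>k\<in>UNIV. \<Sum>l\<in>UNIV. complex_of_real (A $ k $ l) * ?d k l)"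
    by (simp add: assms(1)[symmetric] matrix_matrix_mult_def transpose_def sum_distrib_right)
  finally show ?thesis by (simp add: second_order_def)
qed

lemma second_order_test: "f \<in> test_functions U \<Longrightarrow> second_order A f \<in> test_functions U"
  unfolding second_order_def[abs_def]
  by (intro test_functions_sum test_functions_cmult test_functions_partial_deriv)

lemma partial_deriv_avg:
  assumes "integrable N w" "r \<in> borel_measurable N" "\<xi> \<in> borel_measurable N"
    "f \<in> test_functions U" "\<And>p. \<bar>r p\<bar> \<le> 1"
  shows "partial_deriv k (avg N w r \<xi> f) = avg N (\<lambda>p. w p * complex_of_real (r p)) r \<xi> (partial_deriv k f)"
  unfolding partial_deriv_eq using dir_deriv_avg[OF assms] by (simp add: fun_eq_iff)

lemma avg_sum:
  assumes "integrable N w" "r \<in> borel_measurable N" "\<xi> \<in> borel_measurable N"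
    "\<And>i. i \<in> I \<Longrightarrow> f i \<in> test_functions U"
  shows "avg N w r \<xi> (\<lambda>x. \<Sum>i\<in>I. f i x) x = (\<Sum>i\<in>I. avg N w r \<xi> (f i) x)"
  unfolding avg_def sum_distrib_left
  by (rule Bochner_Integration.integral_sum) (rule avg_integrable[OF assms])

lemma avg_cmult: "avg N w r \<xi> (\<lambda>x. c * f x) x = c * avg N w r \<xi> f x"
  unfolding avg_def by (simp add: mult.left_commute)

lemma second_order_avg:
  assumes "integrable N w" "r \<in> borel_measurable N" "\<xi> \<in> borel_measurable N"
    "f \<in> test_functions U" "\<And>p. \<bar>r p\<bar> \<le> 1"
  shows "second_order A (avg N w r \<xi> f) x =
    avg N (\<lambda>p. w p * complex_of_real (r p) * complex_of_real (r p)) r \<xi> (second_order A f) x"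
proof -
  note t = test_functions_partial_deriv[OF test_functions_partial_deriv[OF assms(4)]]
  note i1 = integrable_weight_mult[OF assms(1,2,5)]
  note i2 = integrable_weight_mult[OF i1 assms(2,5)]
  let ?g = "\<lambda>k l x. complex_of_real (A $ k $ l) * partial_deriv k (partial_deriv l f) x"
  have g: "?g k l \<in> test_functions U" "(\<lambda>x. \<Sum>l\<in>UNIV. ?g k l x) \<in> test_functions U" for k l
    by (intro test_functions_sum test_functions_cmult t)+
  have "avg N (\<lambda>p. w p * complex_of_real (r p) * complex_of_real (r p)) r \<xi> (second_order A f) x
      = (\<Sum>k\<in>UNIV. \<Sum>l\<in>UNIV. avg N (\<lambda>p. w p * complex_of_real (r p) * complex_of_real (r p)) r \<xi> (?g k l) x)"
    unfolding second_order_def[abs_def]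
    by (simp only: avg_sum[OF i2 assms(2,3), where f="\<lambda>k x. \<Sum>l\<in>UNIV. ?g k l x", OF g(2)]
        avg_sum[OF i2 assms(2,3), where f="?g _", OF g(1)])
  then show ?thesis
    unfolding second_order_def partial_deriv_avg[OF assms]
      partial_deriv_avg[OF i1 assms(2,3) test_functions_partial_deriv[OF assms(4)] assms(5)]
    by (simp add: avg_cmult)
qed

text \<open>Averaging the fundamental theorem along the paths over the Gaussian vector produces the term
  with \<open>B \<eta>\<close>, in which Gaussian integration by parts creates the second-order part: the derivative
  \<open>exp (- t) / s\<close> of the spread \<open>s\<close> times the factor \<open>s\<close> from the chain rule is the square of the
  contraction factor.\<close>
theorem ou_avg_resolvent_equation:
  fixes A B :: "real^'d^'d"
  assumes B: "B ** transpose B = A" and f: "f \<in> test_functions U" and \<mu>: "0 < Re \<mu>"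
  shows "OU_expr A (ou_avg B \<mu> f) x + \<mu> * ou_avg B \<mu> f x = f x"
proof -
  let ?W = "ou_weight \<mu> :: real \<times> (real^'d) \<Rightarrow> complex"
  let ?r = "ou_contr :: real \<times> (real^'d) \<Rightarrow> real"
  let ?Z = "\<lambda>p. ?r p *\<^sub>R x + ou_shift B p"
  let ?s' = "\<lambda>t. if 0 < t then exp (- t) / ou_spread t else 0"
  let ?b = "\<lambda>j. B *v axis j 1"
  have W: "integrable lborel ?W" by (rule integrable_ou_weight[OF \<mu>])
  have lin: "linear (frechet_derivative f (at z))" for z
    by (rule has_derivative_linear[OF test_functions_has_derivative[OF f]])
  have tb: "dir_deriv v f \<in> test_functions U" "dir_deriv u (dir_deriv v f) \<in> test_functions U" for u v
    using test_functions_derivative[OF f] test_functions_derivative[OF test_functions_derivative[OF f]] by auto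
  note [measurable] = test_functions_measurable[OF f] test_functions_measurable[OF tb(1)] test_functions_measurable[OF tb(2)]
  have mr: "?r \<in> borel_measurable lborel" "ou_shift B \<in> borel_measurable lborel" by auto
  \<comment> \<open>\<open>T1\<close>, \<open>T2\<close>, \<open>T3\<close> are the three terms of the derivative along the path; Gaussian integration by parts at a
    fixed time turns \<open>T3\<close> into \<open>T4\<close>.\<close>
  define T1 where "T1 = (\<lambda>p. ?W p * f (?Z p))"
  define T2 where "T2 = (\<lambda>p. ?W p * complex_of_real (?r p) * dir_deriv x f (?Z p))"
  define T3 where "T3 = (\<lambda>j p. complex_of_real (?s' (fst p)) * complex_of_real (std_gauss (snd p) * (snd p \<bullet> axis j 1))
      * (ou_decay \<mu> (fst p) * dir_deriv (?b j) f (?Z p)))"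
  define T4 where "T4 = (\<lambda>j p. ?W p * complex_of_real (?r p) * complex_of_real (?r p) * dir_deriv (?b j) (dir_deriv (?b j) f) (?Z p))"
  have i1: "integrable lborel T1" unfolding T1_def by (rule avg_integrable[OF W mr f])
  have i2: "integrable lborel T2" unfolding T2_def
    by (rule avg_integrable[OF integrable_weight_mult[OF W mr(1) ou_contr_le_1] mr tb(1)])
  have i4: "integrable lborel (T4 j)" for j unfolding T4_def
    by (rule avg_integrable[OF integrable_weight_mult[OF integrable_weight_mult[OF W mr(1) ou_contr_le_1] mr(1) ou_contr_le_1] mr tb(2)])
  have i3: "integrable lborel (T3 j)" for j
  proof -
    obtain K where K: "\<And>z. norm (dir_deriv (?b j) f z) \<le> K" using test_functions_bounded[OF tb(1)] by metis
    have "norm (ou_decay \<mu> t) \<le> 1" for t using \<mu> by (auto simp: ou_decay_def norm_exp_eq_Re)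
    then have bd: "norm (ou_decay \<mu> t * dir_deriv (?b j) f z) \<le> K" for t z
      using K[of z] by (auto simp: norm_mult intro: order_trans[OF mult_left_le_one_le])
    have iS: "integrable lborel (\<lambda>\<eta>::real^'d. complex_of_real (std_gauss \<eta> * (\<eta> \<bullet> axis j 1)))"
    proof (rule Bochner_Integration.integrable_bound[OF integrable_std_gauss_norm])
      have "norm (complex_of_real (std_gauss \<eta> * (\<eta> \<bullet> axis j 1))) \<le> norm (norm \<eta> * std_gauss \<eta>)" for \<eta> :: "real^'d"
        using component_le_norm_cart[of \<eta> j]
        by (simp add: norm_mult cart_eq_inner_axis[symmetric] abs_mult mult.commute[of "norm \<eta>"] mult_left_mono del: of_real_mult)
      then show "AE \<eta> in lborel. norm (complex_of_real (std_gauss \<eta> * (\<eta> \<bullet> axis j 1))) \<le> norm (norm (\<eta>::real^'d) * std_gauss \<eta>)"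
        by blast
    qed measurable
    show ?thesis unfolding T3_def
      by (rule integrable_mult_bounded[OF integrable_lborel_prod_mult[OF integrable_of_real[OF integrable_ou_spread_derivative] iS] _ bd])
         measurable
  qed
  have T34: "(\<integral>p. T3 j p \<partial>lborel) = (\<integral>p. T4 j p \<partial>lborel)" for j
  proof -
    have inner: "(\<integral>\<eta>. T3 j (t, \<eta>) \<partial>lborel) = (\<integral>\<eta>. T4 j (t, \<eta>) \<partial>lborel)" for t
    proof (cases "0 < t")
      case True
      let ?s = "ou_spread t"
      let ?m = "exp (- t / 2) *\<^sub>R x"
      have Z: "?Z (t, \<eta>) = ?m + (?s *\<^sub>R B) *v \<eta>" for \<eta>
        using True by (simp add: ou_contr_def ou_shift_def scaleR_matrix_vector_assoc)
      have s: "?s > 0" by (rule ou_spread_pos[OF True])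
      have lin2: "linear (frechet_derivative (dir_deriv (?b j) f) (at z))" for z
        by (rule has_derivative_linear[OF test_functions_has_derivative[OF tb(1)]])
      have dir_scale: "dir_deriv ((?s *\<^sub>R B) *v axis j 1) (dir_deriv (?b j) f) z
          = of_real ?s * dir_deriv (?b j) (dir_deriv (?b j) f) z" for z
        unfolding scaleR_matrix_vector_assoc[symmetric] linear_cmul[OF lin2] by (rule scaleR_conv_of_real)
      have "(\<integral>\<eta>. T3 j (t, \<eta>) \<partial>lborel) = (of_real (exp (- t) / ?s) * ou_decay \<mu> t) *
          (\<integral>\<eta>. complex_of_real (std_gauss \<eta> * (\<eta> \<bullet> axis j 1)) * dir_deriv (?b j) f (?m + (?s *\<^sub>R B) *v \<eta>) \<partial>lborel)"
        unfolding T3_def Z using True by (subst integral_mult_right_zero[symmetric]) (simp add: mult_ac)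
      also have "\<dots> = (of_real (exp (- t) / ?s) * ou_decay \<mu> t) *
          (\<integral>\<eta>. complex_of_real (std_gauss \<eta>) * dir_deriv ((?s *\<^sub>R B) *v axis j 1) (dir_deriv (?b j) f) (?m + (?s *\<^sub>R B) *v \<eta>) \<partial>lborel)"
        by (simp only: std_gauss_by_parts(2)[OF tb(1)])
      also have "\<dots> = (\<integral>\<eta>. (of_real (exp (- t) / ?s) * ou_decay \<mu> t) * (complex_of_real (std_gauss \<eta>) *
          (of_real ?s * dir_deriv (?b j) (dir_deriv (?b j) f) (?m + (?s *\<^sub>R B) *v \<eta>))) \<partial>lborel)"
        by (simp only: integral_mult_right_zero dir_scale)
      also have "\<dots> = (\<integral>\<eta>. T4 j (t, \<eta>) \<partial>lborel)"
      proof (rule Bochner_Integration.integral_cong[OF refl])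
        fix \<eta> :: "real^'d"
        have "exp (- t) / ?s * ?s = ?r (t, \<eta>) * ?r (t, \<eta>)"
          using s True by (simp add: ou_contr_def exp_add[symmetric])
        then have e: "of_real (exp (- t) / ?s) * of_real ?s = (complex_of_real (?r (t, \<eta>)) * complex_of_real (?r (t, \<eta>)))"
          by (simp only: of_real_mult[symmetric])
        have "(of_real (exp (- t) / ?s) * ou_decay \<mu> t) * (complex_of_real (std_gauss \<eta>) *
          (of_real ?s * dir_deriv (?b j) (dir_deriv (?b j) f) (?m + (?s *\<^sub>R B) *v \<eta>)))
          = ou_decay \<mu> t * complex_of_real (std_gauss \<eta>) * (of_real (exp (- t) / ?s) * of_real ?s) *
            dir_deriv (?b j) (dir_deriv (?b j) f) (?m + (?s *\<^sub>R B) *v \<eta>)"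
          by (simp only: mult_ac)
        also have "\<dots> = T4 j (t, \<eta>)"
          unfolding e T4_def Z ou_weight_def fst_conv snd_conv by (simp only: mult.assoc)
        finally show "(of_real (exp (- t) / ?s) * ou_decay \<mu> t) * (complex_of_real (std_gauss \<eta>) *
          (of_real ?s * dir_deriv (?b j) (dir_deriv (?b j) f) (?m + (?s *\<^sub>R B) *v \<eta>))) = T4 j (t, \<eta>)" .
      qed
      finally show ?thesis .
    next
      case False
      then show ?thesis by (simp add: T3_def T4_def ou_weight_def ou_decay_def)
    qed
    show ?thesis unfolding lborel_Fubini(1)[OF i3] lborel_Fubini(1)[OF i4] inner ..
  qed
  have T: "(\<integral>p. - \<mu> * T1 p - T2 p / 2 + (\<Sum>j\<in>UNIV. T3 j p) \<partial>lborel) = - f x"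
  proof -
    have iT: "integrable lborel (\<lambda>p. - \<mu> * T1 p - T2 p / 2 + (\<Sum>j\<in>UNIV. T3 j p))"
      using i1 i2 i3 by (intro Bochner_Integration.integrable_add Bochner_Integration.integrable_diff
        Bochner_Integration.integrable_sum) auto
    have "(\<integral>t. - \<mu> * T1 (t, \<eta>) - T2 (t, \<eta>) / 2 + (\<Sum>j\<in>UNIV. T3 j (t, \<eta>)) \<partial>lborel)
        = of_real (std_gauss \<eta>) * (- f x)" for \<eta> :: "real^'d"
    proof -
      let ?z = "ou_path x (B *v \<eta>)"
      have B\<eta>: "B *v \<eta> = (\<Sum>j\<in>UNIV. (\<eta> \<bullet> axis j 1) *\<^sub>R ?b j)"
        by (subst vec_eq_sum_axis[of \<eta>]) (simp add: linear_sum[OF matrix_vector_mul_linear] matrix_vector_mult_scaleR cart_eq_inner_axis[symmetric])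
      have dB: "dir_deriv (B *v \<eta>) f z = (\<Sum>j\<in>UNIV. of_real (\<eta> \<bullet> axis j 1) * dir_deriv (?b j) f z)" for z
        unfolding B\<eta> linear_sum[OF lin] linear_cmul[OF lin] by (simp only: scaleR_conv_of_real)
      have "- \<mu> * T1 (t, \<eta>) - T2 (t, \<eta>) / 2 + (\<Sum>j\<in>UNIV. T3 j (t, \<eta>)) =
        of_real (std_gauss \<eta>) * (- \<mu> * ou_decay \<mu> t * f (?z t)
      - ou_decay \<mu> t * (of_real (exp (- t / 2)) * dir_deriv x f (?z t)) / 2
      + ou_decay \<mu> t * (of_real (exp (- t) / ou_spread t) * dir_deriv (B *v \<eta>) f (?z t)))" for t
      proof (cases "0 < t")
        case True
        then have Z: "?Z (t, \<eta>) = ?z t" "?r (t, \<eta>) = exp (- t / 2)"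
          by (auto simp: ou_contr_def ou_shift_def ou_path_def)
        have "(\<Sum>j\<in>UNIV. T3 j (t, \<eta>)) = of_real (std_gauss \<eta>) * (ou_decay \<mu> t * (of_real (exp (- t) / ou_spread t) * dir_deriv (B *v \<eta>) f (?z t)))"
          unfolding dB T3_def Z(1) using True by (simp add: sum_distrib_left mult_ac)
        then show ?thesis unfolding T1_def T2_def ou_weight_def Z(1) unfolding Z(2)
          by (simp add: algebra_simps)
      next
        case False
        then show ?thesis by (simp add: T1_def T2_def T3_def ou_weight_def ou_decay_def)
      qed
      then show ?thesis by (simp only: integral_mult_right_zero ou_path_FTC[OF f \<mu>])
    qed
    then have "(\<integral>p. - \<mu> * T1 p - T2 p / 2 + (\<Sum>j\<in>UNIV. T3 j p) \<partial>lborel) = (\<integral>\<eta>. of_real (std_gauss (\<eta> :: real^'d)) * (- f x) \<partial>lborel)"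
      by (simp only: lborel_Fubini(2)[OF iT])
    also have "\<dots> = - f x"
      by (subst integral_mult_left_zero) (simp add: integral_of_real)
    finally show ?thesis .
  qed
  have "(\<integral>p. - \<mu> * T1 p - T2 p / 2 + (\<Sum>j\<in>UNIV. T3 j p) \<partial>lborel)
      = - \<mu> * (\<integral>p. T1 p \<partial>lborel) - (\<integral>p. T2 p \<partial>lborel) / 2 + (\<Sum>j\<in>UNIV. \<integral>p. T4 j p \<partial>lborel)"
    using i1 i2 i3 by (simp add: T34 Bochner_Integration.integral_sum Bochner_Integration.integrable_sum)
  moreover have "(\<integral>p. T1 p \<partial>lborel) = ou_avg B \<mu> f x" by (simp add: T1_def ou_avg_def avg_def)
  moreover have "(\<integral>p. T2 p \<partial>lborel) = dir_deriv x (ou_avg B \<mu> f) x"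
    unfolding ou_avg_def by (subst dir_deriv_avg[OF W mr f ou_contr_le_1]) (simp add: T2_def avg_def)
  moreover have "(\<Sum>j\<in>UNIV. \<integral>p. T4 j p \<partial>lborel) = second_order A (ou_avg B \<mu> f) x"
  proof -
    have so: "second_order A f = (\<lambda>x. \<Sum>j\<in>UNIV. dir_deriv (?b j) (dir_deriv (?b j) f) x)"
      using second_order_factor[OF B f] by blast
    show ?thesis unfolding ou_avg_def second_order_avg[OF W mr f ou_contr_le_1] so
        avg_sum[OF integrable_weight_mult[OF integrable_weight_mult[OF W mr(1) ou_contr_le_1] mr(1) ou_contr_le_1]
          mr, where f="\<lambda>j. dir_deriv (?b j) (dir_deriv (?b j) f)", OF tb(2)]
      by (simp add: T4_def avg_def)
  qed
  ultimately show ?thesis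
    using T by (simp add: OU_expr_eq[OF avg_smooth_ou[OF \<mu> f]] algebra_simps)
qed

subsection \<open>Cutoffs\<close>

lemma test_functions_dilate:
  fixes f :: "'a::euclidean_space \<Rightarrow> complex"
  assumes "f \<in> test_functions UNIV" "c \<noteq> 0"
  shows "(\<lambda>x. f (c *\<^sub>R x)) \<in> test_functions UNIV"
proof -
  obtain K where K: "compact K" "\<And>x. x \<notin> K \<Longrightarrow> f x = 0" using assms(1) test_functions_iff by metis
  have "smooth_on UNIV (\<lambda>x. f (c *\<^sub>R x))"
    by (rule smooth_on_compose[OF test_functions_smooth[OF assms(1)]]) (auto intro: smooth_on_linear bounded_linear_scaleR_right)
  moreover have "compact ((*\<^sub>R) (1 / c) ` K)" by (rule compact_scaling[OF K(1)])
  moreover have "f (c *\<^sub>R x) = 0" if "x \<notin> (*\<^sub>R) (1 / c) ` K" for x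
  proof (rule K(2), rule)
    assume "c *\<^sub>R x \<in> K"
    then have "(1 / c) *\<^sub>R (c *\<^sub>R x) \<in> (*\<^sub>R) (1 / c) ` K" by blast
    then show False using that assms(2) by simp
  qed
  ultimately show ?thesis by (auto simp: test_functions_iff)
qed

lemma dir_deriv_dilate:
  fixes f :: "'a::euclidean_space \<Rightarrow> complex"
  assumes "f \<in> test_functions U"
  shows "dir_deriv v (\<lambda>x. f (c *\<^sub>R x)) x = of_real c * dir_deriv v f (c *\<^sub>R x)"
proof -
  have "((\<lambda>x. f (c *\<^sub>R x)) has_derivative (\<lambda>h. dir_deriv (c *\<^sub>R h) f (c *\<^sub>R x))) (at x)"
    by (rule has_derivative_compose[OF _ test_functions_has_derivative[OF assms]]) (auto intro!: derivative_eq_intros)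
  then have "dir_deriv v (\<lambda>x. f (c *\<^sub>R x)) x = dir_deriv (c *\<^sub>R v) f (c *\<^sub>R x)" by (rule dir_derivI)
  then show ?thesis
    by (simp add: linear_cmul[OF has_derivative_linear[OF test_functions_has_derivative[OF assms]]] scaleR_conv_of_real)
qed

lemma second_order_dilate:
  assumes "f \<in> test_functions U"
  shows "second_order A (\<lambda>x. f (c *\<^sub>R x)) x = (of_real c)\<^sup>2 * second_order A f (c *\<^sub>R x)"
proof -
  have 1: "partial_deriv l (\<lambda>x. f (c *\<^sub>R x)) = (\<lambda>x. of_real c * partial_deriv l f (c *\<^sub>R x))" for l
    unfolding partial_deriv_eq using dir_deriv_dilate[OF assms] by blast
  have 2: "partial_deriv k (\<lambda>x. of_real c * partial_deriv l f (c *\<^sub>R x)) x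
      = (of_real c)\<^sup>2 * partial_deriv k (partial_deriv l f) (c *\<^sub>R x)" for k l
  proof -
    have "(\<lambda>x. of_real c * partial_deriv l f x) \<in> test_functions U"
      by (intro test_functions_cmult test_functions_partial_deriv assms)
    from dir_deriv_dilate[OF this, where v="axis k 1" and c=c and x=x] show ?thesis
      unfolding dir_deriv_cmult[OF test_functions_partial_deriv[OF assms]]
      unfolding partial_deriv_eq
      by (simp add: power2_eq_square)
  qed
  show ?thesis unfolding second_order_def 1 2 by (simp add: sum_distrib_left mult_ac)
qed

lemma second_order_mult:
  assumes "smooth_on UNIV f" "smooth_on UNIV g"
  shows "second_order A (\<lambda>x. f x * g x) x = f x * second_order A g x + second_order A f x * g x
    + (\<Sum>k\<in>UNIV. \<Sum>l\<in>UNIV. complex_of_real (A $ k $ l) *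
        (partial_deriv k f x * partial_deriv l g x + partial_deriv l f x * partial_deriv k g x))"
proof -
  have 1: "partial_deriv l (\<lambda>x. f x * g x) = (\<lambda>x. f x * partial_deriv l g x + partial_deriv l f x * g x)" for l
    unfolding partial_deriv_eq using dir_deriv_mult[OF assms] by blast
  have 2: "partial_deriv k (\<lambda>x. f x * partial_deriv l g x + partial_deriv l f x * g x) x
      = f x * partial_deriv k (partial_deriv l g) x + partial_deriv k f x * partial_deriv l g x
      + (partial_deriv l f x * partial_deriv k g x + partial_deriv k (partial_deriv l f) x * g x)" for k l
    using assms
    by (simp add: partial_deriv_eq dir_deriv_add dir_deriv_mult smooth_on_mult smooth_onD_derivative)
  show ?thesis unfolding second_order_def 1 2
    by (simp add: sum_distrib_left sum_distrib_right sum.distrib[symmetric] algebra_simps)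
qed

lemma OU_expr_mult:
  assumes "smooth_on UNIV f" "smooth_on UNIV g"
  shows "OU_expr A (\<lambda>x. f x * g x) x = f x * OU_expr A g x + OU_expr A f x * g x
    - (\<Sum>k\<in>UNIV. \<Sum>l\<in>UNIV. complex_of_real (A $ k $ l) *
        (partial_deriv k f x * partial_deriv l g x + partial_deriv l f x * partial_deriv k g x))"
  using assms
  by (simp add: OU_expr_eq smooth_on_mult second_order_mult dir_deriv_mult algebra_simps add_divide_distrib)

lemma OU_expr_diff:
  assumes "smooth_on UNIV f" "smooth_on UNIV g"
  shows "OU_expr A (\<lambda>x. f x - g x) x = OU_expr A f x - OU_expr A g x"
proof -
  have d: "dir_deriv v (\<lambda>x. f x - g x) x = dir_deriv v f x - dir_deriv v g x"
    if "smooth_on UNIV f" "smooth_on UNIV g" for f g :: "real^'a \<Rightarrow> complex" and v x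
    by (rule dir_derivI[OF has_derivative_diff[OF smooth_onD_differentiable[OF that(1) UNIV_I]
      smooth_onD_differentiable[OF that(2) UNIV_I]]])
  have 1: "partial_deriv l (\<lambda>x. f x - g x) = (\<lambda>x. partial_deriv l f x - partial_deriv l g x)" for l
    unfolding partial_deriv_eq using d[OF assms] by blast
  have "second_order A (\<lambda>x. f x - g x) x = second_order A f x - second_order A g x"
    unfolding second_order_def 1 using assms
    by (simp add: partial_deriv_eq d smooth_onD_derivative sum_subtractf right_diff_distrib)
  then show ?thesis using assms
    by (simp add: OU_expr_eq smooth_on_diff d diff_divide_distrib)
qed

text \<open>Far away \<open>w\<close> is small, and on a bounded set the dilated argument is close to the zero of \<open>k\<close>.\<close>
lemma uniform_limit_cutoff:
  fixes w k :: "'a::euclidean_space \<Rightarrow> complex"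
  assumes w: "(w \<longlongrightarrow> 0) at_infinity" "\<And>x. norm (w x) \<le> M"
    and k: "isCont k 0" "k 0 = 0" "\<And>x. norm (k x) \<le> N"
  shows "uniform_limit UNIV (\<lambda>n x. k ((1 / real (Suc n)) *\<^sub>R x) * w x) (\<lambda>x. 0) sequentially"
proof (rule uniform_limitI)
  fix e :: real assume e: "0 < e"
  have M0: "0 \<le> M" "0 \<le> N" using w(2) k(3) norm_ge_zero order_trans by blast+
  have "\<forall>\<^sub>F x in at_infinity. norm (w x) < e / (N + 1)"
    using w(1) M0 e by (auto simp: tendsto_iff)
  then obtain R where R: "\<And>x. R \<le> norm x \<Longrightarrow> norm (w x) < e / (N + 1)"
    by (auto simp: eventually_at_infinity)
  obtain \<delta> where \<delta>: "0 < \<delta>" "\<And>z. norm z < \<delta> \<Longrightarrow> norm (k z) < e / (M + 1)"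
    using k(1,2) M0 e unfolding continuous_at_eps_delta dist_norm
    by (metis add_nonneg_pos diff_zero divide_pos_pos zero_less_one)
  have "(\<lambda>n. R / real (Suc n)) \<longlonglongrightarrow> 0" by real_asymp
  then have "\<forall>\<^sub>F n in sequentially. R / real (Suc n) < \<delta>"
    using \<delta>(1) by (rule order_tendstoD(2))
  then show "\<forall>\<^sub>F n in sequentially. \<forall>x\<in>UNIV. dist (k ((1 / real (Suc n)) *\<^sub>R x) * w x) 0 < e"
  proof eventually_elim
    case (elim n)
    show ?case
    proof
      fix x :: 'a
      let ?z = "(1 / real (Suc n)) *\<^sub>R x"
      show "dist (k ?z * w x) 0 < e"
      proof (cases "R \<le> norm x")
        case True
        have "norm (k ?z) * norm (w x) \<le> N * norm (w x)" by (intro mult_right_mono k(3)) auto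
        also have "\<dots> \<le> (N + 1) * norm (w x)" by (simp add: distrib_right)
        also have "\<dots> < e" using R[OF True] M0 by (simp add: field_simps)
        finally show ?thesis by (simp add: norm_mult)
      next
        case False
        have "norm ?z = norm x / real (Suc n)" by simp
        also have "\<dots> \<le> R / real (Suc n)" using False by (intro divide_right_mono) auto
        also note elim
        finally have z: "norm (k ?z) < e / (M + 1)" by (rule \<delta>(2))
        have "norm (k ?z) * norm (w x) \<le> norm (k ?z) * (M + 1)"
          using w(2)[of x] by (intro mult_left_mono) auto
        also have "\<dots> < e" using z M0 by (simp add: field_simps)
        finally show ?thesis by (simp add: norm_mult)
      qed
    qed
  qed
qed

lemma uniform_limit_small:
  fixes g :: "nat \<Rightarrow> 'a \<Rightarrow> complex"
  assumes "\<And>n x. norm (g n x) \<le> K / real (Suc n)"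
  shows "uniform_limit UNIV g (\<lambda>x. 0) sequentially"
proof (rule uniform_limitI)
  fix e :: real assume e: "0 < e"
  have "(\<lambda>n. K / real (Suc n)) \<longlonglongrightarrow> 0" by real_asymp
  then have "\<forall>\<^sub>F n in sequentially. K / real (Suc n) < e" using e by (rule order_tendstoD(2))
  then show "\<forall>\<^sub>F n in sequentially. \<forall>x\<in>UNIV. dist (g n x) 0 < e"
  proof eventually_elim
    case (elim n)
    show ?case using order.strict_trans1[OF assms elim] by (auto simp: dist_norm)
  qed
qed

text \<open>Multiplication by dilated bump functions approximates a decaying smooth function in the graph
  norm: the drift only produces \<open>z \<bullet> \<nabla>\<chi> z\<close> at \<open>z = x / n\<close>, which is bounded and vanishes at the origin.\<close>
lemma OU_graph_smooth:
  fixes u :: "real^'d \<Rightarrow> complex"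
  assumes sm: "smooth_on UNIV u" and u0: "u \<in> C0" and h0: "OU_expr A u \<in> C0"
    and bu: "\<And>x. norm (u x) \<le> M" and bh: "\<And>x. norm (OU_expr A u x) \<le> H"
    and bd: "\<And>l x. norm (partial_deriv l u x) \<le> L"
  shows "OU_graph A u (OU_expr A u)"
proof -
  define b where "b = (bump :: real^'d \<Rightarrow> complex)"
  have bt: "b \<in> test_functions UNIV" unfolding b_def by (rule bump_test)
  let ?c = "\<lambda>n. 1 / real (Suc n)"
  define cut where "cut = (\<lambda>n x. b (?c n *\<^sub>R x))"
  have cut_test: "cut n \<in> test_functions UNIV" for n
    unfolding cut_def by (rule test_functions_dilate[OF bt]) simp
  define v where "v = (\<lambda>n x. cut n x * u x)"
  have vt: "v n \<in> test_functions UNIV" for n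
    unfolding v_def using test_functions_mult_smooth[OF cut_test sm, of n] by (simp add: mult.commute)
  define k2 where "k2 = (\<lambda>z. dir_deriv z b z)"
  have "k2 = (\<lambda>z. \<Sum>i\<in>UNIV. complex_of_real (z $ i) * partial_deriv i b z)"
    unfolding k2_def using dir_deriv_eq_partial[OF test_functions_smooth[OF bt]] by blast
  moreover have "smooth_on UNIV (\<lambda>z::real^'d. complex_of_real (z $ i))" for i
    by (rule smooth_on_linear) (auto intro: bounded_linear_compose[OF bounded_linear_of_real bounded_linear_vec_nth])
  ultimately have k2t: "k2 \<in> test_functions UNIV"
    by (simp add: test_functions_sum test_functions_mult_smooth test_functions_partial_deriv[OF bt])
  obtain Kb where Kb: "0 < Kb" "\<And>x. norm (b x) \<le> Kb" using test_functions_bounded[OF bt] by metis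
  obtain K2 where K2: "0 < K2" "\<And>x. norm (k2 x) \<le> K2" using test_functions_bounded[OF k2t] by metis
  obtain K3 where K3: "0 < K3" "\<And>x. norm (second_order A b x) \<le> K3"
    using test_functions_bounded[OF second_order_test[OF bt]] by metis
  have "\<exists>K>0. \<forall>x. norm (partial_deriv l b x) \<le> K" for l
    using test_functions_bounded[OF test_functions_partial_deriv[OF bt]] by metis
  then obtain K4' where K4': "\<And>l x. norm (partial_deriv l b x) \<le> K4' l" by metis
  define K4 where "K4 = (\<Sum>l\<in>UNIV. \<bar>K4' l\<bar>)"
  have K4: "norm (partial_deriv l b x) \<le> K4" for l x
    using K4'[of l x] member_le_sum[of l UNIV "\<lambda>l. \<bar>K4' l\<bar>"] unfolding K4_def by fastforce
  have L0: "0 \<le> L" "0 \<le> K4" "0 \<le> M" using bd K4 bu norm_ge_zero order_trans by blast+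
  have pd_cut: "partial_deriv l (cut n) x = of_real (?c n) * partial_deriv l b (?c n *\<^sub>R x)" for l n x
    unfolding cut_def partial_deriv_eq by (rule dir_deriv_dilate[OF bt])
  have OU_cut: "OU_expr A (cut n) x = - ((of_real (?c n))\<^sup>2 * second_order A b (?c n *\<^sub>R x)) + k2 (?c n *\<^sub>R x) / 2" for n x
  proof -
    have "dir_deriv x (cut n) x = k2 (?c n *\<^sub>R x)"
      unfolding cut_def k2_def dir_deriv_dilate[OF bt]
        linear_cmul[OF has_derivative_linear[OF test_functions_has_derivative[OF bt]]]
      by (rule scaleR_conv_of_real[symmetric])
    then show ?thesis
      using OU_expr_eq[OF test_functions_smooth[OF cut_test], of A n x] second_order_dilate[OF bt, of A "?c n" x]
      by (simp add: cut_def)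
  qed
  define cr where "cr = (\<lambda>n x. \<Sum>k\<in>UNIV. \<Sum>l\<in>UNIV. complex_of_real (A $ k $ l) *
      (partial_deriv k (cut n) x * partial_deriv l u x + partial_deriv l (cut n) x * partial_deriv k u x))"
  have crx: "(\<Sum>k\<in>UNIV. \<Sum>l\<in>UNIV. complex_of_real (A $ k $ l) *
      (partial_deriv k (cut n) x * partial_deriv l u x + partial_deriv l (cut n) x * partial_deriv k u x)) = cr n x" for n x
    by (simp only: cr_def)
  \<comment> \<open>The error consists of a part from where the cutoff differs from one, a part where the drift hits the cutoff,
    and second-order terms, each of which carries a factor \<open>1 / n\<close>.\<close>
  have OUv: "OU_expr A (v n) x = OU_expr A u x + ((b (?c n *\<^sub>R x) - 1) * OU_expr A u x
      + (k2 (?c n *\<^sub>R x) * (u x / 2) + (- ((of_real (?c n))\<^sup>2 * second_order A b (?c n *\<^sub>R x)) * u x - cr n x)))" for n x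
    unfolding v_def OU_expr_mult[OF test_functions_smooth[OF cut_test] sm] OU_cut crx
    by (simp add: cut_def algebra_simps)
  have isC: "isCont f 0" if "f \<in> test_functions UNIV" for f :: "real^'d \<Rightarrow> complex"
    using test_functions_continuous[OF that] by (simp add: continuous_on_eq_continuous_at)
  have lb: "isCont (\<lambda>z. b z - 1) 0" "b 0 - 1 = 0" "norm (b x - 1) \<le> Kb + 1" for x
    using isC[OF bt] norm_triangle_ineq4[of "b x" 1] Kb(2)[of x] by (auto simp: b_def intro!: continuous_intros)
  have U1: "uniform_limit UNIV (\<lambda>n x. (b (?c n *\<^sub>R x) - 1) * OU_expr A u x) (\<lambda>x. 0) sequentially"
    by (rule uniform_limit_cutoff[OF _ bh lb]) (use h0 in \<open>simp add: C0_def\<close>)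
  have k20: "k2 0 = 0"
    unfolding k2_def using linear_0[OF has_derivative_linear[OF test_functions_has_derivative[OF bt]]] by simp
  have U2: "uniform_limit UNIV (\<lambda>n x. k2 (?c n *\<^sub>R x) * (u x / 2)) (\<lambda>x. 0) sequentially"
  proof (rule uniform_limit_cutoff[OF _ _ isC[OF k2t] k20 K2(2)])
    show "((\<lambda>x. u x / 2) \<longlongrightarrow> 0) at_infinity"
      using u0 tendsto_divide[of u 0 at_infinity "\<lambda>_. 2" 2] by (simp add: C0_def)
    show "norm (u x / 2) \<le> M" for x using bu[of x] L0(3) by (simp add: norm_divide)
  qed
  have U3: "uniform_limit UNIV (\<lambda>n x. - ((of_real (?c n))\<^sup>2 * second_order A b (?c n *\<^sub>R x)) * u x - cr n x) (\<lambda>x. 0) sequentially"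
  proof (rule uniform_limit_small)
    fix n x
    let ?S = "\<Sum>k\<in>UNIV. \<Sum>l\<in>UNIV. \<bar>A $ k $ l\<bar> * (K4 * L + K4 * L)"
    have nc: "norm (complex_of_real (?c n)) = ?c n" by (simp only: norm_of_real) simp
    have c1: "?c n * ?c n \<le> ?c n" by (rule mult_right_le_one_le) auto
    have "norm (- ((of_real (?c n))\<^sup>2 * second_order A b (?c n *\<^sub>R x)) * u x) = (?c n * ?c n) * (norm (second_order A b (?c n *\<^sub>R x)) * norm (u x))"
      by (simp only: norm_mult norm_minus_cancel nc power2_eq_square mult.assoc)
    also have "\<dots> \<le> ?c n * (K3 * M)"
      using K3 bu L0 by (intro mult_mono c1 mult_nonneg_nonneg) auto
    finally have A1: "norm (- ((of_real (?c n))\<^sup>2 * second_order A b (?c n *\<^sub>R x)) * u x) \<le> ?c n * (K3 * M)" .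
    have pp: "norm (partial_deriv i (cut n) x * partial_deriv j u x) \<le> ?c n * (K4 * L)" for i j
    proof -
      have "norm (partial_deriv i (cut n) x * partial_deriv j u x) = ?c n * (norm (partial_deriv i b (?c n *\<^sub>R x)) * norm (partial_deriv j u x))"
        by (simp only: pd_cut norm_mult nc mult.assoc)
      also have "\<dots> \<le> ?c n * (K4 * L)" using K4 bd L0 by (intro mult_left_mono mult_mono) auto
      finally show ?thesis .
    qed
    have "norm (cr n x) \<le> (\<Sum>k\<in>UNIV. \<Sum>l\<in>UNIV. \<bar>A $ k $ l\<bar> * (?c n * (K4 * L) + ?c n * (K4 * L)))"
      unfolding cr_def
    proof (intro order_trans[OF norm_sum] sum_mono)
      fix k l
      have "norm (partial_deriv k (cut n) x * partial_deriv l u x + partial_deriv l (cut n) x * partial_deriv k u x)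
          \<le> ?c n * (K4 * L) + ?c n * (K4 * L)"
        by (rule order_trans[OF norm_triangle_ineq add_mono[OF pp pp]])
      then show "norm (complex_of_real (A $ k $ l) * (partial_deriv k (cut n) x * partial_deriv l u x
          + partial_deriv l (cut n) x * partial_deriv k u x)) \<le> \<bar>A $ k $ l\<bar> * (?c n * (K4 * L) + ?c n * (K4 * L))"
        by (subst norm_mult) (simp only: norm_of_real mult_left_mono abs_ge_zero)
    qed
    also have "\<dots> = ?c n * ?S" by (simp add: sum_distrib_left algebra_simps)
    finally have "norm (cr n x) \<le> ?c n * ?S" .
    then have "norm (- ((of_real (?c n))\<^sup>2 * second_order A b (?c n *\<^sub>R x)) * u x - cr n x) \<le> ?c n * (K3 * M) + ?c n * ?S"
      using A1 by (rule norm_triangle_le_diff[OF add_mono, rotated])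
    then show "norm (- ((of_real (?c n))\<^sup>2 * second_order A b (?c n *\<^sub>R x)) * u x - cr n x) \<le> (K3 * M + ?S) / real (Suc n)"
      by (rule order_trans) (simp only: add_divide_distrib times_divide_eq_left mult_1_left order_refl)
  qed
  have "uniform_limit UNIV (\<lambda>n. OU_expr A (v n)) (\<lambda>x. OU_expr A u x + (0 + (0 + 0))) sequentially"
    unfolding OUv[abs_def]
    by (intro uniform_limit_add U1 U2 U3 uniform_limit_const)
  moreover have "uniform_limit UNIV v u sequentially"
  proof -
    have "uniform_limit UNIV (\<lambda>n x. (b (?c n *\<^sub>R x) - 1) * u x) (\<lambda>x. 0) sequentially"
      by (rule uniform_limit_cutoff[OF _ bu lb]) (use u0 in \<open>simp add: C0_def\<close>)
    then have "uniform_limit UNIV (\<lambda>n x. u x + (b (?c n *\<^sub>R x) - 1) * u x) (\<lambda>x. u x + 0) sequentially"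
      by (intro uniform_limit_add uniform_limit_const)
    moreover have "(\<lambda>n x. u x + (b (?c n *\<^sub>R x) - 1) * u x) = v"
      by (simp add: v_def cut_def fun_eq_iff algebra_simps)
    ultimately show ?thesis by simp
  qed
  ultimately show ?thesis unfolding OU_graph_def using u0 h0 vt by auto
qed

subsection \<open>Identification of the resolvent\<close>

text \<open>If \<open>f\<close> is supported in the ball of radius \<open>R\<close>, only those \<open>p\<close> contribute at \<open>x\<close> for which the noise is larger than
  the contracted distance of \<open>x\<close> minus \<open>R\<close>; by dominated convergence their total weight vanishes at infinity.\<close>
lemma ou_avg_C0:
  assumes \<mu>: "0 < Re \<mu>" and f: "f \<in> test_functions UNIV"
  shows "ou_avg B \<mu> f \<in> C0"
proof -
  let ?W = "ou_weight \<mu> :: real \<times> (real^'a) \<Rightarrow> complex"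
  let ?r = "ou_contr :: real \<times> (real^'a) \<Rightarrow> real"
  have W: "integrable lborel ?W" by (rule integrable_ou_weight[OF \<mu>])
  obtain C where C: "compact C" "\<And>x. x \<notin> C \<Longrightarrow> f x = 0" using f test_functions_iff by metis
  obtain R where R: "\<And>x. x \<in> C \<Longrightarrow> norm x \<le> R" using compact_imp_bounded[OF C(1)] bounded_iff by metis
  obtain K where K: "0 < K" "\<And>x. norm (f x) \<le> K" using test_functions_bounded[OF f] by metis
  define m where "m = (\<lambda>t. \<integral>p. norm (?W p) * indicat_real {p. ?r p * t \<le> R + norm (ou_shift B p)} p \<partial>lborel)"
  have mi: "integrable lborel (\<lambda>p. norm (?W p) * indicat_real {p. ?r p * t \<le> R + norm (ou_shift B p)} p)" for t
    by (rule Bochner_Integration.integrable_bound[OF integrable_norm[OF W]]) (auto simp: indicator_def)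
  have "(m \<longlongrightarrow> (\<integral>p. 0 \<partial>(lborel :: (real \<times> (real^'a)) measure))) at_top"
    unfolding m_def
  proof (rule integral_dominated_convergence_at_top[OF _ _ integrable_norm[OF W]])
    show "AE p in lborel. ((\<lambda>t. norm (?W p) * indicat_real {p. ?r p * t \<le> R + norm (ou_shift B p)} p) \<longlongrightarrow> 0) at_top"
    proof (rule AE_I2)
      fix p :: "real \<times> (real^'a)"
      have "\<forall>\<^sub>F t in at_top. (R + norm (ou_shift B p)) / ?r p < t" by (rule eventually_gt_at_top)
      then have "\<forall>\<^sub>F t in at_top. norm (?W p) * indicat_real {p. ?r p * t \<le> R + norm (ou_shift B p)} p = 0"
        by eventually_elim (auto simp: indicator_def ou_contr_def field_simps)
      then show "((\<lambda>t. norm (?W p) * indicat_real {p. ?r p * t \<le> R + norm (ou_shift B p)} p) \<longlongrightarrow> 0) at_top"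
        by (rule tendsto_eventually)
    qed
  qed (auto simp: indicator_def)
  then have "((\<lambda>x. K * m (norm x)) \<longlongrightarrow> K * 0) (at_infinity :: (real^'a) filter)"
    by (intro tendsto_mult tendsto_const filterlim_compose[OF _ filterlim_norm_at_top]) simp
  moreover have "norm (ou_avg B \<mu> f x) \<le> K * m (norm x)" for x
  proof -
    have "norm (ou_avg B \<mu> f x) \<le> (\<integral>p. norm (?W p * f (?r p *\<^sub>R x + ou_shift B p)) \<partial>lborel)"
      unfolding ou_avg_def avg_def by (rule integral_norm_bound)
    also have "\<dots> \<le> (\<integral>p. K * (norm (?W p) * indicat_real {p. ?r p * norm x \<le> R + norm (ou_shift B p)} p) \<partial>lborel)"
    proof (rule integral_mono)
      show "integrable lborel (\<lambda>p. norm (?W p * f (?r p *\<^sub>R x + ou_shift B p)))"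
        by (intro integrable_norm avg_integrable[OF W _ _ f]) auto
      show "norm (?W p * f (?r p *\<^sub>R x + ou_shift B p)) \<le> K * (norm (?W p) * indicat_real {p. ?r p * norm x \<le> R + norm (ou_shift B p)} p)" for p
      proof (cases "?r p *\<^sub>R x + ou_shift B p \<in> C")
        case True
        have "?r p * norm x = norm (?r p *\<^sub>R x)" by (simp add: ou_contr_def)
        also have "\<dots> \<le> norm (?r p *\<^sub>R x + ou_shift B p) + norm (ou_shift B p)"
          by (metis add_diff_cancel_right' norm_triangle_ineq4)
        also have "\<dots> \<le> R + norm (ou_shift B p)" using R[OF True] by simp
        finally show ?thesis using K(2)[of "?r p *\<^sub>R x + ou_shift B p"]
          by (simp add: norm_mult mult.commute[of K] mult_left_mono)
      next
        case False
        then show ?thesis using C(2) K(1) by (simp add: indicator_def)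
      qed
    qed (use mi in auto)
    finally show ?thesis by (simp add: m_def)
  qed
  ultimately have "(ou_avg B \<mu> f \<longlongrightarrow> 0) at_infinity"
    using Lim_null_comparison[of "ou_avg B \<mu> f" "\<lambda>x. K * m (norm x)" at_infinity] by simp
  then show ?thesis
    using smooth_on_continuous[OF avg_smooth_ou[OF \<mu> f]] by (simp add: C0_def)
qed

lemma second_derivative_max:
  fixes \<psi> :: "real \<Rightarrow> real"
  assumes "\<And>t. (\<psi> has_real_derivative \<psi>' t) (at t)" "(\<psi>' has_real_derivative c) (at 0)" "\<And>t. \<psi> t \<le> \<psi> 0"
  shows "\<psi>' 0 = 0" "c \<le> 0"
proof -
  show 0: "\<psi>' 0 = 0" using DERIV_local_max[OF assms(1)[of 0], of 1] assms(3) by simp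
  show "c \<le> 0"
  proof (rule ccontr)
    assume "\<not> c \<le> 0"
    then obtain d where d: "0 < d" "\<And>h. 0 < h \<Longrightarrow> h < d \<Longrightarrow> \<psi>' 0 < \<psi>' (0 + h)"
      using DERIV_pos_inc_right[OF assms(2)] by force
    obtain z where z: "0 < z" "z < d / 2" "\<psi> (d / 2) - \<psi> 0 = (d / 2 - 0) * \<psi>' z"
      using MVT2[of 0 "d / 2" \<psi> \<psi>'] assms(1) d(1) by auto
    moreover have "0 < (d / 2 - 0) * \<psi>' z" using d(1) d(2)[of z] z 0 by simp
    ultimately have "0 < \<psi> (d / 2) - \<psi> 0" by linarith
    then show False using assms(3)[of "d / 2"] by simp
  qed
qed

text \<open>The maximum principle: rotate the values so that \<open>v\<close> is positive at a maximum point of \<open>|v|\<close>;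
  there the gradient of the real part vanishes and its second derivatives are nonpositive.\<close>
lemma OU_dissipative:
  fixes A B :: "real^'d^'d"
  assumes B: "B ** transpose B = A" and v: "v \<in> test_functions UNIV" and \<mu>: "0 < Re \<mu>"
    and K: "\<And>x. norm (OU_expr A v x + \<mu> * v x) \<le> K"
  shows "Re \<mu> * norm (v x) \<le> K"
proof (cases "\<forall>x. v x = 0")
  case True
  then show ?thesis using order_trans[OF norm_ge_zero K] by simp
next
  case False
  obtain C where C: "compact C" "\<And>x. x \<notin> C \<Longrightarrow> v x = 0" using v test_functions_iff by metis
  have "C \<noteq> {}" using C(2) False by auto
  moreover have "continuous_on C (\<lambda>x. norm (v x))"
    by (intro continuous_intros continuous_on_subset[OF test_functions_continuous[OF v]]) auto
  ultimately obtain x0 where x0: "x0 \<in> C" "\<And>x. x \<in> C \<Longrightarrow> norm (v x) \<le> norm (v x0)"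
    using continuous_attains_sup[OF C(1)] by blast
  have max: "norm (v x) \<le> norm (v x0)" for x using x0 C(2) by (cases "x \<in> C") auto
  then have nz: "v x0 \<noteq> 0" using False by (metis norm_le_zero_iff norm_zero)
  define c where "c = cnj (v x0) / of_real (norm (v x0))"
  have c1: "norm c = 1" using nz by (simp add: c_def norm_divide)
  have cv: "c * v x0 = of_real (norm (v x0))"
  proof -
    have "c * v x0 = (v x0 * cnj (v x0)) / of_real (norm (v x0))" by (simp add: c_def mult.commute)
    also have "\<dots> = of_real ((norm (v x0))\<^sup>2) / of_real (norm (v x0))" by (simp only: complex_norm_square[symmetric] of_real_power)
    also have "\<dots> = of_real (norm (v x0))" using nz by (simp add: power2_eq_square)
    finally show ?thesis .
  qed
  have line: "((\<lambda>t. Re (c * f (x0 + t *\<^sub>R w))) has_real_derivative Re (c * dir_deriv w f (x0 + t *\<^sub>R w))) (at t)"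
    if f: "f \<in> test_functions UNIV" for f w t
  proof -
    have "((\<lambda>t. x0 + t *\<^sub>R w) has_derivative (\<lambda>s. s *\<^sub>R w)) (at t)" by (auto intro!: derivative_eq_intros)
    from has_derivative_compose[OF this test_functions_has_derivative[OF f]]
    have "((\<lambda>t. f (x0 + t *\<^sub>R w)) has_derivative (\<lambda>s. s *\<^sub>R dir_deriv w f (x0 + t *\<^sub>R w))) (at t)"
      by (simp add: linear_cmul[OF has_derivative_linear[OF test_functions_has_derivative[OF f]]])
    from bounded_linear.has_derivative[OF bounded_linear_compose[OF bounded_linear_Re bounded_linear_mult_right] this, of c]
    have "((\<lambda>t. Re (c * f (x0 + t *\<^sub>R w))) has_derivative (\<lambda>s. Re (c * (s *\<^sub>R dir_deriv w f (x0 + t *\<^sub>R w))))) (at t)" .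
    then show ?thesis unfolding has_field_derivative_def
      by (rule has_derivative_eq_rhs) (simp add: fun_eq_iff algebra_simps)
  qed
  have "Re (c * v (x0 + t *\<^sub>R w)) \<le> Re (c * v (x0 + 0 *\<^sub>R w))" for t w
  proof -
    have "Re (c * v (x0 + t *\<^sub>R w)) \<le> norm (c * v (x0 + t *\<^sub>R w))" by (rule complex_Re_le_cmod)
    also have "\<dots> \<le> norm (v x0)" using max by (simp add: norm_mult c1)
    finally show ?thesis by (simp add: cv)
  qed
  note sd = second_derivative_max[OF line[OF v] line[OF test_functions_derivative[OF v], where t=0] this]
  have grad: "Re (c * dir_deriv w v x0) = 0" for w using sd(1)[of w] by simp
  have hess: "Re (c * dir_deriv w (dir_deriv w v) x0) \<le> 0" for w using sd(2)[of w] by simp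
  have "Re (c * second_order A v x0) \<le> 0"
    unfolding second_order_factor[OF B v] sum_distrib_left Re_sum by (intro sum_nonpos hess)
  moreover have "Re (c * (dir_deriv x0 v x0 / 2)) = 0"
    using grad[of x0] by (simp add: times_divide_eq_right[symmetric] del: times_divide_eq_right)
  moreover have "Re (c * (\<mu> * v x0)) = Re \<mu> * norm (v x0)"
    using cv by (simp add: mult.left_commute[of c])
  moreover have "c * (OU_expr A v x0 + \<mu> * v x0) = - (c * second_order A v x0) + c * (dir_deriv x0 v x0 / 2) + c * (\<mu> * v x0)"
    by (simp add: OU_expr_eq[OF test_functions_smooth[OF v]] algebra_simps)
  ultimately have "Re \<mu> * norm (v x0) \<le> Re (c * (OU_expr A v x0 + \<mu> * v x0))" by simp
  also have "\<dots> \<le> norm (c * (OU_expr A v x0 + \<mu> * v x0))" by (rule complex_Re_le_cmod)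
  also have "\<dots> \<le> K" using K by (simp add: norm_mult c1)
  finally have "Re \<mu> * norm (v x0) \<le> K" .
  moreover have "Re \<mu> * norm (v x) \<le> Re \<mu> * norm (v x0)" using max \<mu> by simp
  ultimately show ?thesis by linarith
qed

text \<open>The estimate \<open>OU_dissipative\<close> is applied to the differences of approximating test functions and survives the
  uniform limit.\<close>
lemma OU_graph_unique:
  fixes A B :: "real^'d^'d"
  assumes B: "B ** transpose B = A" and \<mu>: "0 < Re \<mu>"
    and g1: "OU_graph A u1 h1" and g2: "OU_graph A u2 h2"
    and eq: "\<And>x. h1 x + \<mu> * u1 x = h2 x + \<mu> * u2 x"
  shows "u1 = u2"
proof
  fix x
  obtain v1 where v1: "\<And>n. v1 n \<in> test_functions UNIV" "uniform_limit UNIV v1 u1 sequentially"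
      "uniform_limit UNIV (\<lambda>n. OU_expr A (v1 n)) h1 sequentially"
    using g1 unfolding OU_graph_def by blast
  obtain v2 where v2: "\<And>n. v2 n \<in> test_functions UNIV" "uniform_limit UNIV v2 u2 sequentially"
      "uniform_limit UNIV (\<lambda>n. OU_expr A (v2 n)) h2 sequentially"
    using g2 unfolding OU_graph_def by blast
  have "norm (u1 x - u2 x) \<le> 0 + e" if "0 < e" for e
  proof -
    define M where "M = 2 + (2 + 2 * norm \<mu>) / Re \<mu>"
    have M: "0 < M" using \<mu> by (simp add: M_def add_pos_nonneg)
    define d where "d = e / M"
    have d: "0 < d" using that M by (simp add: d_def)
    have "\<forall>\<^sub>F n in sequentially. (\<forall>x. dist (v1 n x) (u1 x) < d) \<and> (\<forall>x. dist (OU_expr A (v1 n) x) (h1 x) < d) \<and>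
        (\<forall>x. dist (v2 n x) (u2 x) < d) \<and> (\<forall>x. dist (OU_expr A (v2 n) x) (h2 x) < d)"
      using uniform_limitD[OF v1(2) d] uniform_limitD[OF v1(3) d] uniform_limitD[OF v2(2) d] uniform_limitD[OF v2(3) d]
      by eventually_elim auto
    then obtain n where n: "\<And>x. norm (v1 n x - u1 x) < d" "\<And>x. norm (OU_expr A (v1 n) x - h1 x) < d"
        "\<And>x. norm (v2 n x - u2 x) < d" "\<And>x. norm (OU_expr A (v2 n) x - h2 x) < d"
      by (auto simp: dist_norm dest!: eventually_happens)
    define w where "w = (\<lambda>x. v1 n x - v2 n x)"
    have wt: "w \<in> test_functions UNIV"
      using test_functions_add[OF v1(1)[of n] test_functions_cmult[OF v2(1)[of n], of "-1"]] by (simp add: w_def)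
    have "norm (OU_expr A w y + \<mu> * w y) \<le> (2 + 2 * norm \<mu>) * d" for y
    proof -
      have "OU_expr A w y + \<mu> * w y = ((OU_expr A (v1 n) y - h1 y) - (OU_expr A (v2 n) y - h2 y))
          + \<mu> * ((v1 n y - u1 y) - (v2 n y - u2 y))"
        using eq[of y] unfolding w_def OU_expr_diff[OF test_functions_smooth[OF v1(1)] test_functions_smooth[OF v2(1)]]
        by (simp add: algebra_simps)
      also have "norm \<dots> \<le> (d + d) + norm \<mu> * (d + d)"
        unfolding norm_mult using n[of y]
        by (intro norm_triangle_mono norm_triangle_le_diff mult_left_mono order_trans[OF norm_triangle_ineq4 add_mono] norm_mult[THEN eq_refl, THEN order_trans]) (auto intro: less_imp_le)
      finally show ?thesis by (simp add: algebra_simps)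
    qed
    from OU_dissipative[OF B wt \<mu> this, of x]
    have "norm (w x) \<le> (2 + 2 * norm \<mu>) / Re \<mu> * d" using \<mu> by (simp add: field_simps)
    moreover have d12: "u1 x - u2 x = w x - (v1 n x - u1 x) + (v2 n x - u2 x)" by (simp add: w_def)
    have "norm (u1 x - u2 x) \<le> norm (w x) + norm (v1 n x - u1 x) + norm (v2 n x - u2 x)"
      unfolding d12 using norm_triangle_ineq[of "w x - (v1 n x - u1 x)" "v2 n x - u2 x"] norm_triangle_ineq4[of "w x" "v1 n x - u1 x"]
      by linarith
    ultimately have "norm (u1 x - u2 x) \<le> (2 + 2 * norm \<mu>) / Re \<mu> * d + d + d"
      using n(1)[of x] n(3)[of x] by linarith
    also have "\<dots> = M * d" by (simp add: M_def algebra_simps)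
    also have "\<dots> = e" using M by (simp add: d_def)
    finally show ?thesis by simp
  qed
  then have "norm (u1 x - u2 x) \<le> 0" by (rule field_le_epsilon)
  then show "u1 x = u2 x" by simp
qed

text \<open>\<open>OU_graph_smooth\<close> applies because the resolvent equation expresses the differential operator on the average through
  the average itself and \<open>f\<close>, both of which vanish at infinity.\<close>
theorem OU_resolvent_eq_ou_avg:
  fixes A B :: "real^'d^'d"
  assumes B: "B ** transpose B = A" and \<mu>: "0 < Re \<mu>" and f: "f \<in> test_functions UNIV"
  shows "OU_resolvent A \<mu> f = ou_avg B \<mu> f"
proof -
  let ?u = "ou_avg B \<mu> f"
  have h: "OU_expr A ?u = (\<lambda>x. f x - \<mu> * ?u x)"
    using ou_avg_resolvent_equation[OF B f \<mu>] by (auto simp: fun_eq_iff algebra_simps)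
  have W: "integrable lborel (ou_weight \<mu> :: real \<times> (real^'d) \<Rightarrow> complex)" by (rule integrable_ou_weight[OF \<mu>])
  have m: "ou_contr \<in> borel_measurable lborel" "ou_shift B \<in> borel_measurable lborel" by auto
  have u0: "?u \<in> C0" by (rule ou_avg_C0[OF \<mu> f])
  obtain M where M: "\<And>x. norm (?u x) \<le> M" unfolding ou_avg_def using avg_bounded[OF W m f] by metis
  obtain K where K: "\<And>x. norm (f x) \<le> K" using test_functions_bounded[OF f] by metis
  obtain C where C: "compact C" "\<And>x. x \<notin> C \<Longrightarrow> f x = 0" using f test_functions_iff by metis
  obtain R where R: "\<And>x. x \<in> C \<Longrightarrow> norm x \<le> R" using compact_imp_bounded[OF C(1)] bounded_iff by metis
  have "\<forall>\<^sub>F x in at_infinity. f x = 0"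
    unfolding eventually_at_infinity using C(2) R by (intro exI[of _ "R + 1"]) force
  then have "(f \<longlongrightarrow> 0) at_infinity" by (rule tendsto_eventually)
  then have h0: "OU_expr A ?u \<in> C0"
    using u0 unfolding h C0_def
    by (auto intro!: continuous_intros test_functions_continuous[OF f] tendsto_eq_intros)
  have "\<exists>L. \<forall>x. norm (partial_deriv l ?u x) \<le> L" for l
    unfolding ou_avg_def partial_deriv_avg[OF W m f ou_contr_le_1]
    using avg_bounded[OF integrable_weight_mult[OF W m(1) ou_contr_le_1] m test_functions_partial_deriv[OF f]] by metis
  then obtain L' where L': "\<And>l x. norm (partial_deriv l ?u x) \<le> L' l" by metis
  have L: "norm (partial_deriv l ?u x) \<le> (\<Sum>l\<in>UNIV. \<bar>L' l\<bar>)" for l x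
    using L'[of l x] member_le_sum[of l UNIV "\<lambda>l. \<bar>L' l\<bar>"] by fastforce
  have H: "norm (OU_expr A ?u x) \<le> K + norm \<mu> * M" for x
    unfolding h by (intro order_trans[OF norm_triangle_ineq4] add_mono K) (simp add: norm_mult mult_left_mono M)
  have g: "OU_graph A ?u (OU_expr A ?u)"
    by (rule OU_graph_smooth[OF avg_smooth_ou[OF \<mu> f] u0 h0 M H L])
  show ?thesis unfolding OU_resolvent_def
  proof (rule the_equality)
    show "\<exists>h. OU_graph A ?u h \<and> (\<forall>x. h x + \<mu> * ?u x = f x)"
      using g h by (intro exI[of _ "OU_expr A ?u"]) auto
    fix u assume "\<exists>h. OU_graph A u h \<and> (\<forall>x. h x + \<mu> * u x = f x)"
    then obtain h' where h': "OU_graph A u h'" "\<forall>x. h' x + \<mu> * u x = f x" by blast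
    show "u = ?u" by (rule OU_graph_unique[OF B \<mu> h'(1) g]) (use h' h in auto)
  qed
qed

section \<open>The weight of a heat tuple\<close>

lemma pos_def_inv_coercive:
  fixes C :: "real^'d^'d"
  assumes "pos_def C"
  obtains \<kappa> where "0 < \<kappa>" "\<And>x. \<kappa> * (norm x)\<^sup>2 \<le> x \<bullet> (matrix_inv C *v x)"
proof -
  obtain B where B: "B ** transpose B = C" "det B \<noteq> 0" using pos_def_factor[OF assms] .
  define K where "K = onorm ((*v) B) + 1"
  have K: "0 < K" using onorm_pos_le[OF matrix_vector_mul_bounded_linear, of B] by (simp add: K_def)
  have "(1 / K\<^sup>2) * (norm x)\<^sup>2 \<le> x \<bullet> (matrix_inv C *v x)" for x
  proof -
    obtain S where S: "B ** S = mat 1" using B(2) by (metis invertible_def invertible_det_nz)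
    define u where "u = S *v x"
    have x: "x = B *v u" by (simp add: u_def matrix_vector_mul_assoc S)
    have "norm x \<le> onorm ((*v) B) * norm u" unfolding x by (rule onorm[OF matrix_vector_mul_bounded_linear])
    also have "\<dots> \<le> K * norm u" by (simp add: K_def distrib_right)
    finally have "(norm x)\<^sup>2 \<le> (K * norm u)\<^sup>2" by (rule power_mono) simp
    then have "(norm x)\<^sup>2 / K\<^sup>2 \<le> (norm u)\<^sup>2" using K by (simp add: power_mult_distrib field_simps)
    moreover have "x \<bullet> (matrix_inv C *v x) = (norm u)\<^sup>2"
      unfolding x factor_inv(1)[OF B] by (simp add: power2_norm_eq_inner)
    ultimately show ?thesis by simp
  qed
  then show ?thesis using that[of "1 / K\<^sup>2"] K by simp
qed

text \<open>Expanding the square in the Gaussian turns the weight into a Gaussian factor times a Laplace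
  transform of \<open>\<theta>\<close> damped by a Gaussian; polynomial moments appear as derivatives.\<close>
definition lap :: "(real^'d) measure \<Rightarrow> real^'d^'d \<Rightarrow> (real^'d \<Rightarrow> real) \<Rightarrow> real^'d \<Rightarrow> real" where
  "lap \<theta> M p w = (\<integral>y. p y * exp (w \<bullet> y - (y \<bullet> (M *v y)) / 2) \<partial>\<theta>)"

text \<open>A class of coefficients that contains the linear functions produced by differentiating \<open>lap\<close> and is closed
  under products.\<close>
definition exp_bounded :: "(real^'d \<Rightarrow> real) \<Rightarrow> bool" where
  "exp_bounded p \<longleftrightarrow> p \<in> borel_measurable borel \<and> (\<exists>C K. \<forall>y. \<bar>p y\<bar> \<le> C * exp (K * norm y))"

lemma exp_bounded_mult:
  assumes "exp_bounded p" "exp_bounded q"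
  shows "exp_bounded (\<lambda>y. p y * q y)"
proof -
  obtain C K where p: "p \<in> borel_measurable borel" "\<And>y. \<bar>p y\<bar> \<le> C * exp (K * norm y)"
    using assms(1) by (auto simp: exp_bounded_def)
  obtain C' K' where q: "q \<in> borel_measurable borel" "\<And>y. \<bar>q y\<bar> \<le> C' * exp (K' * norm y)"
    using assms(2) by (auto simp: exp_bounded_def)
  have "\<bar>p y * q y\<bar> \<le> (C * C') * exp ((K + K') * norm y)" for y
  proof -
    have "\<bar>p y * q y\<bar> \<le> (C * exp (K * norm y)) * (C' * exp (K' * norm y))"
      unfolding abs_mult by (intro mult_mono p q order_trans[OF abs_ge_zero p(2)]) auto
    then show ?thesis by (simp add: algebra_simps exp_add)
  qed
  then show ?thesis using p(1) q(1) unfolding exp_bounded_def by auto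
qed

lemma exp_bounded_inner: "exp_bounded (\<lambda>y. h \<bullet> y)"
proof -
  have "\<bar>h \<bullet> y\<bar> \<le> norm h * exp (1 * norm y)" for y
  proof -
    have "norm y \<le> exp (norm y)" using exp_ge_add_one_self[of "norm y"] by linarith
    then show ?thesis
      using Cauchy_Schwarz_ineq2[of h y] mult_left_mono[of "norm y" "exp (norm y)" "norm h"] by simp
  qed
  then show ?thesis unfolding exp_bounded_def
    by (intro conjI exI[of _ "norm h"] exI[of _ 1] allI) auto
qed

lemma exp_bounded_norm_exp: "exp_bounded (\<lambda>y. (norm y)\<^sup>2 * exp (norm y))"
proof -
  have "\<bar>(norm y)\<^sup>2 * exp (norm y)\<bar> \<le> 1 * exp (3 * norm y)" for y :: "real^'a"
  proof -
    have "norm y \<le> exp (norm y)" using exp_ge_add_one_self[of "norm y"] by linarith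
    then have "(norm y)\<^sup>2 \<le> (exp (norm y))\<^sup>2" by (rule power_mono) simp
    then have "(norm y)\<^sup>2 * exp (norm y) \<le> (exp (norm y))\<^sup>2 * exp (norm y)" by (rule mult_right_mono) simp
    also have "\<dots> = exp (3 * norm y)" by (simp add: power2_eq_square exp_add[symmetric])
    finally show ?thesis by simp
  qed
  then show ?thesis unfolding exp_bounded_def by (intro conjI exI[of _ 1] exI[of _ 3]) (auto intro!: borel_measurable_continuous_onI continuous_intros)
qed

text \<open>Completing the square, \<open>b r \<le> b\<^sup>2 / \<kappa> + \<kappa> r\<^sup>2 / 4\<close>, so that half of the Gaussian damping absorbs the
  exponential growth and the other half is integrable by hypothesis.\<close>
lemma lap_integrable:
  fixes M :: "real^'d^'d"
  assumes sets: "sets \<theta> = sets borel"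
    and fin: "\<forall>c>0. (\<integral>\<^sup>+z. ennreal (exp (- c * (norm z)\<^sup>2)) \<partial>\<theta>) < \<infinity>"
    and \<kappa>: "0 < \<kappa>" "\<And>x. \<kappa> * (norm x)\<^sup>2 \<le> x \<bullet> (M *v x)" and p: "exp_bounded p"
  shows "integrable \<theta> (\<lambda>y. p y * exp (w \<bullet> y - (y \<bullet> (M *v y)) / 2))"
proof -
  obtain C K where pC: "p \<in> borel_measurable borel" "\<And>y. \<bar>p y\<bar> \<le> C * exp (K * norm y)"
    using p by (auto simp: exp_bounded_def)
  note [measurable_cong] = sets
  note [measurable] = pC(1)
  let ?b = "K + norm w"
  have "integrable \<theta> (\<lambda>z. exp (- (\<kappa> / 4) * (norm z)\<^sup>2))"
  proof (rule integrableI_nonneg)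
    show "(\<integral>\<^sup>+ x. ennreal (exp (- (\<kappa> / 4) * (norm x)\<^sup>2)) \<partial>\<theta>) < \<infinity>" using fin[rule_format, of "\<kappa> / 4"] \<kappa>(1) by simp
  qed auto
  then have "integrable \<theta> (\<lambda>z. (C * exp (?b\<^sup>2 / \<kappa>)) * exp (- (\<kappa> / 4) * (norm z)\<^sup>2))" by (rule integrable_mult_right)
  then show ?thesis
  proof (rule Bochner_Integration.integrable_bound)
    have "\<bar>p y * exp (w \<bullet> y - (y \<bullet> (M *v y)) / 2)\<bar> \<le> (C * exp (?b\<^sup>2 / \<kappa>)) * exp (- (\<kappa> / 4) * (norm y)\<^sup>2)" for y
    proof -
      have "0 \<le> (\<kappa> * norm y / 2 - ?b)\<^sup>2" by simp
      then have "?b * norm y * \<kappa> \<le> ?b\<^sup>2 + (\<kappa> * norm y)\<^sup>2 / 4"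
        by (simp add: power2_diff power_divide algebra_simps)
      then have am: "?b * norm y \<le> ?b\<^sup>2 / \<kappa> + \<kappa> / 4 * (norm y)\<^sup>2"
        using \<kappa>(1) by (simp add: field_simps power2_eq_square)
      have "w \<bullet> y \<le> norm w * norm y" using norm_cauchy_schwarz by blast
      then have "K * norm y + (w \<bullet> y - (y \<bullet> (M *v y)) / 2) \<le> ?b\<^sup>2 / \<kappa> + - (\<kappa> / 4) * (norm y)\<^sup>2"
        using am \<kappa>(2)[of y] by (simp add: algebra_simps)
      then have e: "exp (K * norm y) * exp (w \<bullet> y - (y \<bullet> (M *v y)) / 2) \<le> exp (?b\<^sup>2 / \<kappa>) * exp (- (\<kappa> / 4) * (norm y)\<^sup>2)"
        by (simp add: exp_add[symmetric])
      have "0 \<le> C * exp (K * norm y)" using order_trans[OF abs_ge_zero pC(2)] .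
      then have C: "0 \<le> C" by (simp add: zero_le_mult_iff)
      have "\<bar>p y * exp (w \<bullet> y - (y \<bullet> (M *v y)) / 2)\<bar> \<le> C * exp (K * norm y) * exp (w \<bullet> y - (y \<bullet> (M *v y)) / 2)"
        using pC(2) by (simp add: abs_mult mult_right_mono)
      also have "\<dots> \<le> C * (exp (?b\<^sup>2 / \<kappa>) * exp (- (\<kappa> / 4) * (norm y)\<^sup>2))"
        unfolding mult.assoc by (rule mult_left_mono[OF e C])
      finally show ?thesis by (simp add: mult.assoc)
    qed
    then show "AE y in \<theta>. norm (p y * exp (w \<bullet> y - (y \<bullet> (M *v y)) / 2)) \<le> norm ((C * exp (?b\<^sup>2 / \<kappa>)) * exp (- (\<kappa> / 4) * (norm y)\<^sup>2))"
      by (intro AE_I2) (simp only: real_norm_def order_trans[OF _ abs_ge_self])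
  qed measurable
qed

lemma abs_exp_taylor: "\<bar>exp t - 1 - t\<bar> \<le> t\<^sup>2 * exp \<bar>t :: real\<bar>"
proof -
  obtain s where s: "\<bar>s\<bar> \<le> \<bar>t\<bar>" "exp t = (\<Sum>m<2. t ^ m / fact m) + exp s / fact 2 * t ^ 2"
    using Maclaurin_exp_le by blast
  then have "exp t - 1 - t = exp s / 2 * t\<^sup>2" by (simp add: numeral_2_eq_2)
  moreover have "exp s \<le> exp \<bar>t\<bar>" using s(1) by simp
  then have "exp s / 2 \<le> exp \<bar>t\<bar>" using exp_gt_zero[of s] by linarith
  then have "exp s / 2 * t\<^sup>2 \<le> exp \<bar>t\<bar> * t\<^sup>2" by (rule mult_right_mono) simp
  moreover have "0 \<le> exp s / 2 * t\<^sup>2" by simp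
  ultimately show ?thesis by (simp only: abs_of_nonneg mult.commute[of "t\<^sup>2"])
qed

lemma lap_has_derivative:
  fixes M :: "real^'d^'d"
  assumes sets: "sets \<theta> = sets borel"
    and fin: "\<forall>c>0. (\<integral>\<^sup>+z. ennreal (exp (- c * (norm z)\<^sup>2)) \<partial>\<theta>) < \<infinity>"
    and \<kappa>: "0 < \<kappa>" "\<And>x. \<kappa> * (norm x)\<^sup>2 \<le> x \<bullet> (M *v x)" and p: "exp_bounded p"
  shows "(lap \<theta> M p has_derivative (\<lambda>h. lap \<theta> M (\<lambda>y. (h \<bullet> y) * p y) w)) (at w)"
proof -
  note int = lap_integrable[OF sets fin \<kappa>]
  have ph: "exp_bounded (\<lambda>y. (h \<bullet> y) * p y)" for h by (rule exp_bounded_mult[OF exp_bounded_inner p])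
  have absp: "exp_bounded (\<lambda>y. \<bar>p y\<bar>)" using p by (auto simp: exp_bounded_def)
  let ?q = "\<lambda>y. ((norm y)\<^sup>2 * exp (norm y)) * \<bar>p y\<bar>"
  have q: "exp_bounded ?q" by (rule exp_bounded_mult[OF exp_bounded_norm_exp absp])
  have bl: "bounded_linear (\<lambda>h. lap \<theta> M (\<lambda>y. (h \<bullet> y) * p y) w)"
  proof (subst linear_conv_bounded_linear[symmetric], rule linearI)
    show "lap \<theta> M (\<lambda>y. ((h1 + h2) \<bullet> y) * p y) w = lap \<theta> M (\<lambda>y. (h1 \<bullet> y) * p y) w + lap \<theta> M (\<lambda>y. (h2 \<bullet> y) * p y) w" for h1 h2
      unfolding lap_def
      by (subst Bochner_Integration.integral_add[OF int[OF ph] int[OF ph], symmetric])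
         (simp add: inner_add_left algebra_simps)
    show "lap \<theta> M (\<lambda>y. ((c *\<^sub>R h) \<bullet> y) * p y) w = c *\<^sub>R lap \<theta> M (\<lambda>y. (h \<bullet> y) * p y) w" for c h
      unfolding lap_def by (simp add: mult.assoc)
  qed
  have rem: "\<bar>lap \<theta> M p (w + h) - lap \<theta> M p w - lap \<theta> M (\<lambda>y. (h \<bullet> y) * p y) w\<bar> \<le> (norm h)\<^sup>2 * lap \<theta> M ?q w"
    if h: "norm h \<le> 1" for h
  proof -
    let ?e = "\<lambda>w y. exp (w \<bullet> y - (y \<bullet> (M *v y)) / 2)"
    have "\<bar>lap \<theta> M p (w + h) - lap \<theta> M p w - lap \<theta> M (\<lambda>y. (h \<bullet> y) * p y) w\<bar>
        = norm (\<integral>y. p y * ?e (w + h) y - p y * ?e w y - ((h \<bullet> y) * p y) * ?e w y \<partial>\<theta>)"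
      unfolding lap_def using int[OF p] int[OF ph] by simp
    also have "\<dots> \<le> (\<integral>y. (norm h)\<^sup>2 * (?q y * ?e w y) \<partial>\<theta>)"
    proof (rule order_trans[OF integral_norm_bound integral_mono])
      show "integrable \<theta> (\<lambda>y. norm (p y * ?e (w + h) y - p y * ?e w y - ((h \<bullet> y) * p y) * ?e w y))"
        by (intro integrable_norm Bochner_Integration.integrable_diff int[OF p] int[OF ph])
      show "integrable \<theta> (\<lambda>y. (norm h)\<^sup>2 * (?q y * ?e w y))" using int[OF q] by (rule integrable_mult_right)
      fix y
      have "?e (w + h) y = ?e w y * exp (h \<bullet> y)" by (simp add: exp_add[symmetric] inner_add_left)
      then have "p y * ?e (w + h) y - p y * ?e w y - ((h \<bullet> y) * p y) * ?e w y = p y * ?e w y * (exp (h \<bullet> y) - 1 - h \<bullet> y)"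
        by (simp add: algebra_simps)
      then have "norm (p y * ?e (w + h) y - p y * ?e w y - ((h \<bullet> y) * p y) * ?e w y) = \<bar>p y\<bar> * ?e w y * \<bar>exp (h \<bullet> y) - 1 - h \<bullet> y\<bar>"
        by (simp add: abs_mult)
      also have "\<dots> \<le> \<bar>p y\<bar> * ?e w y * ((norm h)\<^sup>2 * ((norm y)\<^sup>2 * exp (norm y)))"
      proof (rule mult_left_mono)
        have cs: "\<bar>h \<bullet> y\<bar> \<le> norm h * norm y" by (rule Cauchy_Schwarz_ineq2)
        then have "(h \<bullet> y)\<^sup>2 \<le> (norm h * norm y)\<^sup>2" using abs_le_square_iff by fastforce
        moreover have "\<bar>h \<bullet> y\<bar> \<le> norm y" using cs h mult_left_le_one_le[of "norm y" "norm h"] by simp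
        ultimately have "(h \<bullet> y)\<^sup>2 * exp \<bar>h \<bullet> y\<bar> \<le> (norm h * norm y)\<^sup>2 * exp (norm y)"
          by (intro mult_mono) auto
        then show "\<bar>exp (h \<bullet> y) - 1 - h \<bullet> y\<bar> \<le> (norm h)\<^sup>2 * ((norm y)\<^sup>2 * exp (norm y))"
          using abs_exp_taylor[of "h \<bullet> y"] by (simp add: power_mult_distrib)
      qed simp
      finally show "norm (p y * ?e (w + h) y - p y * ?e w y - ((h \<bullet> y) * p y) * ?e w y) \<le> (norm h)\<^sup>2 * (?q y * ?e w y)"
        by (simp add: mult_ac)
    qed
    finally show ?thesis by (simp add: lap_def)
  qed
  show ?thesis
  proof (rule has_derivativeI_sandwich[where e=1 and H="\<lambda>y. norm (y - w) * lap \<theta> M ?q w"])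
    show "((\<lambda>y. norm (y - w) * lap \<theta> M ?q w) \<longlongrightarrow> 0) (at w)" by (auto intro!: tendsto_eq_intros)
    fix y assume "y \<noteq> w" "dist y w < 1"
    then show "norm (lap \<theta> M p y - lap \<theta> M p w - lap \<theta> M (\<lambda>x. ((y - w) \<bullet> x) * p x) w) / norm (y - w) \<le> norm (y - w) * lap \<theta> M ?q w"
      using rem[of "y - w"] by (simp add: divide_simps power2_eq_square mult_ac dist_norm)
  qed (use bl in auto)
qed

lemma lap_smooth:
  fixes M :: "real^'d^'d"
  assumes "sets \<theta> = sets borel"
    and "\<forall>c>0. (\<integral>\<^sup>+z. ennreal (exp (- c * (norm z)\<^sup>2)) \<partial>\<theta>) < \<infinity>"
    and "0 < \<kappa>" "\<And>x. \<kappa> * (norm x)\<^sup>2 \<le> x \<bullet> (M *v x)" and "exp_bounded p"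
  shows "smooth_on UNIV (lap \<theta> M p)"
proof (rule smooth_on_coinduct[where P="\<lambda>f. \<exists>p. exp_bounded p \<and> f = lap \<theta> M p"])
  fix f assume "\<exists>p. exp_bounded p \<and> f = lap \<theta> M p"
  then obtain p where p: "exp_bounded p" "f = lap \<theta> M p" by blast
  show "\<exists>f'. (\<forall>x\<in>UNIV. (f has_derivative f' x) (at x)) \<and> (\<forall>v. \<exists>p. exp_bounded p \<and> (\<lambda>x. f' x v) = lap \<theta> M p)"
  proof (intro exI[of _ "\<lambda>w h. lap \<theta> M (\<lambda>y. (h \<bullet> y) * p y) w"] conjI ballI allI)
    show "(f has_derivative (\<lambda>h. lap \<theta> M (\<lambda>y. (h \<bullet> y) * p y) w)) (at w)" for w
      unfolding p(2) by (rule lap_has_derivative[OF assms(1-4) p(1)])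
    show "\<exists>q. exp_bounded q \<and> (\<lambda>w. lap \<theta> M (\<lambda>y. (h \<bullet> y) * p y) w) = lap \<theta> M q" for h
      using exp_bounded_mult[OF exp_bounded_inner p(1)] by blast
  qed
qed (use assms in auto)

lemma heat_F_eq_lap:
  fixes a :: "real^'d^'d"
  assumes "transpose (matrix_inv a) = matrix_inv a"
  shows "heat_F \<theta> a 1 z = exp (- (z \<bullet> (matrix_inv a *v z)) / 2) / sqrt ((2 * pi) ^ CARD('d) * det a)
    * lap \<theta> (matrix_inv a) (\<lambda>_. 1) (matrix_inv a *v z)"
proof -
  let ?M = "matrix_inv a"
  let ?c = "sqrt ((2 * pi) ^ CARD('d) * det a)"
  have "gaussian a (z - y) = exp (- (z \<bullet> (?M *v z)) / 2) / ?c * (1 * exp ((?M *v z) \<bullet> y - (y \<bullet> (?M *v y)) / 2))" for y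
  proof -
    have "z \<bullet> (?M *v y) = (?M *v z) \<bullet> y" using inner_matrix_vector[of z ?M y] assms by simp
    then have "- ((z - y) \<bullet> (?M *v (z - y))) / 2 = - (z \<bullet> (?M *v z)) / 2 + ((?M *v z) \<bullet> y - (y \<bullet> (?M *v y)) / 2)"
      by (simp add: matrix_vector_mult_diff_distrib inner_diff_left inner_diff_right inner_commute[of y] field_simps)
    then show ?thesis unfolding gaussian_def by (simp only: exp_add) simp
  qed
  then show ?thesis unfolding heat_F_def lap_def by simp
qed

lemma heat_F_smooth_pos:
  fixes a :: "real^'d^'d"
  assumes "heat_tuple \<theta> a A q"
  shows "smooth_on UNIV (heat_F \<theta> a 1)" "0 < heat_F \<theta> a 1 z"
proof -
  have a: "pos_def a" and sets: "sets \<theta> = sets borel" and ne: "emeasure \<theta> UNIV \<noteq> 0"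
    and fin: "\<forall>c>0. (\<integral>\<^sup>+z. ennreal (exp (- c * (norm z)\<^sup>2)) \<partial>\<theta>) < \<infinity>"
    using assms unfolding heat_tuple_def radon_measure_def by blast+
  obtain \<kappa> where \<kappa>: "0 < \<kappa>" "\<And>x. \<kappa> * (norm x)\<^sup>2 \<le> x \<bullet> (matrix_inv a *v x)"
    using pos_def_inv_coercive[OF a] by blast
  obtain B where B: "B ** transpose B = a" "det B \<noteq> 0" using pos_def_factor[OF a] .
  let ?M = "matrix_inv a"
  have sym: "transpose ?M = ?M" by (rule factor_inv(2)[OF B])
  have one: "exp_bounded (\<lambda>_::real^'d. 1)" unfolding exp_bounded_def by (intro conjI exI[of _ 1] exI[of _ 0] allI) auto
  define c where "c = sqrt ((2 * pi) ^ CARD('d) * det a)"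
  have "0 < det a" using B(2) by (simp add: factor_inv(4)[OF B])
  then have c: "0 < c" unfolding c_def by (intro real_sqrt_gt_zero mult_pos_pos) auto
  have lin: "smooth_on UNIV ((*v) ?M)" by (rule smooth_on_linear[OF matrix_vector_mul_bounded_linear]) simp
  have "smooth_on UNIV (\<lambda>z. (1 / c) * exp ((- 1 / 2) * (z \<bullet> (?M *v z))) * lap \<theta> ?M (\<lambda>_. 1) (?M *v z))"
    by (intro smooth_on_mult smooth_on_exp smooth_on_inner lin
        smooth_on_compose[OF lap_smooth[OF sets fin \<kappa> one]]) auto
  moreover have "(1 / c) * exp ((- 1 / 2) * (z \<bullet> (?M *v z))) * lap \<theta> ?M (\<lambda>_. 1) (?M *v z) = heat_F \<theta> a 1 z" for z
    using heat_F_eq_lap[OF sym, of \<theta> z] by (simp add: c_def)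
  ultimately show "smooth_on UNIV (heat_F \<theta> a 1)" by simp
  have "0 < lap \<theta> ?M (\<lambda>_. 1) w" for w
  proof -
    let ?f = "\<lambda>y. 1 * exp (w \<bullet> y - (y \<bullet> (?M *v y)) / 2)"
    have i: "integrable \<theta> ?f" by (rule lap_integrable[OF sets fin \<kappa> one])
    have "integral\<^sup>L \<theta> ?f \<noteq> 0"
    proof
      assume "integral\<^sup>L \<theta> ?f = 0"
      then have "AE y in \<theta>. ?f y = 0" using integral_nonneg_eq_0_iff_AE[OF i] by simp
      then have "AE y in \<theta>. False" by simp
      then have "emeasure \<theta> (space \<theta>) = 0" by (simp add: eventually_False ae_filter_eq_bot_iff)
      then show False using ne sets_eq_imp_space_eq[OF sets] by simp
    qed
    moreover have "0 \<le> integral\<^sup>L \<theta> ?f" by (rule integral_nonneg_AE) simp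
    ultimately show ?thesis unfolding lap_def by linarith
  qed
  then show "0 < heat_F \<theta> a 1 z" using heat_F_eq_lap[OF sym, of \<theta> z] c by (simp add: c_def)
qed

lemma gaussian_scale:
  fixes a :: "real^'d^'d"
  assumes "a ** matrix_inv a = mat 1" "0 < t"
  shows "gaussian (t *\<^sub>R a) x = t powr (- real CARD('d) / 2) * gaussian a (t powr (- 1 / 2) *\<^sub>R x)"
proof -
  have tt: "t powr (- 1 / 2) * t powr (- 1 / 2) = 1 / t"
    using assms(2) by (simp add: powr_add[symmetric] powr_minus_divide)
  have "x \<bullet> (matrix_inv (t *\<^sub>R a) *v x) = (t powr (- 1 / 2) *\<^sub>R x) \<bullet> (matrix_inv a *v (t powr (- 1 / 2) *\<^sub>R x))"
    using assms(2) tt by (simp add: matrix_inv_scaleR[OF assms(1)] matrix_vector_mult_scaleR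
        scaleR_matrix_vector_assoc[symmetric] mult.assoc[symmetric] del: times_divide_eq_left times_divide_eq_right)
  moreover have "sqrt ((2 * pi) ^ CARD('d) * det (t *\<^sub>R a)) = t powr (real CARD('d) / 2) * sqrt ((2 * pi) ^ CARD('d) * det a)"
  proof -
    have "sqrt (t ^ CARD('d)) = t powr (real CARD('d) / 2)"
      using assms(2) by (simp add: powr_half_sqrt[symmetric] powr_realpow[symmetric] powr_powr)
    then show ?thesis by (simp add: det_scaleR_matrix real_sqrt_mult)
  qed
  ultimately show ?thesis unfolding gaussian_def by (simp add: powr_minus_divide)
qed

text \<open>The substitution \<open>y = \<surd>t y'\<close> contributes \<open>t powr (k / 2)\<close> by homogeneity of \<open>\<theta>\<close>, and the normalisation of the
  Gaussian contributes \<open>t powr (- d / 2)\<close>.\<close>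
lemma heat_F_scale:
  fixes a :: "real^'d^'d"
  assumes a: "a ** matrix_inv a = mat 1" and sets: "sets \<theta> = sets borel" and t: "0 < t"
    and hom: "\<And>r E. 0 < r \<Longrightarrow> E \<in> sets borel \<Longrightarrow>
           emeasure \<theta> ((\<lambda>x. r *\<^sub>R x) ` E) = ennreal (r powr k) * emeasure \<theta> E"
  shows "heat_F \<theta> a t z = t powr ((k - real CARD('d)) / 2) * heat_F \<theta> a 1 (t powr (- 1 / 2) *\<^sub>R z)"
proof -
  note [measurable_cong] = sets
  define r where "r = t powr (1 / 2)"
  have r: "0 < r" using t by (simp add: r_def)
  have ri: "t powr (- 1 / 2) = 1 / r" by (simp add: r_def powr_minus_divide)
  have "distr \<theta> borel (\<lambda>y. (1 / r) *\<^sub>R y) = density \<theta> (\<lambda>_. ennreal (r powr k))"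
  proof (rule measure_eqI)
    fix E assume "E \<in> sets (distr \<theta> borel (\<lambda>y. (1 / r) *\<^sub>R y))"
    then have E: "E \<in> sets borel" by simp
    have sp: "space \<theta> = UNIV" using sets_eq_imp_space_eq[OF sets] by simp
    have "(\<lambda>y. (1 / r) *\<^sub>R y) -` E = (\<lambda>x. r *\<^sub>R x) ` E"
    proof (rule set_eqI)
      fix x
      show "x \<in> (\<lambda>y. (1 / r) *\<^sub>R y) -` E \<longleftrightarrow> x \<in> (\<lambda>x. r *\<^sub>R x) ` E"
        using r by (auto simp: image_iff intro!: bexI[of _ "(1 / r) *\<^sub>R x"])
    qed
    then have "emeasure (distr \<theta> borel (\<lambda>y. (1 / r) *\<^sub>R y)) E = emeasure \<theta> ((\<lambda>x. r *\<^sub>R x) ` E)"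
      using E by (subst emeasure_distr) (auto simp: sp)
    also have "\<dots> = emeasure (density \<theta> (\<lambda>_. ennreal (r powr k))) E"
      using E by (simp add: hom[OF r] emeasure_density_const sets)
    finally show "emeasure (distr \<theta> borel (\<lambda>y. (1 / r) *\<^sub>R y)) E = emeasure (density \<theta> (\<lambda>_. ennreal (r powr k))) E" .
  qed (simp add: sets)
  then have "(\<integral>y. gaussian a ((1 / r) *\<^sub>R z - y) \<partial>(distr \<theta> borel (\<lambda>y. (1 / r) *\<^sub>R y))) =
      (\<integral>y. gaussian a ((1 / r) *\<^sub>R z - y) \<partial>(density \<theta> (\<lambda>_. ennreal (r powr k))))"
    by (rule arg_cong)
  then have "(\<integral>y. gaussian a ((1 / r) *\<^sub>R z - (1 / r) *\<^sub>R y) \<partial>\<theta>) = (\<integral>y. gaussian a ((1 / r) *\<^sub>R z - y) \<partial>(density \<theta> (\<lambda>_. ennreal (r powr k))))"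
    by (subst (asm) integral_distr) auto
  also have "\<dots> = r powr k * (\<integral>y. gaussian a ((1 / r) *\<^sub>R z - y) \<partial>\<theta>)"
    by (subst integral_density) auto
  finally have e: "(\<integral>y. gaussian a ((1 / r) *\<^sub>R (z - y)) \<partial>\<theta>) = r powr k * heat_F \<theta> a 1 ((1 / r) *\<^sub>R z)"
    by (simp add: heat_F_def scaleR_diff_right)
  have "heat_F \<theta> a t z = t powr (- real CARD('d) / 2) * (r powr k * heat_F \<theta> a 1 ((1 / r) *\<^sub>R z))"
    unfolding heat_F_def[of _ _ t] gaussian_scale[OF a t] ri by (simp only: integral_mult_right_zero e)
  also have "r powr k = t powr (k / 2)" using t by (simp add: r_def powr_powr)
  finally show ?thesis
    unfolding ri by (simp add: powr_add[symmetric] diff_divide_distrib mult.assoc[symmetric])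
qed

section \<open>Self-similar coordinates\<close>

text \<open>On the intervals \<open>{- n..n}\<close> this is substitution for a strictly increasing function; monotone convergence does the
  rest.\<close>
lemma exp_image_measure:
  "distr (density lborel (\<lambda>\<rho>. ennreal (exp \<rho>))) borel exp = density lborel (indicator {0<..} :: real \<Rightarrow> ennreal)"
proof (rule measure_eqI)
  fix E assume "E \<in> sets (distr (density lborel (\<lambda>\<rho>. ennreal (exp \<rho>))) borel (exp :: real \<Rightarrow> real))"
  then have E[measurable]: "E \<in> sets borel" by simp
  let ?I = "\<lambda>n::nat. {- real n..real n}" and ?J = "\<lambda>n::nat. {exp (- real n)..exp (real n)}"
  have sub: "(\<integral>\<^sup>+t. ennreal (indicator E t) * indicator (?J n) t \<partial>lborel)
      = (\<integral>\<^sup>+\<rho>. ennreal (indicator E (exp \<rho>) * exp \<rho>) * indicator (?I n) \<rho> \<partial>lborel)" for n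
  proof -
    have "(\<integral>\<^sup>+t. ennreal (indicator E t * indicator (?J n) t) \<partial>lborel)
      = (\<integral>\<^sup>+\<rho>. ennreal (indicator E (exp \<rho>) * exp \<rho> * indicator (?I n) \<rho>) \<partial>lborel)"
    by (rule nn_integral_substitution[where g=exp and g'=exp and f="indicator E" and a="- real n" and b="real n"]) (auto intro!: DERIV_exp continuous_intros simp: set_borel_measurable_def)
    moreover have "ennreal (indicator E t * indicator (?J n) t) = ennreal (indicator E t) * indicator (?J n) t"
      "ennreal (indicator E (exp \<rho>) * exp \<rho> * indicator (?I n) \<rho>) = ennreal (indicator E (exp \<rho>) * exp \<rho>) * indicator (?I n) \<rho>" for t \<rho> :: real
      by (auto simp: indicator_def)
    ultimately show ?thesis by simp
  qed
  have "(\<lambda>n. \<integral>\<^sup>+t. ennreal (indicator E t) * indicator (?J n) t \<partial>lborel) \<longlonglongrightarrow>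
      (\<integral>\<^sup>+t. ennreal (indicator E t) * indicator {0<..} t \<partial>lborel)"
  proof (rule nn_integral_LIMSEQ)
    show "incseq (\<lambda>n t. ennreal (indicator E t) * indicator (?J n) t)"
    proof (rule incseq_SucI, rule le_funI)
      fix n and t :: real
      have "?J n \<subseteq> ?J (Suc n)" by (intro atLeastatMost_subset_iff[THEN iffD2]) simp
      then show "ennreal (indicator E t) * indicator (?J n) t \<le> ennreal (indicator E t) * indicator (?J (Suc n)) t"
        by (intro mult_left_mono indicator_leI) (erule subsetD, assumption, rule zero_le)
    qed
    show "(\<lambda>n. ennreal (indicator E t) * indicator (?J n) t) \<longlonglongrightarrow> ennreal (indicator E t) * indicator {0<..} t" for t
    proof (cases "0 < t")
      case True
      obtain N where N: "\<bar>ln t\<bar> \<le> real N" using real_arch_simple by blast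
      have "\<forall>\<^sub>F n in sequentially. ennreal (indicator E t) * indicator (?J n) t = ennreal (indicator E t) * indicator {0<..} t"
      proof (rule eventually_sequentiallyI[of N])
        fix n assume "N \<le> n"
        then have "- real n \<le> ln t" "ln t \<le> real n" using N by linarith+
        then have "t \<in> ?J n" using True by (metis atLeastAtMost_iff exp_le_cancel_iff exp_ln)
        then show "ennreal (indicator E t) * indicator (?J n) t = ennreal (indicator E t) * indicator {0<..} t"
          using True by simp
      qed
      then show ?thesis by (rule tendsto_eventually)
    next
      case False
      then have "t \<notin> ?J n" for n by (meson atLeastAtMost_iff exp_gt_zero less_le_trans)
      then show ?thesis using False by simp
    qed
  qed measurable
  moreover have "(\<lambda>n. \<integral>\<^sup>+\<rho>. ennreal (indicator E (exp \<rho>) * exp \<rho>) * indicator (?I n) \<rho> \<partial>lborel) \<longlonglongrightarrow>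
      (\<integral>\<^sup>+\<rho>. ennreal (indicator E (exp \<rho>) * exp \<rho>) \<partial>lborel)"
  proof (rule nn_integral_LIMSEQ)
    show "incseq (\<lambda>n \<rho>. ennreal (indicator E (exp \<rho>) * exp \<rho>) * indicator (?I n) \<rho>)"
      by (auto simp: incseq_def le_fun_def indicator_def)
    show "(\<lambda>n. ennreal (indicator E (exp \<rho>) * exp \<rho>) * indicator (?I n) \<rho>) \<longlonglongrightarrow> ennreal (indicator E (exp \<rho>) * exp \<rho>)" for \<rho> :: real
    proof -
      obtain N where N: "\<bar>\<rho>\<bar> \<le> real N" using real_arch_simple by blast
      have "\<forall>\<^sub>F n in sequentially. ennreal (indicator E (exp \<rho>) * exp \<rho>) * indicator (?I n) \<rho> = ennreal (indicator E (exp \<rho>) * exp \<rho>)"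
      proof (rule eventually_sequentiallyI[of N])
        fix n assume "N \<le> n"
        then have "real N \<le> real n" by simp
        then have "- real n \<le> \<rho>" "\<rho> \<le> real n" using N by linarith+
        then show "ennreal (indicator E (exp \<rho>) * exp \<rho>) * indicator (?I n) \<rho> = ennreal (indicator E (exp \<rho>) * exp \<rho>)"
          by simp
      qed
      then show ?thesis by (rule tendsto_eventually)
    qed
  qed measurable
  ultimately have "(\<integral>\<^sup>+t. ennreal (indicator E t) * indicator {0<..} t \<partial>lborel) = (\<integral>\<^sup>+\<rho>. ennreal (indicator E (exp \<rho>) * exp \<rho>) \<partial>lborel)"
    unfolding sub by (rule LIMSEQ_unique)
  moreover have "emeasure (distr (density lborel (\<lambda>\<rho>. ennreal (exp \<rho>))) borel exp) E = (\<integral>\<^sup>+\<rho>. ennreal (indicator E (exp \<rho>) * exp \<rho>) \<partial>lborel)"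
  proof -
    have "exp -` E \<in> sets borel" by (rule measurable_sets_borel[of _ borel]) auto
    then have "emeasure (density lborel (\<lambda>\<rho>. ennreal (exp \<rho>))) (exp -` E) = (\<integral>\<^sup>+\<rho>. ennreal (exp \<rho>) * indicator (exp -` E) \<rho> \<partial>lborel)"
      by (intro emeasure_density) auto
    also have "\<dots> = (\<integral>\<^sup>+\<rho>. ennreal (indicator E (exp \<rho>) * exp \<rho>) \<partial>lborel)"
      by (intro nn_integral_cong) (auto simp: indicator_def)
    finally show ?thesis by (subst emeasure_distr) auto
  qed
  moreover have "emeasure (density lborel (indicator {0<..})) E = (\<integral>\<^sup>+t. ennreal (indicator E t) * indicator {0<..} t \<partial>lborel)"
    by (subst emeasure_density) (auto simp: indicator_def intro!: nn_integral_cong)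
  ultimately show "emeasure (distr (density lborel (\<lambda>\<rho>. ennreal (exp \<rho>))) borel exp) E = emeasure (density lborel (indicator {0<..})) E"
    by simp
qed simp

lemma nn_integral_exp_subst:
  assumes [measurable]: "f \<in> borel_measurable borel"
  shows "(\<integral>\<^sup>+t. f t * indicator {0<..} t \<partial>lborel) = (\<integral>\<^sup>+\<rho>. ennreal (exp \<rho>) * f (exp \<rho>) \<partial>lborel)"
proof -
  have "(\<integral>\<^sup>+t. f t * indicator {0<..} t \<partial>lborel) = (\<integral>\<^sup>+t. f t \<partial>density lborel (indicator {0<..}))"
    by (subst nn_integral_density) (auto simp: mult.commute)
  also have "\<dots> = (\<integral>\<^sup>+\<rho>. ennreal (exp \<rho>) * f (exp \<rho>) \<partial>lborel)"
    unfolding exp_image_measure[symmetric] by (simp add: nn_integral_distr nn_integral_density)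
  finally show ?thesis .
qed

lemma integral_exp_subst:
  fixes f :: "real \<Rightarrow> 'b::{banach, second_countable_topology}"
  assumes [measurable]: "f \<in> borel_measurable borel"
  shows "(\<integral>t. indicator {0<..} t *\<^sub>R f t \<partial>lborel) = (\<integral>\<rho>. exp \<rho> *\<^sub>R f (exp \<rho>) \<partial>lborel)"
    and "integrable lborel (\<lambda>\<rho>. exp \<rho> *\<^sub>R f (exp \<rho>)) \<Longrightarrow> integrable lborel (\<lambda>t. indicator {0<..} t *\<^sub>R f t)"
proof -
  have e: "density lborel (\<lambda>t. ennreal (indicator {0<..} t)) = distr (density lborel (\<lambda>\<rho>. ennreal (exp \<rho>))) borel exp"
    unfolding exp_image_measure by (simp add: ennreal_indicator)
  have "(\<integral>t. indicator {0<..} t *\<^sub>R f t \<partial>lborel) = (\<integral>t. f t \<partial>density lborel (\<lambda>t. ennreal (indicator {0<..} t)))"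
    by (subst integral_density) auto
  also have "\<dots> = (\<integral>\<rho>. exp \<rho> *\<^sub>R f (exp \<rho>) \<partial>lborel)"
    unfolding e by (simp add: integral_distr integral_density)
  finally show "(\<integral>t. indicator {0<..} t *\<^sub>R f t \<partial>lborel) = (\<integral>\<rho>. exp \<rho> *\<^sub>R f (exp \<rho>) \<partial>lborel)" .
  assume "integrable lborel (\<lambda>\<rho>. exp \<rho> *\<^sub>R f (exp \<rho>))"
  then have "integrable (distr (density lborel (\<lambda>\<rho>. ennreal (exp \<rho>))) borel exp) f"
    by (simp add: integrable_distr_eq integrable_density)
  then show "integrable lborel (\<lambda>t. indicator {0<..} t *\<^sub>R f t)"
    unfolding e[symmetric] by (subst (asm) integrable_density) auto
qed

text \<open>The change of coordinates \<open>\<sigma> = ln t\<close>, \<open>x = y / \<surd>t\<close>.  The value for nonpositive \<open>t\<close> is the one that extends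
  test functions on the half-space smoothly.\<close>
definition selfsim ::
  "(real^'d \<Rightarrow> real) \<Rightarrow> (real \<times> (real^'d) \<Rightarrow> 'c) \<Rightarrow> real \<times> (real^'d) \<Rightarrow> 'c::real_vector" where
  "selfsim F w = (\<lambda>(t, y). if 0 < t
     then (t powr (- (2 + real CARD('d)) / 4) * sqrt (F (t powr (- 1 / 2) *\<^sub>R y))) *\<^sub>R w (ln t, t powr (- 1 / 2) *\<^sub>R y)
     else 0)"

lemma open_half_space: "open half_space"
  unfolding half_space_def by (intro open_Times) auto

lemma selfsim_test:
  fixes F :: "real^'d \<Rightarrow> real"
  assumes F: "smooth_on UNIV F" "\<And>x. 0 < F x" and h: "h \<in> test_functions UNIV"
  shows "selfsim F h \<in> test_functions half_space"
proof -
  obtain C where C: "compact C" "\<And>p. p \<notin> C \<Longrightarrow> h p = 0" using h test_functions_iff by metis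
  let ?K = "(\<lambda>p. (exp (fst p), exp (fst p / 2) *\<^sub>R snd p)) ` C"
  show ?thesis
  proof (rule test_functions_extend[OF open_half_space, where K="?K"])
    show "compact ?K" by (intro compact_continuous_image C(1) continuous_intros) auto
    show "?K \<subseteq> half_space" by (auto simp: half_space_def)
    show "selfsim F h p = 0" if "p \<notin> ?K" for p
    proof (cases "0 < fst p")
      case True
      have "(ln (fst p), fst p powr (- 1 / 2) *\<^sub>R snd p) \<notin> C"
      proof
        assume in_C: "(ln (fst p), fst p powr (- 1 / 2) *\<^sub>R snd p) \<in> C"
        have "exp (ln (fst p) / 2) * fst p powr (- 1 / 2) = 1"
          using True by (simp add: powr_def exp_add[symmetric])
        then have "p = (\<lambda>p. (exp (fst p), exp (fst p / 2) *\<^sub>R snd p)) (ln (fst p), fst p powr (- 1 / 2) *\<^sub>R snd p)"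
          using True by (simp add: prod_eq_iff)
        then show False using that in_C by blast
      qed
      then show ?thesis using C(2) by (simp add: selfsim_def case_prod_beta)
    qed (simp add: selfsim_def case_prod_beta)
    have fs: "smooth_on half_space (fst :: real \<times> (real^'d) \<Rightarrow> real)" "smooth_on half_space (snd :: real \<times> (real^'d) \<Rightarrow> _)"
      by (auto intro: smooth_on_linear bounded_linear_fst bounded_linear_snd open_half_space)
    have pos: "p \<in> half_space \<Longrightarrow> 0 < fst p" for p :: "real \<times> (real^'d)" by (auto simp: half_space_def)
    have y: "smooth_on half_space (\<lambda>p::real \<times> (real^'d). fst p powr (- 1 / 2) *\<^sub>R snd p)"
      by (intro smooth_on_scaleR smooth_on_powr fs open_half_space pos)
    have "smooth_on half_space (\<lambda>p. complex_of_real (fst p powr (- (2 + real CARD('d)) / 4) * F (fst p powr (- 1 / 2) *\<^sub>R snd p) powr (1 / 2))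
        * h (ln (fst p), fst p powr (- 1 / 2) *\<^sub>R snd p))"
      by (intro smooth_on_mult smooth_on_bounded_linear_compose[OF _ bounded_linear_of_real] smooth_on_powr
          smooth_on_compose[OF F(1)] smooth_on_compose[OF test_functions_smooth[OF h]] smooth_on_Pair
          smooth_on_ln y fs open_half_space pos F(2)) auto
    then show "smooth_on half_space (selfsim F h)"
      by (rule smooth_on_cong[OF open_half_space])
         (auto simp: selfsim_def half_space_def powr_half_sqrt[OF less_imp_le[OF F(2)]] scaleR_conv_of_real)
  qed
qed

text \<open>The weight is positive, so the prefactor can be divided out.\<close>
lemma selfsim_surj:
  fixes F :: "real^'d \<Rightarrow> real"
  assumes F: "smooth_on UNIV F" "\<And>x. 0 < F x" and g: "g \<in> test_functions half_space"
  obtains h where "h \<in> test_functions UNIV" "g = selfsim F h"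
proof -
  obtain C where C: "compact C" "C \<subseteq> half_space" "\<And>p. p \<notin> C \<Longrightarrow> g p = 0" using g test_functions_iff by metis
  let ?P = "\<lambda>p. (exp (fst p), exp (fst p / 2) *\<^sub>R snd p)"
  let ?p0 = "(2 + real CARD('d)) / 4"
  define h where "h = (\<lambda>p. complex_of_real (exp (?p0 * fst p) * F (snd p) powr (- 1 / 2)) * g (?P p))"
  have fs: "smooth_on UNIV (fst :: real \<times> (real^'d) \<Rightarrow> real)" "smooth_on UNIV (snd :: real \<times> (real^'d) \<Rightarrow> _)"
    by (auto intro: smooth_on_linear bounded_linear_fst bounded_linear_snd)
  have half: "smooth_on UNIV (\<lambda>p::real \<times> (real^'d). fst p / 2)"
    by (rule smooth_on_bounded_linear_compose[OF _ bounded_linear_divide]) (auto intro: fs)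
  have "smooth_on UNIV h"
    unfolding h_def
    by (intro smooth_on_mult smooth_on_bounded_linear_compose[OF _ bounded_linear_of_real] smooth_on_powr
        smooth_on_compose[OF F(1)] smooth_on_compose[OF test_functions_smooth[OF g]] smooth_on_Pair
        smooth_on_exp smooth_on_scaleR smooth_on_const half fs F(2)) auto
  moreover have "compact ((\<lambda>p. (ln (fst p), fst p powr (- 1 / 2) *\<^sub>R snd p)) ` C)"
  proof (rule compact_continuous_image[OF _ C(1)])
    have "\<forall>p\<in>C. 0 < fst p" using C(2) by (auto simp: half_space_def)
    then have "\<forall>p\<in>C. fst p \<noteq> 0" "\<forall>p\<in>C. 0 < fst p" by force+
    then show "continuous_on C (\<lambda>p. (ln (fst p), fst p powr (- 1 / 2) *\<^sub>R snd p))"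
      by (intro continuous_intros) (auto simp del: split_paired_All)
  qed
  moreover have "h p = 0" if "p \<notin> (\<lambda>p. (ln (fst p), fst p powr (- 1 / 2) *\<^sub>R snd p)) ` C" for p
  proof -
    have "exp (fst p) powr (- 1 / 2) * exp (fst p / 2) = 1"
      by (simp add: powr_def exp_add[symmetric])
    then have "p = (\<lambda>p. (ln (fst p), fst p powr (- 1 / 2) *\<^sub>R snd p)) (?P p)"
      by (simp add: prod_eq_iff)
    then have "?P p \<notin> C" using that by blast
    then show ?thesis using C(3) by (simp add: h_def)
  qed
  ultimately have "h \<in> test_functions UNIV" by (auto simp: test_functions_iff)
  moreover have "g p = selfsim F h p" for p
  proof (cases "0 < fst p")
    case True
    have 1: "exp (ln (fst p) / 2) * fst p powr (- 1 / 2) = 1"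
      using True by (simp add: powr_def exp_add[symmetric])
    have 2: "fst p powr (- (2 + real CARD('d)) / 4) * exp (?p0 * ln (fst p)) = 1"
      using True by (simp add: powr_def exp_add[symmetric] field_simps)
    let ?F = "F (fst p powr (- 1 / 2) *\<^sub>R snd p)"
    have 3: "sqrt ?F * ?F powr (- 1 / 2) = 1"
      using F(2)[of "fst p powr (- 1 / 2) *\<^sub>R snd p"] by (simp add: powr_half_sqrt[symmetric] powr_add[symmetric] less_imp_le)
    have "selfsim F h p = complex_of_real ((fst p powr (- (2 + real CARD('d)) / 4) * exp (?p0 * ln (fst p))) * (sqrt ?F * ?F powr (- 1 / 2)))
        * g (fst p, (exp (ln (fst p) / 2) * fst p powr (- 1 / 2)) *\<^sub>R snd p)"
      using True by (simp add: selfsim_def case_prod_beta h_def scaleR_conv_of_real mult_ac)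
    also have "\<dots> = g p" unfolding 1 2 3 by simp
    finally show ?thesis by simp
  next
    case False
    then have "p \<notin> C" using C(2) by (auto simp: half_space_def)
    then show ?thesis using False C(3) by (simp add: selfsim_def case_prod_beta)
  qed
  ultimately show ?thesis using that by blast
qed

lemma nn_integral_dilate:
  fixes f :: "'a::euclidean_space \<Rightarrow> ennreal"
  assumes [measurable]: "f \<in> borel_measurable borel" and c: "0 < c"
  shows "(\<integral>\<^sup>+x. f x \<partial>lborel) = ennreal (c ^ DIM('a)) * (\<integral>\<^sup>+x. f (c *\<^sub>R x) \<partial>lborel)"
  using c by (subst lborel_affine[of c 0]) (simp_all add: nn_integral_density nn_integral_distr nn_integral_cmult)

lemma selfsim_measurable:
  fixes F :: "real^'d \<Rightarrow> real" and w :: "real \<times> (real^'d) \<Rightarrow> 'c::{real_normed_vector, second_countable_topology}"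
  assumes [measurable]: "F \<in> borel_measurable borel" "w \<in> borel_measurable borel"
  shows "selfsim F w \<in> borel_measurable borel"
  unfolding selfsim_def case_prod_beta by measurable

text \<open>The prefactor of \<open>selfsim\<close> is the square root of the weight times that of the Jacobian: \<open>d\<sigma> dx\<close> is
  \<open>t powr (- (2 + d) / 2) dt dy\<close>.\<close>
lemma selfsim_norm:
  fixes F :: "real^'d \<Rightarrow> real" and w :: "real \<times> (real^'d) \<Rightarrow> 'c::{real_normed_vector, second_countable_topology}"
  assumes mF[measurable]: "F \<in> borel_measurable borel" and mw[measurable]: "w \<in> borel_measurable borel" and F: "\<And>x. 0 \<le> F x"
  shows "(\<integral>\<^sup>+p. ennreal ((norm (selfsim F w p))\<^sup>2) \<partial>restrict_space lborel half_space) =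
    (\<integral>\<^sup>+\<sigma>. \<integral>\<^sup>+x. ennreal (F x * (norm (w (\<sigma>, x)))\<^sup>2) \<partial>lborel \<partial>lborel)"
proof -
  note [measurable] = selfsim_measurable[OF mF mw]
  have hs: "half_space \<in> sets (borel :: (real \<times> (real^'d)) measure)" by (rule borel_open[OF open_half_space])
  define H where "H = (\<lambda>\<sigma>. \<integral>\<^sup>+x. ennreal (F x * (norm (w (\<sigma>, x)))\<^sup>2) \<partial>lborel)"
  have [measurable]: "H \<in> borel_measurable borel" unfolding H_def by measurable
  have "(\<integral>\<^sup>+p. ennreal ((norm (selfsim F w p))\<^sup>2) \<partial>restrict_space lborel half_space)
      = (\<integral>\<^sup>+p. ennreal ((norm (selfsim F w p))\<^sup>2) * indicator half_space p \<partial>lborel)"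
    using hs by (subst nn_integral_restrict_space) auto
  also have "\<dots> = (\<integral>\<^sup>+p. ennreal ((norm (selfsim F w p))\<^sup>2) \<partial>(lborel \<Otimes>\<^sub>M lborel))"
    unfolding lborel_prod by (intro nn_integral_cong) (auto simp: selfsim_def half_space_def indicator_def split: if_splits)
  also have "\<dots> = (\<integral>\<^sup>+t. \<integral>\<^sup>+y. ennreal ((norm (selfsim F w (t, y)))\<^sup>2) \<partial>lborel \<partial>lborel)"
    by (rule lborel.nn_integral_fst[symmetric]) (simp add: lborel_prod)
  also have "\<dots> = (\<integral>\<^sup>+t. (ennreal (1 / t) * H (ln t)) * indicator {0<..} t \<partial>lborel)"
  proof (rule nn_integral_cong)
    fix t :: real
    show "(\<integral>\<^sup>+y. ennreal ((norm (selfsim F w (t, y)))\<^sup>2) \<partial>lborel) = (ennreal (1 / t) * H (ln t)) * indicator {0<..} t"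
    proof (cases "0 < t")
      case True
      let ?c = "t powr (1 / 2)"
      have cc: "t powr (- 1 / 2) * ?c = 1" using True by (simp add: powr_add[symmetric])
      have c0: "0 < ?c" using True by simp
      have "(\<integral>\<^sup>+y. ennreal ((norm (selfsim F w (t, y)))\<^sup>2) \<partial>lborel) =
          ennreal (?c ^ CARD('d)) * (\<integral>\<^sup>+x. ennreal ((norm (selfsim F w (t, ?c *\<^sub>R x)))\<^sup>2) \<partial>lborel)"
        using nn_integral_dilate[OF _ c0, of "\<lambda>y. ennreal ((norm (selfsim F w (t, y)))\<^sup>2)"] by simp
      also have "(\<lambda>x. ennreal ((norm (selfsim F w (t, ?c *\<^sub>R x)))\<^sup>2)) =
          (\<lambda>x. ennreal ((t powr (- (2 + real CARD('d)) / 4))\<^sup>2) * ennreal (F x * (norm (w (ln t, x)))\<^sup>2))"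
        using True F by (auto simp: fun_eq_iff selfsim_def cc[simplified] power_mult_distrib abs_mult ennreal_mult'[symmetric])
      also have "ennreal (?c ^ CARD('d)) * (\<integral>\<^sup>+x. ennreal ((t powr (- (2 + real CARD('d)) / 4))\<^sup>2) * ennreal (F x * (norm (w (ln t, x)))\<^sup>2) \<partial>lborel)
          = ennreal (?c ^ CARD('d) * (t powr (- (2 + real CARD('d)) / 4))\<^sup>2) * H (ln t)"
        by (simp add: H_def nn_integral_cmult ennreal_mult' mult.assoc)
      also have "?c ^ CARD('d) * (t powr (- (2 + real CARD('d)) / 4))\<^sup>2 = 1 / t"
      proof -
        have "?c ^ CARD('d) * (t powr (- (2 + real CARD('d)) / 4))\<^sup>2
            = t powr (1 / 2 * real CARD('d) + (- (2 + real CARD('d)) / 4) * 2)"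
          using True by (simp add: powr_realpow[symmetric] powr_powr powr_add del: powr_numeral)
        also have "1 / 2 * real CARD('d) + (- (2 + real CARD('d)) / 4) * 2 = - 1" by (simp add: field_simps)
        finally show ?thesis using True by (simp add: powr_minus_divide)
      qed
      finally show ?thesis using True by simp
    qed (simp add: selfsim_def)
  qed
  also have "\<dots> = (\<integral>\<^sup>+\<rho>. ennreal (exp \<rho>) * (ennreal (1 / exp \<rho>) * H (ln (exp \<rho>))) \<partial>lborel)"
    by (rule nn_integral_exp_subst) measurable
  also have "\<dots> = (\<integral>\<^sup>+\<rho>. H \<rho> \<partial>lborel)"
    by (intro nn_integral_cong) (simp add: mult.assoc[symmetric] ennreal_mult'[symmetric])
  finally show ?thesis by (simp add: H_def)
qed

section \<open>The space-time operator in self-similar coordinates\<close>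

lemma integral_vec_lambda:
  fixes f :: "'i::finite \<Rightarrow> 'x \<Rightarrow> 'b::euclidean_space"
  assumes "\<And>i. integrable M (f i)"
  shows "integrable M (\<lambda>x. \<chi> i. f i x)" "(\<integral>x. (\<chi> i. f i x) \<partial>M) = (\<chi> i. \<integral>x. f i x \<partial>M)"
proof -
  have bl: "bounded_linear (axis i :: 'b \<Rightarrow> 'b ^ 'i)" for i
    by (subst linear_conv_bounded_linear[symmetric], rule linearI) (auto simp: axis_def vec_eq_iff)
  have "(\<chi> i. f i x) = (\<Sum>i\<in>UNIV. axis i (f i x))" for x
    by (simp add: vec_eq_iff axis_def if_distrib cong: if_cong)
  then show i: "integrable M (\<lambda>x. \<chi> i. f i x)"
    using assms by (simp add: integrable_bounded_linear[OF bl])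
  show "(\<integral>x. (\<chi> i. f i x) \<partial>M) = (\<chi> i. \<integral>x. f i x \<partial>M)"
    using integral_bounded_linear[OF bounded_linear_vec_nth i] by (simp add: vec_eq_iff)
qed

lemma dir_deriv_slice:
  assumes "h \<in> test_functions U"
  shows "dir_deriv v (\<lambda>x. h (\<sigma>, x)) x = dir_deriv (0, v) h (\<sigma>, x)"
proof -
  have "((\<lambda>x. (\<sigma>, x)) has_derivative (\<lambda>v. (0, v))) (at x)"
    by (intro has_derivative_Pair has_derivative_const has_derivative_ident)
  from has_derivative_compose[OF this test_functions_has_derivative[OF assms]]
  show ?thesis by (rule dir_derivI)
qed

lemma test_functions_slice:
  fixes h :: "real \<times> 'a::euclidean_space \<Rightarrow> complex"
  assumes "h \<in> test_functions UNIV"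
  shows "(\<lambda>x. h (\<sigma>, x)) \<in> test_functions UNIV"
proof -
  obtain C where C: "compact C" "\<And>p. p \<notin> C \<Longrightarrow> h p = 0" using assms test_functions_iff by metis
  have "smooth_on UNIV (\<lambda>x. h (\<sigma>, x))"
    by (rule smooth_on_compose[OF test_functions_smooth[OF assms]]) (auto intro: smooth_on_Pair)
  moreover have "h (\<sigma>, x) = 0" if "x \<notin> snd ` C" for x
    using C(2)[of "(\<sigma>, x)"] that by force
  moreover have "compact (snd ` C)" by (intro compact_continuous_image C(1) continuous_intros)
  ultimately show ?thesis by (auto simp: test_functions_iff)
qed

text \<open>An entry of \<open>H\<^sub>q\<close> applied to a function of time and space in the spatial variables.\<close>
definition H_entry ::
  "real^'d^'d \<Rightarrow> 'd \<Rightarrow> 'd \<Rightarrow> (real \<times> (real^'d) \<Rightarrow> complex) \<Rightarrow> real \<times> (real^'d) \<Rightarrow> complex" where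
  "H_entry q i j h p = (\<Sum>l\<in>UNIV. \<Sum>k\<in>UNIV. complex_of_real (mat_sqrt q $ i $ k * mat_sqrt q $ l $ j) *
     dir_deriv (0, axis k 1) (dir_deriv (0, axis l 1) h) p)"

lemma H_entry_test: "h \<in> test_functions U \<Longrightarrow> H_entry q i j h \<in> test_functions U"
  unfolding H_entry_def[abs_def]
  by (intro test_functions_sum test_functions_cmult test_functions_derivative)

lemma matrix_sandwich_entry:
  fixes S X :: "'b::comm_semiring_1^'d^'d"
  shows "(S ** X ** S) $ i $ j = (\<Sum>l\<in>UNIV. \<Sum>k\<in>UNIV. S $ i $ k * S $ l $ j * X $ k $ l)"
  unfolding matrix_matrix_mult_def vec_lambda_beta sum_distrib_right by (simp add: mult_ac)

lemma H_op_slice: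
  assumes h: "h \<in> test_functions U"
  shows "H_op q (\<lambda>x. h (\<sigma>, x)) x $ i $ j = H_entry q i j h (\<sigma>, x)"
proof -
  have 1: "partial_deriv l (\<lambda>x. h (\<sigma>, x)) = (\<lambda>x. dir_deriv (0, axis l 1) h (\<sigma>, x))" for l
    unfolding partial_deriv_eq using dir_deriv_slice[OF h] by blast
  have 2: "partial_deriv k (\<lambda>x. dir_deriv (0, axis l 1) h (\<sigma>, x)) x
      = dir_deriv (0, axis k 1) (dir_deriv (0, axis l 1) h) (\<sigma>, x)" for k l
    unfolding partial_deriv_eq by (rule dir_deriv_slice[OF test_functions_derivative[OF h]])
  have hs: "hessian (\<lambda>x. h (\<sigma>, x)) x $ k $ l = dir_deriv (0, axis k 1) (dir_deriv (0, axis l 1) h) (\<sigma>, x)" for k l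
    by (simp add: hessian_def 1 2)
  show ?thesis
    by (simp add: H_op_def H_entry_def matrix_sandwich_entry hs complex_mat_def)
qed

lemma outer_sandwich_entry:
  fixes M :: "real^'d^'d"
  assumes "transpose M = M"
  shows "(M ** outer w ** M) $ k $ l = (M *v w) $ k * (M *v w) $ l"
proof -
  have sym: "M $ b $ l = M $ l $ b" for b
    using assms by (metis transpose_def vec_lambda_beta)
  have "(M ** outer w) $ k $ b = (M *v w) $ k * w $ b" for b
    unfolding matrix_matrix_mult_def matrix_vector_mult_def outer_def vec_lambda_beta sum_distrib_right
    by (simp add: mult_ac)
  then have "(M ** outer w ** M) $ k $ l = (\<Sum>b\<in>UNIV. (M *v w) $ k * (M $ l $ b * w $ b))"
    unfolding matrix_matrix_mult_def[of "M ** outer w"] vec_lambda_beta by (simp add: sym mult_ac)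
  also have "\<dots> = (M *v w) $ k * (M *v w) $ l"
    by (simp add: sum_distrib_left[symmetric] matrix_vector_mult_def)
  finally show ?thesis .
qed

context
  fixes \<theta> :: "(real^'d) measure" and a A q B :: "real^'d^'d" and \<alpha> k c :: real
    and h :: "real \<times> (real^'d) \<Rightarrow> complex"
  assumes ht: "heat_tuple \<theta> a A q"
    and hom: "\<And>r E. 0 < r \<Longrightarrow> E \<in> sets borel \<Longrightarrow>
           emeasure \<theta> ((\<lambda>x. r *\<^sub>R x) ` E) = ennreal (r powr k) * emeasure \<theta> E"
    and c: "c = (\<alpha> + 1) / 2 + k / 4"
    and B: "B ** transpose B = A" "det B \<noteq> 0"
    and h: "h \<in> test_functions UNIV"
begin

text \<open>The exponents of \<open>s / t\<close> are \<open>\<alpha> / 2\<close> from the kernel, \<open>(k - d) / 4\<close> from the scaling of the weights and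
  \<open>(2 + d) / 4\<close> from the prefactor of \<open>selfsim\<close>; their sum is \<open>c\<close>.\<close>
lemma T_kernel_scalar:
  assumes s: "0 < s" and t: "0 < t"
  shows "(s / t) powr (\<alpha> / 2) * sqrt (heat_F \<theta> a s z / heat_F \<theta> a t y) *
      (t powr (- (2 + real CARD('d)) / 4) * sqrt (heat_F \<theta> a 1 (t powr (- 1 / 2) *\<^sub>R y)))
    = (s powr (- (2 + real CARD('d)) / 4) * sqrt (heat_F \<theta> a 1 (s powr (- 1 / 2) *\<^sub>R z))) * (s / t) powr c"
proof -
  let ?d = "real CARD('d)"
  have a: "pos_def a" and sets: "sets \<theta> = sets borel"
    using ht unfolding heat_tuple_def radon_measure_def by blast+
  obtain Ba where Ba: "Ba ** transpose Ba = a" "det Ba \<noteq> 0" using pos_def_factor[OF a] .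
  note sc = heat_F_scale[OF factor_inv(3)[OF Ba] sets _ hom]
  define f1 where "f1 = heat_F \<theta> a 1 (s powr (- 1 / 2) *\<^sub>R z)"
  define f2 where "f2 = heat_F \<theta> a 1 (t powr (- 1 / 2) *\<^sub>R y)"
  have f: "0 < f1" "0 < f2" unfolding f1_def f2_def by (rule heat_F_smooth_pos(2)[OF ht])+
  have F: "heat_F \<theta> a s z = s powr ((k - ?d) / 2) * f1" "heat_F \<theta> a t y = t powr ((k - ?d) / 2) * f2"
    using sc[OF s, of z] sc[OF t, of y] unfolding f1_def f2_def by blast+
  have sq: "sqrt (x powr ((k - ?d) / 2)) = x powr ((k - ?d) / 4)" if "0 < x" for x :: real
    using that by (simp add: powr_half_sqrt[symmetric] powr_powr)
  have "sqrt (heat_F \<theta> a s z / heat_F \<theta> a t y) * sqrt f2 = s powr ((k - ?d) / 4) * sqrt f1 / t powr ((k - ?d) / 4)"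
    unfolding F using f s t by (simp add: real_sqrt_divide real_sqrt_mult sq)
  moreover have "(s / t) powr (\<alpha> / 2) * sqrt (heat_F \<theta> a s z / heat_F \<theta> a t y) * (t powr (- (2 + ?d) / 4) * sqrt f2)
      = (s / t) powr (\<alpha> / 2) * t powr (- (2 + ?d) / 4) * (sqrt (heat_F \<theta> a s z / heat_F \<theta> a t y) * sqrt f2)"
    by (simp only: mult_ac)
  ultimately have "(s / t) powr (\<alpha> / 2) * sqrt (heat_F \<theta> a s z / heat_F \<theta> a t y) * (t powr (- (2 + ?d) / 4) * sqrt f2)
      = (s / t) powr (\<alpha> / 2) * t powr (- (2 + ?d) / 4) * (s powr ((k - ?d) / 4) * sqrt f1 / t powr ((k - ?d) / 4))"
    by simp
  also have "\<dots> = exp ((\<alpha> / 2) * (ln s - ln t) + (- (2 + ?d) / 4) * ln t + ((k - ?d) / 4) * ln s - ((k - ?d) / 4) * ln t) * sqrt f1"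
    using s t by (simp add: powr_def ln_div exp_add exp_diff)
  also have "(\<alpha> / 2) * (ln s - ln t) + (- (2 + ?d) / 4) * ln t + ((k - ?d) / 4) * ln s - ((k - ?d) / 4) * ln t
      = (- (2 + ?d) / 4) * ln s + c * (ln s - ln t)"
    unfolding c by (simp add: field_simps)
  also have "exp \<dots> * sqrt f1 = (s powr (- (2 + ?d) / 4) * sqrt f1) * (s / t) powr c"
    using s t by (simp add: powr_def ln_div exp_add)
  finally show ?thesis by (simp add: f1_def f2_def)
qed

text \<open>At a fixed time the powers of \<open>t\<close> and the weights combine to \<open>(s / t)\<^sup>c\<close>.  The remaining kernel is the Hessian of
  a Gaussian, which integration by parts moves onto the test function; two derivatives in \<open>y = \<surd>t x\<close> produce the
  factor \<open>1 / t\<close>, which is the density of \<open>d (ln t)\<close>.\<close>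
lemma T_inner:
  fixes i j :: 'd
  assumes s: "0 < s" and st: "s < t"
  shows "integrable lborel (\<lambda>y. complex_of_real (T_kernel \<alpha> \<theta> a A q s z t y $ i $ j) * selfsim (heat_F \<theta> a 1) h (t, y))"
    and "(\<integral>y. complex_of_real (T_kernel \<alpha> \<theta> a A q s z t y $ i $ j) * selfsim (heat_F \<theta> a 1) h (t, y) \<partial>lborel) =
      complex_of_real ((s powr (- (2 + real CARD('d)) / 4) * sqrt (heat_F \<theta> a 1 (s powr (- 1 / 2) *\<^sub>R z))) * ((s / t) powr c / t)) *
      (\<integral>\<eta>. complex_of_real (std_gauss \<eta>) * H_entry q i j h (ln t, t powr (- 1 / 2) *\<^sub>R (z + sqrt (2 * (t - s)) *\<^sub>R (B *v \<eta>))) \<partial>lborel)"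
proof -
  have t: "0 < t" using s st by simp
  define L where "L = 2 * (t - s)"
  have l: "0 < L" using st by (simp add: L_def)
  let ?C = "L *\<^sub>R A" and ?M = "matrix_inv A" and ?q = "mat_sqrt q"
  note fA = factor_inv[OF B]
  have Ci: "matrix_inv ?C = (1 / L) *\<^sub>R ?M" using matrix_inv_scaleR[OF fA(3)] l by simp
  have symC: "transpose (matrix_inv ?C) = matrix_inv ?C"
    unfolding Ci using fA(2) by (simp add: transpose_def vec_eq_iff)
  let ?P = "(s powr (- (2 + real CARD('d)) / 4) * sqrt (heat_F \<theta> a 1 (s powr (- 1 / 2) *\<^sub>R z))) * (s / t) powr c"
  define G where "G = (\<lambda>y. h (ln t, t powr (- 1 / 2) *\<^sub>R y))"
  have Gt: "G \<in> test_functions UNIV"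
    unfolding G_def using t by (intro test_functions_dilate[OF test_functions_slice[OF h]]) simp
  have selfsim_G: "selfsim (heat_F \<theta> a 1) h (t, y) =
      complex_of_real (t powr (- (2 + real CARD('d)) / 4) * sqrt (heat_F \<theta> a 1 (t powr (- 1 / 2) *\<^sub>R y))) * G y" for y
    using t by (simp add: selfsim_def G_def scaleR_conv_of_real)
  define X where "X = (\<lambda>k l y. ((axis k 1 \<bullet> (matrix_inv ?C *v (z - y))) * (axis l 1 \<bullet> (matrix_inv ?C *v (z - y)))
      - axis k 1 \<bullet> (matrix_inv ?C *v axis l 1)) * gaussian ?C (z - y))"
  have ker: "complex_of_real (T_kernel \<alpha> \<theta> a A q s z t y $ i $ j) * selfsim (heat_F \<theta> a 1) h (t, y)
     = complex_of_real ?P * (\<Sum>l\<in>UNIV. \<Sum>k\<in>UNIV. complex_of_real (?q $ i $ k * ?q $ l $ j) * (complex_of_real (X k l y) * G y))" for y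
  proof -
    have X: "gaussian ?C (z - y) / L * (((1 / L) *\<^sub>R (?M ** outer (z - y) ** ?M) - ?M) $ k $ l) = X k l y" for k l
    proof -
      have ax: "axis k 1 \<bullet> (((1 / L) *\<^sub>R ?M) *v w) = (1 / L) * (?M *v w) $ k" for k and w :: "real^'d"
        by (simp add: inner_axis' scaleR_matrix_vector_assoc[symmetric])
      have m: "(?M *v axis l 1) $ k = ?M $ k $ l" by (simp add: matrix_vector_mult_basis column_def)
      have alg: "g / L * ((1 / L) * (p * p') - r) = ((1 / L * p) * (1 / L * p') - 1 / L * r) * g" for g p p' r :: real
        using l by (simp add: field_simps)
      show ?thesis
        unfolding X_def Ci ax m vector_minus_component vector_scaleR_component outer_sandwich_entry[OF fA(2)]
        by (simp only: real_scaleR_def alg)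
    qed
    have "T_kernel \<alpha> \<theta> a A q s z t y $ i $ j = (s / t) powr (\<alpha> / 2) * sqrt (heat_F \<theta> a s z / heat_F \<theta> a t y) *
        (\<Sum>l\<in>UNIV. \<Sum>k\<in>UNIV. ?q $ i $ k * ?q $ l $ j * X k l y)"
      unfolding T_kernel_def vector_scaleR_component matrix_sandwich_entry X[symmetric] L_def[symmetric]
      by (simp add: sum_distrib_left mult_ac)
    then have "complex_of_real (T_kernel \<alpha> \<theta> a A q s z t y $ i $ j) * selfsim (heat_F \<theta> a 1) h (t, y) =
       complex_of_real ((s / t) powr (\<alpha> / 2) * sqrt (heat_F \<theta> a s z / heat_F \<theta> a t y) *
        (t powr (- (2 + real CARD('d)) / 4) * sqrt (heat_F \<theta> a 1 (t powr (- 1 / 2) *\<^sub>R y)))) *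
       (complex_of_real (\<Sum>l\<in>UNIV. \<Sum>k\<in>UNIV. ?q $ i $ k * ?q $ l $ j * X k l y) * G y)"
      unfolding selfsim_G by (simp only: of_real_mult mult_ac)
    also have "\<dots> = complex_of_real ?P * (complex_of_real (\<Sum>l\<in>UNIV. \<Sum>k\<in>UNIV. ?q $ i $ k * ?q $ l $ j * X k l y) * G y)"
      by (simp only: T_kernel_scalar[OF s t])
    also have "\<dots> = complex_of_real ?P * (\<Sum>l\<in>UNIV. \<Sum>k\<in>UNIV. complex_of_real (?q $ i $ k * ?q $ l $ j) * (complex_of_real (X k l y) * G y))"
      by (simp add: of_real_sum sum_distrib_right mult.assoc)
    finally show ?thesis .
  qed
  have cgC: "continuous_on UNIV (gaussian (L *\<^sub>R A))"
    by (rule has_derivative_imp_continuous_on[OF gaussian_has_derivative[OF symC]])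
  have cX: "continuous_on UNIV (\<lambda>y. complex_of_real (X k l y))" for k l
    unfolding X_def
    by (intro continuous_intros continuous_on_compose2[OF cgC]
        continuous_on_compose2[OF matrix_vector_mult_linear_continuous_on]) auto
  have iX: "integrable lborel (\<lambda>y. complex_of_real (X k l y) * G y)" for k l
    by (rule integrable_continuous_times_test[OF cX Gt])
  then show "integrable lborel (\<lambda>y. complex_of_real (T_kernel \<alpha> \<theta> a A q s z t y $ i $ j) * selfsim (heat_F \<theta> a 1) h (t, y))"
    unfolding ker by (intro integrable_mult_right Bochner_Integration.integrable_sum)
  let ?K = "\<lambda>k l. dir_deriv (axis k 1) (dir_deriv (axis l 1) G)"
  have Kt: "?K k l \<in> test_functions UNIV" for k l
    by (intro test_functions_derivative Gt)
  have cg: "continuous_on UNIV (\<lambda>y. complex_of_real (gaussian ?C (z - y)))"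
    by (intro continuous_intros continuous_on_compose2[OF cgC]) auto
  have iK: "integrable lborel (\<lambda>y. complex_of_real (gaussian ?C (z - y)) * ?K k l y)" for k l
    by (rule integrable_continuous_times_test[OF cg Kt])
  define Kij where "Kij = (\<lambda>y. \<Sum>l\<in>UNIV. \<Sum>k\<in>UNIV. complex_of_real (?q $ i $ k * ?q $ l $ j) * ?K k l y)"
  have Kijt: "Kij \<in> test_functions UNIV"
    unfolding Kij_def by (intro test_functions_sum test_functions_cmult Kt)
  have KH: "Kij y = complex_of_real (1 / t) * H_entry q i j h (ln t, t powr (- 1 / 2) *\<^sub>R y)" for y
  proof -
    let ?c = "t powr (- 1 / 2)"
    have cc: "?c * ?c = 1 / t" using t by (simp add: powr_add[symmetric] powr_minus_divide)
    have 1: "dir_deriv (axis l 1) G = (\<lambda>y. of_real ?c * dir_deriv (0, axis l 1) h (ln t, ?c *\<^sub>R y))" for l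
      unfolding G_def using dir_deriv_dilate[OF test_functions_slice[OF h]] dir_deriv_slice[OF h] by fastforce
    have 2: "?K k l y = of_real (?c * ?c) * dir_deriv (0, axis k 1) (dir_deriv (0, axis l 1) h) (ln t, ?c *\<^sub>R y)" for k l
    proof -
      have s1: "(\<lambda>y. dir_deriv (0, axis l 1) h (ln t, y)) \<in> test_functions UNIV"
        by (rule test_functions_slice[OF test_functions_derivative[OF h]])
      have s2: "(\<lambda>y. dir_deriv (0, axis l 1) h (ln t, ?c *\<^sub>R y)) \<in> test_functions UNIV"
        by (rule test_functions_dilate[OF s1]) (use t in simp)
      show ?thesis
        unfolding 1 dir_deriv_cmult[OF s2] dir_deriv_dilate[OF s1] dir_deriv_slice[OF test_functions_derivative[OF h]]
        by simp
    qed
    show ?thesis unfolding Kij_def H_entry_def 2 cc by (simp add: sum_distrib_left mult_ac)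
  qed
  note [measurable] = test_functions_measurable[OF Kijt] test_functions_measurable[OF H_entry_test[OF h]]
  have "(\<integral>y. complex_of_real (T_kernel \<alpha> \<theta> a A q s z t y $ i $ j) * selfsim (heat_F \<theta> a 1) h (t, y) \<partial>lborel)
      = complex_of_real ?P * (\<Sum>l\<in>UNIV. \<Sum>k\<in>UNIV. complex_of_real (?q $ i $ k * ?q $ l $ j) * (\<integral>y. complex_of_real (X k l y) * G y \<partial>lborel))"
    unfolding ker using iX by (simp add: Bochner_Integration.integral_sum Bochner_Integration.integrable_sum)
  also have "\<dots> = complex_of_real ?P * (\<Sum>l\<in>UNIV. \<Sum>k\<in>UNIV. complex_of_real (?q $ i $ k * ?q $ l $ j) *
      (\<integral>y. complex_of_real (gaussian ?C (z - y)) * ?K k l y \<partial>lborel))"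
    unfolding X_def integral_gaussian_hessian[OF symC Gt] ..
  also have "\<dots> = complex_of_real ?P * (\<integral>y. complex_of_real (gaussian ?C (z - y)) * Kij y \<partial>lborel)"
  proof -
    have "(\<integral>y. complex_of_real (gaussian ?C (z - y)) * Kij y \<partial>lborel) = (\<Sum>l\<in>UNIV. \<Sum>k\<in>UNIV. complex_of_real (?q $ i $ k * ?q $ l $ j) *
      (\<integral>y. complex_of_real (gaussian ?C (z - y)) * ?K k l y \<partial>lborel))"
      unfolding Kij_def sum_distrib_left mult.left_commute[of "complex_of_real (gaussian ?C _)"] using iK
      by (simp add: Bochner_Integration.integral_sum Bochner_Integration.integrable_sum)
    then show ?thesis by simp
  qed
  also have "\<dots> = complex_of_real ?P * (\<integral>\<eta>. complex_of_real (std_gauss \<eta>) * Kij (z + sqrt L *\<^sub>R (B *v \<eta>)) \<partial>lborel)"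
    by (subst integral_gaussian_convolution[OF B l]) auto
  also have "\<dots> = complex_of_real ?P * (\<integral>\<eta>. complex_of_real (1 / t) * (complex_of_real (std_gauss \<eta>) * H_entry q i j h (ln t, t powr (- 1 / 2) *\<^sub>R (z + sqrt L *\<^sub>R (B *v \<eta>)))) \<partial>lborel)"
    unfolding KH mult.left_commute[of "complex_of_real (std_gauss _)"] ..
  also have "\<dots> = complex_of_real (?P / t) * (\<integral>\<eta>. complex_of_real (std_gauss \<eta>) * H_entry q i j h (ln t, t powr (- 1 / 2) *\<^sub>R (z + sqrt L *\<^sub>R (B *v \<eta>))) \<partial>lborel)"
    by (simp only: integral_mult_right_zero of_real_divide of_real_1) simp
  finally show "(\<integral>y. complex_of_real (T_kernel \<alpha> \<theta> a A q s z t y $ i $ j) * selfsim (heat_F \<theta> a 1) h (t, y) \<partial>lborel) =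
      complex_of_real ((s powr (- (2 + real CARD('d)) / 4) * sqrt (heat_F \<theta> a 1 (s powr (- 1 / 2) *\<^sub>R z))) * ((s / t) powr c / t)) *
      (\<integral>\<eta>. complex_of_real (std_gauss \<eta>) * H_entry q i j h (ln t, t powr (- 1 / 2) *\<^sub>R (z + sqrt (2 * (t - s)) *\<^sub>R (B *v \<eta>))) \<partial>lborel)"
    by (simp add: L_def)
qed

end

text \<open>For \<open>A = B B\<^sup>T\<close> and a test function \<open>f\<close> this is the solution of \<open>- v' + (L\<^sub>A + \<mu>) v = f\<close>, with \<open>v'\<close> the time
  derivative, that vanishes at all times after the support of \<open>f\<close>.\<close>
definition evolve ::
  "real^'d^'d \<Rightarrow> complex \<Rightarrow> (real \<times> (real^'d) \<Rightarrow> complex) \<Rightarrow> real \<times> (real^'d) \<Rightarrow> complex" where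
  "evolve B \<mu> f z =
     (\<integral>p. ou_weight \<mu> p * f (fst z + fst p, ou_contr p *\<^sub>R snd z + ou_shift B p) \<partial>lborel)"

definition evolve_mat ::
  "real^'d^'d \<Rightarrow> real^'d^'d \<Rightarrow> complex \<Rightarrow> (real \<times> (real^'d) \<Rightarrow> complex) \<Rightarrow> real \<times> (real^'d) \<Rightarrow> complex^'d^'d" where
  "evolve_mat q B \<mu> h z = (\<chi> i j. evolve B \<mu> (H_entry q i j h) z)"

lemma evolve_integrable:
  assumes "0 < Re \<mu>" "f \<in> test_functions U"
  shows "integrable lborel (\<lambda>p. ou_weight \<mu> p * f (\<sigma> + fst p, ou_contr p *\<^sub>R x + ou_shift B p))"
proof -
  obtain K where K: "\<And>x. norm (f x) \<le> K" using test_functions_bounded[OF assms(2)] by metis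
  note [measurable] = test_functions_measurable[OF assms(2)]
  show ?thesis by (rule integrable_mult_bounded[OF integrable_ou_weight[OF assms(1)] _ K]) measurable
qed

lemma evolve_measurable:
  assumes "f \<in> test_functions U"
  shows "evolve B \<mu> f \<in> borel_measurable borel"
proof -
  note [measurable] = test_functions_measurable[OF assms]
  show ?thesis unfolding evolve_def by measurable
qed

lemma borel_measurable_vec_lambda:
  fixes f :: "'i::finite \<Rightarrow> 'x \<Rightarrow> 'b::euclidean_space"
  assumes [measurable]: "\<And>i. f i \<in> borel_measurable M"
  shows "(\<lambda>x. \<chi> i. f i x) \<in> borel_measurable M"
proof -
  have "linear (axis i :: 'b \<Rightarrow> 'b ^ 'i)" for i
    by (rule linearI) (auto simp: axis_def vec_eq_iff)
  then have [measurable]: "(axis i :: 'b \<Rightarrow> 'b ^ 'i) \<in> borel_measurable borel" for i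
    by (intro borel_measurable_continuous_onI linear_continuous_on) (simp add: linear_conv_bounded_linear)
  have "(\<lambda>x. \<chi> i. f i x) = (\<lambda>x. \<Sum>i\<in>UNIV. axis i (f i x))"
    by (simp add: fun_eq_iff vec_eq_iff axis_def if_distrib cong: if_cong)
  then show ?thesis by simp
qed

lemma evolve_mat_measurable:
  assumes "h \<in> test_functions U"
  shows "evolve_mat q B \<mu> h \<in> borel_measurable borel"
  unfolding evolve_mat_def
  by (intro borel_measurable_vec_lambda evolve_measurable[OF H_entry_test[OF assms]])

text \<open>With \<open>s = exp \<sigma>\<close>, \<open>t = exp (\<sigma> + \<tau>)\<close> and \<open>z = \<surd>s x\<close> the point \<open>(z + \<surd>(2 (t - s)) B \<eta>) / \<surd>t\<close> is
  \<open>exp (- \<tau> / 2) x + \<surd>(2 (1 - exp (- \<tau>))) B \<eta>\<close>, a point on an Ornstein--Uhlenbeck path, and \<open>(s / t)\<^sup>c dt / t\<close> is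
  \<open>exp (- c \<tau>) d\<tau>\<close>.\<close>
theorem T_op_selfsim:
  fixes \<theta> :: "(real^'d) measure" and a A q B :: "real^'d^'d"
  assumes ht: "heat_tuple \<theta> a A q"
    and hom: "\<And>r E. 0 < r \<Longrightarrow> E \<in> sets borel \<Longrightarrow>
           emeasure \<theta> ((\<lambda>x. r *\<^sub>R x) ` E) = ennreal (r powr k) * emeasure \<theta> E"
    and c: "c = (\<alpha> + 1) / 2 + k / 4" "0 < c"
    and B: "B ** transpose B = A" "det B \<noteq> 0"
    and h: "h \<in> test_functions UNIV" and p: "p \<in> half_space"
  shows "T_op \<alpha> \<theta> a A q (selfsim (heat_F \<theta> a 1) h) p =
    selfsim (heat_F \<theta> a 1) (evolve_mat q B (complex_of_real c) h) p"
proof -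
  obtain s z where sz: "p = (s, z)" "0 < s" using p by (auto simp: half_space_def)
  let ?F = "heat_F \<theta> a 1"
  define \<sigma> where "\<sigma> = ln s"
  define x where "x = s powr (- 1 / 2) *\<^sub>R z"
  define P where "P = s powr (- (2 + real CARD('d)) / 4) * sqrt (?F x)"
  have \<mu>: "0 < Re (complex_of_real c)" using c(2) by simp
  define J where "J = (\<lambda>i j t. \<integral>\<eta>. complex_of_real (std_gauss \<eta>) *
      H_entry q i j h (ln t, t powr (- 1 / 2) *\<^sub>R (z + sqrt (2 * (t - s)) *\<^sub>R (B *v \<eta>))) \<partial>lborel)"
  define \<Phi> where "\<Phi> = (\<lambda>i j t. indicator {s<..} t *\<^sub>R (complex_of_real (P * ((s / t) powr c / t)) * J i j t))"
  define \<Psi> where "\<Psi> = (\<lambda>i j \<tau>. \<integral>\<eta>. ou_weight (complex_of_real c) (\<tau>, \<eta>) *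
      H_entry q i j h (\<sigma> + \<tau>, ou_contr (\<tau>, \<eta>) *\<^sub>R x + ou_shift B (\<tau>, \<eta>)) \<partial>lborel)"
  have [measurable]: "H_entry q i j h \<in> borel_measurable borel" for i j
    by (rule test_functions_measurable[OF H_entry_test[OF h]])
  have \<Phi>_measurable[measurable]: "\<Phi> i j \<in> borel_measurable borel" for i j
    unfolding \<Phi>_def J_def by measurable
  have \<Psi>_measurable[measurable]: "\<Psi> i j \<in> borel_measurable borel" for i j
    unfolding \<Psi>_def by measurable
  note ev = evolve_integrable[OF \<mu> H_entry_test[OF h], of q _ _ \<sigma> x B]
  have \<Psi>_integrable: "integrable lborel (\<Psi> i j)" for i j
    using lborel_pair.integrable_fst'[of "\<lambda>p. ou_weight (complex_of_real c) p * H_entry q i j h (\<sigma> + fst p, ou_contr p *\<^sub>R x + ou_shift B p)"] ev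
    by (simp add: lborel_prod \<Psi>_def)
  have \<Psi>_integral: "(\<integral>\<tau>. \<Psi> i j \<tau> \<partial>lborel) = evolve B (complex_of_real c) (H_entry q i j h) (\<sigma>, x)" for i j
    using lborel_Fubini(1)[OF ev] by (simp add: evolve_def \<Psi>_def)
  have \<Phi>\<Psi>: "exp \<rho> *\<^sub>R \<Phi> i j (exp \<rho>) = complex_of_real P * \<Psi> i j (- \<sigma> + \<rho>)" for i j \<rho>
  proof (cases "\<sigma> < \<rho>")
    case True
    let ?t = "exp \<rho>" and ?\<tau> = "- \<sigma> + \<rho>"
    have s: "s = exp \<sigma>" using sz(2) by (simp add: \<sigma>_def)
    have st: "s / ?t = exp (- ?\<tau>)" by (simp add: s exp_diff[symmetric])
    have arg: "?t powr (- 1 / 2) *\<^sub>R (z + sqrt (2 * (?t - s)) *\<^sub>R (B *v \<eta>)) = ou_contr (?\<tau>, \<eta>) *\<^sub>R x + ou_shift B (?\<tau>, \<eta>)" for \<eta>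
    proof -
      have 1: "?t powr (- 1 / 2) = ou_contr (?\<tau>, \<eta>) * s powr (- 1 / 2)"
        using True by (simp add: s ou_contr_def powr_def exp_add[symmetric] field_simps)
      have "?t powr (- 1 / 2) * sqrt (2 * (?t - s)) = sqrt (1 / ?t * (2 * (?t - s)))"
        by (simp add: real_sqrt_mult real_sqrt_divide powr_minus_divide powr_half_sqrt)
      also have "1 / ?t * (2 * (?t - s)) = 2 * (1 - s / ?t)" by (simp add: field_simps)
      finally have 2: "?t powr (- 1 / 2) * sqrt (2 * (?t - s)) = ou_spread ?\<tau>"
        unfolding st by (simp add: ou_spread_def)
      show ?thesis
        unfolding scaleR_add_right scaleR_scaleR 2 unfolding 1 by (simp add: x_def ou_shift_def)
    qed
    have "complex_of_real ((s / ?t) powr c) = ou_decay (complex_of_real c) ?\<tau>"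
      using True by (simp add: st ou_decay_def powr_def exp_of_real[symmetric] algebra_simps)
    moreover have "J i j ?t = (\<integral>\<eta>. complex_of_real (std_gauss \<eta>) * H_entry q i j h (\<sigma> + ?\<tau>, ou_contr (?\<tau>, \<eta>) *\<^sub>R x + ou_shift B (?\<tau>, \<eta>)) \<partial>lborel)"
      unfolding J_def arg by simp
    ultimately have "\<Psi> i j ?\<tau> = complex_of_real ((s / ?t) powr c) * J i j ?t"
      unfolding \<Psi>_def ou_weight_def fst_conv snd_conv mult.assoc by simp
    moreover have "indicator {s<..} ?t = (1::real)" using True s by simp
    ultimately show ?thesis unfolding \<Phi>_def by (simp add: scaleR_conv_of_real)
  next
    case False
    then have "\<not> s < exp \<rho>" using sz(2) by (metis \<sigma>_def exp_gt_zero ln_exp ln_less_cancel_iff)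
    then show ?thesis using False by (simp add: \<Phi>_def \<Psi>_def ou_weight_def ou_decay_def)
  qed
  have \<Phi>_subst: "integrable lborel (\<lambda>t. indicator {0<..} t *\<^sub>R \<Phi> i j t)"
    "(\<integral>t. indicator {0<..} t *\<^sub>R \<Phi> i j t \<partial>lborel) = complex_of_real P * evolve B (complex_of_real c) (H_entry q i j h) (\<sigma>, x)" for i j
  proof -
    have "integrable lborel (\<lambda>\<rho>. complex_of_real P * \<Psi> i j (- \<sigma> + \<rho>))"
      by (intro integrable_mult_right integrable_translate \<Psi>_integrable)
    then show "integrable lborel (\<lambda>t. indicator {0<..} t *\<^sub>R \<Phi> i j t)"
      by (intro integral_exp_subst(2) \<Phi>_measurable) (simp only: \<Phi>\<Psi>)
    show "(\<integral>t. indicator {0<..} t *\<^sub>R \<Phi> i j t \<partial>lborel) = complex_of_real P * evolve B (complex_of_real c) (H_entry q i j h) (\<sigma>, x)"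
      unfolding integral_exp_subst(1)[OF \<Phi>_measurable] \<Phi>\<Psi> integral_mult_right_zero
        integral_translate[OF \<Psi>_measurable] \<Psi>_integral ..
  qed
  have inner: "indicator {s<..} t *\<^sub>R (\<integral>y. (\<chi> i j. complex_of_real (T_kernel \<alpha> \<theta> a A q s z t y $ i $ j) * selfsim ?F h (t, y)) \<partial>lborel)
      = (\<chi> i j. indicator {0<..} t *\<^sub>R \<Phi> i j t)" for t
  proof (cases "s < t")
    case True
    note T = T_inner[OF ht hom c(1) B h sz(2) True, of z]
    have "(\<integral>y. (\<chi> i j. complex_of_real (T_kernel \<alpha> \<theta> a A q s z t y $ i $ j) * selfsim ?F h (t, y)) \<partial>lborel)
        = (\<chi> i j. complex_of_real (P * ((s / t) powr c / t)) * J i j t)"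
      by (simp only: integral_vec_lambda(2)[OF integral_vec_lambda(1)[OF T(1)]] integral_vec_lambda(2)[OF T(1)] T(2) P_def x_def J_def)
    then show ?thesis using True sz(2) by (simp add: \<Phi>_def vec_eq_iff)
  next
    case False
    then show ?thesis by (simp add: \<Phi>_def vec_eq_iff)
  qed
  have "T_op \<alpha> \<theta> a A q (selfsim ?F h) p = (\<integral>t. (\<chi> i j. indicator {0<..} t *\<^sub>R \<Phi> i j t) \<partial>lborel)"
    unfolding T_op_def sz(1) prod.case set_lebesgue_integral_def inner ..
  also have "\<dots> = (\<chi> i j. complex_of_real P * evolve B (complex_of_real c) (H_entry q i j h) (\<sigma>, x))"
    by (simp only: integral_vec_lambda(2)[OF integral_vec_lambda(1)[OF \<Phi>_subst(1)]] integral_vec_lambda(2)[OF \<Phi>_subst(1)] \<Phi>_subst(2))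
  also have "\<dots> = selfsim ?F (evolve_mat q B (complex_of_real c) h) p"
  proof -
    have "selfsim ?F (evolve_mat q B (complex_of_real c) h) p = P *\<^sub>R evolve_mat q B (complex_of_real c) h (\<sigma>, x)"
      using sz by (simp add: selfsim_def P_def \<sigma>_def x_def)
    then show ?thesis by (simp add: evolve_mat_def vec_eq_iff scaleR_conv_of_real[where 'a=complex])
  qed
  finally show ?thesis .
qed

section \<open>Plancherel inequalities\<close>

definition ft :: "(real \<Rightarrow> complex) \<Rightarrow> real \<Rightarrow> complex" where
  "ft v \<omega> = (\<integral>\<sigma>. exp (- \<i> * of_real (\<omega> * \<sigma>)) * v \<sigma> \<partial>lborel)"

lemma integrable_std_normal: "integrable lborel std_normal_density"
  by simp

lemma cnj_measurable [measurable]: "cnj \<in> borel_measurable borel"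
  by (intro borel_measurable_continuous_onI continuous_intros)

lemma ft_integrable:
  assumes "integrable lborel v"
  shows "integrable lborel (\<lambda>\<sigma>. exp (- \<i> * of_real (\<omega> * \<sigma>)) * v \<sigma>)"
proof -
  have "integrable lborel (\<lambda>\<sigma>. v \<sigma> * exp (- \<i> * of_real (\<omega> * \<sigma>)))"
    by (rule integrable_mult_bounded[OF assms, of _ 1]) auto
  then show ?thesis by (simp add: mult.commute)
qed

lemma ft_measurable [measurable]:
  assumes [measurable]: "v \<in> borel_measurable borel"
  shows "ft v \<in> borel_measurable borel"
  unfolding ft_def[abs_def] by measurable

text \<open>The characteristic function of the standard normal distribution, rescaled.\<close>
lemma integral_gaussian_exp:
  assumes "0 < \<delta>"
  shows "(\<integral>\<omega>. of_real (exp (- (\<delta> * \<omega>)\<^sup>2 / 2)) * exp (- \<i> * of_real (\<omega> * r)) \<partial>lborel)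
    = complex_of_real (2 * pi / \<delta> * std_normal_density (r / \<delta>))"
proof -
  have ch: "(\<integral>x. std_normal_density x *\<^sub>R exp (\<i> * complex_of_real (t * x)) \<partial>lborel) = complex_of_real (exp (- t\<^sup>2 / 2))" for t
    using fun_cong[OF char_std_normal_distribution, of t] unfolding char_def
    by (subst (asm) integral_density) auto
  let ?f = "\<lambda>\<omega>. of_real (exp (- (\<delta> * \<omega>)\<^sup>2 / 2)) * exp (- \<i> * complex_of_real (\<omega> * r))"
  have "(\<integral>\<omega>. ?f \<omega> \<partial>lborel) = \<bar>1 / \<delta>\<bar> *\<^sub>R (\<integral>x. ?f (0 + (1 / \<delta>) * x) \<partial>lborel)"
    using assms by (intro lborel_integral_real_affine) auto
  also have "(\<lambda>x. ?f (0 + (1 / \<delta>) * x)) = (\<lambda>x. of_real (sqrt (2 * pi)) * (std_normal_density x *\<^sub>R exp (\<i> * complex_of_real (- (r / \<delta>) * x))))"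
    using assms by (auto simp: fun_eq_iff std_normal_density_def scaleR_conv_of_real field_simps)
  also have "\<bar>1 / \<delta>\<bar> *\<^sub>R (\<integral>x. of_real (sqrt (2 * pi)) * (std_normal_density x *\<^sub>R exp (\<i> * complex_of_real (- (r / \<delta>) * x))) \<partial>lborel)
      = complex_of_real (1 / \<delta> * (sqrt (2 * pi) * exp (- (r / \<delta>)\<^sup>2 / 2)))"
    using assms by (simp only: integral_mult_right_zero ch) (simp add: scaleR_conv_of_real)
  also have "1 / \<delta> * (sqrt (2 * pi) * exp (- (r / \<delta>)\<^sup>2 / 2)) = 2 * pi / \<delta> * std_normal_density (r / \<delta>)"
  proof -
    define w where "w = sqrt (2 * pi)"
    have w: "w \<noteq> 0" "2 * pi = w * w" by (simp_all add: w_def)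
    show ?thesis
      unfolding std_normal_density_def w_def[symmetric] unfolding w(2) using w(1) assms by (simp add: field_simps)
  qed
  finally show ?thesis .
qed

lemma integrable_gaussian_weight:
  assumes "0 < (\<delta>::real)"
  shows "integrable lborel (\<lambda>\<omega>. exp (- (\<delta> * \<omega>)\<^sup>2 / 2))"
proof -
  have "integrable lborel (\<lambda>\<omega>. sqrt (2 * pi) * std_normal_density (\<delta> *\<^sub>R \<omega>))"
    using assms by (intro integrable_mult_right integrable_dilate integrable_std_normal) auto
  then show ?thesis by (simp add: std_normal_density_def)
qed

text \<open>Regularising by a Gaussian in frequency is averaging over Gaussian shifts of length \<open>\<delta>\<close> in time.\<close>
lemma plancherel_regularised:
  fixes v :: "real \<Rightarrow> complex"
  assumes v: "integrable lborel v" and M: "\<And>\<sigma>. norm (v \<sigma>) \<le> M" and \<delta>: "0 < \<delta>"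
  shows "integrable lborel (\<lambda>p. of_real (std_normal_density (snd p)) * (v (fst p) * cnj (v (fst p + \<delta> * snd p))))"
    and "complex_of_real (\<integral>\<omega>. exp (- (\<delta> * \<omega>)\<^sup>2 / 2) * (norm (ft v \<omega>))\<^sup>2 \<partial>lborel) =
    2 * pi * (\<integral>p. of_real (std_normal_density (snd p)) * (v (fst p) * cnj (v (fst p + \<delta> * snd p))) \<partial>lborel)"
proof -
  have [measurable]: "v \<in> borel_measurable borel" using v by simp
  have cv: "integrable lborel (\<lambda>\<sigma>. cnj (v \<sigma>))" by (rule integrable_cnj[OF v])
  let ?g = "\<lambda>p. v (fst p) * cnj (v (snd p))"
  have g: "integrable lborel ?g" by (rule integrable_lborel_prod_mult[OF v cv])
  let ?W = "\<lambda>\<omega>. complex_of_real (exp (- (\<delta> * \<omega>)\<^sup>2 / 2))"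
  let ?e = "\<lambda>\<omega> p. exp (- \<i> * of_real (\<omega> * (fst p - snd p)))"
  have sq: "complex_of_real ((norm (ft v \<omega>))\<^sup>2) = (\<integral>p. ?e \<omega> p * ?g p \<partial>lborel)" for \<omega>
  proof -
    have "complex_of_real ((norm (ft v \<omega>))\<^sup>2) = ft v \<omega> * cnj (ft v \<omega>)" by (rule complex_norm_square)
    also have "cnj (ft v \<omega>) = (\<integral>\<sigma>. cnj (exp (- \<i> * of_real (\<omega> * \<sigma>)) * v \<sigma>) \<partial>lborel)"
      unfolding ft_def by (rule Bochner_Integration.integral_cnj[symmetric])
    also have "ft v \<omega> * \<dots> = (\<integral>\<sigma>. (\<integral>\<sigma>'. (exp (- \<i> * of_real (\<omega> * \<sigma>)) * v \<sigma>) * cnj (exp (- \<i> * of_real (\<omega> * \<sigma>')) * v \<sigma>') \<partial>lborel) \<partial>lborel)"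
      unfolding ft_def by (simp only: integral_mult_right_zero integral_mult_left_zero)
    also have "\<dots> = (\<integral>\<sigma>. (\<integral>\<sigma>'. ?e \<omega> (\<sigma>, \<sigma>') * ?g (\<sigma>, \<sigma>') \<partial>lborel) \<partial>lborel)"
    proof -
      have e: "exp (- \<i> * of_real (\<omega> * \<sigma>)) * cnj (exp (- \<i> * of_real (\<omega> * \<sigma>'))) = ?e \<omega> (\<sigma>, \<sigma>')" for \<sigma> \<sigma>'
        by (simp add: exp_cnj exp_add[symmetric] algebra_simps)
      then have "(exp (- \<i> * of_real (\<omega> * \<sigma>)) * v \<sigma>) * cnj (exp (- \<i> * of_real (\<omega> * \<sigma>')) * v \<sigma>') = ?e \<omega> (\<sigma>, \<sigma>') * ?g (\<sigma>, \<sigma>')" for \<sigma> \<sigma>'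
      proof -
        have "(a * u) * cnj (b * w) = (a * cnj b) * (u * cnj w)" for a b u w :: complex by (simp add: mult_ac)
        then show ?thesis by (simp only: e fst_conv snd_conv)
      qed
      then show ?thesis by (simp only:)
    qed
    also have "\<dots> = (\<integral>p. ?e \<omega> p * ?g p \<partial>lborel)"
    proof (rule lborel_Fubini(1)[symmetric])
      have "integrable lborel (\<lambda>p. ?g p * ?e \<omega> p)" by (rule integrable_mult_bounded[OF g, of _ 1]) auto
      then show "integrable lborel (\<lambda>p. ?e \<omega> p * ?g p)" by (simp add: mult.commute)
    qed
    finally show ?thesis .
  qed
  have W: "integrable lborel ?W" by (rule integrable_of_real[OF integrable_gaussian_weight[OF \<delta>]])
  have int3: "integrable lborel (\<lambda>z. (?W (fst z) * ?g (snd z)) * ?e (fst z) (snd z))"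
    by (rule integrable_mult_bounded[OF integrable_lborel_prod_mult[OF W g], of _ 1]) auto
  have "complex_of_real (\<integral>\<omega>. exp (- (\<delta> * \<omega>)\<^sup>2 / 2) * (norm (ft v \<omega>))\<^sup>2 \<partial>lborel)
      = (\<integral>\<omega>. ?W \<omega> * complex_of_real ((norm (ft v \<omega>))\<^sup>2) \<partial>lborel)"
    by (subst integral_complex_of_real[symmetric]) (simp only: of_real_mult)
  also have "\<dots> = (\<integral>\<omega>. (\<integral>p. (?W \<omega> * ?g p) * ?e \<omega> p \<partial>lborel) \<partial>lborel)"
    unfolding sq integral_mult_right_zero[symmetric] by (simp only: mult_ac)
  also have "\<dots> = (\<integral>p. (\<integral>\<omega>. (?W \<omega> * ?g p) * ?e \<omega> p \<partial>lborel) \<partial>lborel)"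
    using lborel_Fubini(1)[OF int3] lborel_Fubini(2)[OF int3] by simp
  also have "\<dots> = (\<integral>p. ?g p * complex_of_real (2 * pi / \<delta> * std_normal_density ((fst p - snd p) / \<delta>)) \<partial>lborel)"
  proof (rule Bochner_Integration.integral_cong[OF refl])
    fix p
    have "(\<integral>\<omega>. (?W \<omega> * ?g p) * ?e \<omega> p \<partial>lborel) = ?g p * (\<integral>\<omega>. ?W \<omega> * ?e \<omega> p \<partial>lborel)"
      by (subst integral_mult_right_zero[symmetric]) (simp only: mult_ac)
    then show "(\<integral>\<omega>. (?W \<omega> * ?g p) * ?e \<omega> p \<partial>lborel) = ?g p * complex_of_real (2 * pi / \<delta> * std_normal_density ((fst p - snd p) / \<delta>))"
      by (simp only: integral_gaussian_exp[OF \<delta>])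
  qed
  also have "\<dots> = (\<integral>\<sigma>. (\<integral>\<sigma>'. ?g (\<sigma>, \<sigma>') * complex_of_real (2 * pi / \<delta> * std_normal_density ((\<sigma> - \<sigma>') / \<delta>)) \<partial>lborel) \<partial>lborel)"
  proof (subst lborel_Fubini(1))
    show "integrable lborel (\<lambda>p. ?g p * complex_of_real (2 * pi / \<delta> * std_normal_density ((fst p - snd p) / \<delta>)))"
    proof (rule integrable_mult_bounded[OF g])
      show "norm (complex_of_real (2 * pi / \<delta> * std_normal_density ((fst p - snd p) / \<delta>))) \<le> 2 * pi / \<delta> * (1 / sqrt (2 * pi))" for p :: "real \<times> real"
        using \<delta> unfolding norm_of_real std_normal_density_def
        by (subst abs_of_nonneg) (auto intro!: mult_left_mono divide_right_mono)
    qed measurable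
  qed simp
  also have "\<dots> = (\<integral>\<sigma>. (\<integral>y. 2 * pi * (of_real (std_normal_density y) * (v \<sigma> * cnj (v (\<sigma> + \<delta> * y)))) \<partial>lborel) \<partial>lborel)"
  proof (rule Bochner_Integration.integral_cong[OF refl])
    fix \<sigma>
    let ?f = "\<lambda>\<sigma>'. ?g (\<sigma>, \<sigma>') * complex_of_real (2 * pi / \<delta> * std_normal_density ((\<sigma> - \<sigma>') / \<delta>))"
    have "(\<integral>\<sigma>'. ?f \<sigma>' \<partial>lborel) = \<bar>\<delta>\<bar> *\<^sub>R (\<integral>y. ?f (\<sigma> + \<delta> * y) \<partial>lborel)"
      using \<delta> by (intro lborel_integral_real_affine) auto
    also have "\<dots> = (\<integral>y. \<bar>\<delta>\<bar> *\<^sub>R ?f (\<sigma> + \<delta> * y) \<partial>lborel)" by simp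
    also have "\<dots> = (\<integral>y. 2 * pi * (of_real (std_normal_density y) * (v \<sigma> * cnj (v (\<sigma> + \<delta> * y)))) \<partial>lborel)"
    proof (rule Bochner_Integration.integral_cong[OF refl])
      fix y
      have "std_normal_density ((\<sigma> - (\<sigma> + \<delta> * y)) / \<delta>) = std_normal_density y"
        using \<delta> by (simp add: std_normal_density_def)
      then show "\<bar>\<delta>\<bar> *\<^sub>R ?f (\<sigma> + \<delta> * y) = 2 * pi * (of_real (std_normal_density y) * (v \<sigma> * cnj (v (\<sigma> + \<delta> * y))))"
        using \<delta> by (simp add: scaleR_conv_of_real)
    qed
    finally show "(\<integral>\<sigma>'. ?f \<sigma>' \<partial>lborel) = (\<integral>y. 2 * pi * (of_real (std_normal_density y) * (v \<sigma> * cnj (v (\<sigma> + \<delta> * y)))) \<partial>lborel)" .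
  qed
  also have "\<dots> = 2 * pi * (\<integral>\<sigma>. (\<integral>y. of_real (std_normal_density y) * (v \<sigma> * cnj (v (\<sigma> + \<delta> * y))) \<partial>lborel) \<partial>lborel)"
    by (simp only: integral_mult_right_zero)
  finally have eq: "complex_of_real (\<integral>\<omega>. exp (- (\<delta> * \<omega>)\<^sup>2 / 2) * (norm (ft v \<omega>))\<^sup>2 \<partial>lborel) =
      2 * pi * (\<integral>\<sigma>. (\<integral>y. of_real (std_normal_density y) * (v \<sigma> * cnj (v (\<sigma> + \<delta> * y))) \<partial>lborel) \<partial>lborel)" .
  have "integrable lborel (\<lambda>p. (v (fst p) * of_real (std_normal_density (snd p))) * cnj (v (fst p + \<delta> * snd p)))"
    by (rule integrable_mult_bounded[OF integrable_lborel_prod_mult[OF v integrable_of_real[OF integrable_std_normal]] _ M[unfolded complex_mod_cnj[symmetric, of "v _"]]]) auto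
  then show i: "integrable lborel (\<lambda>p. of_real (std_normal_density (snd p)) * (v (fst p) * cnj (v (fst p + \<delta> * snd p))))"
    by (simp only: mult_ac)
  show "complex_of_real (\<integral>\<omega>. exp (- (\<delta> * \<omega>)\<^sup>2 / 2) * (norm (ft v \<omega>))\<^sup>2 \<partial>lborel) =
    2 * pi * (\<integral>p. of_real (std_normal_density (snd p)) * (v (fst p) * cnj (v (fst p + \<delta> * snd p))) \<partial>lborel)"
    unfolding lborel_Fubini(1)[OF i] eq by simp
qed

lemma ft_bounded:
  assumes "integrable lborel v"
  shows "norm (ft v \<omega>) \<le> (\<integral>\<sigma>. norm (v \<sigma>) \<partial>lborel)"
  unfolding ft_def by (rule order_trans[OF integral_norm_bound]) (simp add: norm_mult)

lemma integrable_ft_regularised: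
  assumes v: "integrable lborel v" and \<delta>: "0 < (\<delta>::real)"
  shows "integrable lborel (\<lambda>\<omega>. exp (- (\<delta> * \<omega>)\<^sup>2 / 2) * (norm (ft v \<omega>))\<^sup>2)"
proof (rule Bochner_Integration.integrable_bound)
  have [measurable]: "v \<in> borel_measurable borel" using v by simp
  show "integrable lborel (\<lambda>\<omega>. exp (- (\<delta> * \<omega>)\<^sup>2 / 2) * (\<integral>\<sigma>. norm (v \<sigma>) \<partial>lborel)\<^sup>2)"
    using integrable_gaussian_weight[OF \<delta>] by simp
  show "AE \<omega> in lborel. norm (exp (- (\<delta> * \<omega>)\<^sup>2 / 2) * (norm (ft v \<omega>))\<^sup>2) \<le> norm (exp (- (\<delta> * \<omega>)\<^sup>2 / 2) * (\<integral>\<sigma>. norm (v \<sigma>) \<partial>lborel)\<^sup>2)"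
    using ft_bounded[OF v] by (intro AE_I2) (simp add: abs_mult power_mono)
  show "(\<lambda>\<omega>. exp (- (\<delta> * \<omega>)\<^sup>2 / 2) * (norm (ft v \<omega>))\<^sup>2) \<in> borel_measurable lborel" by measurable
qed

lemma integrable_norm_square:
  fixes v :: "real \<Rightarrow> complex"
  assumes v: "integrable lborel v" and M: "\<And>\<sigma>. norm (v \<sigma>) \<le> M"
  shows "integrable lborel (\<lambda>\<sigma>. (norm (v \<sigma>))\<^sup>2)"
proof -
  have [measurable]: "v \<in> borel_measurable borel" using v by simp
  have "integrable lborel (\<lambda>\<sigma>. norm (v \<sigma> * v \<sigma>))"
    by (intro integrable_norm integrable_mult_bounded[OF v _ M]) simp
  then show ?thesis by (simp add: norm_mult power2_eq_square)
qed

text \<open>In the regularised identity the product of \<open>v\<close> with its translate is at most the mean of their squares, which gives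
  the bound for every \<open>\<delta>\<close>; Fatou's lemma removes the regularisation.\<close>
lemma plancherel_le:
  fixes v :: "real \<Rightarrow> complex"
  assumes v: "integrable lborel v" and M: "\<And>\<sigma>. norm (v \<sigma>) \<le> M"
  shows "(\<integral>\<^sup>+\<omega>. ennreal ((norm (ft v \<omega>))\<^sup>2) \<partial>lborel) \<le> ennreal (2 * pi) * (\<integral>\<^sup>+\<sigma>. ennreal ((norm (v \<sigma>))\<^sup>2) \<partial>lborel)"
proof -
  have [measurable]: "v \<in> borel_measurable borel" using v by simp
  note v2 = integrable_norm_square[OF v M]
  let ?n = "std_normal_density"
  let ?E = "\<integral>\<sigma>. (norm (v \<sigma>))\<^sup>2 \<partial>lborel"
  have J: "(\<integral>\<omega>. exp (- (\<delta> * \<omega>)\<^sup>2 / 2) * (norm (ft v \<omega>))\<^sup>2 \<partial>lborel) \<le> 2 * pi * ?E" if \<delta>: "0 < \<delta>" for \<delta>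
  proof -
    let ?J = "\<integral>\<omega>. exp (- (\<delta> * \<omega>)\<^sup>2 / 2) * (norm (ft v \<omega>))\<^sup>2 \<partial>lborel"
    note R = plancherel_regularised[OF v M \<delta>]
    have inn: "integrable lborel (\<lambda>y::real. complex_of_real (?n y))" by (intro integrable_of_real integrable_std_normal) 
    have iv: "integrable lborel (\<lambda>\<sigma>. complex_of_real ((norm (v \<sigma>))\<^sup>2))" by (rule integrable_of_real[OF v2])
    let ?a = "\<lambda>p. complex_of_real (?n (snd p)) * complex_of_real ((norm (v (fst p)))\<^sup>2)"
    let ?b = "\<lambda>p. complex_of_real (?n (snd p)) * complex_of_real ((norm (v (fst p + \<delta> * snd p)))\<^sup>2)"
    have ia: "integrable lborel ?a"
      using integrable_lborel_prod_mult[OF iv inn] by (simp add: mult.commute)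
    have tr: "(\<integral>\<sigma>. complex_of_real ((norm (v (\<sigma> + r)))\<^sup>2) \<partial>lborel) = complex_of_real ?E"
      "integrable lborel (\<lambda>\<sigma>. complex_of_real ((norm (v (\<sigma> + r)))\<^sup>2))" for r
      using integral_translate[of "\<lambda>\<sigma>. complex_of_real ((norm (v \<sigma>))\<^sup>2)" r] integrable_translate[OF iv, of r]
      by (simp_all add: add.commute integral_complex_of_real del: of_real_power)
    have trn: "(\<integral>\<sigma>. (norm (v (\<sigma> + r)))\<^sup>2 \<partial>lborel) = ?E" for r
      using integral_translate[of "\<lambda>\<sigma>. (norm (v \<sigma>))\<^sup>2" r] by (simp add: add.commute)
    have ib: "integrable lborel ?b"
    proof -
      have "integrable (lborel \<Otimes>\<^sub>M lborel) (\<lambda>(y, \<sigma>). complex_of_real (?n y) * complex_of_real ((norm (v (\<sigma> + \<delta> * y)))\<^sup>2))"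
      proof (rule lborel_pair.Fubini_integrable)
        show "integrable lborel (\<lambda>y. \<integral>\<sigma>. norm (case (y, \<sigma>) of (y, \<sigma>) \<Rightarrow> complex_of_real (?n y) * complex_of_real ((norm (v (\<sigma> + \<delta> * y)))\<^sup>2)) \<partial>lborel)"
          by (simp add: norm_mult norm_power trn)
        show "AE y in lborel. integrable lborel (\<lambda>\<sigma>. case (y, \<sigma>) of (y, \<sigma>) \<Rightarrow> complex_of_real (?n y) * complex_of_real ((norm (v (\<sigma> + \<delta> * y)))\<^sup>2))"
          unfolding prod.case by (intro AE_I2 integrable_mult_right tr(2))
      qed measurable
      from lborel_pair.integrable_product_swap[OF this]
      show ?thesis by (simp add: lborel_prod case_prod_beta')
    qed
    have Ia: "(\<integral>p. ?a p \<partial>lborel) = complex_of_real ?E"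
      unfolding lborel_Fubini(2)[OF ia] fst_conv snd_conv integral_mult_right_zero integral_mult_left_zero
      by (simp add: integral_complex_of_real del: of_real_power)
    have Ib: "(\<integral>p. ?b p \<partial>lborel) = complex_of_real ?E"
      unfolding lborel_Fubini(2)[OF ib] fst_conv snd_conv integral_mult_right_zero tr(1) integral_mult_left_zero
      by (simp add: integral_complex_of_real)
    have nn: "0 \<le> ?J" by (rule integral_nonneg_AE) auto
    have eqJ: "?J = 2 * pi * norm (\<integral>p. of_real (?n (snd p)) * (v (fst p) * cnj (v (fst p + \<delta> * snd p))) \<partial>lborel)"
    proof -
      have "?J = norm (complex_of_real ?J)" using nn by simp
      also have "\<dots> = 2 * pi * norm (\<integral>p. of_real (?n (snd p)) * (v (fst p) * cnj (v (fst p + \<delta> * snd p))) \<partial>lborel)"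
        unfolding R(2) by (simp add: norm_mult)
      finally show ?thesis .
    qed
    have "norm (\<integral>p. of_real (?n (snd p)) * (v (fst p) * cnj (v (fst p + \<delta> * snd p))) \<partial>lborel) \<le> (\<integral>p. Re ((?a p + ?b p) / 2) \<partial>lborel)"
    proof (rule order_trans[OF integral_norm_bound integral_mono])
      show "integrable lborel (\<lambda>p. norm (of_real (?n (snd p)) * (v (fst p) * cnj (v (fst p + \<delta> * snd p)))))"
        by (rule integrable_norm[OF R(1)])
      show "integrable lborel (\<lambda>p. Re ((?a p + ?b p) / 2))"
        by (intro integrable_Re integrable_divide Bochner_Integration.integrable_add ia ib)
      fix p :: "real \<times> real"
      have "norm (v (fst p)) * norm (v (fst p + \<delta> * snd p)) \<le> ((norm (v (fst p)))\<^sup>2 + (norm (v (fst p + \<delta> * snd p)))\<^sup>2) / 2"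
        using sum_squares_bound[of "norm (v (fst p))" "norm (v (fst p + \<delta> * snd p))"] by simp
      then have "?n (snd p) * (norm (v (fst p)) * norm (v (fst p + \<delta> * snd p))) \<le> ?n (snd p) * (((norm (v (fst p)))\<^sup>2 + (norm (v (fst p + \<delta> * snd p)))\<^sup>2) / 2)"
        by (rule mult_left_mono) simp
      moreover have "Re ((?a p + ?b p) / 2) = ?n (snd p) * (((norm (v (fst p)))\<^sup>2 + (norm (v (fst p + \<delta> * snd p)))\<^sup>2) / 2)"
        by (simp add: distrib_left flip: of_real_mult of_real_power)
      ultimately show "norm (of_real (?n (snd p)) * (v (fst p) * cnj (v (fst p + \<delta> * snd p)))) \<le> Re ((?a p + ?b p) / 2)"
        by (simp add: norm_mult)
    qed
    also have "(\<integral>p. Re ((?a p + ?b p) / 2) \<partial>lborel) = Re (\<integral>p. (?a p + ?b p) / 2 \<partial>lborel)"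
      by (rule integral_Re) (intro integrable_divide Bochner_Integration.integrable_add ia ib)
    also have "(\<integral>p. (?a p + ?b p) / 2 \<partial>lborel) = complex_of_real ?E"
      unfolding integral_divide_zero Bochner_Integration.integral_add[OF ia ib] Ia Ib by simp
    finally show ?thesis unfolding eqJ by (intro mult_left_mono) simp_all
  qed
  let ?\<delta> = "\<lambda>n::nat. 1 / real (Suc n)"
  let ?u = "\<lambda>n \<omega>. ennreal (exp (- (?\<delta> n * \<omega>)\<^sup>2 / 2) * (norm (ft v \<omega>))\<^sup>2)"
  have lim: "(\<lambda>n. ?u n \<omega>) \<longlonglongrightarrow> ennreal ((norm (ft v \<omega>))\<^sup>2)" for \<omega>
  proof (rule tendsto_ennrealI)
    have "?\<delta> \<longlonglongrightarrow> 0" by real_asymp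
    then have "(\<lambda>n. exp (- (?\<delta> n * \<omega>)\<^sup>2 / 2) * (norm (ft v \<omega>))\<^sup>2) \<longlonglongrightarrow> exp (- (0 * \<omega>)\<^sup>2 / 2) * (norm (ft v \<omega>))\<^sup>2"
      by (intro tendsto_intros) auto
    then show "(\<lambda>n. exp (- (?\<delta> n * \<omega>)\<^sup>2 / 2) * (norm (ft v \<omega>))\<^sup>2) \<longlonglongrightarrow> (norm (ft v \<omega>))\<^sup>2" by simp
  qed
  have "(\<integral>\<^sup>+\<omega>. ennreal ((norm (ft v \<omega>))\<^sup>2) \<partial>lborel) = (\<integral>\<^sup>+\<omega>. liminf (\<lambda>n. ?u n \<omega>) \<partial>lborel)"
    by (intro nn_integral_cong) (metis lim lim_imp_Liminf sequentially_bot)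
  also have "\<dots> \<le> liminf (\<lambda>n. \<integral>\<^sup>+\<omega>. ?u n \<omega> \<partial>lborel)"
    by (rule nn_integral_liminf) measurable
  also have "\<dots> \<le> liminf (\<lambda>n. ennreal (2 * pi * ?E))"
  proof (intro Liminf_mono always_eventually allI)
    fix n
    have "(\<integral>\<^sup>+\<omega>. ?u n \<omega> \<partial>lborel) = ennreal (\<integral>\<omega>. exp (- (?\<delta> n * \<omega>)\<^sup>2 / 2) * (norm (ft v \<omega>))\<^sup>2 \<partial>lborel)"
      by (rule nn_integral_eq_integral[OF integrable_ft_regularised[OF v]]) auto
    also have "\<dots> \<le> ennreal (2 * pi * ?E)" by (intro ennreal_leI J) simp
    finally show "(\<integral>\<^sup>+\<omega>. ?u n \<omega> \<partial>lborel) \<le> ennreal (2 * pi * ?E)" .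
  qed
  also have "\<dots> = ennreal (2 * pi * ?E)" by (simp add: Liminf_const)
  also have "\<dots> = ennreal (2 * pi) * ennreal ?E" by (simp add: ennreal_mult')
  also have "ennreal ?E = (\<integral>\<^sup>+\<sigma>. ennreal ((norm (v \<sigma>))\<^sup>2) \<partial>lborel)"
    by (rule nn_integral_eq_integral[OF v2, symmetric]) simp
  finally show ?thesis .
qed

text \<open>Continuity lets the regularised right-hand side converge to the energy of \<open>v\<close>, and the regularised left-hand side
  is at most the unregularised one.\<close>
lemma plancherel_ge:
  fixes v :: "real \<Rightarrow> complex"
  assumes v: "integrable lborel v" and M: "\<And>\<sigma>. norm (v \<sigma>) \<le> M" and c: "continuous_on UNIV v"
  shows "ennreal (2 * pi) * (\<integral>\<^sup>+\<sigma>. ennreal ((norm (v \<sigma>))\<^sup>2) \<partial>lborel) \<le> (\<integral>\<^sup>+\<omega>. ennreal ((norm (ft v \<omega>))\<^sup>2) \<partial>lborel)"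
proof -
  have [measurable]: "v \<in> borel_measurable borel" using v by simp
  note v2 = integrable_norm_square[OF v M]
  let ?n = "std_normal_density"
  let ?E = "\<integral>\<sigma>. (norm (v \<sigma>))\<^sup>2 \<partial>lborel"
  let ?\<delta> = "\<lambda>n::nat. 1 / real (Suc n)"
  let ?J = "\<lambda>n. \<integral>\<omega>. exp (- (?\<delta> n * \<omega>)\<^sup>2 / 2) * (norm (ft v \<omega>))\<^sup>2 \<partial>lborel"
  have inn: "integrable lborel (\<lambda>y::real. complex_of_real (?n y))" by (intro integrable_of_real integrable_std_normal)
  have M0: "0 \<le> M" using M norm_ge_zero order_trans by blast
  have "(\<lambda>n. \<integral>p. of_real (?n (snd p)) * (v (fst p) * cnj (v (fst p + ?\<delta> n * snd p))) \<partial>lborel)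
      \<longlonglongrightarrow> (\<integral>p. of_real (?n (snd p)) * (v (fst p) * cnj (v (fst p))) \<partial>lborel)"
  proof (rule integral_dominated_convergence[where w="\<lambda>p. norm (v (fst p) * of_real (?n (snd p))) * M"])
    show "integrable lborel (\<lambda>p. norm (v (fst p) * of_real (?n (snd p))) * M)"
      by (intro integrable_mult_left integrable_norm integrable_lborel_prod_mult[OF v inn])
    show "AE p in lborel. (\<lambda>n. of_real (?n (snd p)) * (v (fst p) * cnj (v (fst p + ?\<delta> n * snd p)))) \<longlonglongrightarrow> of_real (?n (snd p)) * (v (fst p) * cnj (v (fst p)))"
    proof (rule AE_I2)
      fix p :: "real \<times> real"
      have "?\<delta> \<longlonglongrightarrow> 0" by real_asymp
      then have "(\<lambda>n. fst p + ?\<delta> n * snd p) \<longlonglongrightarrow> fst p + 0 * snd p" by (intro tendsto_intros)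
      then have "(\<lambda>n. v (fst p + ?\<delta> n * snd p)) \<longlonglongrightarrow> v (fst p + 0 * snd p)"
        using c by (intro isCont_tendsto_compose[of _ v]) (auto simp: continuous_on_eq_continuous_at)
      then show "(\<lambda>n. of_real (?n (snd p)) * (v (fst p) * cnj (v (fst p + ?\<delta> n * snd p)))) \<longlonglongrightarrow> of_real (?n (snd p)) * (v (fst p) * cnj (v (fst p)))"
        by (intro tendsto_intros) simp
    qed
    show "AE p in lborel. norm (of_real (?n (snd p)) * (v (fst p) * cnj (v (fst p + ?\<delta> n * snd p)))) \<le> norm (v (fst p) * of_real (?n (snd p))) * M" for n
    proof (rule AE_I2)
      fix p :: "real \<times> real"
      have "norm (of_real (?n (snd p)) * (v (fst p) * cnj (v (fst p + ?\<delta> n * snd p)))) = norm (v (fst p) * of_real (?n (snd p))) * norm (v (fst p + ?\<delta> n * snd p))"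
        by (simp add: norm_mult)
      also have "\<dots> \<le> norm (v (fst p) * of_real (?n (snd p))) * M" by (intro mult_left_mono M) simp
      finally show "norm (of_real (?n (snd p)) * (v (fst p) * cnj (v (fst p + ?\<delta> n * snd p)))) \<le> norm (v (fst p) * of_real (?n (snd p))) * M" .
    qed
    have "(\<lambda>p. of_real (?n (snd p)) * (v (fst p) * cnj (v (fst p + ?\<delta> n * snd p)))) \<in> borel_measurable borel" for n
      by measurable
    then show "(\<lambda>p. of_real (?n (snd p)) * (v (fst p) * cnj (v (fst p + ?\<delta> n * snd p)))) \<in> borel_measurable lborel" for n
      by simp
    have "(\<lambda>p. of_real (?n (snd p)) * (v (fst p) * cnj (v (fst p)))) \<in> borel_measurable borel"
      by measurable
    then show "(\<lambda>p. of_real (?n (snd p)) * (v (fst p) * cnj (v (fst p)))) \<in> borel_measurable lborel"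
      by simp
  qed
  moreover have "(\<integral>p. of_real (?n (snd p)) * (v (fst p) * cnj (v (fst p))) \<partial>lborel) = complex_of_real ?E"
  proof -
    have e: "of_real (?n (snd p)) * (v (fst p) * cnj (v (fst p))) = complex_of_real ((norm (v (fst p)))\<^sup>2) * of_real (?n (snd p))" for p :: "real \<times> real"
      by (simp only: complex_norm_square) (rule mult.commute)
    show ?thesis unfolding e
      unfolding lborel_Fubini(1)[OF integrable_lborel_prod_mult[OF integrable_of_real[OF v2] inn]] fst_conv snd_conv integral_mult_right_zero integral_mult_left_zero
      by (simp add: integral_complex_of_real del: of_real_power)
  qed
  ultimately have "(\<lambda>n. 2 * pi * (\<integral>p. of_real (?n (snd p)) * (v (fst p) * cnj (v (fst p + ?\<delta> n * snd p))) \<partial>lborel)) \<longlonglongrightarrow> 2 * pi * complex_of_real ?E"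
    by (intro tendsto_mult tendsto_const) simp
  then have "(\<lambda>n. complex_of_real (?J n)) \<longlonglongrightarrow> complex_of_real (2 * pi * ?E)"
    by (subst plancherel_regularised(2)[OF v M]) auto
  then have "?J \<longlonglongrightarrow> 2 * pi * ?E" by (simp only: tendsto_of_real_iff)
  then have lim: "(\<lambda>n. ennreal (?J n)) \<longlonglongrightarrow> ennreal (2 * pi * ?E)" by (rule tendsto_ennrealI)
  have "ennreal (?J n) \<le> (\<integral>\<^sup>+\<omega>. ennreal ((norm (ft v \<omega>))\<^sup>2) \<partial>lborel)" for n
  proof -
    have "ennreal (?J n) = (\<integral>\<^sup>+\<omega>. ennreal (exp (- (?\<delta> n * \<omega>)\<^sup>2 / 2) * (norm (ft v \<omega>))\<^sup>2) \<partial>lborel)"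
      by (rule nn_integral_eq_integral[OF integrable_ft_regularised[OF v], symmetric]) auto
    also have "\<dots> \<le> (\<integral>\<^sup>+\<omega>. ennreal ((norm (ft v \<omega>))\<^sup>2) \<partial>lborel)"
      by (intro nn_integral_mono ennreal_leI mult_left_le_one_le) auto
    finally show ?thesis .
  qed
  then have "ennreal (2 * pi * ?E) \<le> (\<integral>\<^sup>+\<omega>. ennreal ((norm (ft v \<omega>))\<^sup>2) \<partial>lborel)"
    by (intro LIMSEQ_le_const2[OF lim]) blast
  moreover have "ennreal ?E = (\<integral>\<^sup>+\<sigma>. ennreal ((norm (v \<sigma>))\<^sup>2) \<partial>lborel)"
    by (rule nn_integral_eq_integral[OF v2, symmetric]) simp
  ultimately show ?thesis by (simp add: ennreal_mult')
qed

section \<open>Operator norms as inequalities between integrals\<close>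

lemma L2_iff:
  assumes "f \<in> borel_measurable M"
  shows "f \<in> L2 M \<longleftrightarrow> (\<integral>\<^sup>+x. ennreal ((norm (f x))\<^sup>2) \<partial>M) < \<infinity>"
  using assms unfolding L2_def by (simp add: integrable_iff_bounded)

lemma L2_norm_nn:
  assumes "f \<in> L2 M"
  shows "ennreal ((L2_norm M f)\<^sup>2) = (\<integral>\<^sup>+x. ennreal ((norm (f x))\<^sup>2) \<partial>M)" "0 \<le> L2_norm M f"
proof -
  have i: "integrable M (\<lambda>x. (norm (f x))\<^sup>2)" using assms by (simp add: L2_def)
  have "0 \<le> (\<integral>x. (norm (f x))\<^sup>2 \<partial>M)" by (rule integral_nonneg_AE) simp
  then show "0 \<le> L2_norm M f" "ennreal ((L2_norm M f)\<^sup>2) = (\<integral>\<^sup>+x. ennreal ((norm (f x))\<^sup>2) \<partial>M)"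
    using nn_integral_eq_integral[OF i] by (simp_all add: L2_norm_def)
qed

text \<open>As an inequality between integrals with values in \<open>[0, \<infinity>]\<close>, a bound includes membership in \<open>L\<^sup>2\<close>.\<close>
lemma L2_bound_iff:
  fixes f :: "'x \<Rightarrow> 'b::{real_normed_vector, second_countable_topology}"
    and g :: "'x \<Rightarrow> 'c::{real_normed_vector, second_countable_topology}"
  assumes f: "f \<in> borel_measurable M" and g: "g \<in> L2 M" and C: "0 \<le> C"
  shows "f \<in> L2 M \<and> L2_norm M f \<le> C * L2_norm M g \<longleftrightarrow>
    (\<integral>\<^sup>+x. ennreal ((norm (f x))\<^sup>2) \<partial>M) \<le> ennreal (C\<^sup>2) * (\<integral>\<^sup>+x. ennreal ((norm (g x))\<^sup>2) \<partial>M)" (is "?l \<longleftrightarrow> ?r")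
proof -
  have g2: "ennreal (C\<^sup>2) * (\<integral>\<^sup>+x. ennreal ((norm (g x))\<^sup>2) \<partial>M) = ennreal ((C * L2_norm M g)\<^sup>2)"
    by (simp add: L2_norm_nn(1)[OF g, symmetric] power_mult_distrib ennreal_mult)
  have pos: "0 \<le> C * L2_norm M g" using C L2_norm_nn(2)[OF g] by simp
  show ?thesis
  proof
    assume l: ?l
    then have "(L2_norm M f)\<^sup>2 \<le> (C * L2_norm M g)\<^sup>2" using L2_norm_nn(2) by (intro power_mono) auto
    then show ?r unfolding g2 L2_norm_nn(1)[OF conjunct1[OF l], symmetric] by (rule ennreal_leI)
  next
    assume r: ?r
    then have "(\<integral>\<^sup>+x. ennreal ((norm (f x))\<^sup>2) \<partial>M) < \<infinity>" unfolding g2 using ennreal_less_top le_less_trans by fastforce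
    then have fL: "f \<in> L2 M" using L2_iff[OF f] by simp
    have "ennreal ((L2_norm M f)\<^sup>2) \<le> ennreal ((C * L2_norm M g)\<^sup>2)" using r unfolding g2 L2_norm_nn(1)[OF fL] .
    then have "(L2_norm M f)\<^sup>2 \<le> (C * L2_norm M g)\<^sup>2" by (simp add: ennreal_le_iff)
    then have "L2_norm M f \<le> C * L2_norm M g" using pos by (rule power2_le_imp_le)
    then show ?l using fL by blast
  qed
qed

text \<open>The sets of admissible constants are half-lines, whose end points are the norms; intersecting half-lines
  takes the supremum of the end points.\<close>
lemma Inf_eq_SUP_Inf:
  fixes S :: "real set" and R :: "'w \<Rightarrow> real set"
  assumes "\<And>w. S \<subseteq> R w" and up: "\<And>w C C'. C \<in> R w \<Longrightarrow> C \<le> C' \<Longrightarrow> C' \<in> R w"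
    and all: "\<And>C. (\<And>w. C \<in> R w) \<Longrightarrow> C \<in> S" and nonneg: "\<And>w C. C \<in> R w \<Longrightarrow> 0 \<le> C"
  shows "(INF C\<in>S. ennreal C) = (SUP w. INF C\<in>R w. ennreal C)"
proof (rule antisym)
  show "(SUP w. INF C\<in>R w. ennreal C) \<le> (INF C\<in>S. ennreal C)"
    by (intro SUP_least INF_superset_mono assms(1)) auto
  show "(INF C\<in>S. ennreal C) \<le> (SUP w. INF C\<in>R w. ennreal C)" (is "_ \<le> ?N")
  proof (rule ennreal_le_epsilon)
    fix e :: real assume N: "?N < top" and e: "0 < e"
    then obtain r where r: "?N = ennreal r" "0 \<le> r" by (cases ?N) auto
    have "r + e \<in> R w" for w
    proof -
      have "(INF C\<in>R w. ennreal C) \<le> ?N" by (rule SUP_upper) simp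
      also have "?N < ennreal (r + e)" unfolding r(1) using r(2) e by (simp add: ennreal_less_iff)
      finally obtain C where C: "C \<in> R w" "ennreal C < ennreal (r + e)" unfolding INF_less_iff by blast
      then have "C < r + e" using nonneg[OF C(1)] by (simp add: ennreal_less_iff)
      then show ?thesis using up[OF C(1)] by simp
    qed
    then have "(INF C\<in>S. ennreal C) \<le> ennreal (r + e)" by (intro INF_lower all)
    then show "(INF C\<in>S. ennreal C) \<le> ?N + ennreal e" unfolding r(1) using r(2) e by simp
  qed
qed

lemma norm_matrix_square:
  fixes X :: "complex^'n^'m"
  shows "(norm X)\<^sup>2 = (\<Sum>i\<in>UNIV. \<Sum>j\<in>UNIV. (norm (X $ i $ j))\<^sup>2)"
  by (simp add: norm_vec_def L2_set_def sum_nonneg)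

lemma test_functions_weighted_finite:
  fixes h :: "'a::euclidean_space \<Rightarrow> complex"
  assumes h: "h \<in> test_functions U" and G: "continuous_on UNIV G" "\<And>x. 0 \<le> G x"
  shows "(\<integral>\<^sup>+x. ennreal (G x * (norm (h x))\<^sup>2) \<partial>lborel) < \<infinity>"
proof -
  have "integrable lborel (\<lambda>x. complex_of_real (G x) * cnj (h x) * h x)"
    by (intro integrable_continuous_times_test[OF _ h] continuous_intros G test_functions_continuous[OF h])
  then have "(\<integral>\<^sup>+x. ennreal (norm (complex_of_real (G x) * cnj (h x) * h x)) \<partial>lborel) < \<infinity>"
    by (simp add: integrable_iff_bounded)
  moreover have "norm (complex_of_real (G x) * cnj (h x) * h x) = G x * (norm (h x))\<^sup>2" for x
    using G(2)[of x] by (simp add: norm_mult power2_eq_square)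
  ultimately show ?thesis by simp
qed

definition energy :: "(real^'d \<Rightarrow> real) \<Rightarrow> (real^'d \<Rightarrow> 'c::real_normed_vector) \<Rightarrow> ennreal" where
  "energy F u = (\<integral>\<^sup>+x. ennreal (F x * (norm (u x))\<^sup>2) \<partial>lborel)"

text \<open>By \<open>selfsim_norm\<close> this is the square integral of \<open>selfsim F w\<close> over the half-space.\<close>
definition line_energy ::
  "(real^'d \<Rightarrow> real) \<Rightarrow> (real \<times> (real^'d) \<Rightarrow> 'c::real_normed_vector) \<Rightarrow> ennreal" where
  "line_energy F w = (\<integral>\<^sup>+\<sigma>. energy F (\<lambda>x. w (\<sigma>, x)) \<partial>lborel)"

lemma energy_measurable:
  fixes w :: "real \<times> (real^'d) \<Rightarrow> 'c::{real_normed_vector, second_countable_topology}"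
  assumes [measurable]: "F \<in> borel_measurable borel" "w \<in> borel_measurable borel"
  shows "(\<lambda>\<sigma>. energy F (\<lambda>x. w (\<sigma>, x))) \<in> borel_measurable borel"
  unfolding energy_def by measurable

lemma line_energy_dilate:
  fixes w :: "real \<times> (real^'d) \<Rightarrow> 'c::{real_normed_vector, second_countable_topology}"
  assumes "F \<in> borel_measurable borel" "w \<in> borel_measurable borel" "c \<noteq> 0"
  shows "line_energy F w = ennreal \<bar>c\<bar> * (\<integral>\<^sup>+\<sigma>. energy F (\<lambda>x. w (c * \<sigma>, x)) \<partial>lborel)"
  unfolding line_energy_def
  using nn_integral_real_affine[OF energy_measurable[OF assms(1,2)] assms(3), of 0] by simp

text \<open>The resolvent applied to \<open>H_op q \<phi>\<close>, by Mehler's formula.\<close>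
definition resolve ::
  "real^'d^'d \<Rightarrow> real^'d^'d \<Rightarrow> complex \<Rightarrow> (real^'d \<Rightarrow> complex) \<Rightarrow> real^'d \<Rightarrow> complex^'d^'d" where
  "resolve q B \<mu> \<phi> x = (\<chi> i j. ou_avg B \<mu> (\<lambda>y. H_op q \<phi> y $ i $ j) x)"

lemma H_op_entry:
  "H_op q \<phi> x $ i $ j = (\<Sum>l\<in>UNIV. \<Sum>k\<in>UNIV. complex_of_real (mat_sqrt q $ i $ k * mat_sqrt q $ l $ j) *
     partial_deriv k (partial_deriv l \<phi>) x)"
  by (simp add: H_op_def matrix_sandwich_entry complex_mat_def hessian_def)

lemma H_op_test: "\<phi> \<in> test_functions U \<Longrightarrow> (\<lambda>x. H_op q \<phi> x $ i $ j) \<in> test_functions U"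
  unfolding H_op_entry
  by (intro test_functions_sum test_functions_cmult test_functions_partial_deriv)

lemma OU_resolvent_mat_eq_resolve:
  assumes "B ** transpose B = A" "0 < Re \<mu>" "\<phi> \<in> test_functions UNIV"
  shows "OU_resolvent_mat A \<mu> (H_op q \<phi>) = resolve q B \<mu> \<phi>"
  unfolding OU_resolvent_mat_def[abs_def] resolve_def[abs_def] OU_resolvent_eq_ou_avg[OF assms(1,2) H_op_test[OF assms(3)]] ..

lemma resolve_measurable:
  assumes "0 < Re \<mu>" "\<phi> \<in> test_functions UNIV"
  shows "resolve q B \<mu> \<phi> \<in> borel_measurable borel"
  unfolding resolve_def[abs_def]
  by (intro borel_measurable_vec_lambda borel_measurable_continuous_onI smooth_on_continuous[OF avg_smooth_ou[OF assms(1) H_op_test[OF assms(2)]]])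

lemma spatial_bound_iff:
  assumes F: "continuous_on UNIV F" "\<And>x. 0 \<le> F x" and C: "0 \<le> C" and \<phi>: "\<phi> \<in> test_functions UNIV"
    and u: "u \<in> borel_measurable borel"
  shows "u \<in> L2 (weighted F) \<and> L2_norm (weighted F) u \<le> C * L2_norm (weighted F) \<phi> \<longleftrightarrow>
    energy F u \<le> ennreal (C\<^sup>2) * energy F \<phi>"
proof -
  have mF[measurable]: "F \<in> borel_measurable borel" by (rule borel_measurable_continuous_onI[OF F(1)])
  have e: "(\<integral>\<^sup>+x. ennreal ((norm (w x))\<^sup>2) \<partial>weighted F) = energy F w"
    if [measurable]: "w \<in> borel_measurable borel" for w :: "real^'a \<Rightarrow> 'c::{real_normed_vector, second_countable_topology}"
    unfolding weighted_def energy_def using F(2)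
    by (subst nn_integral_density) (auto simp: ennreal_mult')
  have m: "w \<in> borel_measurable (weighted F)" if "w \<in> borel_measurable borel" for w :: "real^'a \<Rightarrow> 'c::{real_normed_vector, second_countable_topology}"
    using that by (simp add: weighted_def)
  have m\<phi>: "\<phi> \<in> borel_measurable borel" by (rule test_functions_measurable[OF \<phi>])
  have "\<phi> \<in> L2 (weighted F)"
    unfolding L2_iff[OF m[OF m\<phi>]] e[OF m\<phi>] energy_def
    by (rule test_functions_weighted_finite[OF \<phi> F])
  from L2_bound_iff[OF m[OF u] this C] show ?thesis unfolding e[OF u] e[OF m\<phi>] .
qed

lemma spacetime_bound_iff:
  fixes F :: "real^'d \<Rightarrow> real" and h :: "real \<times> (real^'d) \<Rightarrow> complex"
    and w :: "real \<times> (real^'d) \<Rightarrow> 'c::{real_normed_vector, second_countable_topology}"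
  assumes F: "continuous_on UNIV F" "\<And>x. 0 \<le> F x" and C: "0 \<le> C" and h: "h \<in> test_functions UNIV"
    and w: "w \<in> borel_measurable borel" and f: "\<And>p. p \<in> half_space \<Longrightarrow> f p = selfsim F w p"
  shows "f \<in> L2 (restrict_space lborel half_space) \<and>
      L2_norm (restrict_space lborel half_space) f \<le> C * L2_norm (restrict_space lborel half_space) (selfsim F h) \<longleftrightarrow>
    line_energy F w \<le> ennreal (C\<^sup>2) * line_energy F h"
proof -
  let ?M = "restrict_space lborel (half_space :: (real \<times> (real^'d)) set)"
  have mF[measurable]: "F \<in> borel_measurable borel" by (rule borel_measurable_continuous_onI[OF F(1)])
  have mh: "h \<in> borel_measurable borel" by (rule test_functions_measurable[OF h])
  have sp: "space ?M = half_space" by (simp add: space_restrict_space)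
  have m: "selfsim F u \<in> borel_measurable ?M" if "u \<in> borel_measurable borel"
    for u :: "real \<times> (real^'d) \<Rightarrow> 'e::{real_normed_vector, second_countable_topology}"
    using selfsim_measurable[OF mF that] by (intro measurable_restrict_space1) simp
  have e: "(\<integral>\<^sup>+p. ennreal ((norm (selfsim F u p))\<^sup>2) \<partial>?M) = line_energy F u" if "u \<in> borel_measurable borel"
    for u :: "real \<times> (real^'d) \<Rightarrow> 'e::{real_normed_vector, second_countable_topology}"
    unfolding line_energy_def energy_def by (rule selfsim_norm[OF mF that F(2)])
  have mf: "f \<in> borel_measurable ?M"
    using m[OF w] measurable_cong[of ?M f "selfsim F w" borel] f sp by blast
  have ef: "(\<integral>\<^sup>+p. ennreal ((norm (f p))\<^sup>2) \<partial>?M) = line_energy F w"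
    unfolding e[OF w, symmetric] by (rule nn_integral_cong) (simp add: sp f)
  have "line_energy F h < \<infinity>"
  proof -
    have "line_energy F h = (\<integral>\<^sup>+p. ennreal (F (snd p) * (norm (h p))\<^sup>2) \<partial>(lborel \<Otimes>\<^sub>M lborel))"
      unfolding line_energy_def energy_def using mh
      by (subst lborel.nn_integral_fst[symmetric]) (simp_all add: lborel_prod)
    then show ?thesis unfolding lborel_prod
      using test_functions_weighted_finite[OF h, of "\<lambda>p. F (snd p)"] F
      by (simp add: continuous_on_compose2[OF F(1)] continuous_intros)
  qed
  then have "selfsim F h \<in> L2 ?M" unfolding L2_iff[OF m[OF mh]] e[OF mh] .
  from L2_bound_iff[OF mf this C] show ?thesis unfolding ef e[OF mh] .
qed

section \<open>Frequencies: from the evolution to the resolvents and back\<close>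

lemma test_functions_tensor:
  fixes \<phi> :: "'b::euclidean_space \<Rightarrow> complex" and f :: "'a::euclidean_space \<Rightarrow> complex"
  assumes "f \<in> test_functions UNIV" "\<phi> \<in> test_functions UNIV"
  shows "(\<lambda>p. f (fst p) * \<phi> (snd p)) \<in> test_functions UNIV"
proof -
  obtain C where C: "compact C" "\<And>x. x \<notin> C \<Longrightarrow> f x = 0" using assms(1) test_functions_iff by metis
  obtain D where D: "compact D" "\<And>x. x \<notin> D \<Longrightarrow> \<phi> x = 0" using assms(2) test_functions_iff by metis
  have "smooth_on UNIV (\<lambda>p. f (fst p) * \<phi> (snd p))"
    by (intro smooth_on_mult smooth_on_compose[OF test_functions_smooth[OF assms(1)]]
        smooth_on_compose[OF test_functions_smooth[OF assms(2)]] smooth_on_linear bounded_linear_fst bounded_linear_snd) auto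
  moreover have "compact (C \<times> D)" by (rule compact_Times[OF C(1) D(1)])
  moreover have "f (fst p) * \<phi> (snd p) = 0" if "p \<notin> C \<times> D" for p
    using that C(2)[of "fst p"] D(2)[of "snd p"] by (auto simp: mem_Times_iff)
  ultimately show ?thesis unfolding test_functions_iff by blast
qed

lemma bump_energy:
  "0 < (\<integral>\<^sup>+t. ennreal ((norm (bump (t::real)))\<^sup>2) \<partial>lborel)" "(\<integral>\<^sup>+t. ennreal ((norm (bump (t::real)))\<^sup>2) \<partial>lborel) < \<infinity>"
proof -
  show "(\<integral>\<^sup>+t. ennreal ((norm (bump (t::real)))\<^sup>2) \<partial>lborel) < \<infinity>"
    using test_functions_weighted_finite[OF bump_test, of "\<lambda>_. 1"] by simp
  have "exp (- 1) \<le> norm (bump t)" if "t \<in> {- 1 / 2..1 / 2}" for t :: real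
  proof -
    have "\<bar>t\<bar> \<le> 1 / 2" using that by auto
    then have "t * t \<le> 1 / 2" using mult_mono[of "\<bar>t\<bar>" "1 / 2" "\<bar>t\<bar>" "1 / 2"] by (simp add: abs_mult_self_eq)
    then have "inverse (1 - t * t) \<le> inverse (1 / 2)" by (intro le_imp_inverse_le) auto
    then have "exp (- 2) \<le> flat 1 (1 - t * t)" using \<open>t * t \<le> 1 / 2\<close> by (simp add: flat_def)
    then have "exp 1 * exp (- 2) \<le> exp 1 * flat 1 (1 - t * t)" by (intro mult_left_mono) auto
    moreover have "0 \<le> flat 1 (1 - t * t)" by (simp add: flat_def)
    ultimately show ?thesis by (simp add: bump_def norm_mult exp_add[symmetric])
  qed
  then have le: "ennreal ((exp (- 1))\<^sup>2) * indicator {- 1 / 2..1 / 2} t \<le> ennreal ((norm (bump t))\<^sup>2)" for t :: real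
    by (cases "t \<in> {- 1 / 2..1 / 2}") (auto intro!: ennreal_leI power_mono)
  have "0 < ennreal ((exp (- 1))\<^sup>2) * emeasure lborel {- 1 / 2..1 / 2::real}"
    by (simp add: ennreal_zero_less_mult_iff)
  also have "\<dots> = (\<integral>\<^sup>+t. ennreal ((exp (- 1))\<^sup>2) * indicator {- 1 / 2..1 / 2} t \<partial>(lborel :: real measure))"
    by (subst nn_integral_cmult_indicator) auto
  also have "\<dots> \<le> (\<integral>\<^sup>+t. ennreal ((norm (bump (t::real)))\<^sup>2) \<partial>lborel)"
    by (rule nn_integral_mono[OF le])
  finally show "0 < (\<integral>\<^sup>+t. ennreal ((norm (bump (t::real)))\<^sup>2) \<partial>lborel)" .
qed

text \<open>Slowly modulated waves \<open>bump (\<sigma> / n) exp (\<i> \<omega> \<sigma>) \<phi> x\<close> isolate one frequency; Fatou's lemma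
  makes pointwise convergence of the rescaled responses sufficient.\<close>
theorem resolve_bound_from_evolution:
  fixes F :: "real^'d \<Rightarrow> real"
  assumes F: "continuous_on UNIV F" "\<And>x. 0 \<le> F x" and c: "0 < c"
    and bound: "\<And>h. h \<in> test_functions UNIV \<Longrightarrow>
        line_energy F (evolve_mat q B (complex_of_real c) h) \<le> ennreal (C\<^sup>2) * line_energy F h"
    and \<phi>: "\<phi> \<in> test_functions UNIV"
  shows "energy F (resolve q B (complex_of_real c - \<i> * complex_of_real \<omega>) \<phi>) \<le> ennreal (C\<^sup>2) * energy F \<phi>"
proof -
  let ?\<mu> = "complex_of_real c - \<i> * complex_of_real \<omega>"
  have mF[measurable]: "F \<in> borel_measurable borel" by (rule borel_measurable_continuous_onI[OF F(1)])
  have \<mu>: "0 < Re ?\<mu>" "0 < Re (complex_of_real c)" using c by auto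
  define N where "N = (\<lambda>n::nat. real (Suc n))"
  have N: "0 < N n" for n by (simp add: N_def)
  define b where "b = (bump :: real \<Rightarrow> complex)"
  have bt: "b \<in> test_functions UNIV" unfolding b_def by (rule bump_test)
  define f where "f = (\<lambda>n \<sigma>. exp (\<i> * complex_of_real \<omega> * complex_of_real \<sigma>) * b ((1 / N n) *\<^sub>R \<sigma>))"
  have ft: "f n \<in> test_functions UNIV" for n
    unfolding f_def using N[of n]
    by (intro test_functions_mult_smooth test_functions_dilate bt smooth_on_exp_of_real) auto
  define h where "h = (\<lambda>n p. f n (fst p) * \<phi> (snd p))"
  have ht: "h n \<in> test_functions UNIV" for n unfolding h_def by (rule test_functions_tensor[OF ft \<phi>])
  define K where "K = (\<lambda>i j x. H_op q \<phi> x $ i $ j)"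
  have Kt: "K i j \<in> test_functions UNIV" for i j unfolding K_def by (rule H_op_test[OF \<phi>])
  note [measurable] = test_functions_measurable[OF Kt] test_functions_measurable[OF bt] test_functions_measurable[OF \<phi>]
  have HK: "H_entry q i j (h n) (\<sigma>, x) = f n \<sigma> * K i j x" for i j n \<sigma> x
  proof -
    have 1: "partial_deriv l (\<lambda>x. f n \<sigma> * \<phi> x) = (\<lambda>x. f n \<sigma> * partial_deriv l \<phi> x)" for l
      unfolding partial_deriv_eq using dir_deriv_cmult[OF \<phi>] by blast
    have 2: "partial_deriv k (\<lambda>x. f n \<sigma> * partial_deriv l \<phi> x) x = f n \<sigma> * partial_deriv k (partial_deriv l \<phi>) x" for k l
      unfolding partial_deriv_eq[of k] by (rule dir_deriv_cmult[OF test_functions_partial_deriv[OF \<phi>]])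
    have "H_entry q i j (h n) (\<sigma>, x) = H_op q (\<lambda>x. f n \<sigma> * \<phi> x) x $ i $ j"
      using H_op_slice[OF ht, of q n \<sigma> x i j] by (simp add: h_def)
    also have "\<dots> = f n \<sigma> * K i j x"
      unfolding K_def H_op_entry 1 2 by (simp add: sum_distrib_left mult_ac)
    finally show ?thesis .
  qed
  define Y where "Y = (\<lambda>n i j \<sigma> x. \<integral>p. ou_weight ?\<mu> p * (b (\<sigma> + (1 / N n) * fst p) * K i j (ou_contr p *\<^sub>R x + ou_shift B p)) \<partial>lborel)"
  have evY: "norm (evolve B (complex_of_real c) (H_entry q i j (h n)) (N n * \<sigma>, x)) = norm (Y n i j \<sigma> x)" for n i j \<sigma> x
  proof -
    have "ou_weight (complex_of_real c) p * H_entry q i j (h n) (N n * \<sigma> + fst p, y)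
        = exp (\<i> * complex_of_real (\<omega> * (N n * \<sigma>))) * (ou_weight ?\<mu> p * (b (\<sigma> + (1 / N n) * fst p) * K i j y))" for p :: "real \<times> (real^'d)" and y
    proof -
      have "ou_decay ?\<mu> t = ou_decay (complex_of_real c) t * exp (\<i> * complex_of_real (\<omega> * t))" for t
        by (simp add: ou_decay_def exp_add[symmetric] algebra_simps)
      moreover have "(1 / N n) *\<^sub>R (N n * \<sigma> + fst p) = \<sigma> + (1 / N n) * fst p"
        using N[of n] by (simp add: field_simps)
      moreover have "exp (\<i> * complex_of_real \<omega> * complex_of_real (N n * \<sigma> + fst p)) = exp (\<i> * complex_of_real (\<omega> * (N n * \<sigma>))) * exp (\<i> * complex_of_real (\<omega> * fst p))"
        by (simp add: exp_add[symmetric] algebra_simps)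
      ultimately show ?thesis unfolding HK f_def ou_weight_def by (simp only: mult_ac)
    qed
    then have "evolve B (complex_of_real c) (H_entry q i j (h n)) (N n * \<sigma>, x) = exp (\<i> * complex_of_real (\<omega> * (N n * \<sigma>))) * Y n i j \<sigma> x"
      unfolding evolve_def Y_def by simp
    then show ?thesis by (simp add: norm_mult)
  qed
  have Ylim: "(\<lambda>n. Y n i j \<sigma> x) \<longlonglongrightarrow> b \<sigma> * ou_avg B ?\<mu> (K i j) x" for i j \<sigma> x
  proof -
    obtain Kb where Kb: "\<And>t. norm (b t) \<le> Kb" using test_functions_bounded[OF bt] by metis
    obtain KK where KK: "\<And>y. norm (K i j y) \<le> KK" using test_functions_bounded[OF Kt] by metis
    have "(\<lambda>n. Y n i j \<sigma> x) \<longlonglongrightarrow> (\<integral>p. ou_weight ?\<mu> p * (b \<sigma> * K i j (ou_contr p *\<^sub>R x + ou_shift B p)) \<partial>lborel)"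
      unfolding Y_def
    proof (rule integral_dominated_convergence[where w="\<lambda>p. norm (ou_weight ?\<mu> p :: complex) * (Kb * KK)"])
      show "integrable lborel (\<lambda>p::real \<times> (real^'d). norm (ou_weight ?\<mu> p) * (Kb * KK))"
        by (intro integrable_mult_left integrable_norm integrable_ou_weight \<mu>)
      show "AE p in lborel. (\<lambda>n. ou_weight ?\<mu> p * (b (\<sigma> + (1 / N n) * fst p) * K i j (ou_contr p *\<^sub>R x + ou_shift B p))) \<longlonglongrightarrow> ou_weight ?\<mu> p * (b \<sigma> * K i j (ou_contr p *\<^sub>R x + ou_shift B p))"
      proof (rule AE_I2)
        fix p :: "real \<times> (real^'d)"
        have "(\<lambda>n. 1 / N n) \<longlonglongrightarrow> 0" unfolding N_def by real_asymp
        then have "(\<lambda>n. \<sigma> + (1 / N n) * fst p) \<longlonglongrightarrow> \<sigma> + 0 * fst p" by (intro tendsto_intros)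
        then have "(\<lambda>n. b (\<sigma> + (1 / N n) * fst p)) \<longlonglongrightarrow> b (\<sigma> + 0 * fst p)"
          using test_functions_continuous[OF bt] by (intro isCont_tendsto_compose[of _ b]) (auto simp: continuous_on_eq_continuous_at)
        then show "(\<lambda>n. ou_weight ?\<mu> p * (b (\<sigma> + (1 / N n) * fst p) * K i j (ou_contr p *\<^sub>R x + ou_shift B p))) \<longlonglongrightarrow> ou_weight ?\<mu> p * (b \<sigma> * K i j (ou_contr p *\<^sub>R x + ou_shift B p))"
          by (intro tendsto_intros) simp
      qed
      show "AE p in lborel. norm (ou_weight ?\<mu> p * (b (\<sigma> + (1 / N n) * fst p) * K i j (ou_contr p *\<^sub>R x + ou_shift B p))) \<le> norm (ou_weight ?\<mu> p :: complex) * (Kb * KK)" for n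
        unfolding norm_mult by (intro AE_I2 mult_left_mono mult_mono Kb KK order_trans[OF norm_ge_zero Kb]) auto
    qed measurable
    also have "(\<integral>p. ou_weight ?\<mu> p * (b \<sigma> * K i j (ou_contr p *\<^sub>R x + ou_shift B p)) \<partial>lborel) = b \<sigma> * ou_avg B ?\<mu> (K i j) x"
      unfolding ou_avg_def avg_def by (subst integral_mult_right_zero[symmetric]) (simp only: mult_ac)
    finally show ?thesis .
  qed
  define S where "S = (\<lambda>n \<sigma> x. F x * (\<Sum>i\<in>UNIV. \<Sum>j\<in>UNIV. (norm (Y n i j \<sigma> x))\<^sup>2))"
  have [measurable]: "(\<lambda>p. S n (fst p) (snd p)) \<in> borel_measurable borel" for n
    unfolding S_def Y_def by measurable
  have S_measurable[measurable]: "(\<lambda>x. S n \<sigma> x) \<in> borel_measurable borel" for n \<sigma>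
    unfolding S_def Y_def by measurable
  have Slim: "(\<lambda>n. ennreal (S n \<sigma> x)) \<longlonglongrightarrow> ennreal ((norm (b \<sigma>))\<^sup>2 * (F x * (norm (resolve q B ?\<mu> \<phi> x))\<^sup>2))" for \<sigma> x
  proof (rule tendsto_ennrealI)
    have "(\<lambda>n. S n \<sigma> x) \<longlonglongrightarrow> F x * (\<Sum>i\<in>UNIV. \<Sum>j\<in>UNIV. (norm (b \<sigma> * ou_avg B ?\<mu> (K i j) x))\<^sup>2)"
      unfolding S_def by (intro tendsto_intros Ylim)
    also have "F x * (\<Sum>i\<in>UNIV. \<Sum>j\<in>UNIV. (norm (b \<sigma> * ou_avg B ?\<mu> (K i j) x))\<^sup>2) = (norm (b \<sigma>))\<^sup>2 * (F x * (norm (resolve q B ?\<mu> \<phi> x))\<^sup>2)"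
      unfolding norm_matrix_square by (simp add: resolve_def K_def norm_mult power_mult_distrib sum_distrib_left mult_ac)
    finally show "(\<lambda>n. S n \<sigma> x) \<longlonglongrightarrow> (norm (b \<sigma>))\<^sup>2 * (F x * (norm (resolve q B ?\<mu> \<phi> x))\<^sup>2)" .
  qed
  let ?b2 = "\<integral>\<^sup>+\<sigma>. ennreal ((norm (b \<sigma>))\<^sup>2) \<partial>lborel"
  let ?R = "resolve q B ?\<mu> \<phi>"
  have [measurable]: "?R \<in> borel_measurable borel" by (rule resolve_measurable[OF \<mu>(1) \<phi>])
  have Sn: "(\<integral>\<^sup>+\<sigma>. \<integral>\<^sup>+x. ennreal (S n \<sigma> x) \<partial>lborel \<partial>lborel) \<le> ennreal (C\<^sup>2) * (?b2 * energy F \<phi>)" for n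
  proof -
    have "line_energy F (evolve_mat q B (complex_of_real c) (h n)) = ennreal \<bar>N n\<bar> * (\<integral>\<^sup>+\<sigma>. energy F (\<lambda>x. evolve_mat q B (complex_of_real c) (h n) (N n * \<sigma>, x)) \<partial>lborel)"
      by (rule line_energy_dilate[OF mF evolve_mat_measurable[OF ht]]) (use N[of n] in simp)
    also have "(\<lambda>\<sigma>. energy F (\<lambda>x. evolve_mat q B (complex_of_real c) (h n) (N n * \<sigma>, x))) = (\<lambda>\<sigma>. \<integral>\<^sup>+x. ennreal (S n \<sigma> x) \<partial>lborel)"
      unfolding energy_def norm_matrix_square by (simp add: evolve_mat_def evY S_def)
    finally have 1: "line_energy F (evolve_mat q B (complex_of_real c) (h n)) = ennreal \<bar>N n\<bar> * (\<integral>\<^sup>+\<sigma>. \<integral>\<^sup>+x. ennreal (S n \<sigma> x) \<partial>lborel \<partial>lborel)" .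
    have nf: "norm (f n (N n * \<sigma>)) = norm (b \<sigma>)" for \<sigma>
      using N[of n] by (simp add: f_def norm_mult norm_exp_eq_Re)
    have "line_energy F (h n) = ennreal \<bar>N n\<bar> * (\<integral>\<^sup>+\<sigma>. energy F (\<lambda>x. h n (N n * \<sigma>, x)) \<partial>lborel)"
      by (rule line_energy_dilate[OF mF test_functions_measurable[OF ht]]) (use N[of n] in simp)
    also have "(\<lambda>\<sigma>. energy F (\<lambda>x. h n (N n * \<sigma>, x))) = (\<lambda>\<sigma>. ennreal ((norm (b \<sigma>))\<^sup>2) * energy F \<phi>)"
    proof
      fix \<sigma>
      have "energy F (\<lambda>x. h n (N n * \<sigma>, x)) = (\<integral>\<^sup>+x. ennreal ((norm (b \<sigma>))\<^sup>2) * ennreal (F x * (norm (\<phi> x))\<^sup>2) \<partial>lborel)"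
        unfolding energy_def by (intro nn_integral_cong) (simp add: h_def norm_mult nf[unfolded mult.commute[of "N n"]] power_mult_distrib ennreal_mult'[symmetric] mult_ac)
      then show "energy F (\<lambda>x. h n (N n * \<sigma>, x)) = ennreal ((norm (b \<sigma>))\<^sup>2) * energy F \<phi>"
        by (simp add: energy_def nn_integral_cmult)
    qed
    finally have 2: "line_energy F (h n) = ennreal \<bar>N n\<bar> * (?b2 * energy F \<phi>)"
      by (simp add: nn_integral_multc)
    have "ennreal \<bar>N n\<bar> * (\<integral>\<^sup>+\<sigma>. \<integral>\<^sup>+x. ennreal (S n \<sigma> x) \<partial>lborel \<partial>lborel) \<le> ennreal \<bar>N n\<bar> * (ennreal (C\<^sup>2) * (?b2 * energy F \<phi>))"
      using bound[OF ht, of n] unfolding 1 2 by (simp only: mult.left_commute)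
    moreover have "0 < ennreal \<bar>N n\<bar>" "ennreal \<bar>N n\<bar> < top" using N[of n] by auto
    ultimately show ?thesis by (simp add: ennreal_mult_le_mult_iff)
  qed
  have "?b2 * energy F ?R = (\<integral>\<^sup>+\<sigma>. ennreal ((norm (b \<sigma>))\<^sup>2) * energy F ?R \<partial>lborel)"
    by (simp add: nn_integral_multc)
  also have "\<dots> = (\<integral>\<^sup>+\<sigma>. \<integral>\<^sup>+x. liminf (\<lambda>n. ennreal (S n \<sigma> x)) \<partial>lborel \<partial>lborel)"
  proof (rule nn_integral_cong)
    fix \<sigma>
    have "liminf (\<lambda>n. ennreal (S n \<sigma> x)) = ennreal ((norm (b \<sigma>))\<^sup>2) * ennreal (F x * (norm (?R x))\<^sup>2)" for x
      using lim_imp_Liminf[OF sequentially_bot Slim[of \<sigma> x]] by (simp add: ennreal_mult')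
    then show "ennreal ((norm (b \<sigma>))\<^sup>2) * energy F ?R = (\<integral>\<^sup>+x. liminf (\<lambda>n. ennreal (S n \<sigma> x)) \<partial>lborel)"
      by (simp add: energy_def nn_integral_cmult)
  qed
  also have "\<dots> \<le> (\<integral>\<^sup>+\<sigma>. liminf (\<lambda>n. \<integral>\<^sup>+x. ennreal (S n \<sigma> x) \<partial>lborel) \<partial>lborel)"
    by (intro nn_integral_mono nn_integral_liminf) measurable
  also have "\<dots> \<le> liminf (\<lambda>n. \<integral>\<^sup>+\<sigma>. \<integral>\<^sup>+x. ennreal (S n \<sigma> x) \<partial>lborel \<partial>lborel)"
  proof (rule nn_integral_liminf)
    fix n
    have "(\<lambda>(\<sigma>, x). ennreal (S n \<sigma> x)) \<in> borel_measurable (borel \<Otimes>\<^sub>M lborel)"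
      unfolding case_prod_beta S_def Y_def by measurable
    then show "(\<lambda>\<sigma>. \<integral>\<^sup>+x. ennreal (S n \<sigma> x) \<partial>lborel) \<in> borel_measurable lborel"
      using lborel.borel_measurable_nn_integral[of "\<lambda>\<sigma> x. ennreal (S n \<sigma> x)" borel] by simp
  qed
  also have "\<dots> \<le> liminf (\<lambda>n. ennreal (C\<^sup>2) * (?b2 * energy F \<phi>))"
    by (intro Liminf_mono always_eventually allI Sn)
  also have "\<dots> = ?b2 * (ennreal (C\<^sup>2) * energy F \<phi>)" by (simp add: Liminf_const mult.left_commute)
  finally have "?b2 * energy F ?R \<le> ?b2 * (ennreal (C\<^sup>2) * energy F \<phi>)" .
  then show ?thesis using bump_energy unfolding b_def[symmetric] by (simp add: ennreal_mult_le_mult_iff)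
qed

text \<open>The Fourier transform in time of a test function is an average over time translates, hence a
  test function in space, and it commutes with spatial derivatives.\<close>
lemma ft_slice_eq_avg:
  fixes f :: "real \<times> (real^'d) \<Rightarrow> complex"
  assumes "\<And>p. M < \<bar>fst p\<bar> \<Longrightarrow> f p = 0"
  shows "ft (\<lambda>\<sigma>. f (\<sigma>, x)) \<omega> =
    avg lborel (\<lambda>\<sigma>. indicator {- M..M} \<sigma> *\<^sub>R exp (- \<i> * complex_of_real (\<omega> * \<sigma>))) (\<lambda>_. 1) (\<lambda>\<sigma>. (\<sigma>, 0)) f (0, x)"
proof -
  have "exp (- \<i> * complex_of_real (\<omega> * \<sigma>)) * f (\<sigma>, x)
      = (indicator {- M..M} \<sigma> *\<^sub>R exp (- \<i> * complex_of_real (\<omega> * \<sigma>))) * f (\<sigma>, x)" for \<sigma>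
    using assms[of "(\<sigma>, x)"] by (cases "\<bar>\<sigma>\<bar> \<le> M") (auto simp: indicator_def)
  then show ?thesis unfolding ft_def avg_def by simp
qed

lemma integrable_cutoff_exp:
  "integrable lborel (\<lambda>\<sigma>. indicator {- M..M} \<sigma> *\<^sub>R exp (- \<i> * complex_of_real (\<omega> * \<sigma>)))"
  using borel_integrable_compact[of "{- M..M}" "\<lambda>\<sigma>. exp (- \<i> * complex_of_real (\<omega> * \<sigma>))"]
  by (simp add: continuous_intros)

lemma test_functions_time_bound:
  fixes f :: "real \<times> (real^'d) \<Rightarrow> complex"
  assumes "f \<in> test_functions U"
  obtains M where "\<And>p. M < \<bar>fst p\<bar> \<Longrightarrow> f p = 0"
proof -
  obtain C where C: "compact C" "\<And>p. p \<notin> C \<Longrightarrow> f p = 0" using assms test_functions_iff by metis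
  obtain R where R: "\<And>p. p \<in> C \<Longrightarrow> norm p \<le> R" using compact_imp_bounded[OF C(1)] bounded_iff by metis
  have "f p = 0" if "R < \<bar>fst p\<bar>" for p
    using that R[of p] norm_fst_le[of "fst p" "snd p"] C(2)[of p] by (cases "p \<in> C") auto
  then show ?thesis using that by blast
qed

lemma ft_slice_dir_deriv:
  fixes f :: "real \<times> (real^'d) \<Rightarrow> complex"
  assumes f: "f \<in> test_functions UNIV"
  shows "dir_deriv v (\<lambda>x. ft (\<lambda>\<sigma>. f (\<sigma>, x)) \<omega>) x = ft (\<lambda>\<sigma>. dir_deriv (0, v) f (\<sigma>, x)) \<omega>"
proof -
  let ?D = "dir_deriv (0, v) f"
  obtain M1 where M1: "\<And>p. M1 < \<bar>fst p\<bar> \<Longrightarrow> f p = 0" using test_functions_time_bound[OF f] by metis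
  obtain M2 where M2: "\<And>p. M2 < \<bar>fst p\<bar> \<Longrightarrow> ?D p = 0"
    using test_functions_time_bound[OF test_functions_derivative[OF f]] by metis
  define M where "M = max M1 M2"
  have M: "\<And>p. M < \<bar>fst p\<bar> \<Longrightarrow> f p = 0" "\<And>p. M < \<bar>fst p\<bar> \<Longrightarrow> ?D p = 0"
    using M1 M2 by (auto simp: M_def)
  let ?w = "\<lambda>\<sigma>. indicator {- M..M} \<sigma> *\<^sub>R exp (- \<i> * complex_of_real (\<omega> * \<sigma>))"
  have \<xi>: "(\<lambda>\<sigma>::real. (\<sigma>, 0::real^'d)) \<in> borel_measurable lborel" by simp
  have "((\<lambda>x. (0::real, x)) has_derivative (\<lambda>v. (0, v))) (at x)"
    by (intro has_derivative_Pair has_derivative_const has_derivative_ident)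
  from has_derivative_compose[OF this avg_has_derivative[OF integrable_cutoff_exp[of M \<omega>] _ \<xi> f, of "\<lambda>_. 1"]]
  have "((\<lambda>x. avg lborel ?w (\<lambda>_. 1) (\<lambda>\<sigma>. (\<sigma>, 0)) f (0, x)) has_derivative
      (\<lambda>v. avg lborel ?w (\<lambda>_. 1) (\<lambda>\<sigma>. (\<sigma>, 0)) (dir_deriv (0, v) f) (0, x))) (at x)"
    by simp
  then have "dir_deriv v (\<lambda>x. avg lborel ?w (\<lambda>_. 1) (\<lambda>\<sigma>. (\<sigma>, 0)) f (0, x)) x = avg lborel ?w (\<lambda>_. 1) (\<lambda>\<sigma>. (\<sigma>, 0)) ?D (0, x)"
    by (rule dir_derivI)
  moreover have "ft (\<lambda>\<sigma>. f (\<sigma>, y)) \<omega> = avg lborel ?w (\<lambda>_. 1) (\<lambda>\<sigma>. (\<sigma>, 0)) f (0, y)" for y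
    by (rule ft_slice_eq_avg) (rule M(1))
  moreover have "ft (\<lambda>\<sigma>. ?D (\<sigma>, x)) \<omega> = avg lborel ?w (\<lambda>_. 1) (\<lambda>\<sigma>. (\<sigma>, 0)) ?D (0, x)"
    by (rule ft_slice_eq_avg) (rule M(2))
  ultimately show ?thesis by presburger
qed

lemma ft_slice_test:
  fixes f :: "real \<times> (real^'d) \<Rightarrow> complex"
  assumes f: "f \<in> test_functions UNIV"
  shows "(\<lambda>x. ft (\<lambda>\<sigma>. f (\<sigma>, x)) \<omega>) \<in> test_functions UNIV"
proof -
  obtain M where M: "\<And>p. M < \<bar>fst p\<bar> \<Longrightarrow> f p = 0" using test_functions_time_bound[OF f] by metis
  obtain C where C: "compact C" "\<And>p. p \<notin> C \<Longrightarrow> f p = 0" using f test_functions_iff by metis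
  have e: "ft (\<lambda>\<sigma>. f (\<sigma>, x)) \<omega> =
      avg lborel (\<lambda>\<sigma>. indicator {- M..M} \<sigma> *\<^sub>R exp (- \<i> * complex_of_real (\<omega> * \<sigma>))) (\<lambda>_. 1) (\<lambda>\<sigma>. (\<sigma>, 0)) f (0, x)" for x
    by (rule ft_slice_eq_avg) (rule M)
  have "smooth_on UNIV (\<lambda>x. ft (\<lambda>\<sigma>. f (\<sigma>, x)) \<omega>)"
    unfolding e
    by (rule smooth_on_compose[OF avg_smooth[OF integrable_cutoff_exp _ _ f]]) (auto intro: smooth_on_Pair)
  moreover have "compact (snd ` C)" by (intro compact_continuous_image C(1) continuous_intros)
  moreover have "ft (\<lambda>\<sigma>. f (\<sigma>, x)) \<omega> = 0" if "x \<notin> snd ` C" for x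
  proof -
    have "f (\<sigma>, x) = 0" for \<sigma> using that C(2)[of "(\<sigma>, x)"] by force
    then show ?thesis by (simp add: ft_def)
  qed
  ultimately show ?thesis unfolding test_functions_iff by blast
qed

lemma integrable_slice:
  fixes f :: "real \<times> (real^'d) \<Rightarrow> complex"
  assumes f: "f \<in> test_functions UNIV"
  shows "integrable lborel (\<lambda>\<sigma>. f (\<sigma>, x))"
proof -
  obtain M where M: "\<And>p. M < \<bar>fst p\<bar> \<Longrightarrow> f p = 0" using test_functions_time_bound[OF f] by metis
  have "continuous_on {- M..M} (\<lambda>\<sigma>. f (\<sigma>, x))"
    by (intro continuous_on_compose2[OF test_functions_continuous[OF f]] continuous_intros) auto
  then have "integrable lborel (\<lambda>\<sigma>. indicator {- M..M} \<sigma> *\<^sub>R f (\<sigma>, x))" by (intro borel_integrable_compact) auto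
  moreover have "(\<lambda>\<sigma>. indicator {- M..M} \<sigma> *\<^sub>R f (\<sigma>, x)) = (\<lambda>\<sigma>. f (\<sigma>, x))"
  proof
    fix \<sigma>
    show "indicator {- M..M} \<sigma> *\<^sub>R f (\<sigma>, x) = f (\<sigma>, x)"
      using M[of "(\<sigma>, x)"] by (cases "\<bar>\<sigma>\<bar> \<le> M") (auto simp: indicator_def)
  qed
  ultimately show ?thesis by simp
qed

lemma ft_H_entry:
  fixes h :: "real \<times> (real^'d) \<Rightarrow> complex"
  assumes h: "h \<in> test_functions UNIV"
  shows "H_op q (\<lambda>x. ft (\<lambda>\<sigma>. h (\<sigma>, x)) \<omega>) x $ i $ j = ft (\<lambda>\<sigma>. H_entry q i j h (\<sigma>, x)) \<omega>"
proof -
  have 1: "partial_deriv l (\<lambda>x. ft (\<lambda>\<sigma>. h (\<sigma>, x)) \<omega>) = (\<lambda>x. ft (\<lambda>\<sigma>. dir_deriv (0, axis l 1) h (\<sigma>, x)) \<omega>)" for l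
    unfolding partial_deriv_eq using ft_slice_dir_deriv[OF h] by blast
  have 2: "partial_deriv k (\<lambda>x. ft (\<lambda>\<sigma>. dir_deriv (0, axis l 1) h (\<sigma>, x)) \<omega>) x
      = ft (\<lambda>\<sigma>. dir_deriv (0, axis k 1) (dir_deriv (0, axis l 1) h) (\<sigma>, x)) \<omega>" for k l
    unfolding partial_deriv_eq by (rule ft_slice_dir_deriv[OF test_functions_derivative[OF h]])
  have i: "integrable lborel (\<lambda>\<sigma>. exp (- \<i> * of_real (\<omega> * \<sigma>)) * dir_deriv (0, axis k 1) (dir_deriv (0, axis l 1) h) (\<sigma>, x))" for k l
    by (intro ft_integrable integrable_slice test_functions_derivative h)
  show ?thesis
    unfolding H_op_entry 1 2
    unfolding ft_def H_entry_def sum_distrib_left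
      mult.left_commute[of "exp (- \<i> * of_real (\<omega> * _))"]
    using i by (simp add: Bochner_Integration.integral_sum Bochner_Integration.integrable_sum)
qed

lemma evolve_bounded:
  assumes \<mu>: "0 < Re \<mu>" and f: "f \<in> test_functions UNIV"
  obtains K where "\<And>\<sigma> x. norm (evolve B \<mu> f (\<sigma>, x)) \<le> K"
proof -
  obtain K where K: "\<And>z. norm (f z) \<le> K" using test_functions_bounded[OF f] by metis
  have "norm (evolve B \<mu> f (\<sigma>, x)) \<le> (\<integral>p. norm (ou_weight \<mu> (p :: real \<times> (real^'a))) * K \<partial>lborel)" for \<sigma> x
    unfolding evolve_def
  proof (rule order_trans[OF integral_norm_bound integral_mono])
    show "integrable lborel (\<lambda>p. norm (ou_weight \<mu> p * f (fst (\<sigma>, x) + fst p, ou_contr p *\<^sub>R snd (\<sigma>, x) + ou_shift B p)))"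
      using evolve_integrable[OF \<mu> f] by simp
    show "integrable lborel (\<lambda>p::real \<times> (real^'a). norm (ou_weight \<mu> p) * K)"
      by (intro integrable_mult_left integrable_norm integrable_ou_weight \<mu>)
  qed (auto simp: norm_mult intro!: mult_left_mono K)
  then show ?thesis using that by blast
qed

text \<open>Test functions are Lipschitz, and the weight is integrable.\<close>
lemma evolve_continuous:
  assumes \<mu>: "0 < Re \<mu>" and f: "f \<in> test_functions UNIV"
  shows "continuous_on UNIV (\<lambda>\<sigma>. evolve B \<mu> f (\<sigma>, x))"
proof -
  obtain L where L: "0 \<le> L" "\<And>y z. norm (f y - f z) \<le> L * norm (y - z)" using test_functions_lipschitz[OF f] by metis
  let ?W = "\<integral>p. norm (ou_weight \<mu> (p :: real \<times> (real^'a))) \<partial>lborel"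
  have lip: "norm (evolve B \<mu> f (\<sigma>, x) - evolve B \<mu> f (\<tau>, x)) \<le> ?W * L * \<bar>\<sigma> - \<tau>\<bar>" for \<sigma> \<tau>
  proof -
    let ?f = "\<lambda>\<sigma> p. f (\<sigma> + fst p, ou_contr p *\<^sub>R x + ou_shift B p)"
    have "evolve B \<mu> f (\<sigma>, x) - evolve B \<mu> f (\<tau>, x) = (\<integral>p. ou_weight \<mu> p * ?f \<sigma> p - ou_weight \<mu> p * ?f \<tau> p \<partial>lborel)"
      unfolding evolve_def using evolve_integrable[OF \<mu> f] by simp
    also have "norm \<dots> \<le> (\<integral>p. norm (ou_weight \<mu> (p :: real \<times> (real^'a))) * (L * \<bar>\<sigma> - \<tau>\<bar>) \<partial>lborel)"
    proof (rule order_trans[OF integral_norm_bound integral_mono])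
      show "integrable lborel (\<lambda>p. norm (ou_weight \<mu> p * ?f \<sigma> p - ou_weight \<mu> p * ?f \<tau> p))"
        by (intro integrable_norm Bochner_Integration.integrable_diff evolve_integrable[OF \<mu> f])
      show "integrable lborel (\<lambda>p::real \<times> (real^'a). norm (ou_weight \<mu> p) * (L * \<bar>\<sigma> - \<tau>\<bar>))"
        by (intro integrable_mult_left integrable_norm integrable_ou_weight \<mu>)
      fix p :: "real \<times> (real^'a)"
      have "norm (?f \<sigma> p - ?f \<tau> p) \<le> L * \<bar>\<sigma> - \<tau>\<bar>"
        using L(2)[of "(\<sigma> + fst p, ou_contr p *\<^sub>R x + ou_shift B p)" "(\<tau> + fst p, ou_contr p *\<^sub>R x + ou_shift B p)"]
        by (simp add: norm_Pair)
      then show "norm (ou_weight \<mu> p * ?f \<sigma> p - ou_weight \<mu> p * ?f \<tau> p) \<le> norm (ou_weight \<mu> p) * (L * \<bar>\<sigma> - \<tau>\<bar>)"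
        by (simp add: right_diff_distrib[symmetric] norm_mult mult_left_mono)
    qed
    finally show ?thesis by (simp add: mult.assoc)
  qed
  have W0: "0 \<le> ?W" by (rule integral_nonneg_AE) simp
  show ?thesis
  proof (rule continuous_on_eq_continuous_at[THEN iffD2, OF open_UNIV], rule ballI)
    fix \<sigma>
    have "((\<lambda>\<tau>. ?W * L * \<bar>\<tau> - \<sigma>\<bar>) \<longlongrightarrow> 0) (at \<sigma>)" by (auto intro!: tendsto_eq_intros)
    then have "((\<lambda>\<tau>. evolve B \<mu> f (\<tau>, x) - evolve B \<mu> f (\<sigma>, x)) \<longlongrightarrow> 0) (at \<sigma>)"
      by (rule Lim_null_comparison[rotated]) (simp add: lip)
    then show "isCont (\<lambda>\<sigma>. evolve B \<mu> f (\<sigma>, x)) \<sigma>" unfolding isCont_def by (rule LIM_zero_cancel)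
  qed
qed

text \<open>The time shift in \<open>evolve\<close> becomes a factor \<open>exp (\<i> \<omega> \<tau>)\<close>, which moves the resolvent parameter
  from \<open>c\<close> to \<open>c - \<i> \<omega>\<close>.\<close>
lemma ft_evolve:
  fixes f :: "real \<times> (real^'d) \<Rightarrow> complex"
  assumes c: "0 < c" and f: "f \<in> test_functions UNIV"
  shows "integrable lborel (\<lambda>\<sigma>. evolve B (complex_of_real c) f (\<sigma>, x))"
    and "ft (\<lambda>\<sigma>. evolve B (complex_of_real c) f (\<sigma>, x)) \<omega>
      = ou_avg B (complex_of_real c - \<i> * complex_of_real \<omega>) (\<lambda>x. ft (\<lambda>\<sigma>. f (\<sigma>, x)) \<omega>) x"
proof -
  let ?c = "complex_of_real c"
  have \<mu>: "0 < Re ?c" using c by simp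
  obtain M where M: "\<And>p. M < \<bar>fst p\<bar> \<Longrightarrow> f p = 0" using test_functions_time_bound[OF f] by metis
  obtain K where K: "\<And>z. norm (f z) \<le> K" using test_functions_bounded[OF f] by metis
  have K0: "0 \<le> K" using K norm_ge_zero order_trans by blast
  note [measurable] = test_functions_measurable[OF f]
  let ?y = "\<lambda>p. ou_contr p *\<^sub>R x + ou_shift B p"
  have si: "integrable lborel (\<lambda>\<sigma>. f (\<tau> + \<sigma>, y))" for \<tau> y
    using integrable_translate[OF integrable_slice[OF f]] .
  have sb: "(\<integral>\<sigma>. norm (f (\<tau> + \<sigma>, y)) \<partial>lborel) \<le> 2 * \<bar>M\<bar> * K" for \<tau> y
  proof -
    have "(\<integral>\<sigma>. norm (f (\<tau> + \<sigma>, y)) \<partial>lborel) = (\<integral>\<sigma>. norm (f (\<sigma>, y)) \<partial>lborel)"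
      by (rule integral_translate[of "\<lambda>\<sigma>. norm (f (\<sigma>, y))"]) measurable
    also have "\<dots> \<le> (\<integral>\<sigma>. K * indicator {- \<bar>M\<bar>..\<bar>M\<bar>} \<sigma> \<partial>lborel)"
    proof (rule integral_mono)
      show "norm (f (\<sigma>, y)) \<le> K * indicator {- \<bar>M\<bar>..\<bar>M\<bar>} \<sigma>" for \<sigma>
        using M[of "(\<sigma>, y)"] K[of "(\<sigma>, y)"] by (cases "M < \<bar>\<sigma>\<bar>") (auto simp: indicator_def K0)
      show "integrable lborel (\<lambda>\<sigma>. norm (f (\<sigma>, y)))" by (intro integrable_norm integrable_slice f)
    qed simp
    also have "\<dots> = 2 * \<bar>M\<bar> * K" by simp
    finally show ?thesis .
  qed
  let ?g = "\<lambda>\<sigma> p. ou_weight ?c p * f (\<sigma> + fst p, ?y p)"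
  have int: "integrable (lborel \<Otimes>\<^sub>M lborel) (\<lambda>(p, \<sigma>). ?g \<sigma> p)"
  proof (rule lborel_pair.Fubini_integrable)
    show m: "(\<lambda>(p, \<sigma>). ?g \<sigma> p) \<in> borel_measurable (lborel \<Otimes>\<^sub>M lborel)" by measurable
    have m2: "(\<lambda>p. \<integral>\<sigma>. norm (case (p, \<sigma>) of (p, \<sigma>) \<Rightarrow> ?g \<sigma> p) \<partial>lborel) \<in> borel_measurable lborel"
      using m by (intro lborel.borel_measurable_lebesgue_integral) measurable
    show "integrable lborel (\<lambda>p. \<integral>\<sigma>. norm (case (p, \<sigma>) of (p, \<sigma>) \<Rightarrow> ?g \<sigma> p) \<partial>lborel)"
    proof (rule Bochner_Integration.integrable_bound[OF _ m2])
      show "integrable lborel (\<lambda>p::real \<times> (real^'d). norm (ou_weight ?c p) * (2 * \<bar>M\<bar> * K))"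
        by (intro integrable_mult_left integrable_norm integrable_ou_weight \<mu>)
      show "AE p in lborel. norm (\<integral>\<sigma>. norm (case (p, \<sigma>) of (p, \<sigma>) \<Rightarrow> ?g \<sigma> p) \<partial>lborel) \<le> norm (norm (ou_weight ?c p) * (2 * \<bar>M\<bar> * K))"
      proof (rule AE_I2)
        fix p :: "real \<times> (real^'d)"
        have "(\<integral>\<sigma>. norm (case (p, \<sigma>) of (p, \<sigma>) \<Rightarrow> ?g \<sigma> p) \<partial>lborel) = norm (ou_weight ?c p) * (\<integral>\<sigma>. norm (f (fst p + \<sigma>, ?y p)) \<partial>lborel)"
          by (simp add: norm_mult add.commute)
        also have "\<dots> \<le> norm (ou_weight ?c p) * (2 * \<bar>M\<bar> * K)" by (intro mult_left_mono sb) simp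
        finally have "(\<integral>\<sigma>. norm (case (p, \<sigma>) of (p, \<sigma>) \<Rightarrow> ?g \<sigma> p) \<partial>lborel) \<le> norm (ou_weight ?c p) * (2 * \<bar>M\<bar> * K)" .
        moreover have "0 \<le> (\<integral>\<sigma>. norm (case (p, \<sigma>) of (p, \<sigma>) \<Rightarrow> ?g \<sigma> p) \<partial>lborel)" by (rule integral_nonneg_AE) simp
        ultimately show "norm (\<integral>\<sigma>. norm (case (p, \<sigma>) of (p, \<sigma>) \<Rightarrow> ?g \<sigma> p) \<partial>lborel) \<le> norm (norm (ou_weight ?c p) * (2 * \<bar>M\<bar> * K))"
          by (simp only: real_norm_def abs_of_nonneg order_trans[OF _ abs_ge_self])
      qed
    qed
    show "AE p in lborel. integrable lborel (\<lambda>\<sigma>. case (p, \<sigma>) of (p, \<sigma>) \<Rightarrow> ?g \<sigma> p)"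
    proof (rule AE_I2)
      fix p :: "real \<times> (real^'d)"
      have "integrable lborel (\<lambda>\<sigma>. f (\<sigma> + fst p, ?y p))" using si[of "fst p" "?y p"] by (simp only: add.commute)
      then show "integrable lborel (\<lambda>\<sigma>. case (p, \<sigma>) of (p, \<sigma>) \<Rightarrow> ?g \<sigma> p)" by simp
    qed
  qed
  have ev: "evolve B ?c f (\<sigma>, x) = (\<integral>p. ?g \<sigma> p \<partial>lborel)" for \<sigma> by (simp add: evolve_def)
  have int': "integrable lborel (\<lambda>z. ?g (snd z) (fst z))"
    using int by (simp add: lborel_prod case_prod_beta')
  show "integrable lborel (\<lambda>\<sigma>. evolve B ?c f (\<sigma>, x))"
    unfolding ev using lborel_pair.integrable_snd[of "\<lambda>p \<sigma>. ?g \<sigma> p"] int by simp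
  let ?E = "\<lambda>\<sigma>. exp (- \<i> * of_real (\<omega> * \<sigma>))"
  have intE: "integrable lborel (\<lambda>z. ?E (snd z) * ?g (snd z) (fst z))"
  proof -
    have "integrable lborel (\<lambda>z. ?g (snd z) (fst z) * ?E (snd z))"
      by (rule integrable_mult_bounded[OF int', of _ 1]) auto
    then show ?thesis by (simp only: mult.commute)
  qed
  have "ft (\<lambda>\<sigma>. evolve B ?c f (\<sigma>, x)) \<omega> = (\<integral>\<sigma>. (\<integral>p. ?E \<sigma> * ?g \<sigma> p \<partial>lborel) \<partial>lborel)"
    unfolding ft_def ev integral_mult_right_zero ..
  also have "\<dots> = (\<integral>p. (\<integral>\<sigma>. ?E \<sigma> * ?g \<sigma> p \<partial>lborel) \<partial>lborel)"
    using lborel_Fubini(1)[OF intE] lborel_Fubini(2)[OF intE] by simp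
  also have "\<dots> = (\<integral>p. ou_weight (?c - \<i> * complex_of_real \<omega>) p * ft (\<lambda>\<sigma>. f (\<sigma>, ?y p)) \<omega> \<partial>lborel)"
  proof (rule Bochner_Integration.integral_cong[OF refl])
    fix p :: "real \<times> (real^'d)"
    have "(\<integral>\<sigma>. ?E \<sigma> * ?g \<sigma> p \<partial>lborel) = (\<integral>\<sigma>. ?E (- fst p + \<sigma>) * ?g (- fst p + \<sigma>) p \<partial>lborel)"
      by (rule integral_translate[symmetric]) measurable
    also have "\<dots> = (\<integral>\<sigma>. (ou_weight ?c p * exp (\<i> * of_real (\<omega> * fst p))) * (?E \<sigma> * f (\<sigma>, ?y p)) \<partial>lborel)"
    proof (rule Bochner_Integration.integral_cong[OF refl])
      fix \<sigma>
      have "?E (- fst p + \<sigma>) = exp (\<i> * of_real (\<omega> * fst p)) * ?E \<sigma>" by (simp add: exp_add[symmetric] algebra_simps)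
      then show "?E (- fst p + \<sigma>) * ?g (- fst p + \<sigma>) p = (ou_weight ?c p * exp (\<i> * of_real (\<omega> * fst p))) * (?E \<sigma> * f (\<sigma>, ?y p))"
        by simp
    qed
    also have "\<dots> = (ou_weight ?c p * exp (\<i> * of_real (\<omega> * fst p))) * ft (\<lambda>\<sigma>. f (\<sigma>, ?y p)) \<omega>"
      unfolding ft_def by (rule integral_mult_right_zero)
    also have "ou_weight ?c p * exp (\<i> * of_real (\<omega> * fst p)) = ou_weight (?c - \<i> * complex_of_real \<omega>) p"
      by (simp add: ou_weight_def ou_decay_def exp_add[symmetric] algebra_simps)
    finally show "(\<integral>\<sigma>. ?E \<sigma> * ?g \<sigma> p \<partial>lborel) = ou_weight (?c - \<i> * complex_of_real \<omega>) p * ft (\<lambda>\<sigma>. f (\<sigma>, ?y p)) \<omega>" .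
  qed
  finally show "ft (\<lambda>\<sigma>. evolve B ?c f (\<sigma>, x)) \<omega> = ou_avg B (?c - \<i> * complex_of_real \<omega>) (\<lambda>x. ft (\<lambda>\<sigma>. f (\<sigma>, x)) \<omega>) x"
    by (simp add: ou_avg_def avg_def)
qed

text \<open>At each \<open>x\<close> the Plancherel inequalities pass between time and frequency.  At each frequency \<open>\<omega>\<close> the transform of
  the evolution is the resolvent applied to the transform of \<open>h\<close>, which is a test function in space, so that the
  hypothesis applies after the integrals over \<open>x\<close> and \<open>\<omega>\<close> have been exchanged.\<close>
theorem evolution_bound_from_resolve:
  fixes F :: "real^'d \<Rightarrow> real" and h :: "real \<times> (real^'d) \<Rightarrow> complex"
  assumes F: "continuous_on UNIV F" "\<And>x. 0 \<le> F x" and c: "0 < c"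
    and bound: "\<And>\<omega> \<phi>. \<phi> \<in> test_functions UNIV \<Longrightarrow>
        energy F (resolve q B (complex_of_real c - \<i> * complex_of_real \<omega>) \<phi>) \<le> ennreal (C\<^sup>2) * energy F \<phi>"
    and h: "h \<in> test_functions UNIV"
  shows "line_energy F (evolve_mat q B (complex_of_real c) h) \<le> ennreal (C\<^sup>2) * line_energy F h"
proof -
  let ?c = "complex_of_real c"
  have mF[measurable]: "F \<in> borel_measurable borel" by (rule borel_measurable_continuous_onI[OF F(1)])
  have \<mu>: "0 < Re ?c" using c by simp
  note Ht = H_entry_test[OF h]
  note [measurable] = test_functions_measurable[OF h] 
  define v where "v = (\<lambda>i j. evolve B ?c (H_entry q i j h))"
  have mv[measurable]: "v i j \<in> borel_measurable borel" for i j
    unfolding v_def by (rule evolve_measurable[OF Ht])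
  have swap: "(\<integral>\<^sup>+\<sigma>. \<integral>\<^sup>+x. g (\<sigma>, x) \<partial>lborel \<partial>lborel) = (\<integral>\<^sup>+x. \<integral>\<^sup>+\<sigma>. g (\<sigma>, x) \<partial>lborel \<partial>lborel)"
    if g: "g \<in> borel_measurable borel" for g :: "real \<times> (real^'d) \<Rightarrow> ennreal"
    using lborel_pair.Fubini'[of "\<lambda>\<sigma> x. g (\<sigma>, x)"] g by (simp add: lborel_prod)
  have sumF: "ennreal (F x * (\<Sum>i\<in>UNIV. \<Sum>j\<in>UNIV. (norm (w i j))\<^sup>2)) = ennreal (F x) * (\<Sum>i\<in>UNIV. \<Sum>j\<in>UNIV. ennreal ((norm (w i j))\<^sup>2))"
    for x and w :: "'d \<Rightarrow> 'd \<Rightarrow> complex"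
    using F(2)[of x] by (simp add: ennreal_mult' sum_nonneg)
  have ftv: "resolve q B (?c - \<i> * complex_of_real \<omega>) (\<lambda>x. ft (\<lambda>\<sigma>. h (\<sigma>, x)) \<omega>) x $ i $ j = ft (\<lambda>\<sigma>. v i j (\<sigma>, x)) \<omega>" for \<omega> x i j
    unfolding resolve_def v_def ft_evolve(2)[OF c Ht] by (simp add: ft_H_entry[OF h])
  have mft: "(\<lambda>p. ft (\<lambda>\<sigma>. w (\<sigma>, snd p)) (fst p)) \<in> borel_measurable borel"
    if [measurable]: "w \<in> borel_measurable borel" for w :: "real \<times> (real^'d) \<Rightarrow> complex"
    unfolding ft_def by measurable
  have mg1: "(\<lambda>p. ennreal (F (snd p)) * (\<Sum>i\<in>UNIV. \<Sum>j\<in>UNIV. ennreal ((norm (ft (\<lambda>\<sigma>. v i j (\<sigma>, snd p)) (fst p)))\<^sup>2))) \<in> borel_measurable borel"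
  proof -
    note [measurable] = mft[OF mv] measurable_compose[OF snd_borel mF]
    show ?thesis by measurable
  qed
  have mft1: "(\<lambda>\<omega>. ft (\<lambda>\<sigma>. v i j (\<sigma>, x)) \<omega>) \<in> borel_measurable borel" for i j x
    by (rule ft_measurable) measurable
  have mg2: "(\<lambda>p. ennreal (F (snd p)) * ennreal ((norm (ft (\<lambda>\<sigma>. h (\<sigma>, snd p)) (fst p)))\<^sup>2)) \<in> borel_measurable borel"
  proof -
    note [measurable] = mft[OF test_functions_measurable[OF h]] measurable_compose[OF snd_borel mF]
    show ?thesis by measurable
  qed
  have mfh1: "(\<lambda>\<omega>. ft (\<lambda>\<sigma>. h (\<sigma>, x)) \<omega>) \<in> borel_measurable borel" for x
    by (rule ft_measurable) measurable
  have mv1: "(\<lambda>\<sigma>. ennreal ((norm (v i j (\<sigma>, x)))\<^sup>2)) \<in> borel_measurable borel" for i j x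
    by measurable
  have pull: "(\<integral>\<^sup>+t. b * (\<Sum>i\<in>UNIV. \<Sum>j\<in>UNIV. f i j t) \<partial>lborel) = b * (\<Sum>i\<in>UNIV. \<Sum>j\<in>UNIV. \<integral>\<^sup>+t. f i j t \<partial>lborel)"
    if [measurable]: "\<And>i j. f i j \<in> borel_measurable borel" for b and f :: "'d \<Rightarrow> 'd \<Rightarrow> real \<Rightarrow> ennreal"
    by (simp add: nn_integral_cmult nn_integral_sum)
  have "ennreal (2 * pi) * line_energy F (evolve_mat q B ?c h)
      = ennreal (2 * pi) * (\<integral>\<^sup>+\<sigma>. \<integral>\<^sup>+x. ennreal (F x) * (\<Sum>i\<in>UNIV. \<Sum>j\<in>UNIV. ennreal ((norm (v i j (\<sigma>, x)))\<^sup>2)) \<partial>lborel \<partial>lborel)"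
    unfolding line_energy_def energy_def norm_matrix_square evolve_mat_def v_def sumF by simp
  also have "\<dots> = ennreal (2 * pi) * (\<integral>\<^sup>+x. \<integral>\<^sup>+\<sigma>. ennreal (F x) * (\<Sum>i\<in>UNIV. \<Sum>j\<in>UNIV. ennreal ((norm (v i j (\<sigma>, x)))\<^sup>2)) \<partial>lborel \<partial>lborel)"
    using swap[of "\<lambda>p. ennreal (F (snd p)) * (\<Sum>i\<in>UNIV. \<Sum>j\<in>UNIV. ennreal ((norm (v i j p))\<^sup>2))"] by simp
  also have "\<dots> = (\<integral>\<^sup>+x. ennreal (F x) * (\<Sum>i\<in>UNIV. \<Sum>j\<in>UNIV. ennreal (2 * pi) * (\<integral>\<^sup>+\<sigma>. ennreal ((norm (v i j (\<sigma>, x)))\<^sup>2) \<partial>lborel)) \<partial>lborel)"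
  proof -
    have "(\<lambda>x. \<integral>\<^sup>+\<sigma>. ennreal (F x) * (\<Sum>i\<in>UNIV. \<Sum>j\<in>UNIV. ennreal ((norm (v i j (\<sigma>, x)))\<^sup>2)) \<partial>lborel) \<in> borel_measurable lborel"
      by measurable
    then show ?thesis
      by (subst nn_integral_cmult[symmetric]) (simp_all only: pull[OF mv1], simp only: sum_distrib_left mult.left_commute)
  qed
  also have "\<dots> \<le> (\<integral>\<^sup>+x. ennreal (F x) * (\<Sum>i\<in>UNIV. \<Sum>j\<in>UNIV. \<integral>\<^sup>+\<omega>. ennreal ((norm (ft (\<lambda>\<sigma>. v i j (\<sigma>, x)) \<omega>))\<^sup>2) \<partial>lborel) \<partial>lborel)"
  proof (intro nn_integral_mono mult_left_mono sum_mono)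
    fix x i j
    obtain K where K: "\<And>\<sigma> x. norm (v i j (\<sigma>, x)) \<le> K" unfolding v_def using evolve_bounded[OF \<mu> Ht] by metis
    show "ennreal (2 * pi) * (\<integral>\<^sup>+\<sigma>. ennreal ((norm (v i j (\<sigma>, x)))\<^sup>2) \<partial>lborel) \<le> (\<integral>\<^sup>+\<omega>. ennreal ((norm (ft (\<lambda>\<sigma>. v i j (\<sigma>, x)) \<omega>))\<^sup>2) \<partial>lborel)"
      by (rule plancherel_ge[OF _ K]) (auto simp: v_def intro: ft_evolve(1)[OF c Ht] evolve_continuous[OF \<mu> Ht])
  qed simp
  also have "\<dots> = (\<integral>\<^sup>+x. \<integral>\<^sup>+\<omega>. ennreal (F x) * (\<Sum>i\<in>UNIV. \<Sum>j\<in>UNIV. ennreal ((norm (ft (\<lambda>\<sigma>. v i j (\<sigma>, x)) \<omega>))\<^sup>2)) \<partial>lborel \<partial>lborel)"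
    by (subst pull) (auto intro: measurable_compose[OF _ measurable_ennreal] borel_measurable_power borel_measurable_norm mft1)
  also have "\<dots> = (\<integral>\<^sup>+\<omega>. \<integral>\<^sup>+x. ennreal (F x) * (\<Sum>i\<in>UNIV. \<Sum>j\<in>UNIV. ennreal ((norm (ft (\<lambda>\<sigma>. v i j (\<sigma>, x)) \<omega>))\<^sup>2)) \<partial>lborel \<partial>lborel)"
    using swap[OF mg1] by simp
  also have "\<dots> = (\<integral>\<^sup>+\<omega>. energy F (resolve q B (?c - \<i> * complex_of_real \<omega>) (\<lambda>x. ft (\<lambda>\<sigma>. h (\<sigma>, x)) \<omega>)) \<partial>lborel)"
    unfolding energy_def norm_matrix_square ftv sumF ..
  also have "\<dots> \<le> (\<integral>\<^sup>+\<omega>. ennreal (C\<^sup>2) * energy F (\<lambda>x. ft (\<lambda>\<sigma>. h (\<sigma>, x)) \<omega>) \<partial>lborel)"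
    by (intro nn_integral_mono bound ft_slice_test h)
  also have "\<dots> = ennreal (C\<^sup>2) * (\<integral>\<^sup>+\<omega>. energy F (\<lambda>x. ft (\<lambda>\<sigma>. h (\<sigma>, x)) \<omega>) \<partial>lborel)"
    by (intro nn_integral_cmult) (use energy_measurable[OF mF mft[OF test_functions_measurable[OF h]]] in simp)
  also have "(\<integral>\<^sup>+\<omega>. energy F (\<lambda>x. ft (\<lambda>\<sigma>. h (\<sigma>, x)) \<omega>) \<partial>lborel)
      = (\<integral>\<^sup>+\<omega>. \<integral>\<^sup>+x. ennreal (F x) * ennreal ((norm (ft (\<lambda>\<sigma>. h (\<sigma>, x)) \<omega>))\<^sup>2) \<partial>lborel \<partial>lborel)"
    unfolding energy_def using F(2) by (simp add: ennreal_mult')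
  also have "\<dots> = (\<integral>\<^sup>+x. \<integral>\<^sup>+\<omega>. ennreal (F x) * ennreal ((norm (ft (\<lambda>\<sigma>. h (\<sigma>, x)) \<omega>))\<^sup>2) \<partial>lborel \<partial>lborel)"
    using swap[OF mg2] by simp
  also have "\<dots> = (\<integral>\<^sup>+x. ennreal (F x) * (\<integral>\<^sup>+\<omega>. ennreal ((norm (ft (\<lambda>\<sigma>. h (\<sigma>, x)) \<omega>))\<^sup>2) \<partial>lborel) \<partial>lborel)"
    using mfh1 by (simp add: nn_integral_cmult)
  finally have 1: "ennreal (2 * pi) * line_energy F (evolve_mat q B ?c h) \<le> ennreal (C\<^sup>2) *
      (\<integral>\<^sup>+x. ennreal (F x) * (\<integral>\<^sup>+\<omega>. ennreal ((norm (ft (\<lambda>\<sigma>. h (\<sigma>, x)) \<omega>))\<^sup>2) \<partial>lborel) \<partial>lborel)" .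
  have "(\<integral>\<^sup>+x. ennreal (F x) * (\<integral>\<^sup>+\<omega>. ennreal ((norm (ft (\<lambda>\<sigma>. h (\<sigma>, x)) \<omega>))\<^sup>2) \<partial>lborel) \<partial>lborel)
      \<le> (\<integral>\<^sup>+x. ennreal (F x) * (ennreal (2 * pi) * (\<integral>\<^sup>+\<sigma>. ennreal ((norm (h (\<sigma>, x)))\<^sup>2) \<partial>lborel)) \<partial>lborel)"
  proof (intro nn_integral_mono mult_left_mono)
    fix x
    obtain K where K: "\<And>p. norm (h p) \<le> K" using test_functions_bounded[OF h] by metis
    show "(\<integral>\<^sup>+\<omega>. ennreal ((norm (ft (\<lambda>\<sigma>. h (\<sigma>, x)) \<omega>))\<^sup>2) \<partial>lborel) \<le> ennreal (2 * pi) * (\<integral>\<^sup>+\<sigma>. ennreal ((norm (h (\<sigma>, x)))\<^sup>2) \<partial>lborel)"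
      by (rule plancherel_le[OF integrable_slice[OF h] K])
  qed simp
  also have "\<dots> = ennreal (2 * pi) * (\<integral>\<^sup>+x. \<integral>\<^sup>+\<sigma>. ennreal (F x) * ennreal ((norm (h (\<sigma>, x)))\<^sup>2) \<partial>lborel \<partial>lborel)"
    by (simp add: nn_integral_cmult mult.left_commute flip: nn_integral_cmult)
  also have "\<dots> = ennreal (2 * pi) * line_energy F h"
    unfolding line_energy_def energy_def
    using swap[of "\<lambda>p. ennreal (F (snd p)) * ennreal ((norm (h p))\<^sup>2)"] F(2) by (simp add: ennreal_mult')
  finally have "ennreal (2 * pi) * line_energy F (evolve_mat q B ?c h) \<le> ennreal (C\<^sup>2) * (ennreal (2 * pi) * line_energy F h)"
    using 1 by (meson mult_left_mono order_trans zero_le)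
  then have "ennreal (2 * pi) * line_energy F (evolve_mat q B ?c h) \<le> ennreal (2 * pi) * (ennreal (C\<^sup>2) * line_energy F h)"
    by (simp only: mult.left_commute)
  then show ?thesis by (simp add: ennreal_mult_le_mult_iff)
qed

section \<open>The norm identity\<close>

theorem proposition4p2:
  fixes \<theta> :: "(real^'d) measure" and a A q :: "real^'d^'d" and \<alpha> k :: real
  assumes "0 \<le> \<alpha>"
    and "heat_tuple \<theta> a A q"
    and "0 \<le> k"
    and "\<And>r E. 0 < r \<Longrightarrow> E \<in> sets borel \<Longrightarrow>
           emeasure \<theta> ((\<lambda>x. r *\<^sub>R x) ` E) = ennreal (r powr k) * emeasure \<theta> E"
  shows "T_norm \<alpha> \<theta> a A q =
    (SUP \<omega>::real. spatial_op_norm (heat_F \<theta> a 1)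
       (\<lambda>u. OU_resolvent_mat A
              (complex_of_real ((\<alpha> + 1) / 2 + k / 4) - \<i> * complex_of_real \<omega>)
              (H_op q u)))"
proof -
  define c where "c = (\<alpha> + 1) / 2 + k / 4"
  have c: "0 < c" using assms(1,3) by (simp add: c_def add_pos_nonneg)
  let ?F = "heat_F \<theta> a 1" and ?c = "complex_of_real c"
  have smooth: "smooth_on UNIV ?F" and pos: "\<And>x. 0 < ?F x" using heat_F_smooth_pos[OF assms(2)] by auto
  have F: "continuous_on UNIV ?F" "\<And>x. 0 \<le> ?F x" using smooth_on_continuous[OF smooth] pos less_imp_le by auto
  have "pos_def A" using assms(2) by (simp add: heat_tuple_def)
  then obtain B where B: "B ** transpose B = A" "det B \<noteq> 0" using pos_def_factor by blast
  let ?M = "restrict_space lborel (half_space :: (real \<times> (real^'d)) set)"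
  define S where "S = {C. 0 \<le> C \<and> (\<forall>h\<in>test_functions UNIV.
      line_energy ?F (evolve_mat q B ?c h) \<le> ennreal (C\<^sup>2) * line_energy ?F h)}"
  define R where "R = (\<lambda>\<omega>. {C. 0 \<le> C \<and> (\<forall>\<phi>\<in>test_functions UNIV.
      energy ?F (resolve q B (?c - \<i> * complex_of_real \<omega>) \<phi>) \<le> ennreal (C\<^sup>2) * energy ?F \<phi>)})"
  \<comment> \<open>Every test function on the half-space comes from one in self-similar coordinates, and conversely.\<close>
  have "{C. 0 \<le> C \<and> (\<forall>g\<in>test_functions half_space. T_op \<alpha> \<theta> a A q g \<in> L2 ?M \<and>
      L2_norm ?M (T_op \<alpha> \<theta> a A q g) \<le> C * L2_norm ?M g)} = S"
  proof -
    have eq: "T_op \<alpha> \<theta> a A q (selfsim ?F h) \<in> L2 ?M \<and>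
        L2_norm ?M (T_op \<alpha> \<theta> a A q (selfsim ?F h)) \<le> C * L2_norm ?M (selfsim ?F h) \<longleftrightarrow>
        line_energy ?F (evolve_mat q B ?c h) \<le> ennreal (C\<^sup>2) * line_energy ?F h"
      if "0 \<le> C" "h \<in> test_functions UNIV" for C h
      by (rule spacetime_bound_iff[OF F that evolve_mat_measurable[OF that(2)]
            T_op_selfsim[OF assms(2,4) c_def c B that(2)]])
    show ?thesis
    proof (rule set_eqI)
      fix C
      show "C \<in> {C. 0 \<le> C \<and> (\<forall>g\<in>test_functions half_space. T_op \<alpha> \<theta> a A q g \<in> L2 ?M \<and>
          L2_norm ?M (T_op \<alpha> \<theta> a A q g) \<le> C * L2_norm ?M g)} \<longleftrightarrow> C \<in> S"
      proof
        assume "C \<in> {C. 0 \<le> C \<and> (\<forall>g\<in>test_functions half_space. T_op \<alpha> \<theta> a A q g \<in> L2 ?M \<and>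
          L2_norm ?M (T_op \<alpha> \<theta> a A q g) \<le> C * L2_norm ?M g)}"
        then show "C \<in> S" unfolding S_def using eq selfsim_test[OF smooth pos] by blast
      next
        assume C: "C \<in> S"
        have "T_op \<alpha> \<theta> a A q g \<in> L2 ?M \<and> L2_norm ?M (T_op \<alpha> \<theta> a A q g) \<le> C * L2_norm ?M g"
          if g: "g \<in> test_functions half_space" for g
        proof -
          obtain h where h: "h \<in> test_functions UNIV" "g = selfsim ?F h" using selfsim_surj[OF smooth pos g] .
          show ?thesis using C eq[OF _ h(1)] h unfolding S_def by blast
        qed
        then show "C \<in> {C. 0 \<le> C \<and> (\<forall>g\<in>test_functions half_space. T_op \<alpha> \<theta> a A q g \<in> L2 ?M \<and>
          L2_norm ?M (T_op \<alpha> \<theta> a A q g) \<le> C * L2_norm ?M g)}" using C unfolding S_def by blast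
      qed
    qed
  qed
  then have T: "T_norm \<alpha> \<theta> a A q = (INF C\<in>S. ennreal C)"
    unfolding T_norm_def L2_op_norm_def by simp
  have Rn: "spatial_op_norm ?F (\<lambda>u. OU_resolvent_mat A (?c - \<i> * complex_of_real \<omega>) (H_op q u)) = (INF C\<in>R \<omega>. ennreal C)" for \<omega>
  proof -
    let ?\<mu> = "?c - \<i> * complex_of_real \<omega>"
    have \<mu>: "0 < Re ?\<mu>" using c by simp
    have "{C. 0 \<le> C \<and> (\<forall>\<phi>\<in>test_functions UNIV. OU_resolvent_mat A ?\<mu> (H_op q \<phi>) \<in> L2 (weighted ?F) \<and>
      L2_norm (weighted ?F) (OU_resolvent_mat A ?\<mu> (H_op q \<phi>)) \<le> C * L2_norm (weighted ?F) \<phi>)} = R \<omega>"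
      unfolding R_def
      by (intro Collect_cong conj_cong ball_cong refl)
         (simp only: OU_resolvent_mat_eq_resolve[OF B(1) \<mu>] spatial_bound_iff[OF F _ _ resolve_measurable[OF \<mu>]])
    then show ?thesis unfolding spatial_op_norm_def L2_op_norm_def by simp
  qed
  have "(INF C\<in>S. ennreal C) = (SUP \<omega>. INF C\<in>R \<omega>. ennreal C)"
  proof (rule Inf_eq_SUP_Inf)
    show "S \<subseteq> R \<omega>" for \<omega>
      unfolding S_def R_def using resolve_bound_from_evolution[OF F c] by blast
    show "C \<in> S" if "\<And>\<omega>. C \<in> R \<omega>" for C
      using that evolution_bound_from_resolve[OF F c] unfolding S_def R_def by blast
    show "C' \<in> R \<omega>" if "C \<in> R \<omega>" "C \<le> C'" for \<omega> C C'
    proof -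
      have "C\<^sup>2 \<le> C'\<^sup>2" using that by (intro power_mono) (auto simp: R_def)
      then have "ennreal (C\<^sup>2) * e \<le> ennreal (C'\<^sup>2) * e" for e by (intro mult_right_mono ennreal_leI) auto
      then show ?thesis using that unfolding R_def by (auto intro: order_trans)
    qed
    show "0 \<le> C" if "C \<in> R \<omega>" for \<omega> C using that by (simp add: R_def)
  qed
  then show ?thesis unfolding T c_def[symmetric] Rn .
qed

end
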